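(* There is the following asymptotic as $x\to\infty$. Suppose $N=N(x)$ satisfies $N>\exp(3.42\sqrt{\log x})$. Then for any positive constant $D$, $$ \frac1{N^2}\sum_{a\leq N}\sum_{b\leq N}\#\{p\leq x:\ p\mid a^n-b \text{ for some positive integer } n\}=C\,\mathrm{Li}(x)+O\!\left(\frac{x}{(\log x)^D}\right), $$ where the implied constant depends only on $D$.
   Context: $a,b$ run over positive integers and $p$ over primes. $\mathrm{Li}(x)=\int_2^x\frac{dt}{\log t}$. $C=\prod_p\left(1-\frac{p}{p^3-1}\right)$ (Stephens' constant), the product over all primes. *)

theory Defs
  imports "HOL-Analysis.Analysis" "HOL-Computational_Algebra.Primes"
begin

definition Li :: "real \<Rightarrow> real" where
  "Li x = integral {2..x} (\<lambda>t. 1 / ln t)"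

definition stephens_C :: real where
  "stephens_C = (\<Prod>n. (if prime n then 1 - real n / (real n ^ 3 - 1) else 1))"

definition cnt :: "real \<Rightarrow> nat \<Rightarrow> nat \<Rightarrow> nat" where
  "cnt x a b = card {p :: nat. prime p \<and> real p \<le> x \<and>
      (\<exists>n::nat. n \<ge> 1 \<and> int p dvd (int a ^ n - int b))}"

end

theory Submission
 imports Defs "HOL-Complex_Analysis.Complex_Analysis" "HOL-Number_Theory.Number_Theory"
  "HOL-Computational_Algebra.Squarefree" "HOL-Real_Asymp.Real_Asymp"
begin

text \<open>For a prime \<open>p\<close> the average counts the pairs \<open>(a, b)\<close> with \<open>b\<close> in the subgroup generated by \<open>a\<close>
modulo \<open>p\<close>. Moebius inversion over the divisors of \<open>p - 1\<close> and the characters of those orders turn the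
proportion of such pairs into \<open>Mdens (p - 1)\<close>, up to character sums over \<open>{1..N}\<close>. The primes with a
large character sum are few: choosing one bad character per prime, the duality form of the large sieve
for \<open>k\<close>-th powers of the sums, \<open>N ^ k \<approx> x ^ 3\<close>, bounds their number by a second moment of \<open>k\<close>-fold
factorisations. As \<open>k\<^sup>2\<close> is at most a multiple of \<open>ln x\<close>, Rankin's trick makes this moment smaller than a
small power of \<open>x\<close>, so the value of the constant 3.42 plays no role.

The main term is the sum of \<open>Mdens (p - 1)\<close> over the primes, evaluated by the theorem of Siegel and Walfisz for
the residue class 1; the resulting series over the moduli is the Euler product of Stephens' constant.

No zero-free region is needed for Siegel--Walfisz. Estermann's proof of Siegel's theorem and the 3-4-1
inequality bound \<open>L(s, \<xi>)\<close> from below by \<open>c * (q * (\<bar>t\<bar> + 2)) powr (- e)\<close> in \<open>Re s > 1\<close>. Cauchy's estimates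
on small discs then bound all derivatives of \<open>L'/L\<close> equally well up to the line \<open>Re s = 1\<close>, and inserting the
weight \<open>ln n ^ (3 * m)\<close> into a Perron formula with kernel \<open>1 / (s * (s + 1))\<close> saves the factor \<open>ln x ^ m\<close>.\<close>

text \<open>Uniformity in the modulus is the obstacle. Moduli above a power of \<open>ln x\<close>
  are left to the trivial count, since their densities \<open>gdens q\<close> are at most
  \<open>1 / q\<close>; below that power an error \<open>q * x / ln x ^ m\<close> is harmless. So
  the analytic bounds may lose any small power of \<open>q * (\<bar>t\<bar> + 2)\<close>, and the
  growth exponent 1/2 is still integrable against the kernel. This is why lower bounds for L as weak
  as Siegel's are enough. On the line \<open>Re s = 1 + 1 / ln y\<close> the power
  \<open>y powr s\<close> has the size of \<open>y\<close>, so the contour itself gains nothing: the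
  saving arises when the logarithmic weight is removed by partial summation. The weight has to
  outlast the loss in passing from smoothed to sharp sums, whence \<open>3 * m\<close> logarithms
  for a saving of \<open>m\<close>. In the large sieve, one character per prime makes all mixed
  products nonprincipal, with sums at most \<open>x ^ 2\<close> by periodicity. The price is a
  moment with \<open>k\<close> as large as \<open>2 * sqrt (ln x)\<close>, where a bound exp(c k^2)
  with a fixed \<open>c\<close> could exceed a small power of \<open>x\<close>; splitting off
  finitely many primes makes \<open>c\<close> as small as desired.\<close>

declare One_nat_def [simp del]

section \<open>Dirichlet characters\<close>

text \<open>Characters live on all of \<open>nat\<close> and not on a group of units: products of
  characters of different moduli are then ordinary pointwise products, and a character is directly a
  coefficient sequence. Periodicity keeps \<open>{\<xi>. dchar q \<xi>}\<close> finite.\<close>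

definition dchar :: "nat => (nat => complex) => bool" where
 "dchar q \<xi> \<longleftrightarrow> q > 0 \<and> (\<forall>m n. \<xi> (m * n) = \<xi> m * \<xi> n) \<and> (\<forall>n. \<xi> (n + q) = \<xi> n)
  \<and> (\<forall>n. \<xi> n = 0 \<longleftrightarrow> \<not> coprime n q)"

definition prin :: "nat => nat => complex" where
 "prin q n = (if coprime n q then 1 else 0)"

lemma dchar_pos: "dchar q \<xi> ==> q > 0"
 and dchar_mult: "dchar q \<xi> ==> \<xi> (m * n) = \<xi> m * \<xi> n"
 and dchar_periodic: "dchar q \<xi> ==> \<xi> (n + q) = \<xi> n"
 and dchar_eq_0_iff: "dchar q \<xi> ==> \<xi> n = 0 \<longleftrightarrow> \<not> coprime n q"
 by (auto simp: dchar_def)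

lemma dchar_1 [simp]: assumes "dchar q \<xi>" shows "\<xi> 1 = 1" "\<xi> (Suc 0) = 1"
proof -
 have "\<xi> 1 * \<xi> 1 = \<xi> 1" "\<xi> 1 \<noteq> 0" using dchar_mult[OF assms, of 1 1] dchar_eq_0_iff[OF assms, of 1] by auto
 thus "\<xi> 1 = 1" by simp
 thus "\<xi> (Suc 0) = 1" by (simp add: One_nat_def)
qed

lemma coprime_mod_left_nat: "coprime (n mod q) q \<longleftrightarrow> coprime n (q::nat)"
 by (simp only: coprime_iff_gcd_eq_1 gcd.commute[of "n mod q" q] gcd_red_nat[symmetric])

lemma coprime_add_self_nat: "coprime (n + q) q \<longleftrightarrow> coprime n (q::nat)"
 by (subst (1 2) coprime_mod_left_nat[symmetric]) simp

lemma periodic_mod: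
 fixes f :: "nat => 'a"
 assumes "\<And>n. f (n + q) = f n"
 shows "f (n mod q) = f n"
proof -
 have "f (m + k * q) = f m" for m k
 proof (induction k)
  case (Suc k)
  have "f (m + Suc k * q) = f ((m + k * q) + q)" by (simp add: algebra_simps)
  also have "... = f m" using assms Suc by simp
  finally show ?case .
 qed simp
 from this[of "n mod q" "n div q"] show ?thesis by simp
qed

lemma dchar_mod: "dchar q \<xi> ==> \<xi> (n mod q) = \<xi> n" by (rule periodic_mod) (simp add: dchar_periodic)

lemma dchar_cong: "dchar q \<xi> ==> [m = n] (mod q) ==> \<xi> m = \<xi> n"
 by (metis dchar_mod cong_def)

lemma dchar_power: "dchar q \<xi> ==> \<xi> (n ^ k) = \<xi> n ^ k"
 by (induction k) (auto simp: dchar_mult simp del: One_nat_def)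

lemma dchar_root: assumes "dchar q \<xi>" "coprime n q" shows "\<xi> n ^ totient q = 1"
proof -
 have "\<xi> n ^ totient q = \<xi> (n ^ totient q)" using dchar_power[OF assms(1)] by simp
 also have "... = \<xi> 1" by (rule dchar_cong[OF assms(1)]) (use euler_theorem assms in auto)
 finally show ?thesis using assms by simp
qed

lemma dchar_norm: assumes "dchar q \<xi>" shows "norm (\<xi> n) = (if coprime n q then 1 else 0)"
proof (cases "coprime n q")
 case True
 have "norm (\<xi> n) ^ totient q = 1" by (metis dchar_root[OF assms True] norm_power norm_one)
 moreover have "totient q > 0" using dchar_pos[OF assms] by simp
 ultimately have "norm (\<xi> n) = 1" using power_eq_imp_eq_base[of "norm (\<xi> n)" "totient q" 1] by simp
 thus ?thesis using True by simp
qed (use dchar_eq_0_iff[OF assms] in auto)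

lemma dchar_norm_le: "dchar q \<xi> ==> norm (\<xi> n) \<le> 1" by (simp add: dchar_norm)

lemma dchar_prin: assumes "q > 0" shows "dchar q (prin q)"
proof -
 show ?thesis using assms by (auto simp: dchar_def prin_def coprime_add_self_nat)
qed

lemma dchar_times:
 "dchar q \<xi> ==> dchar q \<psi> ==> dchar q (\<lambda>n. \<xi> n * \<psi> n)"
 by (auto simp: dchar_def)

lemma dchar_times':
 assumes "dchar q \<xi>" "dchar r \<psi>" shows "dchar (q * r) (\<lambda>n. \<xi> n * \<psi> n)"
proof -
 have "\<xi> (n + q * r) = \<xi> n" "\<psi> (n + q * r) = \<psi> n" for n
  by (auto intro!: dchar_cong[OF assms(1)] dchar_cong[OF assms(2)] simp: cong_def)
 with assms show ?thesis by (auto simp: dchar_def)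
qed

lemma dchar_cnj: "dchar q \<xi> ==> dchar q (\<lambda>n. cnj (\<xi> n))" by (auto simp: dchar_def)

lemma sum_period_shift:
 fixes f :: "nat => 'a::ab_group_add"
 assumes "\<And>n. f (n + q) = f n"
 shows "(\<Sum>n\<in>{k<..k+q}. f n) = (\<Sum>n=1..q. f n)"
proof (induction k)
 case 0
 show ?case by (rule sum.cong) auto
next
 case (Suc k)
 have "(\<Sum>n\<in>{Suc k<..Suc k + q}. f n) + f (Suc k) = (\<Sum>n\<in>{k<..Suc k+q}. f n)"
 proof -
  have "{k<..Suc k + q} = insert (Suc k) {Suc k<..Suc k + q}" by auto
  thus ?thesis by (simp add: add.commute)
 qed
 also have "... = (\<Sum>n\<in>{k<..k+q}. f n) + f (Suc k + q)"
 proof -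
  have "{k<..Suc k+q} = insert (Suc k + q) {k<..k+q}" by auto
  thus ?thesis by (simp add: add.commute)
 qed
 finally show ?case using Suc assms[of "Suc k"] by simp
qed

text \<open>Whole periods, which sum to 0, are cut off from the right until fewer than
  \<open>q\<close> terms are left, and these are bounded trivially.\<close>

lemma sum_periodic_zero_bound:
 fixes f :: "nat => 'a::real_normed_vector"
 assumes per: "\<And>n. f (n + q) = f n" and z: "(\<Sum>n=1..q. f n) = 0" and b: "\<And>n. norm (f n) \<le> c"
  and q: "q > 0"
 shows "norm (\<Sum>n=1..N. f n) \<le> c * real q"
proof (induction N rule: less_induct)
 case (less N)
 have c: "c \<ge> 0" using b[of 0] norm_ge_zero[of "f 0"] by linarith
 show ?case
 proof (cases "N \<ge> q")
  case False
  have "norm (\<Sum>n=1..N. f n) \<le> (\<Sum>n=1..N. c)" by (intro sum_norm_le b)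
  also have "... \<le> c * real q" using False c by (simp add: mult_left_mono mult.commute)
  finally show ?thesis .
 next
  case True
  have "{1..N} = {1..N-q} \<union> {N-q<..N-q+q}" using True by auto
  hence "(\<Sum>n=1..N. f n) = (\<Sum>n=1..N-q. f n) + (\<Sum>n\<in>{N-q<..N-q+q}. f n)"
   by (simp only:) (rule sum.union_disjoint, auto)
  also have "... = (\<Sum>n=1..N-q. f n)" using sum_period_shift[of f q "N-q"] per z by simp
  finally show ?thesis using less[of "N-q"] True q by simp
 qed
qed

text \<open>Multiplication by \<open>a\<close> permutes the residues prime to \<open>q\<close>,
  represented by \<open>totatives q\<close>.\<close>

lemma sum_mult_coprime_period:
 fixes f :: "nat => complex"
 assumes q: "q > 0" and per: "\<And>n. f (n + q) = f n" and supp: "\<And>n. \<not> coprime n q ==> f n = 0"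
  and a: "coprime a q"
 shows "(\<Sum>n=1..q. f (a * n)) = (\<Sum>n=1..q. f n)"
proof -
 have tot: "(\<Sum>n=1..q. g n) = (\<Sum>n\<in>totatives q. g n)" if "\<And>n. \<not> coprime n q ==> g n = 0"
  for g :: "nat => complex" by (rule sum.mono_neutral_right) (use that in \<open>auto simp: totatives_def\<close>)
 have fm: "f (n mod q) = f n" for n by (rule periodic_mod) (rule per)
 show ?thesis
 \<comment> \<open>For \<open>q = 1\<close> the representative in \<open>totatives\<close> is 1,
   whereas \<open>mod\<close> yields 0.\<close>
 proof (cases "q = 1")
  case True
  thus ?thesis using fm[of a] fm[of 1] by simp
 next
  case False
  hence q1: "q > 1" using q by simp
  have rng: "a * n mod q \<in> totatives q" if "n \<in> totatives q" for n
  proof -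
   have "coprime (a * n) q" using that a by (auto simp: totatives_def coprime_mult_left_iff)
   hence "coprime (a * n mod q) q" by (simp only: coprime_mod_left_nat)
   moreover have "a * n mod q \<noteq> 0" using \<open>coprime (a * n mod q) q\<close> q1 by (intro notI) auto
   ultimately show ?thesis using q by (auto simp: totatives_def intro: less_imp_le)
  qed
  have inj: "inj_on (\<lambda>n. a * n mod q) (totatives q)"
  proof (rule inj_onI)
   fix x y assume xy: "x \<in> totatives q" "y \<in> totatives q" and e: "a * x mod q = a * y mod q"
   have "[a * x = a * y] (mod q)" using e by (simp add: cong_def)
   hence "[x = y] (mod q)" using a by (simp add: cong_mult_lcancel_nat)
   moreover have "x < q" "y < q" using xy totatives_less q1 by auto
   ultimately show "x = y" by (simp add: cong_def)
  qed
  have bij: "bij_betw (\<lambda>n. a * n mod q) (totatives q) (totatives q)"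
   unfolding bij_betw_def using inj rng endo_inj_surj[OF finite_totatives _ inj] by blast
  have "(\<Sum>n\<in>totatives q. f (a * n)) = (\<Sum>n\<in>totatives q. f (a * n mod q))" using fm by simp
  also have "... = (\<Sum>n\<in>totatives q. f n)" by (rule sum.reindex_bij_betw[OF bij])
  finally show ?thesis by (subst (1 2) tot) (use supp a in \<open>auto simp: coprime_mult_left_iff\<close>)
 qed
qed

text \<open>Multiplying the sum by a value \<open>\<xi> a\<close> other than 0 and 1 only permutes
  its terms.\<close>

lemma dchar_sum_eq_0:
 assumes "dchar q \<xi>" "\<xi> \<noteq> prin q" shows "(\<Sum>n=1..q. \<xi> n) = 0"
proof -
 obtain a where a: "\<xi> a \<noteq> prin q a" using assms(2) by blast
 have c: "coprime a q" using a dchar_eq_0_iff[OF assms(1), of a] by (auto simp: prin_def)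
 have "(\<Sum>n=1..q. \<xi> (a * n)) = (\<Sum>n=1..q. \<xi> n)" by (rule sum_mult_coprime_period)
   (use assms(1) c dchar_eq_0_iff[OF assms(1)] in \<open>auto simp: dchar_pos dchar_periodic\<close>)
 hence "(\<xi> a - 1) * (\<Sum>n=1..q. \<xi> n) = 0"
  by (simp add: dchar_mult[OF assms(1)] sum_distrib_left[symmetric] left_diff_distrib)
 thus ?thesis using a c by (auto simp: prin_def)
qed

lemma dchar_partial_sum:
 assumes "dchar q \<xi>" "\<xi> \<noteq> prin q" shows "norm (\<Sum>n=1..N. \<xi> n) \<le> real q"
 using sum_periodic_zero_bound[of \<xi> q 1 N] assms dchar_sum_eq_0[OF assms]
 by (auto simp: dchar_periodic dchar_pos dchar_norm_le)

lemma sum_prin: "(\<Sum>n=1..q. prin q n) = of_nat (totient q)"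
proof -
 have "(\<Sum>n=1..q. prin q n) = (\<Sum>n\<in>totatives q. 1)"
  by (rule sum.mono_neutral_cong_right) (auto simp: totatives_def prin_def)
 thus ?thesis by (simp add: totient_def)
qed

lemma prin_partial_sum:
 assumes "q > 0"
 shows "norm (\<Sum>n=1..N. prin q n - of_nat (totient q) / of_nat q) \<le> real q"
proof -
 have t: "totient q \<le> q" by (rule totient_le)
 have "norm (\<Sum>n=1..N. prin q n - of_nat (totient q) / of_nat q) \<le> 1 * real q"
 proof (rule sum_periodic_zero_bound)
  show "prin q (n + q) - of_nat (totient q) / of_nat q = prin q n - of_nat (totient q) / of_nat q" for n
   by (simp add: prin_def coprime_add_self_nat)
  show "(\<Sum>n = 1..q. prin q n - of_nat (totient q) / of_nat q) = 0" using assms by (simp add: sum_subtractf sum_prin)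
  fix n
  have "prin q n - of_nat (totient q) / of_nat q = of_real ((if coprime n q then 1 else 0) - real (totient q) / real q)"
   by (simp add: prin_def)
  moreover have "real (totient q) / real q \<le> 1" using t assms by (simp add: divide_simps)
  ultimately show "norm (prin q n - of_nat (totient q) / of_nat q) \<le> 1" by (simp only: norm_of_real) auto
 qed (use assms in auto)
 thus ?thesis by simp
qed

section \<open>Existence of enough characters, and orthogonality\<close>

definition unity_root :: "nat => complex" where
 "unity_root m = exp (2 * of_real pi * \<i> / of_nat m)"

lemma unity_root_power_eq_1_iff: "m > 0 ==> unity_root m ^ j = 1 \<longleftrightarrow> m dvd j"
proof -
 assume m: "m > 0"
 have "unity_root m ^ j = exp (2 * of_real pi * \<i> * of_nat j / of_nat m)"
  unfolding unity_root_def exp_of_nat_mult[symmetric] by (simp add: field_simps)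
 thus ?thesis using complex_root_unity_eq_1[of m j] m by (simp add: )
qed

lemma unity_root_nz [simp]: "unity_root m \<noteq> 0" by (simp add: unity_root_def)

lemma unity_root_sum:
 assumes "m > 0"
 shows "(\<Sum>i<m. unity_root m ^ (i * j)) = (if m dvd j then of_nat m else 0)"
proof (cases "m dvd j")
 case True
 have "unity_root m ^ (i * j) = 1" for i using unity_root_power_eq_1_iff[OF assms] True by simp
 thus ?thesis using True by simp
next
 case False
 let ?w = "unity_root m ^ j"
 have w: "?w \<noteq> 1" using False unity_root_power_eq_1_iff[OF assms] by simp
 have "(\<Sum>i<m. unity_root m ^ (i * j)) = (\<Sum>i<m. ?w ^ i)" by (simp add: power_mult[symmetric] mult.commute)
 also have "... = (?w ^ m - 1) / (?w - 1)" by (rule geometric_sum[OF w])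
 also have "?w ^ m = 1" by (simp add: power_mult[symmetric] unity_root_power_eq_1_iff[OF assms])
 finally show ?thesis using False by simp
qed

text \<open>The \<open>m\<close>-th power of translation by \<open>g\<close> is the identity, so
  \<open>P i\<close> is \<open>m\<close> times the projection of \<open>f\<close> onto the
  eigenspace whose eigenvalue is the inverse of the \<open>i\<close>-th power of the root of unity.
  The second claim decomposes \<open>f\<close> into its components.\<close>

lemma char_separate_aux:
 fixes f :: "nat => complex"
 assumes q: "q > 0" and g: "coprime g q" and per: "\<And>n. f (n + q) = f n"
 defines "m \<equiv> totient q"
 defines "P \<equiv> \<lambda>i n. \<Sum>j<m. unity_root m ^ (i * j) * f (g ^ j * n)"
 shows "\<And>i n. P i (g * n) = inverse (unity_root m ^ i) * P i n"
  and "\<And>n. (\<Sum>i<m. P i n) = of_nat m * f n"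
proof -
 have m: "m > 0" using q by (simp add: m_def)
 fix i n
 define F where "F = (\<lambda>j. unity_root m ^ (i * j) * f (g ^ j * n))"
 have fm: "f (n mod q) = f n" for n by (rule periodic_mod) (rule per)
 have "[g ^ m * n = 1 * n] (mod q)" by (rule cong_mult) (use euler_theorem[of g q] g in \<open>auto simp: m_def\<close>)
 hence "f (g ^ m * n) = f n" using fm[of "g ^ m * n"] fm[of n] by (simp add: cong_def)
 hence F0: "F m = F 0" using unity_root_power_eq_1_iff[OF m, of "i * m"] by (simp add: F_def)
 have "unity_root m ^ i * P i (g * n) = (\<Sum>j<m. F (Suc j))"
  unfolding P_def F_def sum_distrib_left by (rule sum.cong) (auto simp: power_add mult_ac)
 also have "... = (\<Sum>j<m. F j)" using sum.lessThan_Suc_shift[of F m] F0 by simp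
 also have "... = P i n" by (simp add: F_def P_def)
 finally show "P i (g * n) = inverse (unity_root m ^ i) * P i n" by (simp add: field_simps)
next
 have m: "m > 0" using q by (simp add: m_def)
 fix n
 have "(\<Sum>i<m. P i n) = (\<Sum>j<m. (\<Sum>i<m. unity_root m ^ (i * j)) * f (g ^ j * n))"
  unfolding P_def by (subst sum.swap) (simp add: sum_distrib_right)
 also have "... = (\<Sum>j<m. if j = 0 then of_nat m * f n else 0)"
  by (rule sum.cong) (auto simp: unity_root_sum[OF m] dest: dvd_imp_le)
 also have "... = of_nat m * f n" using m by simp
 finally show "(\<Sum>i<m. P i n) = of_nat m * f n" .
qed

text \<open>A simultaneous eigenfunction of all translations, with eigenvalue \<open>\<noteq> 1\<close> for
 translation by \<open>a\<close>, is produced by projecting successively onto eigenspaces.\<close>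

lemma dchar_separate:
 assumes q: "q > 0" and a: "coprime a q" and na: "\<not> [a = 1] (mod q)"
 shows "\<exists>\<xi>. dchar q \<xi> \<and> \<xi> a \<noteq> 1"
proof -
 define m where "m = totient q"
 have m: "m > 0" using q by (simp add: m_def)
 \<comment> \<open>The space on which the translations act: periodic functions supported on the
   residues prime to \<open>q\<close>, without the zero function.\<close>
 define good where "good = (\<lambda>f :: nat => complex. (\<forall>n. f (n + q) = f n) \<and>
  (\<forall>n. \<not> coprime n q --> f n = 0) \<and> (\<exists>n. f n \<noteq> 0))"
 have goodP: "good (\<lambda>n. \<Sum>j<m. unity_root m ^ (i * j) * f (g ^ j * n))"
  if f: "good f" and g: "coprime g q" and ex: "\<exists>n. (\<Sum>j<m. unity_root m ^ (i * j) * f (g ^ j * n)) \<noteq> 0"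
  for f g i
 proof -
  have fm: "f (n mod q) = f n" for n by (rule periodic_mod) (use f in \<open>auto simp: good_def\<close>)
  have "f (g ^ j * (n + q)) = f (g ^ j * n)" for j n by (subst (1 2) fm[symmetric]) (simp add: distrib_left)
  moreover have "f (g ^ j * n) = 0" if "\<not> coprime n q" for j n using f that by (auto simp: good_def coprime_mult_left_iff)
  ultimately show ?thesis using ex unfolding good_def by (auto simp del: mult_eq_0_iff)
 qed
 \<comment> \<open>The indicator of the class of 1 is moved by translation by \<open>a\<close>,
   because \<open>a\<close> lies outside that class.\<close>
 define f0 :: "nat => complex" where "f0 = (\<lambda>n. if [n = 1] (mod q) then 1 else 0)"
 have f0: "good f0"
 proof -
  have "coprime n q" if "[n = 1] (mod q)" for n using that by (metis cong_imp_coprime cong_sym coprime_1_left)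
  moreover have "f0 1 \<noteq> 0" by (simp add: f0_def)
  ultimately show ?thesis unfolding good_def by (auto simp del: One_nat_def simp: f0_def cong_def split: if_splits)
 qed
 \<comment> \<open>If all components of \<open>f0\<close> with eigenvalue other than 1 vanished,
   \<open>f0\<close> would be fixed by translation by \<open>a\<close>.\<close>
 have base: "\<exists>f w. good f \<and> w \<noteq> 1 \<and> (\<forall>n. f (a * n) = w * f n)"
 proof (rule ccontr)
  assume neg: "\<not> ?thesis"
  define P where "P = (\<lambda>i n. \<Sum>j<m. unity_root m ^ (i * j) * f0 (a ^ j * n))"
  have P1: "P i (a * n) = inverse (unity_root m ^ i) * P i n" for i n
   unfolding P_def m_def by (rule char_separate_aux(1)) (use q a f0 in \<open>auto simp: good_def\<close>)
  have P2: "(\<Sum>i<m. P i n) = of_nat m * f0 n" for n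
   unfolding P_def m_def by (rule char_separate_aux(2)) (use q a f0 in \<open>auto simp: good_def\<close>)
  have Pz: "P i n = 0" if i: "i < m" "i \<noteq> 0" for i n
  proof (rule ccontr)
   assume nz: "P i n \<noteq> 0"
   have gp: "good (P i)" unfolding P_def by (rule goodP[OF f0 a]) (use nz in \<open>auto simp: P_def\<close>)
   have "inverse (unity_root m ^ i) \<noteq> 1" using unity_root_power_eq_1_iff[OF m, of i] i by (auto dest: dvd_imp_le)
   thus False using neg gp P1 by blast
  qed
  have "of_nat m * f0 n = P 0 n" for n
  proof -
   have "(\<Sum>i<m. P i n) = (\<Sum>i\<in>{0}. P i n)" by (rule sum.mono_neutral_right) (use m Pz in auto)
   thus ?thesis using P2[of n] by simp
  qed
  hence "of_nat m * f0 (a * 1) = of_nat m * f0 1" using P1[of 0 1] by simp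
  thus False using m na by (simp add: f0_def)
 qed
 \<comment> \<open>Translations commute, so projecting onto an eigenspace of \<open>g\<close> keeps
   every eigenvector property reached before. Some component is nonzero, because the components add
   up to a multiple of \<open>f\<close>.\<close>
 have step: "finite S ==> (\<forall>g\<in>S. coprime g q) ==>
  \<exists>f w. good f \<and> w \<noteq> 1 \<and> (\<forall>n. f (a * n) = w * f n) \<and> (\<forall>g\<in>S. \<exists>l. \<forall>n. f (g * n) = l * f n)" for S
 proof (induction S rule: finite_induct)
  case empty
  thus ?case using base by auto
 next
  case (insert g S)
  then obtain f w where f: "good f" "w \<noteq> 1" "\<forall>n. f (a * n) = w * f n"
   "\<forall>g\<in>S. \<exists>l. \<forall>n. f (g * n) = l * f n" by auto
  have g: "coprime g q" using insert by auto
  define P where "P = (\<lambda>i n. \<Sum>j<m. unity_root m ^ (i * j) * f (g ^ j * n))"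
  have P1: "P i (g * n) = inverse (unity_root m ^ i) * P i n" for i n
   unfolding P_def m_def by (rule char_separate_aux(1)) (use q g f in \<open>auto simp: good_def\<close>)
  have P2: "(\<Sum>i<m. P i n) = of_nat m * f n" for n
   unfolding P_def m_def by (rule char_separate_aux(2)) (use q g f in \<open>auto simp: good_def\<close>)
  obtain n0 where "f n0 \<noteq> 0" using f by (auto simp: good_def)
  hence "(\<Sum>i<m. P i n0) \<noteq> 0" using P2 m by simp
  then obtain i where i: "P i n0 \<noteq> 0" by (meson sum.not_neutral_contains_not_neutral)
  have gp: "good (P i)" unfolding P_def by (rule goodP[OF f(1) g]) (use i in \<open>auto simp: P_def\<close>)
  have tr: "P i (h * n) = l * P i n" if "\<forall>n. f (h * n) = l * f n" for h l n
   unfolding P_def sum_distrib_left by (rule sum.cong) (use that in \<open>auto simp: mult.left_commute\<close>)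
  show ?case
  proof (intro exI conjI)
   show "good (P i)" by fact
   show "w \<noteq> 1" by fact
   show "\<forall>n. P i (a * n) = w * P i n" using tr f(3) by blast
   show "\<forall>h\<in>insert g S. \<exists>l. \<forall>n. P i (h * n) = l * P i n"
   proof
    fix h assume h: "h \<in> insert g S"
    show "\<exists>l. \<forall>n. P i (h * n) = l * P i n"
    proof (cases "h = g")
     case True
     thus ?thesis using P1 by blast
    next
     case False
     then obtain l where "\<forall>n. f (h * n) = l * f n" using f(4) h by blast
     thus ?thesis using tr by blast
    qed
   qed
  qed
 qed
 have "\<exists>f w. good f \<and> w \<noteq> 1 \<and> (\<forall>n. f (a * n) = w * f n) \<and>
   (\<forall>g\<in>{g. g < q \<and> coprime g q}. \<exists>l. \<forall>n. f (g * n) = l * f n)"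
  by (rule step) auto
 then obtain f w where ff: "good f \<and> w \<noteq> 1 \<and> (\<forall>n. f (a * n) = w * f n) \<and>
   (\<forall>g\<in>{g. g < q \<and> coprime g q}. \<exists>l. \<forall>n. f (g * n) = l * f n)"
  by (elim exE)
 note f = ff[THEN conjunct1] ff[THEN conjunct2, THEN conjunct1]
  ff[THEN conjunct2, THEN conjunct2, THEN conjunct1] ff[THEN conjunct2, THEN conjunct2, THEN conjunct2]
 have fm: "f (n mod q) = f n" for n by (rule periodic_mod) (use f in \<open>auto simp: good_def\<close>)
 have ev: "\<exists>l. \<forall>n. f (g * n) = l * f n" if "coprime g q" for g
 proof -
  have "g mod q \<in> {g. g < q \<and> coprime g q}" using that q by auto
  then obtain l where l: "\<forall>n. f (g mod q * n) = l * f n" using f(4) by blast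
  have "f (g * n) = f (g mod q * n)" for n by (subst (1 2) fm[symmetric]) (simp add: mod_mult_left_eq)
  thus ?thesis using l by auto
 qed
 obtain n0 where n0: "f n0 \<noteq> 0" using f by (auto simp: good_def)
 \<comment> \<open>The eigenvalue of the common eigenfunction, read off at a point where it is
   nonzero, is the character.\<close>
 define \<xi> where "\<xi> = (\<lambda>g. if coprime g q then f (g * n0) / f n0 else 0)"
 have ev': "f (g * n) = \<xi> g * f n" if g: "coprime g q" for g n
 proof -
  obtain l where "\<forall>n. f (g * n) = l * f n" using ev[OF g] by blast
  thus ?thesis using n0 g by (simp add: \<xi>_def)
 qed
 have c0: "coprime n0 q" using n0 f by (auto simp: good_def)
 have "\<xi> (x * y) = \<xi> x * \<xi> y" for x y
  using ev'[of x "y * n0"] ev'[of y n0] n0 by (auto simp: \<xi>_def coprime_mult_left_iff mult.assoc)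
 moreover have "\<xi> (n + q) = \<xi> n" for n
 proof -
  have "f ((n + q) * n0) = f (n * n0)" by (subst (1 2) fm[symmetric]) (simp add: distrib_right)
  thus ?thesis by (simp add: \<xi>_def coprime_add_self_nat)
 qed
 moreover have "\<xi> n \<noteq> 0" if n: "coprime n q" for n
 proof
  assume z: "\<xi> n = 0"
  have "[n ^ m * n0 = 1 * n0] (mod q)" by (rule cong_mult) (use euler_theorem[of n q] n in \<open>auto simp: m_def\<close>)
  hence "f (n ^ m * n0) = f n0" using fm[of "n ^ m * n0"] fm[of n0] by (simp add: cong_def)
  moreover have "n ^ m * n0 = n * (n ^ (m - 1) * n0)" using m by (cases m) auto
  ultimately show False using ev'[OF n] z n0 by simp
 qed
 ultimately have "dchar q \<xi>" using q by (auto simp: dchar_def) (auto simp: \<xi>_def)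
 moreover have "\<xi> a = w" using a f(3) n0 by (simp add: \<xi>_def)
 ultimately show ?thesis using f(2) by blast
qed

lemma finite_dchar: "finite {\<xi>. dchar q \<xi>}"
proof (cases "q = 0")
 case True thus ?thesis by (simp add: dchar_def)
next
 case False
 define R where "R = insert 0 {z :: complex. z ^ totient q = 1}"
 have "finite R" unfolding R_def using finite_roots_unity[of "totient q"] False by (simp add: Suc_le_eq One_nat_def)
 hence fin: "finite (PiE {..<q} (\<lambda>_. R))" by (intro finite_PiE) auto
 have "inj_on (\<lambda>\<xi>. restrict \<xi> {..<q}) {\<xi>. dchar q \<xi>}"
 proof (rule inj_onI, clarify)
  fix \<xi> \<psi> assume c: "dchar q \<xi>" "dchar q \<psi>" and e: "restrict \<xi> {..<q} = restrict \<psi> {..<q}"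
  show "\<xi> = \<psi>"
  proof
   fix n
   have "\<xi> (n mod q) = \<psi> (n mod q)" using fun_cong[OF e, of "n mod q"] False by simp
   thus "\<xi> n = \<psi> n" using c by (simp add: dchar_mod)
  qed
 qed
 moreover have "\<xi> n \<in> R" if "dchar q \<xi>" for \<xi> n
  using dchar_root[OF that, of n] dchar_eq_0_iff[OF that, of n] by (auto simp: R_def)
 hence "(\<lambda>\<xi>. restrict \<xi> {..<q}) ` {\<xi>. dchar q \<xi>} \<subseteq> PiE {..<q} (\<lambda>_. R)"
  by (auto split: if_splits)
 ultimately show ?thesis using fin by (meson inj_on_finite)
qed

text \<open>If \<open>n\<close> is prime to \<open>q\<close> and not 1 modulo \<open>q\<close>,
  multiplication by a character with \<open>\<psi> n \<noteq> 1\<close> permutes the characters and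
  multiplies the sum by \<open>\<psi> n\<close>. The count stays a cardinality, because
  \<open>card_dchar\<close> finds it from this very identity.\<close>

lemma sum_dchar_raw:
 assumes q: "q > 0"
 shows "(\<Sum>\<xi>|dchar q \<xi>. \<xi> n) = (if [n = 1] (mod q) then of_nat (card {\<xi>. dchar q \<xi>}) else 0)"
proof -
 consider "[n = 1] (mod q)" | "\<not> coprime n q" | "coprime n q" "\<not> [n = 1] (mod q)" by blast
 thus ?thesis
 proof cases
  case 1
  hence "\<xi> n = 1" if "dchar q \<xi>" for \<xi> using dchar_cong[OF that, of n 1] dchar_1(1)[OF that] by simp
  hence "(\<Sum>\<xi>|dchar q \<xi>. \<xi> n) = (\<Sum>\<xi>|dchar q \<xi>. 1)" by (intro sum.cong) auto
  thus ?thesis using 1 by simp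
 next
  case 2
  hence "(\<Sum>\<xi>|dchar q \<xi>. \<xi> n) = 0" by (intro sum.neutral) (auto simp: dchar_eq_0_iff)
  moreover have "\<not> [n = 1] (mod q)" using 2 by (metis cong_imp_coprime cong_sym coprime_1_left)
  ultimately show ?thesis by simp
 next
  case 3
  then obtain \<psi> where p: "dchar q \<psi>" "\<psi> n \<noteq> 1" using dchar_separate[OF q] by blast
  have psi: "\<psi> k * cnj (\<psi> k) = (if coprime k q then 1 else 0)" for k
   using dchar_norm[OF p(1), of k] by (simp add: complex_norm_square[symmetric])
  have can: "(\<lambda>k. \<psi> k * (cnj (\<psi> k) * \<xi> k)) = \<xi>" "(\<lambda>k. cnj (\<psi> k) * (\<psi> k * \<xi> k)) = \<xi>" if "dchar q \<xi>" for \<xi>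
  proof -
   have "\<psi> k * (cnj (\<psi> k) * \<xi> k) = \<xi> k" "cnj (\<psi> k) * (\<psi> k * \<xi> k) = \<xi> k" for k
    using psi[of k] dchar_eq_0_iff[OF that, of k] by (auto simp: mult.assoc[symmetric] mult.commute split: if_splits)
   thus "(\<lambda>k. \<psi> k * (cnj (\<psi> k) * \<xi> k)) = \<xi>" "(\<lambda>k. cnj (\<psi> k) * (\<psi> k * \<xi> k)) = \<xi>" by auto
  qed
  have "(\<Sum>\<xi>|dchar q \<xi>. \<xi> n) = (\<Sum>\<xi>|dchar q \<xi>. \<psi> n * \<xi> n)"
  proof (rule sum.reindex_bij_witness[of _ "\<lambda>\<xi> k. \<psi> k * \<xi> k" "\<lambda>\<xi> k. cnj (\<psi> k) * \<xi> k"])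
   fix \<xi> assume "\<xi> \<in> {\<xi>. dchar q \<xi>}"
   hence x: "dchar q \<xi>" by simp
   show "(\<lambda>k. \<psi> k * (cnj (\<psi> k) * \<xi> k)) = \<xi>" "(\<lambda>k. cnj (\<psi> k) * (\<psi> k * \<xi> k)) = \<xi>"
    by (rule can[OF x])+
   show "(\<lambda>k. cnj (\<psi> k) * \<xi> k) \<in> {\<xi>. dchar q \<xi>}" "(\<lambda>k. \<psi> k * \<xi> k) \<in> {\<xi>. dchar q \<xi>}"
    using dchar_times[OF dchar_cnj[OF p(1)] x] dchar_times[OF p(1) x] by simp_all
   show "\<psi> n * (cnj (\<psi> n) * \<xi> n) = \<xi> n" using fun_cong[OF can(1)[OF x], of n] by simp
  qed
  hence "(1 - \<psi> n) * (\<Sum>\<xi>|dchar q \<xi>. \<xi> n) = 0" by (simp add: sum_distrib_left[symmetric] left_diff_distrib)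
  thus ?thesis using p 3 by simp
 qed
qed

text \<open>Double counting of all character values over one period: by columns through
  \<open>sum_dchar_raw\<close>, by rows through \<open>dchar_sum_eq_0\<close>.\<close>

lemma card_dchar: assumes q: "q > 0" shows "card {\<xi>. dchar q \<xi>} = totient q"
proof -
 let ?X = "{\<xi>. dchar q \<xi>}"
 have "(\<Sum>n=1..q. \<Sum>\<xi>\<in>?X. \<xi> n) = (\<Sum>\<xi>\<in>?X. \<Sum>n=1..q. \<xi> n)" by (rule sum.swap)
 also have "... = (\<Sum>\<xi>\<in>?X. if \<xi> = prin q then of_nat (totient q) else 0)"
  by (rule sum.cong) (auto simp: dchar_sum_eq_0 sum_prin)
 also have "... = of_nat (totient q)" using finite_dchar[of q] dchar_prin[OF q] by simp
 also have "(\<Sum>n=1..q. \<Sum>\<xi>\<in>?X. \<xi> n) = (\<Sum>n=1..q. if n = 1 then of_nat (card ?X) else 0)"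
 proof (rule sum.cong)
  fix n assume n: "n \<in> {1..q}"
  have "[n = 1] (mod q) \<longleftrightarrow> n = 1"
  proof
   assume c: "[n = 1] (mod q)"
   show "n = 1"
   proof (cases "n = q")
    case True
    have "q dvd 1" using c True by (simp add: cong_def cong_dvd_iff mod_eq_0_iff_dvd mod_eq_dvd_iff_nat)
    thus ?thesis using True by simp
   next
    case False
    thus ?thesis using n c by (cases "q = 1") (auto simp: cong_def)
   qed
  qed auto
  thus "(\<Sum>\<xi>\<in>?X. \<xi> n) = (if n = 1 then of_nat (card ?X) else 0)" using sum_dchar_raw[OF q, of n] by simp
 qed simp
 also have "... = of_nat (card ?X)" using q by simp
 finally show ?thesis using of_nat_eq_iff by blast
qed

lemma sum_dchar:
 assumes q: "q > 0"
 shows "(\<Sum>\<xi>|dchar q \<xi>. \<xi> n) = (if [n = 1] (mod q) then of_nat (totient q) else 0)"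
 using sum_dchar_raw[OF q] card_dchar[OF q] by simp

section \<open>Dirichlet series\<close>

text \<open>The summand at 0 vanishes since \<open>0 powr z = 0\<close>, so the series starts in
  effect at 1.\<close>

definition DS :: "(nat => complex) => complex => complex" where
 "DS a s = (\<Sum>n. a n * of_nat n powr (- s))"

definition tame :: "(nat => complex) => bool" where
 "tame a \<longleftrightarrow> (\<forall>\<sigma>>1. summable (\<lambda>n. norm (a n) * real n powr (- \<sigma>)))"

lemma norm_nat_powr: "norm (of_nat n powr s :: complex) = real n powr Re s" using norm_powr_real_powr[of "of_nat n" s] by simp

lemma norm_DS_term: "norm (a n * of_nat n powr (- s) :: complex) = norm (a n) * real n powr (- Re s)"
 by (simp add: norm_mult norm_nat_powr)

lemma tameD: "tame a ==> Re s > 1 ==> summable (\<lambda>n. norm (a n * of_nat n powr (- s)))"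
 by (simp add: tame_def norm_DS_term)

lemma tame_summable: "tame a ==> Re s > 1 ==> summable (\<lambda>n. a n * of_nat n powr (- s))"
 by (rule summable_norm_cancel) (rule tameD)

lemma tame_comparison:
 assumes "tame b" "\<And>n. n > 0 ==> norm (a n) \<le> norm (b n)" shows "tame a"
 unfolding tame_def
proof (intro allI impI)
 fix \<sigma> :: real assume s: "\<sigma> > 1"
 show "summable (\<lambda>n. norm (a n) * real n powr (- \<sigma>))"
 proof (rule summable_comparison_test')
  show "summable (\<lambda>n. norm (b n) * real n powr (- \<sigma>))" using assms(1) s by (simp add: tame_def)
  show "norm (norm (a n) * real n powr (- \<sigma>)) \<le> norm (b n) * real n powr (- \<sigma>)" if "n \<ge> 0" for n
   using assms(2)[of n] by (cases "n = 0") (auto intro: mult_right_mono)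
 qed
qed

lemma tame_bounded: assumes "\<And>n. n > 0 ==> norm (a n) \<le> C" shows "tame a"
proof -
 have "tame (\<lambda>n. of_real C)" unfolding tame_def by (auto intro!: summable_mult simp: summable_real_powr_iff)
 thus ?thesis
 proof (rule tame_comparison)
  fix n :: nat assume "n > 0"
  thus "norm (a n) \<le> norm (complex_of_real C)" using assms[of n] by simp
 qed
qed

text \<open>Half of the distance from \<open>\<sigma>\<close> to 1 is spent on
  \<open>ln n \<le> n powr d / d\<close>.\<close>

lemma tame_ln: assumes "tame a" shows "tame (\<lambda>n. a n * of_real (ln (real n)))" unfolding tame_def
proof (intro allI impI)
 fix \<sigma> :: real assume s: "\<sigma> > 1"
 define d where "d = (\<sigma> - 1) / 2"
 have d: "d > 0" "\<sigma> - d > 1" using s by (auto simp: d_def field_simps)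
 show "summable (\<lambda>n. norm (a n * of_real (ln (real n))) * real n powr (- \<sigma>))"
 proof (rule summable_comparison_test')
  show "summable (\<lambda>n. (1 / d) * (norm (a n) * real n powr (- (\<sigma> - d))))"
   using assms d unfolding tame_def by (intro summable_mult) blast
  show "norm (norm (a n * of_real (ln (real n))) * real n powr (- \<sigma>))
    \<le> (1 / d) * (norm (a n) * real n powr (- (\<sigma> - d)))" if "n \<ge> 0" for n
  proof (cases "n = 0")
   case False
   hence "ln (real n) \<le> real n powr d / d" "ln (real n) \<ge> 0" using d by (auto intro: ln_powr_bound)
   hence "norm (a n) * (ln (real n) * real n powr (- \<sigma>)) \<le> norm (a n) * (real n powr d / d * real n powr (- \<sigma>))"
    by (intro mult_left_mono mult_right_mono) auto
   also have "... = (1 / d) * (norm (a n) * (real n powr d * real n powr (- \<sigma>)))" by simp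
   also have "real n powr d * real n powr (- \<sigma>) = real n powr (- (\<sigma> - d))" by (simp add: powr_add[symmetric])
   finally show ?thesis using \<open>ln (real n) \<ge> 0\<close> by (simp add: norm_mult mult_ac)
  qed auto
 qed
qed

lemma tame_ln_power: "tame a ==> tame (\<lambda>n. a n * of_real (ln (real n) ^ k))"
proof (induction k)
 case (Suc k)
 have "tame (\<lambda>n. (a n * of_real (ln (real n) ^ k)) * of_real (ln (real n)))" by (rule tame_ln) (rule Suc.IH[OF Suc.prems])
 thus ?case by (simp add: mult_ac)
qed simp

lemma tame_minus: "tame a ==> tame (\<lambda>n. - a n)" by (simp add: tame_def)

lemma tame_add: assumes "tame a" "tame b" shows "tame (\<lambda>n. a n + b n)" unfolding tame_def
proof (intro allI impI)
 fix \<sigma> :: real assume s: "\<sigma> > 1"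
 show "summable (\<lambda>n. norm (a n + b n) * real n powr (- \<sigma>))"
 proof (rule summable_comparison_test')
  show "summable (\<lambda>n. norm (a n) * real n powr (- \<sigma>) + norm (b n) * real n powr (- \<sigma>))"
   using assms s by (intro summable_add) (auto simp: tame_def)
  show "norm (norm (a n + b n) * real n powr (- \<sigma>)) \<le> norm (a n) * real n powr (- \<sigma>) + norm (b n) * real n powr (- \<sigma>)" for n
   using mult_right_mono[OF norm_triangle_ineq[of "a n" "b n"], of "real n powr (- \<sigma>)"] by (simp add: distrib_right)
 qed
qed

lemma DS_add: assumes "tame a" "tame b" "Re s > 1" shows "DS (\<lambda>n. a n + b n) s = DS a s + DS b s"
 unfolding DS_def distrib_right by (rule suminf_add[symmetric]) (auto intro: tame_summable assms)

lemma DS_minus: "tame a ==> Re s > 1 ==> DS (\<lambda>n. - a n) s = - DS a s"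
 unfolding DS_def by (simp add: suminf_minus tame_summable)

lemma DS_cmult: "tame a ==> Re s > 1 ==> DS (\<lambda>n. c * a n) s = c * DS a s"
 unfolding DS_def by (simp add: suminf_mult[symmetric] tame_summable mult.assoc)

lemma DS_cong: "(\<And>n. n > 0 ==> a n = b n) ==> DS a s = DS b s"
 unfolding DS_def by (rule suminf_cong) (metis gr0I mult_zero_right of_nat_0 powr_0)

lemma DS_has_field_derivative:
 assumes a: "tame a" and s: "Re s > 1"
 shows "(DS a has_field_derivative (- DS (\<lambda>n. a n * of_real (ln (real n))) s)) (at s)"
proof -
 define f where "f = (\<lambda>n s. a n * of_nat n powr (- s))"
 define f' where "f' = (\<lambda>n s. - (a n * of_real (ln (real n)) * of_nat n powr (- s)))"
 have "\<exists>g g'. \<forall>x \<in> {s. Re s > 1}. ((\<lambda>n. f n x) sums g x) \<and> ((\<lambda>n. f' n x) sums g' x) \<and> (g has_field_derivative g' x) (at x)"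
 proof (rule series_and_derivative_comparison_local)
  show "open {s. Re s > 1}" by (rule open_halfspace_Re_gt)
  show "(f n has_field_derivative f' n x) (at x)" if "x \<in> {s. Re s > 1}" for n x
  proof (cases "n = 0")
   case True
   have "f n = (\<lambda>s. 0)" "f' n x = 0" by (auto simp: f_def f'_def True)
   thus ?thesis by simp
  next
   case False
   have "((\<lambda>s. a n * of_nat n powr (- s)) has_field_derivative a n * (Ln (of_nat n) * of_nat n powr (- x) * (- 1))) (at x)"
    by (rule DERIV_cmult, rule DERIV_chain2[of "\<lambda>z. of_nat n powr z" _ uminus],
      rule has_field_derivative_powr_right, use False in simp, rule DERIV_minus, rule DERIV_ident)
   moreover have "Ln (of_nat n) = of_real (ln (real n))" using False Ln_of_real[of "real n"] by simp
   ultimately show ?thesis by (simp add: f_def f'_def mult_ac)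
  qed
  fix x assume x: "x \<in> {s. Re s > 1}"
  define c where "c = (1 + Re x) / 2"
  have c: "c > 1" "c < Re x" using x by (auto simp: c_def field_simps)
  show "\<exists>d h. 0 < d \<and> summable h \<and> (\<forall>\<^sub>F n in sequentially. \<forall>y\<in>ball x d \<inter> {s. Re s > 1}. norm (f n y) \<le> h n)"
  proof (intro exI conjI always_eventually allI ballI)
   show "Re x - c > 0" using c by simp
   show "summable (\<lambda>n. norm (a n) * real n powr (- c))" using a c by (simp add: tame_def)
   fix n y assume y: "y \<in> ball x (Re x - c) \<inter> {s. Re s > 1}"
   have "Re x - Re y \<le> norm (x - y)" using complex_Re_le_cmod[of "x - y"] by simp
   hence "Re y \<ge> c" using y by (auto simp: dist_norm)
   hence "real n powr (- Re y) \<le> real n powr (- c)" by (cases "n = 0") (auto intro: powr_mono)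
   thus "norm (f n y) \<le> norm (a n) * real n powr (- c)" by (auto simp: f_def norm_DS_term intro: mult_left_mono)
  qed
 qed
 then obtain g g' where g: "\<And>x. Re x > 1 ==> ((\<lambda>n. f n x) sums g x) \<and> ((\<lambda>n. f' n x) sums g' x) \<and> (g has_field_derivative g' x) (at x)"
  by blast
 have eq: "g x = DS a x" if "Re x > 1" for x using g[OF that] by (auto simp: DS_def f_def sums_iff)
 have eq': "g' s = - DS (\<lambda>n. a n * of_real (ln (real n))) s"
 proof -
  have "(\<lambda>n. - f' n s) sums (- g' s)" using g[OF s] sums_minus by blast
  thus ?thesis by (simp add: DS_def f'_def sums_iff)
 qed
 have "(DS a has_field_derivative g' s) (at s)" by (rule has_field_derivative_transform_within_open[of g _ _ "{s. Re s > 1}"])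
   (use g[OF s] s eq open_halfspace_Re_gt in auto)
 thus ?thesis using eq' by simp
qed

lemma DS_holomorphic: "tame a ==> DS a holomorphic_on {s. Re s > 1}"
 by (rule holomorphic_onI) (use DS_has_field_derivative field_differentiable_at_within field_differentiable_def in blast)

lemma DS_higher_deriv:
 assumes a: "tame a" shows "Re s > 1 ==> (deriv ^^ k) (DS a) s = (-1) ^ k * DS (\<lambda>n. a n * of_real (ln (real n) ^ k)) s"
proof (induction k arbitrary: s)
 case (Suc k)
 let ?b = "\<lambda>n. a n * of_real (ln (real n) ^ k)"
 have tb: "tame ?b" by (rule tame_ln_power[OF a])
 have "((deriv ^^ k) (DS a) has_field_derivative (-1) ^ k * (- DS (\<lambda>n. ?b n * of_real (ln (real n))) s)) (at s)"
  by (rule has_field_derivative_transform_within_open[OF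
     DERIV_cmult[OF DS_has_field_derivative[OF tb Suc.prems], of "(-1) ^ k"] open_halfspace_Re_gt[of 1]])
   (use Suc in auto)
 hence "deriv ((deriv ^^ k) (DS a)) s = (-1) ^ k * (- DS (\<lambda>n. ?b n * of_real (ln (real n))) s)" by (rule DERIV_imp_deriv)
 thus ?case by (simp add: mult_ac)
qed simp

text \<open>Everything after the first term is at most \<open>2 powr (2 - \<sigma>)\<close> times
  the sum of absolute values at 2. The limit fixes the constant of integration in
  \<open>DS_eq_exp\<close>.\<close>

lemma DS_tendsto_1:
 assumes a: "tame a" shows "((\<lambda>\<sigma>. DS a (of_real \<sigma>)) \<longlongrightarrow> a 1) at_top"
proof -
 define A where "A = (\<Sum>n. norm (a n) * real n powr (- 2))"
 have sA: "summable (\<lambda>n. norm (a n) * real n powr (- 2))" using a by (simp add: tame_def)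
 have ev: "\<forall>\<^sub>F \<sigma> in at_top. norm (DS a (of_real \<sigma>) - a 1) \<le> A * 2 powr (2 - \<sigma>)"
  using eventually_ge_at_top[of 2]
 proof eventually_elim
  fix \<sigma> :: real assume s: "\<sigma> \<ge> 2"
  let ?f = "\<lambda>n. a n * of_nat n powr (- of_real \<sigma>)"
  let ?g = "\<lambda>n. if n = 1 then 0 else ?f n"
  have sf: "summable ?f" using tame_summable[OF a, of "of_real \<sigma>"] s by simp
  have "?f sums DS a (of_real \<sigma>)" using sf by (simp add: DS_def summable_sums)
  hence "(\<lambda>n. ?f n - (if n = 1 then a 1 else 0)) sums (DS a (of_real \<sigma>) - a 1)"
   by (intro sums_diff) (auto intro: sums_single)
  moreover have "(\<lambda>n. ?f n - (if n = 1 then a 1 else 0)) = ?g" by auto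
  ultimately have gs: "?g sums (DS a (of_real \<sigma>) - a 1)" by simp
  have gb: "norm (?g n) \<le> norm (a n) * real n powr (- 2) * 2 powr (2 - \<sigma>)" for n
  proof (cases "n \<le> 1")
   case False
   have "real n powr (- \<sigma>) = real n powr (- 2) * real n powr (2 - \<sigma>)" using False by (simp add: powr_add[symmetric])
   also have "real n powr (2 - \<sigma>) \<le> 2 powr (2 - \<sigma>)" using False s by (intro powr_mono2') auto
   finally show ?thesis using False by (auto simp: norm_DS_term mult.assoc intro!: mult_left_mono)
  qed (auto simp: le_Suc_eq One_nat_def)
  have sb: "summable (\<lambda>n. norm (a n) * real n powr (- 2) * 2 powr (2 - \<sigma>))" using sA by (rule summable_mult2)
  have sg: "summable (\<lambda>n. norm (?g n))" by (rule summable_comparison_test'[OF sb]) (use gb in auto)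
  have "norm (DS a (of_real \<sigma>) - a 1) \<le> (\<Sum>n. norm (?g n))" using summable_norm[OF sg] gs by (simp add: sums_iff)
  also have "... \<le> (\<Sum>n. norm (a n) * real n powr (- 2) * 2 powr (2 - \<sigma>))" by (rule suminf_le[OF gb sg sb])
  also have "... = A * 2 powr (2 - \<sigma>)" unfolding A_def by (rule suminf_mult2[OF sA, symmetric])
  finally show "norm (DS a (of_real \<sigma>) - a 1) \<le> A * 2 powr (2 - \<sigma>)" .
 qed
 have "((\<lambda>\<sigma>::real. A * 2 powr (2 - \<sigma>)) \<longlongrightarrow> 0) at_top" by real_asymp
 from Lim_null_comparison[OF ev this] show ?thesis by (rule LIM_zero_cancel)
qed

text \<open>The double series over all pairs converges absolutely and may be regrouped along
  \<open>n = x * y\<close>.\<close>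

lemma DS_mult:
 assumes f: "tame f" and g: "tame g" and s: "Re s > 1"
 shows "DS f s * DS g s = DS (\<lambda>n. \<Sum>d | d dvd n. f d * g (n div d)) s"
proof -
 define u where "u = (\<lambda>n. f n * of_nat n powr (- s))"
 define v where "v = (\<lambda>n. g n * of_nat n powr (- s))"
 have su: "summable (\<lambda>n. norm (u n))" and sv: "summable (\<lambda>n. norm (v n))"
  using tameD f g s by (auto simp: u_def v_def)
 have hu: "(u has_sum DS f s) UNIV" and hv: "(v has_sum DS g s) UNIV"
  using norm_summable_imp_has_sum[OF su] norm_summable_imp_has_sum[OF sv]
   summable_sums[OF summable_norm_cancel[OF su]] summable_sums[OF summable_norm_cancel[OF sv]]
  by (auto simp: DS_def u_def v_def)
 have au: "(\<lambda>n. norm (u n)) summable_on UNIV" and av: "(\<lambda>n. norm (v n)) summable_on UNIV"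
  using norm_summable_imp_summable_on[of "\<lambda>n. norm (u n)"] norm_summable_imp_summable_on[of "\<lambda>n. norm (v n)"] su sv
  by simp_all
 define P where "P = (\<lambda>(x, y). u x * v y)"
 have "(\<lambda>z. norm (P z)) summable_on UNIV \<times> UNIV" unfolding Infinite_Sum.abs_summable_on_Sigma_iff
 proof (intro conjI ballI)
  show "(\<lambda>y. norm (P (x, y))) summable_on UNIV" for x
   unfolding P_def using av by (simp add: norm_mult summable_on_cmult_right)
  have "(\<lambda>x. norm (norm (u x) * infsum (\<lambda>y. norm (v y)) UNIV)) summable_on UNIV"
   using summable_on_cmult_left[OF au, of "infsum (\<lambda>y. norm (v y)) UNIV"] by (simp add: norm_mult abs_mult infsum_nonneg)
  thus "(\<lambda>x. norm (infsum (\<lambda>y. norm (P (x, y))) UNIV)) summable_on UNIV"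
   using av by (simp add: P_def norm_mult infsum_cmult_right)
 qed
 hence sP: "P summable_on UNIV \<times> UNIV" by (rule abs_summable_summable)
 have "infsum P (UNIV \<times> UNIV) = infsum (\<lambda>x. infsum (\<lambda>y. P (x, y)) UNIV) UNIV"
  by (rule infsum_Sigma_banach[OF sP, symmetric])
 also have "... = infsum (\<lambda>x. u x * DS g s) UNIV"
  using hv by (simp add: P_def infsum_cmult_right infsumI has_sum_imp_summable)
 also have "... = DS f s * DS g s" using hu by (simp add: infsum_cmult_left infsumI has_sum_imp_summable)
 finally have 1: "infsum P (UNIV \<times> UNIV) = DS f s * DS g s" .
 \<comment> \<open>Pairs containing a 0 contribute nothing. Leaving them out gives a bijection with
   the pairs of a positive number and one of its divisors.\<close>
 let ?A = "{1::nat..} \<times> {1::nat..}"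
 let ?B = "SIGMA n:{1::nat..}. {d. d dvd n}"
 have P0: "P z = 0" if "z \<notin> ?A" for z using that by (cases z) (auto simp: P_def u_def v_def One_nat_def not_less_eq_eq)
 define Q where "Q = (\<lambda>(n, d). f d * g (n div d) * of_nat n powr (- s))"
 have pw: "of_nat (x * y) powr (- s) = of_nat x powr (- s) * (of_nat y :: complex) powr (- s)" for x y
  using powr_times_real[of "of_nat x" "of_nat y" "- s"] by simp
 have 2: "infsum P (UNIV \<times> UNIV) = infsum P ?A" by (rule infsum_cong_neutral) (use P0 in auto)
 have sPA: "P summable_on ?A" by (rule summable_on_subset_banach[OF sP]) auto
 have bij: "bij_betw (\<lambda>(n, d). (d, n div d)) ?B ?A" by (rule bij_betwI[of _ _ _ "\<lambda>(x, y). (x * y, x)"])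
   (auto simp: Suc_le_eq One_nat_def dvd_div_eq_0_iff intro!: Nat.gr0I dest: dvd_pos_nat)
 have PQ: "P ((\<lambda>(n, d). (d, n div d)) z) = Q z" if "z \<in> ?B" for z
  using that pw by (cases z) (auto simp: P_def Q_def u_def v_def elim!: dvdE)
 have 3: "infsum P ?A = infsum Q ?B" using infsum_reindex_bij_betw[OF bij, of P] PQ by (simp cong: infsum_cong)
 have sQ: "Q summable_on ?B" using summable_on_reindex_bij_betw[OF bij, of P] sPA PQ by (simp cong: summable_on_cong)
 have "infsum Q ?B = infsum (\<lambda>n. infsum (\<lambda>d. Q (n, d)) {d. d dvd n}) {1..}"
  by (rule infsum_Sigma_banach[OF sQ, symmetric])
 also have "... = infsum (\<lambda>n. (\<Sum>d | d dvd n. f d * g (n div d)) * of_nat n powr (- s)) {1..}"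
  by (rule infsum_cong) (auto simp: Q_def sum_distrib_right One_nat_def)
 also have "... = infsum (\<lambda>n. (\<Sum>d | d dvd n. f d * g (n div d)) * of_nat n powr (- s)) UNIV"
  by (rule infsum_cong_neutral) (auto simp: not_less_eq_eq One_nat_def)
 finally have 4: "infsum Q ?B = ..." .
 have "(\<lambda>n. infsum (\<lambda>d. Q (n, d)) {d. d dvd n}) summable_on {1..}"
  using summable_on_Sigma_banach[of "\<lambda>n d. Q (n, d)"] sQ by simp
 hence "(\<lambda>n. (\<Sum>d | d dvd n. f d * g (n div d)) * of_nat n powr (- s)) summable_on {1..}"
  by (rule summable_on_cong[THEN iffD1, rotated]) (auto simp: Q_def sum_distrib_right One_nat_def)
 hence "(\<lambda>n. (\<Sum>d | d dvd n. f d * g (n div d)) * of_nat n powr (- s)) summable_on UNIV"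
  by (rule summable_on_cong_neutral[THEN iffD1, rotated 3]) (auto simp: not_less_eq_eq One_nat_def)
 hence "(\<lambda>n. (\<Sum>d | d dvd n. f d * g (n div d)) * of_nat n powr (- s)) sums
   infsum (\<lambda>n. (\<Sum>d | d dvd n. f d * g (n div d)) * of_nat n powr (- s)) UNIV"
  by (intro has_sum_imp_sums has_sum_infsum)
 thus ?thesis using 1 2 3 4 by (simp add: DS_def sums_iff)
qed

section \<open>Logarithms of L-functions and the 3-4-1 inequality\<close>

lemma mangoldt_nonneg: "mangoldt n \<ge> (0 :: real)"
proof (cases "primepow n")
 case True
 hence "aprimedivisor n > 0" using primepow_gt_Suc_0[of n] by (intro aprimedivisor_pos_nat) simp
 hence "real (aprimedivisor n) \<ge> 1" by simp
 thus ?thesis using True by (simp add: mangoldt_def)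
qed (simp add: mangoldt_def)

lemma mangoldt_le_ln: assumes "n > 0" shows "mangoldt n \<le> ln (real n)"
proof -
 have "mangoldt n \<le> (\<Sum>d | d dvd n. mangoldt d :: real)" by (rule member_le_sum) (use assms mangoldt_nonneg in auto)
 thus ?thesis using mangoldt_sum[where 'a = real, of n] assms by simp
qed

text \<open>The coefficients of log L(s, \<xi>). At \<open>n = 1\<close> the division by
  \<open>ln 1 = 0\<close> gives 0, which is the right value.\<close>

definition logcoef :: "(nat => complex) => nat => complex" where
 "logcoef \<xi> n = \<xi> n * of_real (mangoldt n / ln (real n))"

lemma logcoef_weight: assumes "n > 0" shows "mangoldt n / ln (real n) \<in> {0..1 :: real}"
proof (cases "n = 1")
 case False
 have l: "ln (real n) > 0" using False assms by simp
 have "mangoldt n / ln (real n) \<ge> 0" using mangoldt_nonneg l by (intro divide_nonneg_pos)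
 moreover have "mangoldt n / ln (real n) \<le> 1" using mangoldt_le_ln[OF assms] divide_le_eq_1_pos[OF l] by blast
 ultimately show ?thesis by simp
qed (auto simp: One_nat_def)

lemma tame_dchar: "dchar q \<xi> ==> tame \<xi>" by (rule tame_bounded[of _ 1]) (rule dchar_norm_le)

lemma norm_logcoef_le: assumes "\<And>n. norm (\<xi> n) \<le> C" "n > 0" shows "norm (logcoef \<xi> n) \<le> C"
proof -
 have "norm (\<xi> n) * (mangoldt n / ln (real n)) \<le> norm (\<xi> n) * 1"
  using logcoef_weight[OF assms(2)] by (intro mult_left_mono) auto
 hence "norm (\<xi> n) * (mangoldt n / ln (real n)) \<le> C" using assms(1)[of n] by simp
 moreover have "norm (of_real (mangoldt n / ln (real n)) :: complex) = mangoldt n / ln (real n)"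
  using logcoef_weight[OF assms(2)] by (simp only: norm_of_real atLeastAtMost_iff abs_of_nonneg)
 ultimately show ?thesis by (simp only: logcoef_def norm_mult)
qed

lemma tame_logcoef: "dchar q \<xi> ==> tame (logcoef \<xi>)"
 by (rule tame_bounded[of _ 1]) (auto intro: norm_logcoef_le dchar_norm_le)

lemma tame_mangoldt: assumes "dchar q \<xi>" shows "tame (\<lambda>n. \<xi> n * of_real (mangoldt n))"
proof (rule tame_comparison)
 show "tame (\<lambda>n. (\<lambda>n. 1) n * of_real (ln (real n)))" by (rule tame_ln) (rule tame_bounded[of _ 1], simp)
 fix n :: nat assume n: "n > 0"
 have "norm (\<xi> n) * mangoldt n \<le> 1 * ln (real n)"
  using dchar_norm_le[OF assms] mangoldt_le_ln[OF n] mangoldt_nonneg by (intro mult_mono) auto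
 moreover have "norm (\<xi> n * of_real (mangoldt n)) = norm (\<xi> n) * mangoldt n"
  using mangoldt_nonneg[of n] by (simp only: norm_mult norm_of_real abs_of_nonneg)
 moreover have "ln (real n) \<le> norm (1 * complex_of_real (ln (real n)))" by (simp only: mult_1 norm_of_real abs_ge_self)
 ultimately show "norm (\<xi> n * of_real (mangoldt n)) \<le> norm (1 * complex_of_real (ln (real n)))" by linarith
qed

lemma DS_dchar_mangoldt:
 assumes c: "dchar q \<xi>" and s: "Re s > 1"
 shows "DS \<xi> s * DS (\<lambda>n. \<xi> n * of_real (mangoldt n)) s = DS (\<lambda>n. \<xi> n * of_real (ln (real n))) s"
proof -
 have "DS (\<lambda>n. \<xi> n * of_real (mangoldt n)) s * DS \<xi> s =
   DS (\<lambda>n. \<Sum>d | d dvd n. \<xi> d * of_real (mangoldt d) * \<xi> (n div d)) s"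
  by (rule DS_mult[OF tame_mangoldt[OF c] tame_dchar[OF c] s])
 also have "... = DS (\<lambda>n. \<xi> n * of_real (ln (real n))) s"
 proof (rule DS_cong)
  fix n :: nat assume n: "n > 0"
  have "(\<Sum>d | d dvd n. \<xi> d * of_real (mangoldt d) * \<xi> (n div d)) = (\<Sum>d | d dvd n. \<xi> n * of_real (mangoldt d))"
  proof (rule sum.cong)
   fix d assume "d \<in> {d. d dvd n}"
   hence "\<xi> n = \<xi> d * \<xi> (n div d)" using dchar_mult[OF c, of d "n div d"] by simp
   thus "\<xi> d * of_real (mangoldt d) * \<xi> (n div d) = \<xi> n * of_real (mangoldt d)" by simp
  qed simp
  also have "... = \<xi> n * of_real (\<Sum>d | d dvd n. mangoldt d)" by (simp only: sum_distrib_left of_real_sum)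
  also have "(\<Sum>d | d dvd n. mangoldt d) = ln (real n)" using mangoldt_sum[where 'a = real, of n] n by simp
  finally show "(\<Sum>d | d dvd n. \<xi> d * of_real (mangoldt d) * \<xi> (n div d)) = \<xi> n * of_real (ln (real n))" .
 qed
 finally show ?thesis by (simp add: mult.commute)
qed

text \<open>The product of L(s, \<xi>) and the exponential of minus its candidate logarithm has
  derivative 0 by \<open>DS_dchar_mangoldt\<close>; the constant is found by going to infinity along
  the real axis. The absence of zeros in \<open>Re s > 1\<close> is a by-product.\<close>

lemma DS_eq_exp:
 assumes c: "dchar q \<xi>" and s: "Re s > 1"
 shows "DS \<xi> s = exp (DS (logcoef \<xi>) s)"
proof -
 define G where "G = (\<lambda>s. DS \<xi> s * exp (- DS (logcoef \<xi>) s))"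
 have lc: "DS (\<lambda>n. logcoef \<xi> n * of_real (ln (real n))) = DS (\<lambda>n. \<xi> n * of_real (mangoldt n))"
 proof
  fix s
  show "DS (\<lambda>n. logcoef \<xi> n * of_real (ln (real n))) s = DS (\<lambda>n. \<xi> n * of_real (mangoldt n)) s"
  proof (rule DS_cong)
   fix n :: nat assume "n > 0"
   thus "logcoef \<xi> n * of_real (ln (real n)) = \<xi> n * of_real (mangoldt n)"
    by (cases "n = 1") (auto simp: logcoef_def One_nat_def)
  qed
 qed
 have "(G has_field_derivative 0) (at s within {s. Re s > 1})" if "s \<in> {s. Re s > 1}" for s
 proof -
  have s: "Re s > 1" using that by simp
  note D1 = DS_has_field_derivative[OF tame_dchar[OF c] s]
  note D2 = DS_has_field_derivative[OF tame_logcoef[OF c] s]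
  have "(G has_field_derivative
   (- DS (\<lambda>n. \<xi> n * of_real (ln (real n))) s) * exp (- DS (logcoef \<xi>) s) +
   (exp (- DS (logcoef \<xi>) s) * (- (- DS (\<lambda>n. logcoef \<xi> n * of_real (ln (real n))) s))) * DS \<xi> s) (at s)"
   unfolding G_def by (intro DERIV_mult D1 DERIV_chain2[OF DERIV_exp] DERIV_minus D2)
  moreover have "(- DS (\<lambda>n. \<xi> n * of_real (ln (real n))) s) * exp (- DS (logcoef \<xi>) s) +
   (exp (- DS (logcoef \<xi>) s) * (- (- DS (\<lambda>n. logcoef \<xi> n * of_real (ln (real n))) s))) * DS \<xi> s = 0"
   unfolding lc DS_dchar_mangoldt[OF c s, symmetric] by (simp add: algebra_simps)
  ultimately have "(G has_field_derivative 0) (at s)" by (simp only:)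
  thus ?thesis by (rule has_field_derivative_at_within)
 qed
 then obtain k where k: "\<And>s. s \<in> {s. Re s > 1} ==> G s = k"
  using has_field_derivative_zero_constant[of "{s. Re s > 1}" G] convex_halfspace_Re_gt by blast
 have "((\<lambda>\<sigma>. G (of_real \<sigma>)) \<longlongrightarrow> \<xi> 1 * exp (- logcoef \<xi> 1)) at_top"
  unfolding G_def by (intro tendsto_intros DS_tendsto_1 tame_dchar[OF c] tame_logcoef[OF c])
 moreover have "\<forall>\<^sub>F \<sigma> in at_top. G (of_real \<sigma>) = k"
  using eventually_gt_at_top[of 1] by eventually_elim (rule k, simp)
 ultimately have "((\<lambda>\<sigma>::real. k) \<longlongrightarrow> \<xi> 1 * exp (- logcoef \<xi> 1)) at_top"
  using tendsto_cong by fast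
 hence "k = \<xi> 1 * exp (- logcoef \<xi> 1)" by (simp add: tendsto_const_iff)
 also have "... = 1" using dchar_1(1)[OF c] by (simp add: logcoef_def)
 finally have "G s = 1" using k s by simp
 thus ?thesis by (simp add: G_def exp_minus field_simps)
qed

lemma DS_nonzero: "dchar q \<xi> ==> Re s > 1 ==> DS \<xi> s \<noteq> 0" using DS_eq_exp by simp

lemma DS_log_deriv:
 assumes c: "dchar q \<xi>" and s: "Re s > 1"
 shows "deriv (DS \<xi>) s / DS \<xi> s = - DS (\<lambda>n. \<xi> n * of_real (mangoldt n)) s"
proof -
 have "deriv (DS \<xi>) s = - DS (\<lambda>n. \<xi> n * of_real (ln (real n))) s"
  by (rule DERIV_imp_deriv[OF DS_has_field_derivative[OF tame_dchar[OF c] s]])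
 also have "... = - (DS \<xi> s * DS (\<lambda>n. \<xi> n * of_real (mangoldt n)) s)"
  by (simp only: DS_dchar_mangoldt[OF c s])
 finally show ?thesis using DS_nonzero[OF c s] by simp
qed

lemma prin_1: "prin 1 = (\<lambda>_. 1)" by (auto simp: prin_def)

text \<open>Zeta itself takes the third power: at \<open>n\<close> not coprime to \<open>q\<close>
  the other two terms drop out and a 3 remains. At the other \<open>n\<close> the combination is
  \<open>2 * (1 + c) ^ 2\<close> with \<open>c\<close> the real part of a number of modulus
  1.\<close>

lemma three_four_one:
 assumes c: "dchar q \<xi>" and s: "\<sigma> > 1"
 shows "norm (DS (prin 1) (of_real \<sigma>)) ^ 3 * norm (DS \<xi> (Complex \<sigma> t)) ^ 4 * norm (DS (\<lambda>n. \<xi> n * \<xi> n) (Complex \<sigma> (2 * t))) \<ge> 1"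
proof -
 have c1: "dchar 1 (prin 1)" by (rule dchar_prin) simp
 have c2: "dchar q (\<lambda>n. \<xi> n * \<xi> n)" by (rule dchar_times[OF c c])
 define x where "x = DS (logcoef (prin 1)) (of_real \<sigma>)"
 define y where "y = DS (logcoef \<xi>) (Complex \<sigma> t)"
 define z where "z = DS (logcoef (\<lambda>n. \<xi> n * \<xi> n)) (Complex \<sigma> (2 * t))"
 let ?X = "\<lambda>n. logcoef (prin 1) n * of_nat n powr (- of_real \<sigma>)"
 let ?Y = "\<lambda>n. logcoef \<xi> n * of_nat n powr (- Complex \<sigma> t)"
 let ?Z = "\<lambda>n. logcoef (\<lambda>n. \<xi> n * \<xi> n) n * of_nat n powr (- Complex \<sigma> (2 * t))"
 have sx: "?X sums x" unfolding x_def DS_def by (rule summable_sums, rule tame_summable[OF tame_logcoef[OF c1]]) (use s in auto)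
 have sy: "?Y sums y" unfolding y_def DS_def by (rule summable_sums, rule tame_summable[OF tame_logcoef[OF c]]) (use s in auto)
 have sz: "?Z sums z" unfolding z_def DS_def by (rule summable_sums, rule tame_summable[OF tame_logcoef[OF c2]]) (use s in auto)
 have "(\<lambda>n. 3 * Re (?X n) + 4 * Re (?Y n) + Re (?Z n)) sums (3 * Re x + 4 * Re y + Re z)"
  by (intro sums_add sums_mult sums_Re sx sy sz)
 moreover have "3 * Re (?X n) + 4 * Re (?Y n) + Re (?Z n) \<ge> 0" for n
 proof (cases "n = 0")
  case False
  define w where "w = mangoldt n / ln (real n)"
  have w: "w \<ge> 0" using logcoef_weight[of n] False by (auto simp: w_def)
  define e where "e = \<xi> n * of_nat n powr (- (\<i> * of_real t))"
  define r where "r = real n powr (- \<sigma>)"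
  have pr: "of_nat n powr (- of_real \<sigma>) = complex_of_real r"
   using powr_of_real[of "real n" "- \<sigma>"] by (simp add: r_def)
  have p1: "of_nat n powr (- Complex \<sigma> u) = complex_of_real r * of_nat n powr (- (\<i> * of_real u))" for u
   unfolding pr[symmetric] powr_add[symmetric] by (simp add: Complex_eq algebra_simps)
  have p2: "of_nat n powr (- (\<i> * of_real (2 * t))) = (of_nat n powr (- (\<i> * of_real t))) * (of_nat n powr (- (\<i> * of_real t)) :: complex)"
   by (simp add: powr_add[symmetric] algebra_simps)
  have X: "?X n = of_real (w * r)" by (simp add: logcoef_def prin_1 pr w_def)
  have Y: "?Y n = of_real (w * r) * e" unfolding logcoef_def p1 e_def w_def by (simp only: of_real_mult mult_ac)
  have Z: "?Z n = of_real (w * r) * (e * e)" unfolding logcoef_def p1 p2 e_def w_def by (simp only: of_real_mult mult_ac)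
  have ne: "norm e = norm (\<xi> n)" using False by (simp add: e_def norm_mult norm_nat_powr)
  have "3 * Re (?X n) + 4 * Re (?Y n) + Re (?Z n) = (w * r) * (3 + 4 * Re e + Re (e * e))"
   by (simp only: X Y Z) (simp add: algebra_simps)
  moreover have "3 + 4 * Re e + Re (e * e) \<ge> 0"
  proof (cases "coprime n q")
   case True
   hence "norm e = 1" using ne dchar_norm[OF c] by simp
   hence "(Re e)\<^sup>2 + (Im e)\<^sup>2 = 1" by (metis cmod_power2 one_power2)
   hence "3 + 4 * Re e + Re (e * e) = 2 * (1 + Re e)\<^sup>2" by (simp add: power2_eq_square algebra_simps)
   thus ?thesis by simp
  next
   case False
   hence "e = 0" using ne dchar_norm[OF c] by simp
   thus ?thesis by simp
  qed
  ultimately show ?thesis using w by (simp add: r_def)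
 qed simp
 ultimately have nn: "3 * Re x + 4 * Re y + Re z \<ge> 0" by (metis (no_types, lifting) sums_le sums_zero)
 have "norm (DS (prin 1) (of_real \<sigma>)) ^ 3 * norm (DS \<xi> (Complex \<sigma> t)) ^ 4 * norm (DS (\<lambda>n. \<xi> n * \<xi> n) (Complex \<sigma> (2 * t)))
  = exp (Re x) ^ 3 * exp (Re y) ^ 4 * exp (Re z)"
  using DS_eq_exp[OF c1, of "of_real \<sigma>"] DS_eq_exp[OF c, of "Complex \<sigma> t"] DS_eq_exp[OF c2, of "Complex \<sigma> (2 * t)"] s
  by (simp add: x_def y_def z_def)
 also have "... = exp (3 * Re x + 4 * Re y + Re z)" by (simp add: exp_add exp_of_nat_mult[symmetric])
 finally show ?thesis using nn by simp
qed

section \<open>Coefficients with bounded partial sums\<close>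

text \<open>The hypothesis from which Abel summation continues a Dirichlet series to
  \<open>Re s > 0\<close>. It covers the nonprincipal characters and \<open>prin0\<close>.\<close>

definition bps :: "real => (nat => complex) => bool" where
 "bps B b \<longleftrightarrow> (\<forall>N. norm (\<Sum>n=1..N. b n) \<le> B)"

text \<open>By their derivatives, the complex power moves at most \<open>norm s / Re s\<close> times
  as fast as the real one. The bound is a difference, so that sums of such bounds telescope.\<close>

lemma powr_diff_bound:
 fixes a b :: real and s :: complex
 assumes ab: "0 < a" "a \<le> b" and s: "Re s > 0"
 shows "norm (of_real a powr (- s) - of_real b powr (- s)) \<le> norm s / Re s * (a powr (- Re s) - b powr (- Re s))"
proof (cases "a = b")
 case False
 hence "a < b" using ab by simp
 have "norm (of_real b powr (- s) - of_real a powr (- s))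
  \<le> (- (norm s / Re s) * b powr (- Re s)) - (- (norm s / Re s) * a powr (- Re s))"
 proof (rule differentiable_bound_general[OF \<open>a < b\<close>])
  have vd: "((\<lambda>u. of_real u powr (- s)) has_vector_derivative (- s * of_real u powr (- s - 1))) (at u)" if "u > 0" for u :: real
   by (rule has_vector_derivative_real_field[OF has_field_derivative_powr])
    (use that in \<open>auto simp: complex_nonpos_Reals_iff\<close>)
  have rd: "((\<lambda>u. - (norm s / Re s) * u powr (- Re s)) has_real_derivative norm s * u powr (- Re s - 1)) (at u)" if "u > 0" for u :: real
   using DERIV_cmult[OF has_real_derivative_powr[OF that, of "- Re s"], of "- (norm s / Re s)"] s by simp
  show "continuous_on {a..b} (\<lambda>u. of_real u powr (- s))"
   by (intro continuous_at_imp_continuous_on ballI has_vector_derivative_continuous[OF vd]) (use ab in auto)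
  show "continuous_on {a..b} (\<lambda>u. - (norm s / Re s) * u powr (- Re s))" using ab by (intro continuous_intros) auto
  fix x assume x: "a < x" "x < b"
  show "((\<lambda>u. of_real u powr (- s)) has_vector_derivative (- s * of_real x powr (- s - 1))) (at x)"
   by (rule vd) (use x ab in simp)
  show "((\<lambda>u. - (norm s / Re s) * u powr (- Re s)) has_vector_derivative norm s * x powr (- Re s - 1)) (at x)"
   using rd[of x] x ab by (simp add: has_real_derivative_iff_has_vector_derivative)
  show "norm (- s * of_real x powr (- s - 1)) \<le> norm s * x powr (- Re s - 1)"
   using norm_powr_real_powr[of "of_real x" "- s - 1"] x ab by (simp add: norm_mult)
 qed
 thus ?thesis by (simp add: norm_minus_commute algebra_simps)
qed simp

lemma nat_powr_diff_bound:
 assumes "0 < m" "m \<le> n" "Re s > 0"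
 shows "norm (of_nat m powr (- s) - of_nat n powr (- s) :: complex) \<le> norm s / Re s * (real m powr (- Re s) - real n powr (- Re s))"
 using powr_diff_bound[of "real m" "real n" s] assms by simp

lemma sum_telescope_shift:
 fixes f :: "nat => 'a::ab_group_add"
 assumes "M \<le> N"
 shows "(\<Sum>n\<in>{M<..N}. f n - f (Suc n)) = f (Suc M) - f (Suc N)" using assms
proof (induction N rule: dec_induct)
 case (step N)
 have "{M<..Suc N} = insert (Suc N) {M<..N}" using step by auto
 thus ?case using step by simp
qed simp

lemma bps_nonneg: "bps B b ==> B \<ge> 0" unfolding bps_def by (metis norm_ge_zero order_trans)

lemma bps_segment:
 assumes "bps B b" "M \<le> N" shows "norm (\<Sum>n\<in>{M<..N}. b n) \<le> 2 * B"
proof -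
 have "{1..N} = {1..M} \<union> {M<..N}" using assms by auto
 hence "(\<Sum>n=1..N. b n) = (\<Sum>n=1..M. b n) + (\<Sum>n\<in>{M<..N}. b n)" by (simp only:) (rule sum.union_disjoint, auto)
 hence "(\<Sum>n\<in>{M<..N}. b n) = (\<Sum>n=1..N. b n) - (\<Sum>n=1..M. b n)" by simp
 hence "norm (\<Sum>n\<in>{M<..N}. b n) \<le> norm (\<Sum>n=1..N. b n) + norm (\<Sum>n=1..M. b n)"
  by (simp add: norm_triangle_ineq4)
 also have "... \<le> B + B" using assms(1) unfolding bps_def by (intro add_mono) auto
 finally show ?thesis by simp
qed

text \<open>Abel summation with partial sums that start after \<open>M\<close>; these are
  differences of two bounded sums, whence the factor 2.\<close>

lemma bps_DS_segment:
 assumes b: "bps B b" and MN: "M \<le> N" and s: "Re s > 0"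
 shows "norm (\<Sum>n\<in>{M<..N}. b n * of_nat n powr (- s)) \<le> 2 * B * (1 + norm s / Re s) * real (Suc M) powr (- Re s)"
proof -
 define S where "S = (\<lambda>n. \<Sum>m\<in>{M<..n}. b m)"
 define c where "c = (\<lambda>n. of_nat n powr (- s) :: complex)"
 define r where "r = (\<lambda>n. real n powr (- Re s))"
 have B: "B \<ge> 0" by (rule bps_nonneg[OF b])
 have eq: "(\<Sum>n\<in>{M<..N}. b n * c n) = S N * c (Suc N) + (\<Sum>n\<in>{M<..N}. S n * (c n - c (Suc n)))" using MN
 proof (induction N rule: dec_induct)
  case base
  show ?case by (simp add: S_def)
 next
  case (step N)
  have i: "{M<..Suc N} = insert (Suc N) {M<..N}" using step by auto
  have "S (Suc N) = b (Suc N) + S N" by (simp add: S_def i)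
  thus ?case using step by (simp add: i algebra_simps)
 qed
 have Sb: "norm (S n) \<le> 2 * B" if "M \<le> n" for n unfolding S_def by (rule bps_segment[OF b that])
 have "norm (\<Sum>n\<in>{M<..N}. S n * (c n - c (Suc n))) \<le> (\<Sum>n\<in>{M<..N}. 2 * B * (norm s / Re s * (r n - r (Suc n))))"
 proof (rule sum_norm_le)
  fix n assume n: "n \<in> {M<..N}"
  have "norm (c n - c (Suc n)) \<le> norm s / Re s * (r n - r (Suc n))"
   unfolding c_def r_def by (rule nat_powr_diff_bound) (use n s in auto)
  thus "norm (S n * (c n - c (Suc n))) \<le> 2 * B * (norm s / Re s * (r n - r (Suc n)))"
   unfolding norm_mult using Sb[of n] n B by (intro mult_mono) auto
 qed
 also have "... = 2 * B * (norm s / Re s) * (\<Sum>n\<in>{M<..N}. r n - r (Suc n))" by (simp add: sum_distrib_left mult.assoc)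
 also have "... = 2 * B * (norm s / Re s) * (r (Suc M) - r (Suc N))" by (simp only: sum_telescope_shift[OF MN])
 finally have 1: "norm (\<Sum>n\<in>{M<..N}. S n * (c n - c (Suc n))) \<le> 2 * B * (norm s / Re s) * (r (Suc M) - r (Suc N))" .
 have "norm (c (Suc N)) = r (Suc N)" unfolding c_def r_def by (subst norm_nat_powr) simp
 hence 2: "norm (S N * c (Suc N)) \<le> 2 * B * r (Suc N)" using Sb[OF MN] by (simp add: norm_mult r_def mult_right_mono)
 have mono: "r (Suc N) \<le> r (Suc M)" unfolding r_def using MN s by (intro powr_mono2') auto
 have "norm (\<Sum>n\<in>{M<..N}. b n * c n) \<le> 2 * B * r (Suc N) + 2 * B * (norm s / Re s) * (r (Suc M) - r (Suc N))"
  unfolding eq using norm_triangle_mono[OF 2 1] .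
 also have "... \<le> 2 * B * r (Suc M) + 2 * B * (norm s / Re s) * r (Suc M)"
  using mono B s by (intro add_mono mult_left_mono) (auto simp: r_def)
 also have "... = 2 * B * (1 + norm s / Re s) * r (Suc M)" by (simp add: algebra_simps)
 finally show ?thesis by (simp add: c_def r_def)
qed

lemma Suc_powr_tendsto_0: "\<sigma> > 0 ==> (\<lambda>M. real (Suc M) powr (- \<sigma>)) \<longlonglongrightarrow> 0"
 by (rule tendsto_neg_powr[OF _ filterlim_compose[OF filterlim_real_sequentially filterlim_Suc]]) simp

lemma bps_summable:
 assumes b: "bps B b" and s: "Re s > 0"
 shows "summable (\<lambda>n. b n * of_nat n powr (- s))" unfolding summable_Cauchy
proof (intro allI impI)
 fix e :: real assume e: "e > 0"
 define K where "K = 2 * B * (1 + norm s / Re s)"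
 have "(\<lambda>M. K * real (Suc M) powr (- Re s)) \<longlonglongrightarrow> K * 0"
  by (intro tendsto_mult_left Suc_powr_tendsto_0 s)
 hence "\<forall>\<^sub>F M in sequentially. K * real (Suc M) powr (- Re s) < e" using e by (intro order_tendstoD) auto
 then obtain M0 where M0: "\<And>M. M \<ge> M0 ==> K * real (Suc M) powr (- Re s) < e"
  by (auto simp: eventually_sequentially)
 show "\<exists>N. \<forall>m\<ge>N. \<forall>n. norm (\<Sum>k = m..<n. b k * of_nat k powr (- s)) < e"
 proof (intro exI allI impI)
  fix m n assume m: "m \<ge> Suc M0"
  show "norm (\<Sum>k = m..<n. b k * of_nat k powr (- s)) < e"
  proof (cases "m < n")
   case True
   have "{m..<n} = {m - 1<..n - 1}" using m True by auto
   hence "norm (\<Sum>k = m..<n. b k * of_nat k powr (- s)) \<le> K * real (Suc (m - 1)) powr (- Re s)"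
    using bps_DS_segment[OF b _ s, of "m - 1" "n - 1"] True by (simp add: K_def)
   also have "... < e" by (rule M0) (use m in auto)
   finally show ?thesis .
  qed (use e in auto)
 qed
qed

lemma DS_partial_tendsto:
 assumes "summable (\<lambda>n. b n * of_nat n powr (- s))"
 shows "(\<lambda>N. \<Sum>n=1..N. b n * of_nat n powr (- s)) \<longlonglongrightarrow> DS b s"
proof -
 let ?f = "\<lambda>n. b n * of_nat n powr (- s) :: complex"
 have "?f sums DS b s" using assms by (simp add: DS_def summable_sums)
 hence "(\<lambda>N. \<Sum>n<Suc N. ?f n) \<longlonglongrightarrow> DS b s"
  unfolding sums_def by (rule filterlim_compose) (rule filterlim_Suc)
 moreover have "(\<Sum>n<Suc N. ?f n) = (\<Sum>n=1..N. ?f n)" for N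
  by (rule sum.mono_neutral_right) (auto simp: not_less_eq_eq One_nat_def)
 ultimately show ?thesis by simp
qed

lemma bps_DS_tail:
 assumes b: "bps B b" and s: "Re s > 0"
 shows "norm (DS b s - (\<Sum>n=1..M. b n * of_nat n powr (- s))) \<le> 2 * B * (1 + norm s / Re s) * real (Suc M) powr (- Re s)"
proof -
 let ?f = "\<lambda>n. b n * of_nat n powr (- s) :: complex"
 have "(\<lambda>N. (\<Sum>n=1..N. ?f n) - (\<Sum>n=1..M. ?f n)) \<longlonglongrightarrow> DS b s - (\<Sum>n=1..M. ?f n)"
  by (intro tendsto_diff tendsto_const DS_partial_tendsto bps_summable[OF b s])
 hence lim: "(\<lambda>N. norm ((\<Sum>n=1..N. ?f n) - (\<Sum>n=1..M. ?f n))) \<longlonglongrightarrow> norm (DS b s - (\<Sum>n=1..M. ?f n))"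
  by (rule tendsto_norm)
 show ?thesis
 proof (rule tendsto_upperbound[OF lim])
  show "\<forall>\<^sub>F N in sequentially. norm ((\<Sum>n=1..N. ?f n) - (\<Sum>n=1..M. ?f n)) \<le> 2 * B * (1 + norm s / Re s) * real (Suc M) powr (- Re s)"
   using eventually_ge_at_top[of M]
  proof eventually_elim
   fix N assume N: "M \<le> N"
   have "{1..N} = {1..M} \<union> {M<..N}" using N by auto
   hence "(\<Sum>n=1..N. ?f n) = (\<Sum>n=1..M. ?f n) + (\<Sum>n\<in>{M<..N}. ?f n)"
    by (simp only:) (rule sum.union_disjoint, auto)
   thus "norm ((\<Sum>n=1..N. ?f n) - (\<Sum>n=1..M. ?f n)) \<le> 2 * B * (1 + norm s / Re s) * real (Suc M) powr (- Re s)"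
    using bps_DS_segment[OF b N s] by simp
  qed
 qed simp
qed

text \<open>A truncation error of this form is uniform on small discs, so the limit is holomorphic;
  it serves L-functions and \<open>zt\<close> alike. By its monotonicity, \<open>P\<close> at the
  largest norm and the smallest real part bounds it on the whole disc.\<close>

lemma holomorphic_from_tail:
 fixes f :: "nat => complex => complex" and g :: "complex => complex"
 assumes hol: "\<And>M. f M holomorphic_on {s. Re s > 0}"
  and tail: "\<And>M s. Re s > 0 ==> norm (g s - f M s) \<le> P (norm s) (Re s) * real (Suc M) powr (- Re s)"
  and mono: "\<And>x x' y y'. 0 \<le> x ==> x \<le> x' ==> 0 < y' ==> y' \<le> y ==> P x y \<le> P x' y'"
  and nonneg: "\<And>x y. 0 \<le> x ==> 0 < y ==> P x y \<ge> 0"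
 shows "g holomorphic_on {s. Re s > 0}"
proof (rule holomorphic_uniform_sequence[OF open_halfspace_Re_gt hol])
 fix x assume "x \<in> {s. Re s > 0}"
 hence x: "Re x > 0" by simp
 define d where "d = Re x / 2"
 have d: "d > 0" using x by (simp add: d_def)
 have inb: "Re s \<ge> d \<and> norm s \<le> norm x + d" if "s \<in> cball x d" for s
 proof -
  have "dist x s \<le> d" using that by simp
  moreover have "Re x - Re s \<le> norm (x - s)" using complex_Re_le_cmod[of "x - s"] by simp
  moreover have "norm s \<le> norm x + norm (x - s)" by (metis norm_triangle_sub norm_minus_commute)
  ultimately show ?thesis unfolding d_def dist_norm by (simp add: field_simps)
 qed
 define K where "K = P (norm x + d) d"
 have "uniform_limit (cball x d) f g sequentially"
 proof (rule uniform_limitI)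
  fix e :: real assume e: "e > 0"
  have "(\<lambda>M. K * real (Suc M) powr (- d)) \<longlonglongrightarrow> K * 0"
   by (intro tendsto_mult_left Suc_powr_tendsto_0 d)
  hence "\<forall>\<^sub>F M in sequentially. K * real (Suc M) powr (- d) < e" using e by (intro order_tendstoD) auto
  thus "\<forall>\<^sub>F M in sequentially. \<forall>s\<in>cball x d. dist (f M s) (g s) < e"
  proof eventually_elim
   case (elim M)
   show ?case
   proof
    fix s assume s: "s \<in> cball x d"
    have sd: "Re s \<ge> d" "norm s \<le> norm x + d" "Re s > 0" using inb[OF s] d by auto
    have "dist (f M s) (g s) \<le> P (norm s) (Re s) * real (Suc M) powr (- Re s)"
     using tail[OF sd(3), of M] by (simp add: dist_norm norm_minus_commute)
    also have "... \<le> K * real (Suc M) powr (- d)"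
     unfolding K_def using sd d by (intro mult_mono mono nonneg powr_mono) auto
    also have "... < e" by (rule elim)
    finally show "dist (f M s) (g s) < e" .
   qed
  qed
 qed
 moreover have "cball x d \<subseteq> {s. Re s > 0}" using inb d by force
 ultimately show "\<exists>d>0. cball x d \<subseteq> {s. Re s > 0} \<and> uniform_limit (cball x d) f g sequentially"
  using d by blast
qed

lemma nat_powr_holomorphic: "n > 0 ==> f holomorphic_on A ==> (\<lambda>s. of_nat n powr f s :: complex) holomorphic_on A"
 unfolding powr_def by (auto intro!: holomorphic_intros)

lemma bps_DS_holomorphic:
 assumes b: "bps B b" shows "DS b holomorphic_on {s. Re s > 0}"
proof (rule holomorphic_from_tail[where P = "\<lambda>x y. 2 * B * (1 + x / y)"])
 show "(\<lambda>s. \<Sum>n=1..M. b n * of_nat n powr (- s)) holomorphic_on {s. Re s > 0}" for M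
  by (intro holomorphic_intros nat_powr_holomorphic) auto
 show "2 * B * (1 + x / y) \<le> 2 * B * (1 + x' / y')" if "0 \<le> x" "x \<le> x'" "0 < y'" "y' \<le> y" for x x' y y' :: real
  using that bps_nonneg[OF b] by (intro mult_left_mono add_left_mono frac_le) auto
 show "2 * B * (1 + x / y) \<ge> 0" if "0 \<le> x" "0 < y" for x y :: real using that bps_nonneg[OF b] by simp
qed (rule bps_DS_tail[OF b])

text \<open>The tail bound with an empty head. Both hypotheses hold on the disc of radius 3/2 about
  2, where Estermann's argument takes place; \<open>16 = 2 * (1 + 7)\<close>.\<close>

lemma bps_DS_crude:
 assumes b: "bps B b" and s: "Re s \<ge> 1/2" "norm s \<le> 7/2"
 shows "norm (DS b s) \<le> 16 * B"
proof -
 have B: "B \<ge> 0" by (rule bps_nonneg[OF b])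
 have "norm s / Re s \<le> (7/2) / (1/2)" using s by (intro frac_le) auto
 hence "2 * B * (1 + norm s / Re s) \<le> 2 * B * 8" using B by (intro mult_left_mono) auto
 thus ?thesis using bps_DS_tail[OF b, of s 0] s by simp
qed

text \<open>This is zeta(1 + e).\<close>

definition zbound :: "real => real" where "zbound e = (\<Sum>n. real n powr (- 1 - e))"

lemma zbound_nonneg: "e > 0 ==> zbound e \<ge> 0"
 unfolding zbound_def by (rule suminf_nonneg) (auto simp: summable_real_powr_iff)

lemma sum_powr_bound:
 assumes e: "e > 0" and s: "\<sigma> \<ge> 1 - e" and V: "real M \<le> V"
 shows "(\<Sum>n=1..M. real n powr (- \<sigma>)) \<le> zbound e * V powr (2 * e)"
proof -
 have "(\<Sum>n=1..M. real n powr (- \<sigma>)) \<le> (\<Sum>n=1..M. real n powr (- 1 - e) * V powr (2 * e))"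
 proof (rule sum_mono)
  fix n assume n: "n \<in> {1..M}"
  have "real n powr (- \<sigma>) \<le> real n powr (- 1 - e + 2 * e)" using n s by (intro powr_mono) auto
  also have "... = real n powr (- 1 - e) * real n powr (2 * e)" by (rule powr_add)
  also have "... \<le> real n powr (- 1 - e) * V powr (2 * e)" using n V e by (intro mult_left_mono powr_mono2) auto
  finally show "real n powr (- \<sigma>) \<le> real n powr (- 1 - e) * V powr (2 * e)" .
 qed
 also have "... = (\<Sum>n=1..M. real n powr (- 1 - e)) * V powr (2 * e)" by (simp add: sum_distrib_right)
 also have "(\<Sum>n=1..M. real n powr (- 1 - e)) \<le> zbound e"
  unfolding zbound_def by (rule sum_le_suminf) (use e in \<open>auto simp: summable_real_powr_iff\<close>)
 finally show ?thesis by (simp add: mult_right_mono)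
qed

lemma norm_sum_powr_le:
 assumes "\<And>n. norm (b n) \<le> 1"
 shows "norm (\<Sum>n=1..M. b n * of_nat n powr (- s)) \<le> (\<Sum>n=1..M. real n powr (- Re s))"
proof (rule sum_norm_le)
 fix n
 show "norm (b n * of_nat n powr (- s)) \<le> real n powr (- Re s)"
  unfolding norm_DS_term using mult_right_mono[OF assms[of n], of "real n powr (- Re s)"] by simp
qed

text \<open>The series is cut at about \<open>V = B * (\<bar>Im s\<bar> + 2)\<close>, because the
  factor in front of the tail bound is at most \<open>4 * V\<close> and is then offset by
  \<open>V powr (- Re s)\<close>.\<close>

lemma bps_DS_bound:
 assumes b: "bps B b" and b1: "\<And>n. norm (b n) \<le> 1" and B: "B \<ge> 1"
  and e: "0 < e" "e \<le> 1/2" and s: "Re s \<ge> 1 - e"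
 shows "norm (DS b s) \<le> (zbound e + 4) * (B * (\<bar>Im s\<bar> + 2)) powr (2 * e)"
proof -
 define V where "V = B * (\<bar>Im s\<bar> + 2)"
 define M where "M = nat \<lfloor>V\<rfloor>"
 have V2: "V \<ge> 1 * 2" unfolding V_def using B by (intro mult_mono) auto
 have M: "real M \<le> V" "V \<le> real (Suc M)" using V2 unfolding M_def by linarith+
 have s0: "Re s > 0" using s e by auto
 have h1: "norm (\<Sum>n=1..M. b n * of_nat n powr (- s)) \<le> zbound e * V powr (2 * e)"
  using norm_sum_powr_le[of b s M] sum_powr_bound[OF e(1) s M(1)] b1 by fastforce
 have "norm s \<le> Re s + \<bar>Im s\<bar>" using cmod_le[of s] s0 by simp
 hence "norm s / Re s \<le> 1 + \<bar>Im s\<bar> / Re s" using s0 by (simp add: field_simps)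
 also have "... \<le> 1 + \<bar>Im s\<bar> / (1/2)" using s e by (intro add_left_mono frac_le) auto
 finally have r: "norm s / Re s \<le> 1 + 2 * \<bar>Im s\<bar>" by simp
 have "2 * B * (1 + norm s / Re s) * real (Suc M) powr (- Re s) \<le> 4 * V * V powr (- Re s)"
 proof (rule mult_mono)
  have "2 * B * (1 + norm s / Re s) \<le> 2 * B * (2 * (\<bar>Im s\<bar> + 2))" using r B by (intro mult_left_mono) auto
  thus "2 * B * (1 + norm s / Re s) \<le> 4 * V" by (simp add: V_def algebra_simps)
  show "real (Suc M) powr (- Re s) \<le> V powr (- Re s)" using M V2 s0 by (intro powr_mono2') auto
 qed (use V2 in auto)
 also have "4 * V * V powr (- Re s) = 4 * V powr (1 - Re s)" using V2 by (simp add: powr_mult_base)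
 also have "... \<le> 4 * V powr (2 * e)" using V2 s e by (intro mult_left_mono powr_mono) auto
 finally have h2: "2 * B * (1 + norm s / Re s) * real (Suc M) powr (- Re s) \<le> 4 * V powr (2 * e)" .
 have "norm (DS b s) \<le> norm (\<Sum>n=1..M. b n * of_nat n powr (- s)) + norm (DS b s - (\<Sum>n=1..M. b n * of_nat n powr (- s)))"
  by (rule norm_triangle_sub)
 also have "... \<le> zbound e * V powr (2 * e) + 4 * V powr (2 * e)" using h1 h2 bps_DS_tail[OF b s0, of M] by linarith
 finally show ?thesis by (simp add: V_def algebra_simps)
qed

section \<open>Continuation of zeta to the half-plane of positive real part\<close>

text \<open>The first Euler-Maclaurin approximation to zeta, multiplied by \<open>s - 1\<close> so
  that the pole disappears.\<close>

definition zpart :: "nat => complex => complex" where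
 "zpart M s = (s - 1) * (\<Sum>n=1..M. of_nat n powr (- s)) + of_nat (Suc M) powr (1 - s)"

text \<open>\<open>zt s\<close> is \<open>(s - 1) * zeta s\<close>, for \<open>Re s > 0\<close>.\<close>

definition zt :: "complex => complex" where
 "zt s = lim (\<lambda>M. zpart M s)"

text \<open>A summand is compared with the integral over the unit interval to its right. As a
  function of the right end \<open>u\<close>, the expression \<open>w\<close> vanishes at
  \<open>u = n\<close> and has the derivative
  \<open>(s - 1) * (n powr (- s) - u powr (- s))\<close>, which \<open>powr_diff_bound\<close>
  controls.\<close>

lemma zpart_step:
 assumes n: "n > 0" and s: "Re s > 0"
 shows "norm ((s - 1) * of_nat n powr (- s) - of_nat n powr (1 - s) + of_nat (Suc n) powr (1 - s))
  \<le> norm (s - 1) * (norm s / Re s) * (real n powr (- Re s) - real (Suc n) powr (- Re s))"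
proof -
 define K where "K = norm (s - 1) * (norm s / Re s) * (real n powr (- Re s) - real (Suc n) powr (- Re s))"
 define w where "w = (\<lambda>u::real. (s - 1) * (of_real u - of_nat n) * of_nat n powr (- s) - of_nat n powr (1 - s) + of_real u powr (1 - s))"
 have "norm (w (real (Suc n)) - w (real n)) \<le> K * real (Suc n) - K * real n"
 proof (rule differentiable_bound_general)
  have wd: "(w has_vector_derivative ((s - 1) * (of_nat n powr (- s) - of_real u powr (- s)))) (at u)" if u: "u > 0" for u :: real
  proof -
   have "((\<lambda>z. (s - 1) * (z - of_nat n) * of_nat n powr (- s) - of_nat n powr (1 - s) + z powr (1 - s))
     has_field_derivative ((s - 1) * (1 - 0) * of_nat n powr (- s) - 0 + (1 - s) * of_real u powr (1 - s - 1))) (at (of_real u))"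
    by (intro DERIV_add DERIV_diff DERIV_cmult DERIV_cmult_right DERIV_ident DERIV_const has_field_derivative_powr)
     (use u in \<open>auto simp: complex_nonpos_Reals_iff\<close>)
   hence "((\<lambda>z. (s - 1) * (z - of_nat n) * of_nat n powr (- s) - of_nat n powr (1 - s) + z powr (1 - s))
     has_field_derivative ((s - 1) * (of_nat n powr (- s) - of_real u powr (- s)))) (at (of_real u))"
    by (simp add: algebra_simps)
   thus ?thesis unfolding w_def by (rule has_vector_derivative_real_field)
  qed
  show "continuous_on {real n..real (Suc n)} w"
   by (intro continuous_at_imp_continuous_on ballI has_vector_derivative_continuous[OF wd]) (use n in auto)
  show "continuous_on {real n..real (Suc n)} (\<lambda>u. K * u)" by (intro continuous_intros)
  fix x assume x: "real n < x" "x < real (Suc n)"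
  show "(w has_vector_derivative ((s - 1) * (of_nat n powr (- s) - of_real x powr (- s)))) (at x)" by (rule wd) (use x in auto)
  show "((\<lambda>u. K * u) has_vector_derivative K) (at x)"
   using DERIV_cmult[OF DERIV_ident, of K x] by (simp add: has_real_derivative_iff_has_vector_derivative)
  have "norm (of_nat n powr (- s) - of_real x powr (- s)) \<le> norm s / Re s * (real n powr (- Re s) - x powr (- Re s))"
   using powr_diff_bound[of "real n" x s] n x s by simp
  also have "... \<le> norm s / Re s * (real n powr (- Re s) - real (Suc n) powr (- Re s))"
   using s x n by (intro mult_left_mono diff_left_mono powr_mono2') auto
  finally show "norm ((s - 1) * (of_nat n powr (- s) - of_real x powr (- s))) \<le> K"
   unfolding K_def norm_mult mult.assoc by (rule mult_left_mono) simp
 qed simp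
 moreover have "w (real n) = 0" by (simp add: w_def)
 moreover have "w (real (Suc n)) = (s - 1) * of_nat n powr (- s) - of_nat n powr (1 - s) + of_nat (Suc n) powr (1 - s)"
  by (simp add: w_def)
 moreover have "K * real (Suc n) - K * real n = K" by (simp add: algebra_simps)
 ultimately show ?thesis by (simp only: K_def diff_zero)
qed

lemma zpart_segment:
 assumes MN: "M \<le> N" and s: "Re s > 0"
 shows "norm (zpart N s - zpart M s) \<le> norm (s - 1) * (norm s / Re s) * real (Suc M) powr (- Re s)"
proof -
 let ?K = "norm (s - 1) * (norm s / Re s)"
 let ?r = "\<lambda>n. real n powr (- Re s)"
 define z where "z = (\<lambda>n. (s - 1) * of_nat n powr (- s) - of_nat n powr (1 - s) + of_nat (Suc n) powr (1 - s))"
 have "zpart N s - zpart M s = (\<Sum>n\<in>{M<..N}. z n)" using MN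
 proof (induction N rule: dec_induct)
  case (step N)
  have i: "{M<..Suc N} = insert (Suc N) {M<..N}" "{1..Suc N} = insert (Suc N) {1..N}" using step by auto
  have "zpart (Suc N) s = zpart N s + z (Suc N)" by (simp add: zpart_def z_def i algebra_simps)
  thus ?case using step by (simp add: i)
 qed simp
 hence "norm (zpart N s - zpart M s) \<le> (\<Sum>n\<in>{M<..N}. ?K * (?r n - ?r (Suc n)))"
  by (simp only:) (intro sum_norm_le, simp only: z_def, rule zpart_step, use s in auto)
 also have "... = ?K * (\<Sum>n\<in>{M<..N}. ?r n - ?r (Suc n))" by (rule sum_distrib_left[symmetric])
 also have "(\<Sum>n\<in>{M<..N}. ?r n - ?r (Suc n)) = ?r (Suc M) - ?r (Suc N)" by (rule sum_telescope_shift[OF MN, of ?r])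
 also have "?K * (?r (Suc M) - ?r (Suc N)) \<le> ?K * ?r (Suc M)" using s by (intro mult_left_mono) auto
 finally show ?thesis .
qed

lemma zpart_tendsto:
 assumes s: "Re s > 0" shows "(\<lambda>M. zpart M s) \<longlonglongrightarrow> zt s"
proof -
 define K where "K = norm (s - 1) * (norm s / Re s)"
 have "Cauchy (\<lambda>M. zpart M s)"
 proof (rule CauchyI')
  fix e :: real assume e: "e > 0"
  have "(\<lambda>M. K * real (Suc M) powr (- Re s)) \<longlonglongrightarrow> K * 0"
   by (intro tendsto_mult_left Suc_powr_tendsto_0 s)
  hence "\<forall>\<^sub>F M in sequentially. K * real (Suc M) powr (- Re s) < e" using e by (intro order_tendstoD) auto
  then obtain M0 where M0: "\<And>M. M \<ge> M0 ==> K * real (Suc M) powr (- Re s) < e"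
   by (auto simp: eventually_sequentially)
  show "\<exists>M. \<forall>m\<ge>M. \<forall>n>m. dist (zpart m s) (zpart n s) < e"
  proof (intro exI allI impI)
   fix m n assume mn: "m \<ge> M0" "n > m"
   have "dist (zpart m s) (zpart n s) \<le> K * real (Suc m) powr (- Re s)"
    unfolding dist_norm norm_minus_commute[of "zpart m s"] K_def by (rule zpart_segment) (use mn s in auto)
   also have "... < e" by (rule M0[OF mn(1)])
   finally show "dist (zpart m s) (zpart n s) < e" .
  qed
 qed
 thus ?thesis unfolding zt_def by (simp add: Cauchy_convergent convergent_LIMSEQ_iff[symmetric])
qed

lemma zt_tail:
 assumes s: "Re s > 0"
 shows "norm (zt s - zpart M s) \<le> norm (s - 1) * (norm s / Re s) * real (Suc M) powr (- Re s)"
proof (rule tendsto_upperbound)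
 show "(\<lambda>N. norm (zpart N s - zpart M s)) \<longlonglongrightarrow> norm (zt s - zpart M s)"
  by (intro tendsto_norm tendsto_diff tendsto_const zpart_tendsto s)
 show "\<forall>\<^sub>F N in sequentially. norm (zpart N s - zpart M s) \<le> norm (s - 1) * (norm s / Re s) * real (Suc M) powr (- Re s)"
  using eventually_ge_at_top[of M] by eventually_elim (rule zpart_segment, use s in auto)
qed simp

lemma zt_holomorphic: "zt holomorphic_on {s. Re s > 0}"
proof (rule holomorphic_from_tail[where P = "\<lambda>x y. (x + 1) * (x / y)"])
 show "zpart M holomorphic_on {s. Re s > 0}" for M unfolding zpart_def by (intro holomorphic_intros nat_powr_holomorphic) auto
 show "norm (zt s - zpart M s) \<le> (norm s + 1) * (norm s / Re s) * real (Suc M) powr (- Re s)" if s: "Re s > 0" for M s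
 proof -
  have "norm (s - 1) * (norm s / Re s) * real (Suc M) powr (- Re s) \<le> (norm s + 1) * (norm s / Re s) * real (Suc M) powr (- Re s)"
   using s norm_triangle_ineq4[of s 1] by (intro mult_right_mono) auto
  thus ?thesis using zt_tail[OF s, of M] by linarith
 qed
 show "(x + 1) * (x / y) \<le> (x' + 1) * (x' / y')" if "0 \<le> x" "x \<le> x'" "0 < y'" "y' \<le> y" for x x' y y' :: real
  using that by (intro mult_mono frac_le) auto
qed auto

lemma zt_eq: assumes s: "Re s > 1" shows "zt s = (s - 1) * DS (prin 1) s"
proof -
 have t: "tame (prin 1)" by (rule tame_dchar[of 1]) (rule dchar_prin, simp)
 have "(\<lambda>N. \<Sum>n=1..N. prin 1 n * of_nat n powr (- s)) \<longlonglongrightarrow> DS (prin 1) s"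
  by (rule DS_partial_tendsto) (rule tame_summable[OF t s])
 hence 1: "(\<lambda>N. \<Sum>n=1..N. of_nat n powr (- s)) \<longlonglongrightarrow> DS (prin 1) s" by (simp add: prin_1)
 have "(\<lambda>M. of_nat (Suc M) powr (1 - s) :: complex) \<longlonglongrightarrow> 0"
 proof (rule tendsto_norm_zero_cancel)
  have "(\<lambda>M. real (Suc M) powr (- (Re s - 1))) \<longlonglongrightarrow> 0" by (rule Suc_powr_tendsto_0) (use s in simp)
  moreover have "norm (of_nat (Suc M) powr (1 - s) :: complex) = real (Suc M) powr (- (Re s - 1))" for M
   unfolding norm_nat_powr by simp
  ultimately show "(\<lambda>M. norm (of_nat (Suc M) powr (1 - s) :: complex)) \<longlonglongrightarrow> 0" by simp
 qed
 hence "(\<lambda>M. zpart M s) \<longlonglongrightarrow> (s - 1) * DS (prin 1) s + 0"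
  unfolding zpart_def by (intro tendsto_intros 1)
 moreover have "(\<lambda>M. zpart M s) \<longlonglongrightarrow> zt s" by (rule zpart_tendsto) (use s in simp)
 ultimately show ?thesis using LIMSEQ_unique by fastforce
qed

lemma zt_1: "zt 1 = 1"
proof -
 have "zpart M 1 = 1" for M by (simp add: zpart_def del: of_nat_Suc)
 hence "(\<lambda>M. zpart M 1) \<longlonglongrightarrow> 1" by simp
 moreover have "(\<lambda>M. zpart M 1) \<longlonglongrightarrow> zt 1" by (rule zpart_tendsto) simp
 ultimately show ?thesis using LIMSEQ_unique by blast
qed

text \<open>\<open>zpart 0 s = 1\<close>, and the tail bound adds at most \<open>(5/2) * 7\<close>;
  the total is rounded up.\<close>

lemma zt_crude:
 assumes s: "Re s \<ge> 1/2" "norm s \<le> 7/2" "norm (s - 1) \<le> 5/2"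
 shows "norm (zt s) \<le> 19"
proof -
 have "norm s / Re s \<le> (7/2) / (1/2)" using s by (intro frac_le) auto
 hence "norm (s - 1) * (norm s / Re s) \<le> (5/2) * 7" using s by (intro mult_mono) auto
 hence "norm (zt s - zpart 0 s) \<le> (5/2) * 7" using zt_tail[of s 0] s
  by (simp only: powr_one_eq_one of_nat_1 One_nat_def[symmetric] mult_1_right) linarith
 moreover have "norm (zt s) \<le> norm (zpart 0 s) + norm (zt s - zpart 0 s)" by (rule norm_triangle_sub)
 moreover have "zpart 0 s = 1" by (simp add: zpart_def)
 ultimately show ?thesis by simp
qed

text \<open>As in \<open>bps_DS_bound\<close>, with a cut at about
  \<open>\<bar>Im s\<bar> + 2\<close>; the last factor accounts for the multiplication by
  \<open>s - 1\<close>.\<close>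

lemma zt_bound:
 assumes e: "0 < e" "e \<le> 1/2" and s: "Re s \<ge> 1 - e"
 shows "norm (zt s) \<le> (zbound e + 4) * (\<bar>Im s\<bar> + 2) powr (2 * e) * (1 + norm (s - 1))"
proof -
 define V where "V = \<bar>Im s\<bar> + 2"
 define M where "M = nat \<lfloor>V\<rfloor>"
 have V2: "V \<ge> 2" unfolding V_def by simp
 have M: "real M \<le> V" "V \<le> real (Suc M)" "real (Suc M) \<le> 2 * V" using V2 unfolding M_def by linarith+
 have s0: "Re s > 0" using s e by auto
 have z0: "zbound e \<ge> 0" using zbound_nonneg e by simp
 have h1: "norm (\<Sum>n=1..M. of_nat n powr (- s) :: complex) \<le> zbound e * V powr (2 * e)"
  using norm_sum_powr_le[of "\<lambda>_. 1" s M] sum_powr_bound[OF e(1) s M(1)] by fastforce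
 have "norm s \<le> Re s + \<bar>Im s\<bar>" using cmod_le[of s] s0 by simp
 hence "norm s / Re s \<le> 1 + \<bar>Im s\<bar> / Re s" using s0 by (simp add: field_simps)
 also have "... \<le> 1 + \<bar>Im s\<bar> / (1/2)" using s e by (intro add_left_mono frac_le) auto
 finally have r: "norm s / Re s \<le> 2 * V" by (simp add: V_def)
 have "norm s / Re s * real (Suc M) powr (- Re s) \<le> 2 * V * V powr (- Re s)"
  using r M V2 s0 by (intro mult_mono powr_mono2') auto
 also have "... = 2 * V powr (1 - Re s)" using V2 by (simp add: powr_mult_base)
 also have "... \<le> 2 * V powr (2 * e)" using V2 s e by (intro mult_left_mono powr_mono) auto
 finally have h2: "norm s / Re s * real (Suc M) powr (- Re s) \<le> 2 * V powr (2 * e)" .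
 have "norm (of_nat (Suc M) powr (1 - s) :: complex) = real (Suc M) powr (1 - Re s)" unfolding norm_nat_powr by simp
 also have "... \<le> real (Suc M) powr e" using s by (intro powr_mono) auto
 also have "... \<le> (2 * V) powr e" using M e by (intro powr_mono2) auto
 also have "... \<le> (V * V) powr e" using V2 e by (intro powr_mono2) auto
 also have "... = V powr (2 * e)" using V2 by (simp add: powr_mult powr_add[symmetric])
 finally have h3: "norm (of_nat (Suc M) powr (1 - s) :: complex) \<le> V powr (2 * e)" .
 have "norm (zpart M s) \<le> norm (s - 1) * (zbound e * V powr (2 * e)) + V powr (2 * e)" unfolding zpart_def
  by (rule order_trans[OF norm_triangle_ineq]) (intro add_mono h3, simp only: norm_mult, intro mult_left_mono h1, simp)
 moreover have "norm (zt s - zpart M s) \<le> norm (s - 1) * (2 * V powr (2 * e))"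
  using zt_tail[OF s0, of M] mult_left_mono[OF h2, of "norm (s - 1)"] by (simp add: mult.assoc)
 moreover have "norm (zt s) \<le> norm (zpart M s) + norm (zt s - zpart M s)" by (rule norm_triangle_sub)
 ultimately have "norm (zt s) \<le> ((zbound e + 2) * norm (s - 1) + 1) * V powr (2 * e)" by (simp add: algebra_simps)
 also have "... \<le> ((zbound e + 4) * (1 + norm (s - 1))) * V powr (2 * e)"
  using z0 by (intro mult_right_mono) (auto simp: algebra_simps)
 finally show ?thesis by (simp add: V_def mult_ac)
qed

lemma bps_dchar: "dchar q \<xi> ==> \<xi> \<noteq> prin q ==> bps (real q) \<xi>"
 unfolding bps_def using dchar_partial_sum by blast

text \<open>The principal character minus its mean has bounded partial sums. Hence the pole of L(s,
  \<open>prin q\<close>) at 1 comes from the mean alone, that is, from a multiple of zeta.\<close>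

definition prin0 :: "nat => nat => complex" where
 "prin0 q n = prin q n - of_nat (totient q) / of_nat q"

lemma bps_prin0: "q > 0 ==> bps (real q) (prin0 q)" unfolding bps_def prin0_def using prin_partial_sum by blast

lemma norm_prin0_le: assumes "q > 0" shows "norm (prin0 q n) \<le> 1"
proof -
 have "prin0 q n = of_real ((if coprime n q then 1 else 0) - real (totient q) / real q)" by (simp add: prin_def prin0_def)
 moreover have "real (totient q) / real q \<le> 1" using totient_le[of q] assms by (simp add: divide_simps)
 ultimately show ?thesis by (simp only: norm_of_real) auto
qed

lemma DS_prin:
 assumes q: "q > 0" and s: "Re s > 1"
 shows "DS (prin q) s = of_nat (totient q) / of_nat q * (zt s / (s - 1)) + DS (prin0 q) s"
proof -
 have t1: "tame (prin 1)" by (rule tame_dchar[of 1]) (rule dchar_prin, simp)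
 have t2: "tame (\<lambda>n. of_nat (totient q) / of_nat q * prin 1 n)"
  by (rule tame_bounded[of _ "norm (of_nat (totient q) / of_nat q :: complex)"]) (simp add: prin_1)
 have t3: "tame (prin0 q)" by (rule tame_bounded[of _ 1]) (rule norm_prin0_le[OF q])
 have "prin q = (\<lambda>n. of_nat (totient q) / of_nat q * prin 1 n + prin0 q n)" by (auto simp: prin0_def prin_1)
 hence "DS (prin q) s = DS (\<lambda>n. of_nat (totient q) / of_nat q * prin 1 n) s + DS (prin0 q) s"
  using DS_add[OF t2 t3 s] by simp
 also have "DS (\<lambda>n. of_nat (totient q) / of_nat q * prin 1 n) s = of_nat (totient q) / of_nat q * DS (prin 1) s"
  by (rule DS_cmult[OF t1 s])
 also have "DS (prin 1) s = zt s / (s - 1)"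
 proof -
  have "s - 1 \<noteq> 0" using s by auto
  thus ?thesis using zt_eq[OF s] by simp
 qed
 finally show ?thesis .
qed

lemma nat_powr_of_real: "of_nat n powr (- of_real \<sigma>) = complex_of_real (real n powr (- \<sigma>))"
 using powr_of_real[of "real n" "- \<sigma>"] by simp

lemma DS_of_real:
 assumes "summable (\<lambda>n. f n * real n powr (- \<sigma>))"
 shows "DS (\<lambda>n. of_real (f n)) (of_real \<sigma>) = of_real (\<Sum>n. f n * real n powr (- \<sigma>))"
 unfolding DS_def nat_powr_of_real of_real_mult[symmetric] by (rule suminf_of_real[OF assms, symmetric])

lemma tame_summable_real:
 assumes "tame (\<lambda>n. of_real (f n))" "\<sigma> > 1"
 shows "summable (\<lambda>n. f n * real n powr (- \<sigma>))"
proof (rule summable_comparison_test')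
 show "summable (\<lambda>n. norm (complex_of_real (f n)) * real n powr (- \<sigma>))" using assms by (simp add: tame_def)
 show "norm (f n * real n powr (- \<sigma>)) \<le> norm (complex_of_real (f n)) * real n powr (- \<sigma>)" for n
  by (simp add: abs_mult)
qed

section \<open>Siegel's theorem\<close>

text \<open>Estermann's argument: at 2 the Taylor coefficients of \<open>P s / (s - 1)\<close> in powers of \<open>2 - s\<close> are
 nonnegative and the constant one is at least 1, while those of the regular part \<open>R\<close> decay by
 Cauchy's estimate; so \<open>P 1\<close> cannot be small if \<open>P \<beta> \<ge> 0\<close> for some \<open>\<beta> < 1\<close> close to 1.\<close>

locale estermann =
 fixes P :: "complex => complex" and h :: "nat => real"
 assumes P_hol: "P holomorphic_on {s. Re s > 0}"
  and h_nonneg: "\<And>n. h n \<ge> 0"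
  and h_tame: "tame (\<lambda>n. of_real (h n))"
  and P_eq: "\<And>s. Re s > 1 ==> P s = (s - 1) * exp (DS (\<lambda>n. of_real (h n)) s)"
begin

text \<open>With \<open>w = 2 - s\<close> every derivative brings out \<open>ln n\<close> without a
  sign, so all derivatives of \<open>K\<close> at 0, and with them those of \<open>G\<close>, are
  nonnegative. On the unit disc \<open>G w\<close> equals P(s) / (s - 1).\<close>

definition K :: "complex => complex" where "K w = DS (\<lambda>n. of_real (h n)) (2 - w)"
definition G :: "complex => complex" where "G w = exp (K w)"
definition kap :: "nat => real" where "kap m = (\<Sum>n. h n * ln (real n) ^ m * real n powr (- 2))"
definition gam :: "nat => real" where "gam m = Re ((deriv ^^ m) G 0)"
text \<open>P(s) / (s - 1) without its polar part. The value at 1 removes the singularity, so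
  \<open>Q\<close> is holomorphic on a disc of radius 2, beyond the pole of \<open>G\<close> at
  1.\<close>

definition R :: "complex => complex" where "R s = (if s = 1 then deriv P 1 else (P s - P 1) / (s - 1))"
definition Q :: "complex => complex" where "Q w = R (2 - w)"

lemma Re_2_minus: "w \<in> ball 0 1 ==> Re (2 - w) > 1" using complex_Re_le_cmod[of w] by simp

lemma K_hol: "K holomorphic_on ball 0 1"
proof -
 have "DS (\<lambda>n. of_real (h n)) \<circ> (\<lambda>w. 2 - w) holomorphic_on ball 0 1"
  by (rule holomorphic_on_compose_gen[OF _ DS_holomorphic[OF h_tame]])
   (use Re_2_minus in \<open>auto intro!: holomorphic_intros\<close>)
 thus ?thesis by (simp add: K_def[abs_def] o_def)
qed

lemma G_hol: "G holomorphic_on ball 0 1" unfolding G_def[abs_def] by (intro holomorphic_intros K_hol)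

lemma tame_h_ln: "tame (\<lambda>n. of_real (h n * ln (real n) ^ m))" using tame_ln_power[OF h_tame, of m] by simp

lemma summable_kap: "summable (\<lambda>n. h n * ln (real n) ^ m * real n powr (- 2))"
 by (rule tame_summable_real[OF tame_h_ln]) simp

lemma kap_nonneg: "kap m \<ge> 0" unfolding kap_def
proof (rule suminf_nonneg[OF summable_kap])
 fix n :: nat
 show "0 \<le> h n * ln (real n) ^ m * real n powr (- 2)" using h_nonneg[of n] by (cases "n = 0") auto
qed

lemma K_deriv: "(deriv ^^ m) K 0 = of_real (kap m)"
proof -
 have "(deriv ^^ m) (\<lambda>w. DS (\<lambda>n. of_real (h n)) ((-1) * w + 2)) 0 =
   (-1) ^ m * (deriv ^^ m) (DS (\<lambda>n. of_real (h n))) ((-1) * 0 + 2)"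
  by (rule higher_deriv_compose_linear'[OF DS_holomorphic[OF h_tame], of "ball 0 1"])
   (use Re_2_minus open_halfspace_Re_gt in auto)
 also have "(\<lambda>w. DS (\<lambda>n. of_real (h n)) ((-1) * w + 2)) = K" by (simp add: K_def[abs_def])
 also have "(deriv ^^ m) (DS (\<lambda>n. of_real (h n))) ((-1) * 0 + 2) = (-1) ^ m * DS (\<lambda>n. of_real (h n) * of_real (ln (real n) ^ m)) 2"
  by (subst DS_higher_deriv[OF h_tame]) auto
 also have "DS (\<lambda>n. of_real (h n) * of_real (ln (real n) ^ m)) 2 = of_real (kap m)"
  using DS_of_real[OF summable_kap[of m]] by (simp add: kap_def)
 finally show ?thesis by (simp add: mult.assoc[symmetric] power_mult_distrib[symmetric])
qed

lemma G_0: "G 0 = of_real (exp (kap 0))" using K_deriv[of 0] by (simp add: G_def exp_of_real)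

text \<open>Leibniz' rule for \<open>G' = K' * G\<close>; it lets nonnegativity pass from
  \<open>kap\<close> to \<open>gam\<close> by induction.\<close>

lemma G_deriv_Suc:
 "(deriv ^^ Suc m) G 0 = (\<Sum>i=0..m. of_nat (m choose i) * of_real (kap (Suc i)) * (deriv ^^ (m - i)) G 0)"
proof -
 have "(deriv ^^ Suc m) G 0 = (deriv ^^ m) (deriv G) 0" by (simp only: funpow_Suc_right o_apply)
 also have "... = (deriv ^^ m) (\<lambda>w. deriv K w * G w) 0"
 proof (rule higher_deriv_transform_within_open[of _ "ball 0 1"])
  show "deriv G holomorphic_on ball 0 1" by (intro holomorphic_deriv G_hol open_ball)
  show "(\<lambda>w. deriv K w * G w) holomorphic_on ball 0 1"
   by (intro holomorphic_intros holomorphic_deriv K_hol G_hol open_ball)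
  fix w :: complex assume w: "w \<in> ball 0 1"
  have "(K has_field_derivative deriv K w) (at w)" by (rule holomorphic_derivI[OF K_hol open_ball w])
  hence "(G has_field_derivative exp (K w) * deriv K w) (at w)" unfolding G_def[abs_def] by (rule DERIV_chain2[OF DERIV_exp])
  thus "deriv G w = deriv K w * G w" by (simp add: DERIV_imp_deriv G_def)
 qed auto
 also have "... = (\<Sum>i=0..m. of_nat (m choose i) * (deriv ^^ i) (deriv K) 0 * (deriv ^^ (m - i)) G 0)"
  by (rule higher_deriv_mult[of _ "ball 0 1"]) (auto intro: holomorphic_deriv K_hol G_hol)
 also have "... = (\<Sum>i=0..m. of_nat (m choose i) * of_real (kap (Suc i)) * (deriv ^^ (m - i)) G 0)"
  using K_deriv[of "Suc i" for i] by (simp add: funpow_Suc_right del: funpow.simps)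
 finally show ?thesis .
qed

lemma G_deriv: "(deriv ^^ m) G 0 = of_real (gam m) \<and> gam m \<ge> 0"
proof (induction m rule: less_induct)
 case (less m)
 show ?case
 proof (cases m)
  case 0
  thus ?thesis using G_0 by (simp add: gam_def)
 next
  case (Suc k)
  have "(deriv ^^ m) G 0 = of_real (\<Sum>i=0..k. of_nat (k choose i) * kap (Suc i) * gam (k - i))"
   unfolding Suc G_deriv_Suc of_real_sum by (rule sum.cong) (use less[of "k - i" for i] Suc in auto)
  moreover have "(\<Sum>i=0..k. of_nat (k choose i) * kap (Suc i) * gam (k - i)) \<ge> 0"
   by (intro sum_nonneg mult_nonneg_nonneg) (use less Suc kap_nonneg in auto)
  ultimately show ?thesis by (simp add: gam_def)
 qed
qed

lemma gam_nonneg: "gam m \<ge> 0" using G_deriv by blast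

lemma gam_0: "gam 0 \<ge> 1" "gam 0 \<ge> kap 0"
proof -
 have "gam 0 = exp (kap 0)" using G_0 by (simp add: gam_def)
 thus "gam 0 \<ge> 1" "gam 0 \<ge> kap 0" using kap_nonneg[of 0] exp_ge_add_one_self[of "kap 0"] by linarith+
qed

text \<open>Only the summand in which \<open>K\<close> takes all derivatives is kept, together with
  \<open>gam 0 \<ge> 1\<close>.\<close>

lemma gam_ge_kap: "gam m \<ge> kap m"
proof (cases m)
 case 0
 thus ?thesis using gam_0 by simp
next
 case (Suc k)
 have "(deriv ^^ m) G 0 = of_real (\<Sum>i=0..k. of_nat (k choose i) * kap (Suc i) * gam (k - i))"
  unfolding Suc G_deriv_Suc of_real_sum by (rule sum.cong) (use G_deriv in auto)
 hence eq: "gam m = (\<Sum>i=0..k. of_nat (k choose i) * kap (Suc i) * gam (k - i))" by (simp add: gam_def)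
 have "kap m * 1 \<le> kap m * gam 0" using gam_0 kap_nonneg by (intro mult_left_mono) auto
 also have "... = of_nat (k choose k) * kap (Suc k) * gam (k - k)" using Suc by simp
 also have "... \<le> gam m" unfolding eq by (rule member_le_sum) (auto intro!: mult_nonneg_nonneg kap_nonneg gam_nonneg)
 finally show ?thesis by simp
qed

lemma R_hol: "R holomorphic_on {s. Re s > 0}" unfolding R_def[abs_def] by (rule pole_lemma_open[OF P_hol open_halfspace_Re_gt])

lemma Q_hol: "Q holomorphic_on ball 0 2"
proof -
 have "R \<circ> (\<lambda>w. 2 - w) holomorphic_on ball 0 2"
 proof (rule holomorphic_on_compose_gen[OF _ R_hol])
  show "(\<lambda>w. 2 - w) ` ball 0 2 \<subseteq> {s. Re s > 0}"
  proof safe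
   fix w :: complex assume "w \<in> ball 0 2"
   thus "0 < Re (2 - w)" using complex_Re_le_cmod[of w] by simp
  qed
 qed (auto intro!: holomorphic_intros)
 thus ?thesis by (simp add: Q_def[abs_def] o_def)
qed

lemma G_eq_Q: assumes w: "w \<in> ball 0 1" shows "G w = Q w + P 1 / (1 - w)"
proof -
 have w1: "w \<noteq> 1" using w by auto
 have "P (2 - w) = (1 - w) * G w" using P_eq[OF Re_2_minus[OF w]] by (simp add: G_def K_def)
 hence "G w = P (2 - w) / (1 - w)" using w1 by simp
 moreover have "2 - w - 1 = 1 - w" "2 - w \<noteq> 1" using w1 by auto
 hence "Q w = (P (2 - w) - P 1) / (1 - w)" by (simp add: Q_def R_def)
 ultimately show ?thesis by (simp add: diff_divide_distrib)
qed

text \<open>The pole part P(1) / (1 - w) has all its Taylor coefficients equal to P(1).\<close>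

lemma Q_deriv: "(deriv ^^ m) Q 0 / fact m = of_real (gam m / fact m) - P 1"
proof -
 \<comment> \<open>The power series with these coefficients is 0 on the unit disc, hence so is each
   coefficient.\<close>
 define a where "a = (\<lambda>m. of_real (gam m / fact m) - (deriv ^^ m) Q 0 / fact m - P 1)"
 have s: "(\<lambda>n. a n * (w - 0) ^ n) sums 0" if w: "norm (w - 0) < 1" for w :: complex
 proof -
  have w': "w \<in> ball 0 1" "w \<in> ball 0 2" using w by auto
  have 1: "(\<lambda>n. (deriv ^^ n) G 0 / fact n * (w - 0) ^ n) sums G w" by (rule holomorphic_power_series[OF G_hol w'(1)])
  have 2: "(\<lambda>n. (deriv ^^ n) Q 0 / fact n * (w - 0) ^ n) sums Q w" by (rule holomorphic_power_series[OF Q_hol w'(2)])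
  have 3: "(\<lambda>n. P 1 * w ^ n) sums (P 1 * (1 / (1 - w)))" by (rule sums_mult[OF geometric_sums]) (use w in simp)
  have "(\<lambda>n. (deriv ^^ n) G 0 / fact n * (w - 0) ^ n - (deriv ^^ n) Q 0 / fact n * (w - 0) ^ n - P 1 * w ^ n)
    sums (G w - Q w - P 1 * (1 / (1 - w)))" by (intro sums_diff 1 2 3)
  moreover have "G w - Q w - P 1 * (1 / (1 - w)) = 0" using G_eq_Q[OF w'(1)] by simp
  ultimately show ?thesis using G_deriv by (simp add: a_def algebra_simps)
 qed
 have "a m = 0"
 proof (cases "m = 0")
  case True
  have "(\<lambda>n. a n * 0 ^ n) sums a 0" by (rule powser_sums_zero)
  moreover have "(\<lambda>n. a n * 0 ^ n) sums 0" using s[of 0] by simp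
  ultimately show ?thesis using True sums_unique2 by blast
 next
  case False
  show ?thesis
  proof (rule ccontr)
   assume nz: "a m \<noteq> 0"
   obtain t :: real where t: "0 < t" "\<And>z::complex. z \<in> cball 0 t - {0} ==> (\<lambda>_. 0::complex) z \<noteq> 0"
    using powser_0_nonzero[OF zero_less_one s refl nz] False by auto
   have "of_real t \<in> cball (0::complex) t - {0}" using t by simp
   thus False using t(2) by blast
  qed
 qed
 moreover have "(deriv ^^ m) Q 0 / fact m = of_real (gam m / fact m) - P 1 - a m" by (simp add: a_def)
 ultimately show ?thesis by simp
qed

text \<open>\<open>Q\<close> is expanded at \<open>w0 = 2 - \<beta>\<close>, slightly beyond the
  pole of \<open>G\<close>. There the tail of the series is at most 1/2 in size, while in the first
  \<open>k\<close> terms the constant coefficient contributes at least 1 and every P(1) is a loss.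
  Since Re P(\<beta>) is nonnegative, Re Q(w0) is at most Re P(1) / (1 - \<beta>), so Re P(1) cannot
  be too small.\<close>

lemma lower_bound:
 assumes M: "\<And>s. s \<in> cball 2 (3/2) ==> norm (P s) \<le> M" and M1: "M \<ge> 1"
  and b: "3/4 < \<beta>" "\<beta> < 1" and Pb: "Re (P (of_real \<beta>)) \<ge> 0"
 shows "Re (P 1) \<ge> (1 - \<beta>) / 2 * exp (- ((1 - \<beta>) * (6 * ln (48 * M) + 1)))"
proof -
 define L where "L = Re (P 1)"
 define r where "r = (\<lambda>m. (deriv ^^ m) Q 0 / fact m)"
 define w0 where "w0 = 2 - \<beta>"
 have w0: "1 < w0" "w0 < 5/4" using b by (auto simp: w0_def)
 have P1: "norm (P 1) \<le> M" by (rule M) (simp add: dist_norm)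
 \<comment> \<open>Cauchy's estimate on the circle of radius 3/2: the numerator is at most
   \<open>2 * M\<close>, the denominator at least 1/2. As \<open>w0 < 5/4\<close>, the terms at
   \<open>w0\<close> decay like \<open>(5/6) ^ m\<close>.\<close>
 have rb: "norm (r m) \<le> 4 * M * (2/3) ^ m" for m
 proof -
  have "norm ((deriv ^^ m) Q 0) \<le> fact m * (4 * M) / (3/2) ^ m"
  proof (rule Cauchy_inequality)
   show "Q holomorphic_on ball 0 (3/2)" by (rule holomorphic_on_subset[OF Q_hol]) auto
   show "continuous_on (cball 0 (3/2)) Q" by (rule holomorphic_on_imp_continuous_on, rule holomorphic_on_subset[OF Q_hol]) auto
   fix w :: complex assume "norm (0 - w) = 3/2"
   hence w: "norm w = 3/2" by simp
   have "2 - w \<noteq> 1" using w by auto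
   hence Qw: "Q w = (P (2 - w) - P 1) / (1 - w)" by (simp add: Q_def R_def)
   have "norm (1 - w) \<ge> norm w - norm (1::complex)" by (metis norm_minus_commute norm_triangle_ineq2)
   hence n1: "norm (1 - w) \<ge> 1/2" using w by simp
   have "norm (P (2 - w)) \<le> M" by (rule M) (use w in \<open>simp add: dist_norm\<close>)
   hence "norm (P (2 - w) - P 1) \<le> 2 * M" using P1 norm_triangle_ineq4[of "P (2 - w)" "P 1"] by linarith
   hence "norm (P (2 - w) - P 1) / norm (1 - w) \<le> 2 * M / (1/2)" using n1 M1 by (intro frac_le) auto
   thus "norm (Q w) \<le> 4 * M" by (simp add: Qw norm_divide)
  qed auto
  thus ?thesis by (simp add: r_def norm_divide field_simps)
 qed
 have rr: "Re (r m) = gam m / fact m - L" for m unfolding r_def Q_deriv L_def by (simp only: minus_complex.sel Re_complex_of_real)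
 have "(\<lambda>n. r n * (of_real w0 - 0) ^ n) sums Q (of_real w0)"
  unfolding r_def by (rule holomorphic_power_series[OF Q_hol]) (use w0 in simp)
 hence "(\<lambda>n. Re (r n * of_real w0 ^ n)) sums Re (Q (of_real w0))" by (intro sums_Re) simp
 hence sm: "(\<lambda>n. Re (r n) * w0 ^ n) sums Re (Q (of_real w0))" by (simp add: of_real_power[symmetric] del: of_real_power)
 have "complex_of_real \<beta> \<noteq> 1" using b by (metis less_irrefl of_real_eq_1_iff)
 hence "Q (of_real w0) = (P (of_real \<beta>) - P 1) / of_real (\<beta> - 1)" by (simp add: Q_def R_def w0_def)
 hence "Re (Q (of_real w0)) = (Re (P (of_real \<beta>)) - L) / (\<beta> - 1)" by (simp add: L_def Re_divide_of_real del: of_real_diff)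
 also have "... = (L - Re (P (of_real \<beta>))) / (1 - \<beta>)" by (metis minus_diff_eq minus_divide_divide)
 also have "... \<le> L / (1 - \<beta>)" using Pb b by (intro divide_right_mono) auto
 finally have Qle: "Re (Q (of_real w0)) \<le> L / (1 - \<beta>)" .
 \<comment> \<open>The tail is at most \<open>24 * M * (5/6) ^ k\<close>; this is at most 1/2 for
   the chosen \<open>k\<close>, because 5/6 is at most \<open>exp (-1/6)\<close>.\<close>
 define k where "k = nat \<lceil>6 * ln (48 * M)\<rceil>"
 have k: "real k \<ge> 6 * ln (48 * M)" "real k \<le> 6 * ln (48 * M) + 1"
 proof -
  have "ln (48 * M) \<ge> 0" using M1 by simp
  thus "real k \<ge> 6 * ln (48 * M)" "real k \<le> 6 * ln (48 * M) + 1" unfolding k_def by linarith+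
 qed
 have sg: "(\<lambda>n. 4 * M * (5/6) ^ (n + k)) sums (4 * M * (5/6) ^ k * (1 / (1 - 5/6)))"
  unfolding power_add using sums_mult[OF geometric_sums[of "5/6 :: real"], of "4 * M * (5/6) ^ k"] by (simp add: mult_ac)
 have "Re (Q (of_real w0)) = (\<Sum>n. Re (r (n + k)) * w0 ^ (n + k)) + (\<Sum>n<k. Re (r n) * w0 ^ n)"
  using suminf_split_initial_segment[OF sums_summable[OF sm], of k] sm by (simp add: sums_iff)
 moreover have "(\<Sum>n. Re (r (n + k)) * w0 ^ (n + k)) \<ge> (\<Sum>n. - (4 * M * (5/6) ^ (n + k)))"
 proof (rule suminf_le)
  fix n
  have "\<bar>Re (r (n + k)) * w0 ^ (n + k)\<bar> \<le> (4 * M * (2/3) ^ (n + k)) * (5/4) ^ (n + k)"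
   unfolding abs_mult using order_trans[OF abs_Re_le_cmod rb] w0 M1 by (intro mult_mono) (auto intro!: power_mono)
  also have "... = 4 * M * (5/6) ^ (n + k)" unfolding mult.assoc power_mult_distrib[symmetric] by simp
  finally show "- (4 * M * (5/6) ^ (n + k)) \<le> Re (r (n + k)) * w0 ^ (n + k)" by linarith
  show "summable (\<lambda>n. - (4 * M * (5/6) ^ (n + k)))" using sums_summable[OF sg] summable_minus by blast
  show "summable (\<lambda>n. Re (r (n + k)) * w0 ^ (n + k))"
   using sums_summable[OF sm] summable_iff_shift[of "\<lambda>n. Re (r n) * w0 ^ n" k] by simp
 qed
 moreover have "(\<Sum>n. - (4 * M * (5/6) ^ (n + k))) = - (24 * M * (5/6) ^ k)" using sums_minus[OF sg] by (simp add: sums_iff)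
 moreover have "24 * M * (5/6) ^ k \<le> 1/2"
 proof -
  have "(5/6 :: real) \<le> exp (- (1/6))" using exp_ge_add_one_self[of "- (1/6) :: real"] by simp
  hence "(5/6 :: real) ^ k \<le> exp (- (1/6)) ^ k" by (rule power_mono) simp
  also have "... = exp (- (real k / 6))" by (simp add: exp_of_nat_mult[symmetric])
  also have "... \<le> exp (- ln (48 * M))" using k by simp
  also have "... = 1 / (48 * M)" using M1 by (simp add: exp_minus divide_simps)
  finally have "24 * M * (5/6) ^ k \<le> 24 * M * (1 / (48 * M))" using M1 by (intro mult_left_mono) auto
  thus ?thesis using M1 by simp
 qed
 moreover have "(\<Sum>n<k. Re (r n) * w0 ^ n) \<ge> 1 - L * ((w0 ^ k - 1) / (w0 - 1))"
 proof -
  have "k > 0"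
  proof (rule ccontr)
   assume "\<not> k > 0"
   hence "ln (48 * M) \<le> 0" using k by simp
   thus False using M1 by simp
  qed
  have "(\<Sum>n<k. Re (r n) * w0 ^ n) = (\<Sum>n<k. gam n / fact n * w0 ^ n) - L * (\<Sum>n<k. w0 ^ n)"
   by (simp add: rr sum_subtractf[symmetric] sum_distrib_left left_diff_distrib)
  moreover have "(\<Sum>n<k. w0 ^ n) = (w0 ^ k - 1) / (w0 - 1)" by (rule geometric_sum) (use w0 in simp)
  moreover have "gam 0 / fact 0 * w0 ^ 0 \<le> (\<Sum>n<k. gam n / fact n * w0 ^ n)"
   by (rule member_le_sum) (use \<open>k > 0\<close> gam_nonneg w0 in auto)
  ultimately show ?thesis using gam_0 by simp
 qed
 ultimately have "L / (1 - \<beta>) \<ge> 1/2 - L * ((w0 ^ k - 1) / (w0 - 1))" using Qle by linarith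
 moreover have "w0 - 1 = 1 - \<beta>" by (simp add: w0_def)
 hence "L / (1 - \<beta>) + L * ((w0 ^ k - 1) / (w0 - 1)) = L * w0 ^ k / (1 - \<beta>)"
  by (simp add: add_divide_distrib[symmetric] right_diff_distrib)
 ultimately have "1/2 \<le> L * w0 ^ k / (1 - \<beta>)" by linarith
 hence main: "L * w0 ^ k \<ge> (1 - \<beta>) / 2" using b by (simp add: pos_le_divide_eq)
 have "w0 \<le> exp (1 - \<beta>)" using exp_ge_add_one_self[of "1 - \<beta>"] by (simp add: w0_def)
 hence "w0 ^ k \<le> exp (1 - \<beta>) ^ k" using w0 by (intro power_mono) auto
 also have "... = exp ((1 - \<beta>) * real k)" by (simp add: exp_of_nat_mult[symmetric] mult.commute)
 also have "... \<le> exp ((1 - \<beta>) * (6 * ln (48 * M) + 1))" using k b by (simp add: mult_left_mono)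
 finally have wk: "w0 ^ k \<le> exp ((1 - \<beta>) * (6 * ln (48 * M) + 1))" .
 have Lpos: "L \<ge> 0"
 proof (rule ccontr)
  assume "\<not> L \<ge> 0"
  hence "L * w0 ^ k \<le> 0" using w0 by (simp add: mult_nonpos_nonneg)
  thus False using main b by simp
 qed
 have "(1 - \<beta>) / 2 \<le> L * exp ((1 - \<beta>) * (6 * ln (48 * M) + 1))" using main mult_left_mono[OF wk Lpos] by linarith
 thus ?thesis unfolding L_def[symmetric] exp_minus by (simp add: field_simps)
qed

text \<open>When P(1) = 0, the coefficients of \<open>Q\<close> are those of \<open>G\<close> and
  dominate those of the logarithm, and the series converges for all \<open>w < 2\<close>. For
  finitely many \<open>n\<close>, the exponential series of \<open>n powr w\<close> turns the
  smaller coefficients into a partial sum of the Dirichlet series of the logarithm at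
  \<open>\<sigma> = 2 - w\<close>, to the left of 1.\<close>

lemma partial_sum_le:
 assumes P1: "P 1 = 0" and s: "1/2 \<le> \<sigma>" "\<sigma> \<le> 1"
 shows "(\<Sum>n=1..X. h n * real n powr (- \<sigma>)) \<le> Re (R (of_real \<sigma>))"
proof -
 define w where "w = 2 - \<sigma>"
 have w: "0 \<le> w" "w < 2" using s by (auto simp: w_def)
 have "(\<lambda>n. (deriv ^^ n) Q 0 / fact n * (of_real w - 0) ^ n) sums Q (of_real w)"
  by (rule holomorphic_power_series[OF Q_hol]) (use w in simp)
 hence "(\<lambda>n. of_real (gam n / fact n * w ^ n)) sums Q (of_real w)" unfolding Q_deriv P1 by simp
 from sums_Re[OF this] have gs: "(\<lambda>n. gam n / fact n * w ^ n) sums Re (Q (of_real w))" by (simp only: Re_complex_of_real)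
 have es: "(\<lambda>m. (\<Sum>n=1..X. h n * ln (real n) ^ m * real n powr (- 2)) / fact m * w ^ m) sums
   (\<Sum>n=1..X. h n * real n powr (- \<sigma>))"
 proof -
  have "(\<lambda>m. \<Sum>n=1..X. h n * real n powr (- 2) * ((w * ln (real n)) ^ m /\<^sub>R fact m)) sums
    (\<Sum>n=1..X. h n * real n powr (- 2) * exp (w * ln (real n)))"
   by (intro sums_sum sums_mult exp_converges)
  moreover have "h n * real n powr (- 2) * exp (w * ln (real n)) = h n * real n powr (- \<sigma>)" if "n \<in> {1..X}" for n
  proof -
   have "exp (w * ln (real n)) = real n powr w" using that by (simp add: powr_def)
   thus ?thesis by (simp add: mult.assoc powr_add[symmetric] w_def)
  qed
  hence "(\<Sum>n=1..X. h n * real n powr (- 2) * exp (w * ln (real n))) = (\<Sum>n=1..X. h n * real n powr (- \<sigma>))"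
   by (rule sum.cong[OF refl])
  moreover have "(\<lambda>m. \<Sum>n=1..X. h n * real n powr (- 2) * ((w * ln (real n)) ^ m /\<^sub>R fact m)) =
   (\<lambda>m. (\<Sum>n=1..X. h n * ln (real n) ^ m * real n powr (- 2)) / fact m * w ^ m)"
   by (rule ext) (simp add: sum_distrib_left sum_distrib_right power_mult_distrib divide_inverse mult_ac)
  ultimately show ?thesis by (simp only:)
 qed
 have "(\<Sum>n=1..X. h n * real n powr (- \<sigma>)) \<le> Re (Q (of_real w))"
 proof (rule sums_le[OF _ es gs])
  fix m
  have "(\<Sum>n=1..X. h n * ln (real n) ^ m * real n powr (- 2)) \<le> kap m" unfolding kap_def
  proof (rule sum_le_suminf[OF summable_kap])
   fix n :: nat
   show "0 \<le> h n * ln (real n) ^ m * real n powr (- 2)" using h_nonneg[of n] by (cases "n = 0") auto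
  qed simp
  also have "... \<le> gam m" by (rule gam_ge_kap)
  finally show "(\<Sum>n=1..X. h n * ln (real n) ^ m * real n powr (- 2)) / fact m * w ^ m \<le> gam m / fact m * w ^ m"
   using w by (intro mult_right_mono divide_right_mono) auto
 qed
 thus ?thesis by (simp add: Q_def w_def)
qed

lemma partial_sums_bounded:
 assumes P1: "P 1 = 0"
 shows "\<exists>C. \<forall>\<sigma> X. 1/2 \<le> \<sigma> \<and> \<sigma> \<le> 1 --> (\<Sum>n=1..X. h n * real n powr (- \<sigma>)) \<le> C"
proof -
 have "continuous_on {1/2..1} (\<lambda>\<sigma>. R (of_real \<sigma>))"
  by (rule continuous_on_compose2[OF holomorphic_on_imp_continuous_on[OF R_hol]])
   (auto intro!: continuous_intros)
 hence "compact ((\<lambda>\<sigma>. R (of_real \<sigma>)) ` {1/2..1})" by (rule compact_continuous_image) simp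
 hence "bounded ((\<lambda>\<sigma>. R (of_real \<sigma>)) ` {1/2..1})" by (rule compact_imp_bounded)
 then obtain C where C0: "\<forall>x\<in>(\<lambda>\<sigma>. R (of_real \<sigma>)) ` {1/2..1}. norm x \<le> C"
  unfolding bounded_iff by blast
 hence C: "norm (R (of_real \<sigma>)) \<le> C" if "\<sigma> \<in> {1/2..1}" for \<sigma> using that by blast
 have "(\<Sum>n=1..X. h n * real n powr (- \<sigma>)) \<le> C" if "1/2 \<le> \<sigma>" "\<sigma> \<le> 1" for \<sigma> X
  using partial_sum_le[OF P1 that, of X] C[of \<sigma>] complex_Re_le_cmod[of "R (of_real \<sigma>)"] that by force
 thus ?thesis by blast
qed

end

section \<open>Real characters\<close>

definition rchar :: "nat => (nat => complex) => bool" where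
 "rchar q \<xi> \<longleftrightarrow> dchar q \<xi> \<and> \<xi> \<noteq> prin q \<and> (\<forall>n. \<xi> n \<in> \<real>)"

lemma rchar_dchar: "rchar q \<xi> ==> dchar q \<xi>" and rchar_bps: "rchar q \<xi> ==> bps (real q) \<xi>"
 and rchar_real: "rchar q \<xi> ==> complex_of_real (Re (\<xi> n)) = \<xi> n"
 and rchar_pos: "rchar q \<xi> ==> q > 0"
 by (auto simp: rchar_def bps_dchar dchar_pos)

lemma rchar_abs: "rchar q \<xi> ==> \<bar>Re (\<xi> n)\<bar> = (if coprime n q then 1 else 0)"
 using dchar_norm[OF rchar_dchar, of q \<xi> n] rchar_real[of q \<xi> n] by (metis norm_of_real)

lemma rchar_square: assumes "rchar q \<xi>" shows "\<xi> n * \<xi> n = prin q n"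
proof -
 have "Re (\<xi> n) * Re (\<xi> n) = (if coprime n q then 1 else 0)"
  using rchar_abs[OF assms, of n] abs_mult_self_eq[of "Re (\<xi> n)"] by (auto split: if_splits)
 hence "complex_of_real (Re (\<xi> n)) * complex_of_real (Re (\<xi> n)) = (if coprime n q then 1 else 0)"
  by (metis of_real_0 of_real_1 of_real_mult)
 thus ?thesis using rchar_real[OF assms, of n] by (simp add: prin_def)
qed

abbreviation lw :: "nat => real" where "lw n \<equiv> mangoldt n / ln (real n)"

lemma lw_nonneg: "lw n \<ge> 0" using logcoef_weight[of n] by (cases "n = 0") auto

lemma dchar_prin1: "dchar 1 (prin 1)" by (rule dchar_prin) simp

lemma DS_real_axis:
 assumes x: "\<And>n. \<xi> n \<in> \<real>" and s: "summable (\<lambda>n. \<xi> n * of_nat n powr (- of_real \<sigma>))"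
 shows "DS \<xi> (of_real \<sigma>) \<in> \<real>"
proof -
 have t: "\<xi> n * of_nat n powr (- of_real \<sigma>) \<in> \<real>" for n using x[of n] by (simp add: nat_powr_of_real)
 have "(\<lambda>n. \<Sum>i<n. \<xi> i * of_nat i powr (- of_real \<sigma>)) \<longlonglongrightarrow> DS \<xi> (of_real \<sigma>)"
  using summable_sums[OF s] by (simp add: DS_def sums_def)
 moreover have "(\<Sum>i<n. \<xi> i * of_nat i powr (- of_real \<sigma>)) \<in> \<real>" for n by (intro sum_in_Reals t)
 ultimately show ?thesis by (intro Lim_in_closed_set[OF closed_complex_Reals]) auto
qed

lemma rchar_DS_real: assumes "rchar q \<xi>" "\<sigma> > 0" shows "DS \<xi> (of_real \<sigma>) \<in> \<real>"
 by (rule DS_real_axis) (use assms bps_summable[OF rchar_bps] in \<open>auto simp: rchar_def\<close>)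

lemma rchar_DS_pos: assumes c: "rchar q \<xi>" and s: "\<sigma> > 1" shows "Re (DS \<xi> (of_real \<sigma>)) > 0"
proof -
 have "logcoef \<xi> n \<in> \<real>" for n
  unfolding logcoef_def by (intro Reals_mult Reals_of_real) (use c in \<open>auto simp: rchar_def\<close>)
 hence "DS (logcoef \<xi>) (of_real \<sigma>) \<in> \<real>"
  by (rule DS_real_axis) (rule tame_summable[OF tame_logcoef[OF rchar_dchar[OF c]]], use s in simp)
 hence "DS (logcoef \<xi>) (of_real \<sigma>) = of_real (Re (DS (logcoef \<xi>) (of_real \<sigma>)))" by simp
 hence "DS \<xi> (of_real \<sigma>) = of_real (exp (Re (DS (logcoef \<xi>) (of_real \<sigma>))))"
  using DS_eq_exp[OF rchar_dchar[OF c], of "of_real \<sigma>"] s by (metis Re_complex_of_real exp_of_real)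
 thus ?thesis by simp
qed

lemma isCont_of_holomorphic_right:
 assumes "f holomorphic_on {s. Re s > 0}" "x > 0"
 shows "isCont (\<lambda>\<sigma>. f (of_real \<sigma>)) x"
proof -
 have "isCont f (of_real x)" using holomorphic_on_imp_continuous_on[OF assms(1)] assms(2) open_halfspace_Re_gt
  by (simp add: continuous_on_eq_continuous_at)
 thus ?thesis by (intro isCont_o2[of x of_real f] continuous_intros) auto
qed

lemma tendsto_at_right_1:
 assumes "f holomorphic_on {s. Re s > 0}"
 shows "((\<lambda>\<sigma>. f (of_real \<sigma>)) \<longlongrightarrow> f 1) (at_right (1::real))"
 using isCont_of_holomorphic_right[OF assms, of 1] by (simp add: isCont_def filterlim_at_split)

lemma prin_residue:
 assumes q: "q > 0"
 shows "((\<lambda>\<sigma>. of_real (\<sigma> - 1) * DS (prin q) (of_real \<sigma>)) \<longlongrightarrow> of_real (real (totient q) / real q)) (at_right (1::real))"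
proof -
 have "((\<lambda>\<sigma>. of_nat (totient q) / of_nat q * zt (of_real \<sigma>) + of_real (\<sigma> - 1) * DS (prin0 q) (of_real \<sigma>)) \<longlongrightarrow>
   of_nat (totient q) / of_nat q * zt 1 + of_real (1 - 1) * DS (prin0 q) 1) (at_right (1::real))"
  by (intro tendsto_intros tendsto_at_right_1 zt_holomorphic bps_DS_holomorphic[OF bps_prin0[OF q]])
 hence "((\<lambda>\<sigma>. of_nat (totient q) / of_nat q * zt (of_real \<sigma>) + of_real (\<sigma> - 1) * DS (prin0 q) (of_real \<sigma>)) \<longlongrightarrow>
   of_real (real (totient q) / real q)) (at_right (1::real))" by (simp add: zt_1)
 moreover have "\<forall>\<^sub>F \<sigma> in at_right (1::real). of_nat (totient q) / of_nat q * zt (of_real \<sigma>) + of_real (\<sigma> - 1) * DS (prin0 q) (of_real \<sigma>)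
   = of_real (\<sigma> - 1) * DS (prin q) (of_real \<sigma>)"
  using eventually_at_right_less[of "1::real"]
 proof eventually_elim
  case (elim \<sigma>)
  have "complex_of_real (\<sigma> - 1) \<noteq> 0" using elim by (metis eq_iff_diff_eq_0 less_irrefl of_real_eq_0_iff)
  thus ?case using DS_prin[OF q, of "of_real \<sigma>"] elim by (simp add: distrib_left)
 qed
 ultimately show ?thesis by (rule Lim_transform_eventually)
qed

lemma mangoldt_square: assumes "m > 0" shows "mangoldt (m ^ 2) = (mangoldt m :: real)"
proof (cases "primepow m")
 case True
 thus ?thesis using assms by (simp add: mangoldt_def primepow_power_iff_nat aprimedivisor_primepow_power)
qed (use assms in \<open>simp add: mangoldt_def primepow_power_iff_nat\<close>)

text \<open>The square of a prime power belongs to the same prime, while the logarithm doubles. The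
  squares are what forces divergence in \<open>rchar_L1_pos\<close>.\<close>

lemma lw_square: assumes "m > 0" shows "lw (m ^ 2) = lw m / 2" using mangoldt_square[OF assms] assms by (simp add: ln_realpow)

lemma estermann_pair:
 assumes c: "rchar q \<xi>"
 shows "estermann (\<lambda>s. zt s * DS \<xi> s) (\<lambda>n. lw n * (1 + Re (\<xi> n)))"
proof
 note d = rchar_dchar[OF c]
 show "(\<lambda>s. zt s * DS \<xi> s) holomorphic_on {s. Re s > 0}"
  by (intro holomorphic_intros zt_holomorphic bps_DS_holomorphic[OF rchar_bps[OF c]])
 show "lw n * (1 + Re (\<xi> n)) \<ge> 0" for n
  using rchar_abs[OF c, of n] by (intro mult_nonneg_nonneg lw_nonneg) (auto split: if_splits)
 have eq: "(\<lambda>n. complex_of_real (lw n * (1 + Re (\<xi> n)))) = (\<lambda>n. logcoef (prin 1) n + logcoef \<xi> n)"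
 proof
  fix n
  have "complex_of_real (lw n * (1 + Re (\<xi> n))) = of_real (lw n) * (1 + \<xi> n)"
   by (simp only: of_real_mult of_real_add of_real_1 rchar_real[OF c])
  moreover have "w * (1 + \<xi> n) = 1 * w + \<xi> n * w" for w :: complex by (simp add: algebra_simps)
  ultimately show "complex_of_real (lw n * (1 + Re (\<xi> n))) = logcoef (prin 1) n + logcoef \<xi> n"
   by (simp only: logcoef_def prin_1)
 qed
 show "tame (\<lambda>n. complex_of_real (lw n * (1 + Re (\<xi> n))))"
  unfolding eq by (intro tame_add tame_logcoef[OF dchar_prin1] tame_logcoef[OF d])
 show "zt s * DS \<xi> s = (s - 1) * exp (DS (\<lambda>n. complex_of_real (lw n * (1 + Re (\<xi> n)))) s)" if s: "Re s > 1" for s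
  unfolding eq DS_add[OF tame_logcoef[OF dchar_prin1] tame_logcoef[OF d] s] exp_add
   DS_eq_exp[OF dchar_prin1 s, symmetric] DS_eq_exp[OF d s, symmetric] zt_eq[OF s] by simp
qed

text \<open>The characters 1, \<xi>1, \<xi>2 and their product add up to (1 + \<xi>1)(1 + \<xi>2),
  which is nonnegative.\<close>

lemma estermann_quad:
 assumes c1: "rchar q1 \<xi>1" and c2: "rchar q2 \<xi>2" and c12: "rchar (q1 * q2) (\<lambda>n. \<xi>1 n * \<xi>2 n)"
 shows "estermann (\<lambda>s. zt s * DS \<xi>1 s * DS \<xi>2 s * DS (\<lambda>n. \<xi>1 n * \<xi>2 n) s) (\<lambda>n. lw n * ((1 + Re (\<xi>1 n)) * (1 + Re (\<xi>2 n))))"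
proof
 note d1 = rchar_dchar[OF c1] and d2 = rchar_dchar[OF c2] and d12 = rchar_dchar[OF c12]
 show "(\<lambda>s. zt s * DS \<xi>1 s * DS \<xi>2 s * DS (\<lambda>n. \<xi>1 n * \<xi>2 n) s) holomorphic_on {s. Re s > 0}"
  by (intro holomorphic_intros zt_holomorphic bps_DS_holomorphic[OF rchar_bps[OF c1]]
   bps_DS_holomorphic[OF rchar_bps[OF c2]] bps_DS_holomorphic[OF rchar_bps[OF c12]])
 show "lw n * ((1 + Re (\<xi>1 n)) * (1 + Re (\<xi>2 n))) \<ge> 0" for n using rchar_abs[OF c1, of n] rchar_abs[OF c2, of n]
  by (intro mult_nonneg_nonneg lw_nonneg) (auto split: if_splits)
 have eq: "(\<lambda>n. complex_of_real (lw n * ((1 + Re (\<xi>1 n)) * (1 + Re (\<xi>2 n))))) =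
  (\<lambda>n. logcoef (prin 1) n + (logcoef \<xi>1 n + (logcoef \<xi>2 n + logcoef (\<lambda>n. \<xi>1 n * \<xi>2 n) n)))"
 proof
  fix n
  have "complex_of_real (lw n * ((1 + Re (\<xi>1 n)) * (1 + Re (\<xi>2 n)))) = of_real (lw n) * ((1 + \<xi>1 n) * (1 + \<xi>2 n))"
   by (simp only: of_real_mult of_real_add of_real_1 rchar_real[OF c1] rchar_real[OF c2])
  moreover have "w * ((1 + \<xi>1 n) * (1 + \<xi>2 n)) = 1 * w + (\<xi>1 n * w + (\<xi>2 n * w + \<xi>1 n * \<xi>2 n * w))" for w :: complex
   by (simp add: algebra_simps)
  ultimately show "complex_of_real (lw n * ((1 + Re (\<xi>1 n)) * (1 + Re (\<xi>2 n)))) =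
   logcoef (prin 1) n + (logcoef \<xi>1 n + (logcoef \<xi>2 n + logcoef (\<lambda>n. \<xi>1 n * \<xi>2 n) n))"
   by (simp only: logcoef_def prin_1)
 qed
 note t = tame_logcoef[OF dchar_prin1] tame_logcoef[OF d1] tame_logcoef[OF d2] tame_logcoef[OF d12]
 show "tame (\<lambda>n. complex_of_real (lw n * ((1 + Re (\<xi>1 n)) * (1 + Re (\<xi>2 n)))))" unfolding eq by (intro tame_add t)
 show "zt s * DS \<xi>1 s * DS \<xi>2 s * DS (\<lambda>n. \<xi>1 n * \<xi>2 n) s =
  (s - 1) * exp (DS (\<lambda>n. complex_of_real (lw n * ((1 + Re (\<xi>1 n)) * (1 + Re (\<xi>2 n))))) s)" if s: "Re s > 1" for s
  unfolding eq DS_add[OF t(1) tame_add[OF t(2) tame_add[OF t(3,4)]] s] DS_add[OF t(2) tame_add[OF t(3,4)] s]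
   DS_add[OF t(3,4) s] exp_add DS_eq_exp[OF dchar_prin1 s, symmetric] DS_eq_exp[OF d1 s, symmetric]
   DS_eq_exp[OF d2 s, symmetric] DS_eq_exp[OF d12 s, symmetric] zt_eq[OF s] by simp
qed

lemma rchar_L1_nonneg: assumes c: "rchar q \<xi>" shows "Re (DS \<xi> 1) \<ge> 0"
proof (rule tendsto_lowerbound)
 show "((\<lambda>\<sigma>. Re (DS \<xi> (of_real \<sigma>))) \<longlongrightarrow> Re (DS \<xi> 1)) (at_right (1::real))"
  by (intro tendsto_Re tendsto_at_right_1 bps_DS_holomorphic[OF rchar_bps[OF c]])
 show "\<forall>\<^sub>F \<sigma> in at_right (1::real). 0 \<le> Re (DS \<xi> (of_real \<sigma>))"
  using eventually_at_right_less[of "1::real"] by eventually_elim (use rchar_DS_pos[OF c] in \<open>simp add: less_imp_le\<close>)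
qed simp

text \<open>If \<open>L(1) = 0\<close>, the product of zeta with \<open>L\<close> is regular at 1 and its logarithm converges down to
 \<open>1/2\<close>, where the squares alone make it diverge.\<close>

lemma rchar_L1_pos: assumes c: "rchar q \<xi>" shows "Re (DS \<xi> 1) > 0"
proof (rule ccontr)
 assume "\<not> Re (DS \<xi> 1) > 0"
 hence "Re (DS \<xi> 1) = 0" using rchar_L1_nonneg[OF c] by simp
 moreover have "DS \<xi> (of_real 1) \<in> \<real>" by (rule rchar_DS_real[OF c]) simp
 ultimately have L0: "DS \<xi> 1 = 0" by (simp add: complex_eq_iff complex_is_Real_iff)
 interpret estermann "\<lambda>s. zt s * DS \<xi> s" "\<lambda>n. lw n * (1 + Re (\<xi> n))" by (rule estermann_pair[OF c])
 obtain C where C: "\<And>\<sigma> X. 1/2 \<le> \<sigma> ==> \<sigma> \<le> 1 ==> (\<Sum>n=1..X. lw n * (1 + Re (\<xi> n)) * real n powr (- \<sigma>)) \<le> C"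
 proof -
  have "zt 1 * DS \<xi> 1 = 0" by (simp add: L0)
  from partial_sums_bounded[OF this] show thesis using that by blast
 qed
 have q: "q > 0" by (rule rchar_pos[OF c])
 \<comment> \<open>Only squares are kept: \<open>\<xi> (m ^ 2) = 1\<close> for \<open>m\<close>
   coprime to \<open>q\<close>, and a square at exponent \<open>\<sigma> / 2\<close> is an ordinary
   term at \<open>\<sigma>\<close>.\<close>
 have part: "(\<Sum>m=1..Y. Re (prin q m) * lw m * real m powr (- \<sigma>)) \<le> C" if s: "1 < \<sigma>" "\<sigma> \<le> 2" for \<sigma> Y
 proof -
  let ?g = "\<lambda>n. lw n * (1 + Re (\<xi> n)) * real n powr (- (\<sigma> / 2))"
  have g0: "?g n \<ge> 0" for n by (rule mult_nonneg_nonneg[OF h_nonneg powr_ge_zero])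
  have "(\<Sum>m=1..Y. Re (prin q m) * lw m * real m powr (- \<sigma>)) \<le> (\<Sum>m=1..Y. ?g (m ^ 2))"
  proof (rule sum_mono)
   fix m assume m: "m \<in> {1..Y}"
   show "Re (prin q m) * lw m * real m powr (- \<sigma>) \<le> ?g (m ^ 2)"
   proof (cases "coprime m q")
    case True
    have "\<xi> (m ^ 2) = \<xi> m * \<xi> m" using dchar_mult[OF rchar_dchar[OF c]] by (simp add: power2_eq_square)
    hence x1: "\<xi> (m ^ 2) = 1" using rchar_square[OF c, of m] True by (simp add: prin_def)
    have "real (m ^ 2) powr (- (\<sigma> / 2)) = real m powr (- \<sigma>)"
    proof -
     have "real (m ^ 2) = real m powr 2" using m by (simp add: powr_numeral)
     thus ?thesis by (simp only: powr_powr) simp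
    qed
    moreover have "lw (m ^ 2) = lw m / 2" by (rule lw_square) (use m in simp)
    ultimately have "?g (m ^ 2) = lw m / 2 * (1 + 1) * real m powr (- \<sigma>)" by (simp only: x1 one_complex.sel)
    thus ?thesis using True by (simp add: prin_def)
   next
    case False
    thus ?thesis using g0[of "m ^ 2"] by (simp add: prin_def)
   qed
  qed
  also have "... = (\<Sum>n\<in>(\<lambda>m. m ^ 2) ` {1..Y}. ?g n)" by (subst sum.reindex) (auto simp: inj_on_def)
  also have "... \<le> (\<Sum>n=1..Y ^ 2. ?g n)"
   by (rule sum_mono2) (use g0 in \<open>auto intro!: power_mono simp: One_nat_def Suc_le_eq\<close>)
  also have "... \<le> C" by (rule C) (use s in auto)
  finally show ?thesis .
 qed
 have dq: "dchar q (prin q)" by (rule dchar_prin[OF q])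
 have nb: "norm (DS (prin q) (of_real \<sigma>)) \<le> exp C" if s: "1 < \<sigma>" "\<sigma> \<le> 2" for \<sigma>
 proof -
  have sm: "summable (\<lambda>n. logcoef (prin q) n * of_nat n powr (- of_real \<sigma>))"
   by (rule tame_summable[OF tame_logcoef[OF dq]]) (use s in simp)
  have "(\<lambda>N. Re (\<Sum>n=1..N. logcoef (prin q) n * of_nat n powr (- of_real \<sigma>))) \<longlonglongrightarrow> Re (DS (logcoef (prin q)) (of_real \<sigma>))"
   by (intro tendsto_Re DS_partial_tendsto[OF sm])
  moreover have "Re (\<Sum>n=1..N. logcoef (prin q) n * of_nat n powr (- of_real \<sigma>)) \<le> C" for N
  proof -
   have "Re (logcoef (prin q) n * of_nat n powr (- of_real \<sigma>)) = Re (prin q n) * lw n * real n powr (- \<sigma>)" for n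
    unfolding nat_powr_of_real logcoef_def prin_def by (auto simp del: of_real_divide)
   thus ?thesis using part[OF s, of N] by simp
  qed
  ultimately have "Re (DS (logcoef (prin q)) (of_real \<sigma>)) \<le> C" by (intro LIMSEQ_le_const2) auto
  thus ?thesis using DS_eq_exp[OF dq, of "of_real \<sigma>"] s by simp
 qed
 \<comment> \<open>A bounded L(s, \<open>prin q\<close>) to the right of 1 contradicts its positive
   residue \<open>totient q / q\<close>.\<close>
 have "((\<lambda>\<sigma>. norm (of_real (\<sigma> - 1) * DS (prin q) (of_real \<sigma>))) \<longlongrightarrow> norm (complex_of_real (real (totient q) / real q))) (at_right (1::real))"
  by (intro tendsto_norm prin_residue[OF q])
 moreover have "((\<lambda>\<sigma>. (\<sigma> - 1) * exp C) \<longlongrightarrow> (1 - 1) * exp C) (at_right (1::real))" by (intro tendsto_intros)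
 moreover have "\<forall>\<^sub>F \<sigma> in at_right (1::real). norm (of_real (\<sigma> - 1) * DS (prin q) (of_real \<sigma>)) \<le> (\<sigma> - 1) * exp C"
 proof -
  have "\<forall>\<^sub>F \<sigma> in at_right (1::real). \<sigma> \<in> {1<..<2}" by (rule eventually_at_right_real) simp
  thus ?thesis
  proof eventually_elim
   case (elim \<sigma>)
   thus ?case using mult_left_mono[OF nb[of \<sigma>], of "\<sigma> - 1"] by (simp add: norm_mult del: of_real_diff)
  qed
 qed
 ultimately have "norm (complex_of_real (real (totient q) / real q)) \<le> (1 - 1) * exp C"
  by (intro tendsto_le[of "at_right (1::real)"]) auto
 thus False using q by simp
qed

text \<open>Two such characters agree at all \<open>n\<close> prime to \<open>q1 * q2\<close>, and
  \<xi>1 + \<open>prin (q1 * q2)\<close> is at most \<xi>2 + 1 at every \<open>n\<close>. Comparing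
  logarithms to the right of 1 and multiplying by \<open>\<sigma> - 1\<close> leaves the two
  residues in the limit. It settles the case of \<open>siegel_aux\<close> in which the product
  character is principal.\<close>

lemma rchar_ratio:
 assumes c1: "rchar q1 \<xi>1" and c2: "rchar q2 \<xi>2" and eq: "\<And>n. \<xi>1 n * \<xi>2 n = prin (q1 * q2) n"
 shows "Re (DS \<xi>2 1) \<ge> Re (DS \<xi>1 1) * (real (totient (q1 * q2)) / real (q1 * q2))"
proof -
 define q where "q = q1 * q2"
 have q: "q > 0" using rchar_pos[OF c1] rchar_pos[OF c2] by (simp add: q_def)
 note d1 = rchar_dchar[OF c1] and d2 = rchar_dchar[OF c2] and dq = dchar_prin[OF q]
 have ineq: "norm (DS \<xi>1 (of_real \<sigma>)) * norm (DS (prin q) (of_real \<sigma>)) \<le> norm (DS \<xi>2 (of_real \<sigma>)) * norm (DS (prin 1) (of_real \<sigma>))"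
  if s: "\<sigma> > 1" for \<sigma>
 proof -
  have sm: "(\<lambda>n. Re (logcoef \<psi> n * of_nat n powr (- of_real \<sigma>))) sums Re (DS (logcoef \<psi>) (of_real \<sigma>))" if "dchar r \<psi>" for r \<psi>
   unfolding DS_def by (intro sums_Re summable_sums tame_summable[OF tame_logcoef[OF that]]) (use s in simp)
  have tm: "Re (logcoef \<psi> n * of_nat n powr (- of_real \<sigma>)) = Re (\<psi> n) * (lw n * real n powr (- \<sigma>))" for \<psi> n
   unfolding nat_powr_of_real logcoef_def by (simp del: of_real_divide)
  have "Re (DS (logcoef \<xi>1) (of_real \<sigma>)) + Re (DS (logcoef (prin q)) (of_real \<sigma>)) \<le>
    Re (DS (logcoef \<xi>2) (of_real \<sigma>)) + Re (DS (logcoef (prin 1)) (of_real \<sigma>))"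
  proof (rule sums_le[OF _ sums_add[OF sm[OF d1] sm[OF dq]] sums_add[OF sm[OF d2] sm[OF dchar_prin1]]])
   fix n
   have "Re (\<xi>1 n) + Re (prin q n) \<le> Re (\<xi>2 n) + Re (prin 1 n)"
   proof (cases "coprime n q")
    case True
    hence cp: "coprime n q1" "coprime n q2" by (auto simp: q_def)
    have "Re (\<xi>1 n) * Re (\<xi>2 n) = 1" using eq[of n] True rchar_real[OF c1, of n] rchar_real[OF c2, of n]
     by (metis Re_complex_of_real of_real_mult one_complex.sel(1) prin_def q_def)
    hence "Re (\<xi>1 n) = Re (\<xi>2 n)"
     using rchar_abs[OF c1, of n] rchar_abs[OF c2, of n] cp by (auto simp: abs_if split: if_splits)
    thus ?thesis by (simp add: prin_def)
   next
    case False
    hence "\<not> coprime n q1 \<or> \<not> coprime n q2" by (auto simp: q_def)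
    thus ?thesis using rchar_abs[OF c1, of n] rchar_abs[OF c2, of n] False by (auto simp: prin_def abs_if split: if_splits)
   qed
   hence "(Re (\<xi>1 n) + Re (prin q n)) * (lw n * real n powr (- \<sigma>)) \<le> (Re (\<xi>2 n) + Re (prin 1 n)) * (lw n * real n powr (- \<sigma>))"
    by (intro mult_right_mono mult_nonneg_nonneg lw_nonneg) auto
   thus "Re (logcoef \<xi>1 n * of_nat n powr (- of_real \<sigma>)) + Re (logcoef (prin q) n * of_nat n powr (- of_real \<sigma>)) \<le>
    Re (logcoef \<xi>2 n * of_nat n powr (- of_real \<sigma>)) + Re (logcoef (prin 1) n * of_nat n powr (- of_real \<sigma>))"
    unfolding tm by (simp only: distrib_right)
  qed
  thus ?thesis
   using DS_eq_exp[OF d1, of "of_real \<sigma>"] DS_eq_exp[OF d2, of "of_real \<sigma>"] DS_eq_exp[OF dq, of "of_real \<sigma>"]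
    DS_eq_exp[OF dchar_prin1, of "of_real \<sigma>"] s by (simp add: exp_add[symmetric])
 qed
 have "norm (DS \<xi>1 1) * norm (complex_of_real (real (totient q) / real q)) \<le> norm (DS \<xi>2 1) * norm (complex_of_real (real (totient 1) / real 1))"
 proof (rule tendsto_le[of "at_right (1::real)"])
  show "((\<lambda>\<sigma>. norm (DS \<xi>2 (of_real \<sigma>)) * norm (of_real (\<sigma> - 1) * DS (prin 1) (of_real \<sigma>))) \<longlongrightarrow>
   norm (DS \<xi>2 1) * norm (complex_of_real (real (totient 1) / real 1))) (at_right (1::real))"
   by (intro tendsto_mult tendsto_norm prin_residue tendsto_at_right_1 bps_DS_holomorphic[OF rchar_bps[OF c2]]) simp
  show "((\<lambda>\<sigma>. norm (DS \<xi>1 (of_real \<sigma>)) * norm (of_real (\<sigma> - 1) * DS (prin q) (of_real \<sigma>))) \<longlongrightarrow>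
   norm (DS \<xi>1 1) * norm (complex_of_real (real (totient q) / real q))) (at_right (1::real))"
   by (intro tendsto_mult tendsto_norm prin_residue[OF q] tendsto_at_right_1 bps_DS_holomorphic[OF rchar_bps[OF c1]])
  show "\<forall>\<^sub>F \<sigma> in at_right (1::real). norm (DS \<xi>1 (of_real \<sigma>)) * norm (of_real (\<sigma> - 1) * DS (prin q) (of_real \<sigma>))
   \<le> norm (DS \<xi>2 (of_real \<sigma>)) * norm (of_real (\<sigma> - 1) * DS (prin 1) (of_real \<sigma>))"
   using eventually_at_right_less[of "1::real"]
  proof eventually_elim
   case (elim \<sigma>)
   show ?case using mult_left_mono[OF ineq[OF elim], of "\<sigma> - 1"] elim by (simp add: norm_mult mult_ac del: of_real_diff)
  qed
 qed simp
 moreover have nr: "norm (DS \<psi> 1) = Re (DS \<psi> 1)" if "rchar r \<psi>" for r \<psi>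
 proof -
  have "DS \<psi> (of_real 1) \<in> \<real>" by (rule rchar_DS_real[OF that]) simp
  hence "DS \<psi> 1 = of_real (Re (DS \<psi> 1))" by simp
  thus ?thesis using rchar_L1_nonneg[OF that] by (metis abs_of_nonneg norm_of_real)
 qed
 moreover have "norm (complex_of_real (real (totient q) / real q)) = real (totient q) / real q" by (simp only: norm_of_real) simp
 moreover have "norm (complex_of_real (real (totient 1) / real 1)) = 1" by simp
 ultimately have "Re (DS \<xi>1 1) * (real (totient q) / real q) \<le> Re (DS \<xi>2 1) * 1" by (simp only: nr[OF c1] nr[OF c2])
 thus ?thesis by (simp only: q_def mult_1_right)
qed

text \<open>In increasing order the members are at least 2, 3, 4, ..., for which the product
  telescopes; hence the induction inserts the largest member.\<close>

lemma prod_one_minus_inverse_ge: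
 fixes S :: "nat set"
 assumes "finite S" "\<forall>p\<in>S. p \<ge> 2"
 shows "(\<Prod>p\<in>S. 1 - 1 / real p) \<ge> 1 / (real (card S) + 1)" using assms
proof (induction S rule: finite_linorder_max_induct)
 case (insert b A)
 have "A \<subseteq> {2..<b}" using insert by auto
 hence "card A \<le> b - 2" using card_mono[of "{2..<b}" A] by simp
 moreover have "b \<ge> 2" using insert by auto
 ultimately have kb: "real (card A) + 2 \<le> real b" by linarith
 have nb: "b \<notin> A" using insert by auto
 have "1 / (real (card A) + 2) = (1 - 1 / (real (card A) + 2)) * (1 / (real (card A) + 1))" by (simp add: field_simps)
 also have "... \<le> (1 - 1 / real b) * (\<Prod>p\<in>A. 1 - 1 / real p)"
  using insert kb by (intro mult_mono diff_left_mono frac_le) auto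
 finally show ?case using insert nb by (simp add: add_ac)
qed simp

text \<open>At most log2(q) primes divide \<open>q\<close>, so the preceding product is at least the
  reciprocal of a logarithm, and any power of \<open>q\<close> beats that.\<close>

lemma totient_lower:
 assumes e: "e > 0"
 shows "\<exists>c>0. \<forall>q>0. real (totient q) / real q \<ge> c * real q powr (- e)"
proof (intro exI conjI allI impI)
 \<comment> \<open>With this constant, \<open>k + 1\<close> times it is at most
   \<open>1 + k * (e * ln 2)\<close>, hence at most \<open>(2 powr k) powr e\<close>.\<close>
 show "min 1 (e * ln 2) > 0" using e by simp
 fix q :: nat assume q: "q > 0"
 define k where "k = card (prime_factors q)"
 have "(\<Prod>p\<in>prime_factors q. 2) \<le> (\<Prod>p\<in>prime_factors q. p ^ multiplicity p q)"
 proof (rule prod_mono, intro conjI)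
  fix p assume p: "p \<in> prime_factors q"
  have p2: "2 \<le> p" using p prime_ge_2_nat by blast
  have "1 \<le> multiplicity p q" using p by (simp add: prime_factors_multiplicity Suc_le_eq One_nat_def)
  hence "p ^ 1 \<le> p ^ multiplicity p q" by (rule power_increasing) (use p2 in simp)
  thus "2 \<le> p ^ multiplicity p q" using p2 by simp
 qed auto
 hence "2 ^ k \<le> q" using prime_factorization_nat[OF q] by (simp add: k_def)
 hence "real (2 ^ k) \<le> real q" by (simp only: of_nat_le_iff)
 hence kq: "2 powr real k \<le> real q" by (simp add: powr_realpow)
 have "min 1 (e * ln 2) * (real k + 1) \<le> 1 + real k * (e * ln 2)"
 proof -
  define u where "u = min 1 (e * ln 2)"
  have "real k * u \<le> real k * (e * ln 2)" unfolding u_def by (intro mult_left_mono) auto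
  moreover have "u \<le> 1" by (simp add: u_def)
  moreover have "u * (real k + 1) = real k * u + u" by (simp add: algebra_simps)
  ultimately show ?thesis unfolding u_def[symmetric] by linarith
 qed
 also have "... \<le> exp (real k * (e * ln 2))" using exp_ge_add_one_self by blast
 also have "... = (2 powr real k) powr e" by (simp add: powr_powr powr_def mult_ac)
 also have "... \<le> real q powr e" using kq e by (intro powr_mono2) auto
 finally have "min 1 (e * ln 2) * (real k + 1) \<le> real q powr e" .
 hence "min 1 (e * ln 2) * real q powr (- e) \<le> 1 / (real k + 1)" using q by (simp add: powr_minus field_simps)
 also have "... \<le> (\<Prod>p\<in>prime_factors q. 1 - 1 / real p)"
  unfolding k_def by (rule prod_one_minus_inverse_ge) (auto dest: in_prime_factors_imp_prime prime_ge_2_nat)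
 also have "... = real (totient q) / real q" using totient_formula2[of q] q by simp
 finally show "min 1 (e * ln 2) * real q powr (- e) \<le> real (totient q) / real q" .
qed

lemma rchar_L1_upper:
 assumes c: "rchar q \<xi>" and e: "0 < e" "e \<le> 1/2"
 shows "Re (DS \<xi> 1) \<le> (zbound e + 4) * (real q * 2) powr (2 * e)"
proof -
 have "norm (DS \<xi> 1) \<le> (zbound e + 4) * (real q * (\<bar>Im 1\<bar> + 2)) powr (2 * e)"
  by (rule bps_DS_bound[OF rchar_bps[OF c]]) (use e rchar_pos[OF c] dchar_norm_le[OF rchar_dchar[OF c]] in auto)
 thus ?thesis using complex_Re_le_cmod[of "DS \<xi> 1"] by simp
qed

lemma ball_2_bounds:
 assumes "s \<in> cball 2 (3/2)"
 shows "Re s \<ge> 1/2" "norm s \<le> 7/2" "norm (s - 1) \<le> 5/2"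
proof -
 have d: "norm (2 - s) \<le> 3/2" using assms by (simp add: dist_norm)
 have "2 - Re s \<le> norm (2 - s)" using complex_Re_le_cmod[of "2 - s"] by simp
 thus "Re s \<ge> 1/2" using d by simp
 have "norm s \<le> norm (2::complex) + norm (s - 2)" by (rule norm_triangle_sub)
 thus "norm s \<le> 7/2" using d by (simp add: norm_minus_commute)
 have "s - 1 = 1 - (2 - s)" by simp
 hence "norm (s - 1) \<le> norm (1::complex) + norm (2 - s)" by (metis norm_triangle_ineq4)
 thus "norm (s - 1) \<le> 5/2" using d by simp
qed

text \<open>For the case in which real characters have no zeros near 1. The constant
  \<open>304 = 19 * 16\<close> combines \<open>zt_crude\<close> with
  \<open>bps_DS_crude\<close>.\<close>

lemma rchar_lower_pair:
 assumes c: "rchar q \<xi>" and b: "3/4 < \<beta>" "\<beta> < 1" and nn: "Re (zt (of_real \<beta>) * DS \<xi> (of_real \<beta>)) \<ge> 0"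
 shows "Re (DS \<xi> 1) \<ge> (1 - \<beta>) / 2 * exp (- ((1 - \<beta>) * (6 * ln (48 * (304 * real q)) + 1)))"
proof -
 interpret estermann "\<lambda>s. zt s * DS \<xi> s" "\<lambda>n. lw n * (1 + Re (\<xi> n))" by (rule estermann_pair[OF c])
 have "(1 - \<beta>) / 2 * exp (- ((1 - \<beta>) * (6 * ln (48 * (304 * real q)) + 1))) \<le> Re (zt 1 * DS \<xi> 1)"
 proof (rule lower_bound[OF _ _ b nn])
  fix s :: complex assume s: "s \<in> cball 2 (3/2)"
  note sb = ball_2_bounds[OF s]
  have "norm (zt s) * norm (DS \<xi> s) \<le> 19 * (16 * real q)"
   by (intro mult_mono zt_crude sb bps_DS_crude[OF rchar_bps[OF c]]) auto
  thus "norm (zt s * DS \<xi> s) \<le> 304 * real q" by (simp add: norm_mult)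
 qed (use rchar_pos[OF c] in auto)
 thus ?thesis by (simp add: zt_1)
qed

lemma rchar_L1_eq: assumes "rchar q \<xi>" shows "DS \<xi> 1 = of_real (Re (DS \<xi> 1))"
proof -
 have "DS \<xi> (of_real 1) \<in> \<real>" by (rule rchar_DS_real[OF assms]) simp
 thus ?thesis by simp
qed

text \<open>For the case in which \<xi>1 has a zero \<beta> near 1: the fourfold product vanishes at
  \<beta> whatever \<xi>2 is. Here \<open>77824 = 19 * 16 ^ 3\<close>, and \<open>q1 * q2\<close> is
  squared because the product character has that modulus too.\<close>

lemma rchar_lower_quad:
 assumes c1: "rchar q1 \<xi>1" and c2: "rchar q2 \<xi>2" and c12: "rchar (q1 * q2) (\<lambda>n. \<xi>1 n * \<xi>2 n)"
  and b: "3/4 < \<beta>" "\<beta> < 1" and z: "DS \<xi>1 (of_real \<beta>) = 0"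
 shows "Re (DS \<xi>1 1) * Re (DS \<xi>2 1) * Re (DS (\<lambda>n. \<xi>1 n * \<xi>2 n) 1) \<ge>
  (1 - \<beta>) / 2 * exp (- ((1 - \<beta>) * (6 * ln (48 * (77824 * (real q1 * real q2) ^ 2)) + 1)))"
proof -
 let ?P = "\<lambda>s. zt s * DS \<xi>1 s * DS \<xi>2 s * DS (\<lambda>n. \<xi>1 n * \<xi>2 n) s"
 interpret estermann ?P "\<lambda>n. lw n * ((1 + Re (\<xi>1 n)) * (1 + Re (\<xi>2 n)))" by (rule estermann_quad[OF c1 c2 c12])
 have q: "real q1 \<ge> 1" "real q2 \<ge> 1" using rchar_pos[OF c1] rchar_pos[OF c2] by auto
 have "(1 - \<beta>) / 2 * exp (- ((1 - \<beta>) * (6 * ln (48 * (77824 * (real q1 * real q2) ^ 2)) + 1))) \<le> Re (?P 1)"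
 proof (rule lower_bound[OF _ _ b])
  show "0 \<le> Re (?P (of_real \<beta>))" by (simp add: z)
  have "real q1 * real q2 \<ge> 1 * 1" using q by (intro mult_mono) auto
  hence "(real q1 * real q2) ^ 2 \<ge> 1" by simp
  thus "77824 * (real q1 * real q2) ^ 2 \<ge> 1" by simp
  fix s :: complex assume s: "s \<in> cball 2 (3/2)"
  note sb = ball_2_bounds[OF s]
  have "norm (zt s) * norm (DS \<xi>1 s) * norm (DS \<xi>2 s) * norm (DS (\<lambda>n. \<xi>1 n * \<xi>2 n) s) \<le>
   19 * (16 * real q1) * (16 * real q2) * (16 * real (q1 * q2))"
   by (intro mult_mono zt_crude sb bps_DS_crude[OF rchar_bps[OF c1]] bps_DS_crude[OF rchar_bps[OF c2]]
    bps_DS_crude[OF rchar_bps[OF c12]]) auto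
  thus "norm (?P s) \<le> 77824 * (real q1 * real q2) ^ 2" by (simp add: norm_mult power2_eq_square algebra_simps)
 qed
 also have "?P 1 = of_real (Re (DS \<xi>1 1) * Re (DS \<xi>2 1) * Re (DS (\<lambda>n. \<xi>1 n * \<xi>2 n) 1))"
  using rchar_L1_eq[OF c1] rchar_L1_eq[OF c2] rchar_L1_eq[OF c12] by (simp add: zt_1)
 finally show ?thesis by simp
qed

lemma zt_pos_near_1: "\<exists>d>0. d \<le> 1/8 \<and> (\<forall>\<beta>. 1 - d \<le> \<beta> \<and> \<beta> \<le> 1 --> Re (zt (of_real \<beta>)) > 0)"
proof -
 have "isCont (\<lambda>\<sigma>. Re (zt (of_real \<sigma>))) 1"
  using isCont_of_holomorphic_right[OF zt_holomorphic, of 1] by (simp add: continuous_Re)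
 then obtain d where d: "d > 0" "\<And>x. dist x 1 < d ==> dist (Re (zt (of_real x))) (Re (zt (of_real 1))) < 1"
  unfolding continuous_at_eps_delta by (metis zero_less_one)
 show ?thesis
 proof (intro exI conjI allI impI)
  show "min (d/2) (1/8) > 0" using d by simp
  fix \<beta> :: real assume b: "1 - min (d/2) (1/8) \<le> \<beta> \<and> \<beta> \<le> 1"
  hence "dist \<beta> 1 < d" using d(1) by (auto simp: dist_real_def min_def split: if_splits)
  from d(2)[OF this] show "Re (zt (of_real \<beta>)) > 0" by (simp add: zt_1 dist_real_def abs_less_iff)
 qed simp
qed

text \<open>Siegel's dichotomy, the source of ineffectivity. Either some real character has a zero
  close to 1, and it bounds L(1) from below for all the others; or none has, and the sign condition
  of \<open>rchar_lower_pair\<close> holds at a point \<beta> fixed beforehand.\<close>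

lemma siegel_aux:
 assumes e: "0 < e" "e \<le> 1"
 shows "\<exists>c>0. \<forall>q \<xi>. rchar q \<xi> --> Re (DS \<xi> 1) \<ge> c * real q powr (- e)"
proof -
 obtain d0 where d0: "d0 > 0" "d0 \<le> 1/8" "\<And>\<beta>. 1 - d0 \<le> \<beta> ==> \<beta> \<le> 1 ==> Re (zt (of_real \<beta>)) > 0"
  using zt_pos_near_1 by blast
 \<comment> \<open>The lower bound loses \<open>q2\<close> to the power \<open>12 * d\<close>, at
   most \<open>e / 2\<close>; the other half of \<open>e\<close> pays for the upper bound of L(1)
   for the product character.\<close>
 define d where "d = min d0 (e / 24)"
 have d: "d > 0" "d \<le> 1/8" "d \<le> d0" "24 * d \<le> e" using d0 e by (auto simp: d_def)
 show ?thesis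
 proof (cases "\<exists>q1 \<xi>1 \<beta>. rchar q1 \<xi>1 \<and> 1 - d < \<beta> \<and> \<beta> < 1 \<and> DS \<xi>1 (of_real \<beta>) = 0")
  case True
  then obtain q1 \<xi>1 \<beta> where c1: "rchar q1 \<xi>1" and b: "1 - d < \<beta>" "\<beta> < 1" and z: "DS \<xi>1 (of_real \<beta>) = 0" by blast
  have q1: "real q1 \<ge> 1" using rchar_pos[OF c1] by simp
  obtain ct where ct: "ct > 0" "\<And>q. q > 0 ==> real (totient q) / real q \<ge> ct * real q powr (- e)"
   using totient_lower[OF e(1)] by blast
  define L1 where "L1 = Re (DS \<xi>1 1)"
  have L1: "L1 > 0" unfolding L1_def by (rule rchar_L1_pos[OF c1])
  define A where "A = zbound (e/4) + 4"
  have A: "A > 0" using zbound_nonneg[of "e/4"] e by (simp add: A_def)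
  \<comment> \<open>\<open>cA\<close> serves the case of a principal product character,
    \<open>cB\<close> the other one. Both depend on the exceptional character, which is
    fixed.\<close>
  define cA where "cA = L1 * ct * real q1 powr (- e)"
  define m where "m = (1 - \<beta>) / 2 * exp (- (d * (6 * ln (48 * (77824 * real q1 ^ 2)) + 1)))"
  define cB where "cB = m / (L1 * (A * (real q1 * 2) powr (e/2)))"
  have cA: "cA > 0" using L1 ct q1 by (simp add: cA_def)
  have m: "m > 0" using b by (simp add: m_def)
  have cB: "cB > 0" using m L1 A q1 by (simp add: cB_def)
  show ?thesis
  proof (intro exI conjI allI impI)
   show "min cA cB > 0" using cA cB by simp
   fix q2 \<xi>2 assume c2: "rchar q2 \<xi>2"
   have q2: "real q2 \<ge> 1" using rchar_pos[OF c2] by simp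
   show "min cA cB * real q2 powr (- e) \<le> Re (DS \<xi>2 1)"
   proof (cases "(\<lambda>n. \<xi>1 n * \<xi>2 n) = prin (q1 * q2)")
    case True
    have "min cA cB * real q2 powr (- e) \<le> cA * real q2 powr (- e)" by (intro mult_right_mono) auto
    also have "... = L1 * (ct * real (q1 * q2) powr (- e))" by (simp add: cA_def powr_mult mult_ac)
    also have "... \<le> L1 * (real (totient (q1 * q2)) / real (q1 * q2))"
     using L1 rchar_pos[OF c1] rchar_pos[OF c2] by (intro mult_left_mono ct) auto
    also have "... \<le> Re (DS \<xi>2 1)" unfolding L1_def by (rule rchar_ratio[OF c1 c2]) (rule fun_cong[OF True])
    finally show ?thesis .
   next
    case False
    have c12: "rchar (q1 * q2) (\<lambda>n. \<xi>1 n * \<xi>2 n)"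
     unfolding rchar_def using False dchar_times'[OF rchar_dchar[OF c1] rchar_dchar[OF c2]] c1 c2 by (auto simp: rchar_def)
    define L2 where "L2 = Re (DS \<xi>2 1)"
    define L12 where "L12 = Re (DS (\<lambda>n. \<xi>1 n * \<xi>2 n) 1)"
    have L2: "L2 > 0" unfolding L2_def by (rule rchar_L1_pos[OF c2])
    have L12: "L12 \<le> A * (real (q1 * q2) * 2) powr (2 * (e/4))"
     unfolding L12_def A_def by (rule rchar_L1_upper[OF c12]) (use e in auto)
    have l48: "6 * ln (48 * (77824 * (real q1 * real q2) ^ 2)) = 6 * ln (48 * (77824 * real q1 ^ 2)) + 12 * ln (real q2)"
     using q1 q2 by (simp add: ln_mult ln_realpow power_mult_distrib)
    have l0: "ln (48 * (77824 * real q1 ^ 2)) \<ge> 0" "ln (real q2) \<ge> 0"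
    proof -
     have "real q1 ^ 2 \<ge> 1" using q1 by simp
     thus "ln (48 * (77824 * real q1 ^ 2)) \<ge> 0" by (intro ln_ge_zero) auto
    qed (use q2 in simp)
    have "(1 - \<beta>) * (6 * ln (48 * (77824 * (real q1 * real q2) ^ 2)) + 1) \<le> d * (6 * ln (48 * (77824 * (real q1 * real q2) ^ 2)) + 1)"
     unfolding l48 using b l0 by (intro mult_right_mono) auto
    also have "... = d * (6 * ln (48 * (77824 * real q1 ^ 2)) + 1) + 12 * d * ln (real q2)"
     unfolding l48 by (simp add: algebra_simps)
    also have "12 * d * ln (real q2) \<le> e/2 * ln (real q2)" using d l0 by (intro mult_right_mono) auto
    finally have ex: "(1 - \<beta>) * (6 * ln (48 * (77824 * (real q1 * real q2) ^ 2)) + 1) \<le> d * (6 * ln (48 * (77824 * real q1 ^ 2)) + 1) + e/2 * ln (real q2)" by simp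
    have "m * real q2 powr (- e/2) = (1 - \<beta>) / 2 * exp (- (d * (6 * ln (48 * (77824 * real q1 ^ 2)) + 1) + e/2 * ln (real q2)))"
     using q2 by (simp add: m_def powr_def exp_add[symmetric] exp_diff[symmetric] mult.assoc)
    also have "... \<le> (1 - \<beta>) / 2 * exp (- ((1 - \<beta>) * (6 * ln (48 * (77824 * (real q1 * real q2) ^ 2)) + 1)))"
     using ex b by (intro mult_left_mono) auto
    also have "... \<le> L1 * L2 * L12"
     unfolding L1_def L2_def L12_def by (rule rchar_lower_quad[OF c1 c2 c12 _ b(2) z]) (use b d in simp)
    also have "... \<le> L1 * L2 * (A * (real (q1 * q2) * 2) powr (2 * (e/4)))" using L12 L1 L2 by (intro mult_left_mono) auto
    also have "(real (q1 * q2) * 2) powr (2 * (e/4)) = (real q1 * 2) powr (e/2) * real q2 powr (e/2)"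
     by (simp add: powr_mult mult_ac)
    finally have "m * real q2 powr (- e/2) \<le> L2 * (L1 * (A * (real q1 * 2) powr (e/2))) * real q2 powr (e/2)"
     by (simp add: mult_ac)
    hence "m * real q2 powr (- e/2) * real q2 powr (- e/2) \<le> L2 * (L1 * (A * (real q1 * 2) powr (e/2))) * real q2 powr (e/2) * real q2 powr (- e/2)"
     by (rule mult_right_mono) simp
    hence "m * real q2 powr (- e) \<le> L2 * (L1 * (A * (real q1 * 2) powr (e/2)))"
     using q2 by (simp add: mult.assoc powr_add[symmetric])
    hence "cB * real q2 powr (- e) \<le> L2" using L1 A q1 by (simp add: cB_def field_simps)
    moreover have "min cA cB * real q2 powr (- e) \<le> cB * real q2 powr (- e)" by (intro mult_right_mono) auto
    ultimately show ?thesis by (simp add: L2_def)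
   qed
  qed
 next
  case False
  define \<beta> where "\<beta> = 1 - d / 2"
  have b: "3/4 < \<beta>" "\<beta> < 1" "1 - d < \<beta>" "1 - d0 \<le> \<beta>" using d by (auto simp: \<beta>_def)
  show ?thesis
  proof (intro exI conjI allI impI)
   define c where "c = d / 4 * exp (- (d / 2 * (6 * ln (48 * 304) + 1)))"
   show "c > 0" using d by (simp add: c_def)
   fix q \<xi> assume ch: "rchar q \<xi>"
   have q: "real q \<ge> 1" using rchar_pos[OF ch] by simp
   \<comment> \<open>A sign change between \<beta> and 1 would produce a zero in the excluded
     interval.\<close>
   have pos: "Re (DS \<xi> (of_real \<beta>)) > 0"
   proof (rule ccontr)
    assume "\<not> Re (DS \<xi> (of_real \<beta>)) > 0"
    hence "Re (DS \<xi> (of_real \<beta>)) \<le> 0" by simp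
    moreover have "0 \<le> Re (DS \<xi> (of_real 1))" using rchar_L1_pos[OF ch] by simp
    moreover have "isCont (\<lambda>x. Re (DS \<xi> (of_real x))) x" if "\<beta> \<le> x \<and> x \<le> 1" for x
     using isCont_of_holomorphic_right[OF bps_DS_holomorphic[OF rchar_bps[OF ch]], of x] that b by (simp add: continuous_Re)
    ultimately obtain x where x: "\<beta> \<le> x" "x \<le> 1" "Re (DS \<xi> (of_real x)) = 0"
     using IVT[of "\<lambda>x. Re (DS \<xi> (of_real x))" \<beta> 0 1] b by auto
    have "x \<noteq> 1" using x(3) rchar_L1_pos[OF ch] by auto
    moreover have "DS \<xi> (of_real x) \<in> \<real>" by (rule rchar_DS_real[OF ch]) (use x b in simp)
    hence "DS \<xi> (of_real x) = 0" using x(3) by (simp add: complex_eq_iff complex_is_Real_iff)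
    ultimately show False using False ch x b by (metis less_le_trans order_le_imp_less_or_eq)
   qed
   have "DS \<xi> (of_real \<beta>) \<in> \<real>" by (rule rchar_DS_real[OF ch]) (use b in simp)
   hence "Re (zt (of_real \<beta>) * DS \<xi> (of_real \<beta>)) = Re (zt (of_real \<beta>)) * Re (DS \<xi> (of_real \<beta>))"
    by (simp add: complex_is_Real_iff)
   also have "... \<ge> 0" using pos d0(3)[of \<beta>] b by simp
   finally have nn: "Re (zt (of_real \<beta>) * DS \<xi> (of_real \<beta>)) \<ge> 0" .
   have "ln (48 * (304 * real q)) = ln (48 * 304) + ln (real q)" using q by (simp add: ln_mult)
   hence "d / 2 * (6 * ln (48 * (304 * real q)) + 1) = d / 2 * (6 * ln (48 * 304) + 1) + 3 * d * ln (real q)"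
    by (simp add: algebra_simps)
   also have "... \<le> d / 2 * (6 * ln (48 * 304) + 1) + e * ln (real q)"
    using d q by (intro add_left_mono mult_right_mono) auto
   finally have "exp (- (d / 2 * (6 * ln (48 * 304) + 1) + e * ln (real q))) \<le> exp (- (d / 2 * (6 * ln (48 * (304 * real q)) + 1)))" by simp
   hence "d / 4 * exp (- (d / 2 * (6 * ln (48 * 304) + 1) + e * ln (real q))) \<le> d / 4 * exp (- (d / 2 * (6 * ln (48 * (304 * real q)) + 1)))"
    using d by (intro mult_left_mono) auto
   also have "... \<le> Re (DS \<xi> 1)" using rchar_lower_pair[OF ch b(1,2) nn] by (simp add: \<beta>_def)
   finally show "c * real q powr (- e) \<le> Re (DS \<xi> 1)"
    using q by (simp add: c_def powr_def exp_add[symmetric] exp_diff[symmetric] mult.assoc)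
  qed
 qed
qed

theorem siegel:
 assumes e: "0 < e"
 shows "\<exists>c>0. \<forall>q \<xi>. rchar q \<xi> --> Re (DS \<xi> 1) \<ge> c * real q powr (- e)"
proof -
 obtain c where c: "c > 0" "\<And>q \<xi>. rchar q \<xi> ==> Re (DS \<xi> 1) \<ge> c * real q powr (- min e 1)"
  using siegel_aux[of "min e 1"] e by auto
 have "c * real q powr (- e) \<le> Re (DS \<xi> 1)" if ch: "rchar q \<xi>" for q \<xi>
 proof -
  have "c * real q powr (- e) \<le> c * real q powr (- min e 1)" using c rchar_pos[OF ch] by (intro mult_left_mono powr_mono) auto
  thus ?thesis using c(2)[OF ch] by simp
 qed
 thus ?thesis using c(1) by blast
qed

section \<open>Logarithmic derivatives in the half-plane of convergence\<close>

lemma cauchy_deriv_bound: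
 assumes f: "f holomorphic_on ball z R" and U: "\<And>w. w \<in> ball z R ==> norm (f w) \<le> U" and R: "R > 0"
 shows "norm ((deriv ^^ k) f z) \<le> fact k * U / (R / 2) ^ k"
proof (rule Cauchy_inequality)
 have sub: "cball z (R / 2) \<subseteq> ball z R" using R by auto
 show "f holomorphic_on ball z (R / 2)" by (rule holomorphic_on_subset[OF f]) (use R in auto)
 show "continuous_on (cball z (R / 2)) f" by (rule holomorphic_on_imp_continuous_on[OF holomorphic_on_subset[OF f sub]])
 fix x assume "norm (z - x) = R / 2"
 thus "norm (f x) \<le> U" using R by (intro U) (simp add: dist_norm)
qed (use R in simp)

lemma cauchy_deriv_bound_1:
 assumes "f holomorphic_on ball z R" "\<And>w. w \<in> ball z R ==> norm (f w) \<le> U" "R > 0"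
 shows "norm (deriv f z) \<le> 2 * U / R" using cauchy_deriv_bound[OF assms, of 1] by (simp add: One_nat_def mult.commute)

text \<open>On the disc of radius \<open>r\<close> the function stays above \<open>l / 2\<close>,
  because its derivative is at most \<open>4 * U / R\<close>. Cauchy's estimate there costs a
  constant times \<open>U / (R * l)\<close> per derivative. The lower bound is assumed at the centre
  alone.\<close>

lemma logderiv_bound:
 assumes f: "f holomorphic_on ball z R" and U: "\<And>w. w \<in> ball z R ==> norm (f w) \<le> U" and R: "R > 0"
  and l: "0 < l" "l \<le> norm (f z)"
 shows "norm ((deriv ^^ k) (\<lambda>w. deriv f w / f w) z) \<le> fact k * (16 * U / (R * l)) ^ Suc k"
proof -
 have lU: "l \<le> U" using l U[of z] R by simp
 have U0: "U > 0" using l lU by simp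
 define r where "r = l * R / (8 * U)"
 have r: "r > 0" "r \<le> R / 8" using l R U0 lU by (auto simp: r_def field_simps)
 have d: "norm (deriv f w) \<le> 4 * U / R" if w: "w \<in> ball z (R / 2)" for w
 proof -
  have sub: "ball w (R / 2) \<subseteq> ball z R"
  proof
   fix x assume "x \<in> ball w (R / 2)"
   thus "x \<in> ball z R" using w dist_triangle[of z x w] by simp
  qed
  have "norm (deriv f w) \<le> 2 * U / (R / 2)"
   by (rule cauchy_deriv_bound_1) (use sub f U R in \<open>auto intro: holomorphic_on_subset\<close>)
  thus ?thesis by simp
 qed
 have low: "norm (f w) \<ge> l / 2" if w: "w \<in> ball z r" for w
 proof -
  have "norm (f w - f z) \<le> (4 * U / R) * norm (w - z)"
  proof (rule field_differentiable_bound[of "ball z (R / 2)"])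
   fix x assume x: "x \<in> ball z (R / 2)"
   show "(f has_field_derivative deriv f x) (at x within ball z (R / 2))"
    by (rule has_field_derivative_at_within, rule holomorphic_derivI[OF f]) (use x R in auto)
   show "norm (deriv f x) \<le> 4 * U / R" by (rule d[OF x])
  qed (use w r R in auto)
  also have "... \<le> (4 * U / R) * r" using w U0 R by (intro mult_left_mono) (auto simp: dist_norm norm_minus_commute)
  also have "... = l / 2" using U0 R by (simp add: r_def)
  finally have "norm (f w - f z) \<le> l / 2" .
  moreover have "norm (f z) \<le> norm (f w) + norm (f w - f z)" by (metis norm_minus_commute norm_triangle_sub)
  ultimately show ?thesis using l by linarith
 qed
 have "norm ((deriv ^^ k) (\<lambda>w. deriv f w / f w) z) \<le> fact k * (8 * U / (R * l)) / (r / 2) ^ k"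
 proof (rule cauchy_deriv_bound)
  show "(\<lambda>w. deriv f w / f w) holomorphic_on ball z r"
  proof (rule holomorphic_on_divide)
   show "deriv f holomorphic_on ball z r" "f holomorphic_on ball z r"
    using holomorphic_deriv[OF f open_ball] f r R by (auto intro: holomorphic_on_subset)
   show "f w \<noteq> 0" if "w \<in> ball z r" for w using low[OF that] l by auto
  qed
  fix w assume w: "w \<in> ball z r"
  have "norm (deriv f w) / norm (f w) \<le> (4 * U / R) / (l / 2)" using w r R l U0 low[OF w] by (intro frac_le d) auto
  thus "norm (deriv f w / f w) \<le> 8 * U / (R * l)" by (simp add: norm_divide)
 qed (rule r)
 also have "... = fact k * (8 * U / (R * l)) * (16 * U / (R * l)) ^ k"
  using U0 R l by (simp add: r_def power_divide field_simps)
 also have "... \<le> fact k * (16 * U / (R * l)) * (16 * U / (R * l)) ^ k"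
  using U0 R l by (intro mult_right_mono mult_left_mono divide_right_mono) auto
 finally show ?thesis by (simp add: mult_ac)
qed

section \<open>Lower bounds to the right of the line of real part 1\<close>

lemma zeta_real_bound:
 assumes "1 < \<sigma>" "\<sigma> \<le> 2" shows "norm (DS (prin 1) (of_real \<sigma>)) \<le> 19 / (\<sigma> - 1)"
proof -
 have "norm (complex_of_real \<sigma> - 1) = \<sigma> - 1" using assms by (metis abs_of_pos diff_gt_0_iff_gt norm_of_real of_real_1 of_real_diff)
 moreover have "norm (zt (of_real \<sigma>)) \<le> 19" using assms calculation by (intro zt_crude) auto
 moreover have "norm (zt (of_real \<sigma>)) = norm (complex_of_real \<sigma> - 1) * norm (DS (prin 1) (of_real \<sigma>))"
  using zt_eq[of "of_real \<sigma>"] assms by (simp add: norm_mult)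
 ultimately have "(\<sigma> - 1) * norm (DS (prin 1) (of_real \<sigma>)) \<le> 19" by metis
 thus ?thesis using assms by (simp add: pos_le_divide_eq mult.commute)
qed

lemma quartic_lower_341:
 fixes h L U a :: real
 assumes 1: "1 \<le> (a / h) ^ 3 * L * U" and h: "h > 0" and U: "U > 0" and a: "a > 0"
 shows "h ^ 3 / (a ^ 3 * U) \<le> L"
proof -
 have h3: "h ^ 3 > 0" and aU: "a ^ 3 * U > 0" using h a U by simp_all
 have "(a / h) ^ 3 * L * U = L * (a ^ 3 * U) / h ^ 3" by (simp add: power_divide)
 hence "1 \<le> L * (a ^ 3 * U) / h ^ 3" using 1 by simp
 hence "h ^ 3 \<le> L * (a ^ 3 * U)" using le_divide_eq_1_pos[OF h3] by blast
 thus ?thesis by (rule mult_imp_div_pos_le[OF aU])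
qed

lemma balance_341:
 fixes h U m :: real
 assumes h: "h = 1 / (16 * m * U ^ 5)" and U: "U > 0" and m: "m > 0"
 shows "(2 * U * h) ^ 4 = h ^ 3 / (m * U)" and "U * h = 1 / (16 * m * U ^ 4)"
proof -
 have U5: "U ^ 5 = U * U ^ 4" using power_Suc[of U 4] by simp
 show 2: "U * h = 1 / (16 * m * U ^ 4)" using U by (simp add: h U5)
 have "(2 * U * h) ^ 4 = 16 * U ^ 4 * h ^ 4" by (simp add: power_mult_distrib)
 also have "h ^ 4 = h * h ^ 3" using power_Suc[of h 3] by simp
 also have "16 * U ^ 4 * (h * h ^ 3) = (16 * U ^ 4 * h) * h ^ 3" by simp
 also have "16 * U ^ 4 * h = 1 / (m * U)" using U m by (simp add: h U5)
 finally show "(2 * U * h) ^ 4 = h ^ 3 / (m * U)" by simp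
qed

text \<open>To the right of \<open>1 + \<eta>\<close> the 3-4-1 inequality gives
  \<open>2 * U * \<eta>\<close>, as zeta is at most \<open>19 / \<eta>\<close> there. Closer to 1, a
  horizontal step to \<open>1 + \<eta>\<close> loses at most \<open>U * \<eta>\<close>. The constant
  is \<open>109744 = 16 * 19 ^ 3\<close>.\<close>

lemma lower_from_341:
 assumes c: "dchar q \<xi>" and s: "1 < \<sigma>" "\<sigma> \<le> 2" and U: "U \<ge> 1"
  and W: "\<And>r. \<sigma> \<le> r ==> r \<le> 2 ==> norm (DS (\<lambda>n. \<xi> n * \<xi> n) (Complex r (2 * t))) \<le> U"
  and D: "\<And>r. \<sigma> \<le> r ==> r \<le> 2 ==> norm (deriv (DS \<xi>) (Complex r t)) \<le> U"
 shows "norm (DS \<xi> (Complex \<sigma> t)) \<ge> 1 / (109744 * U ^ 4)"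
proof -
 define m where "m = (19::real) ^ 3"
 have m1: "m \<ge> 1" by (simp add: m_def)
 define \<eta> where "\<eta> = 1 / (16 * m * U ^ 5)"
 have "U ^ 5 \<ge> 1" using U by simp
 hence "16 * m * U ^ 5 \<ge> 16 * 1 * 1" using m1 by (intro mult_mono) auto
 hence U5: "16 * m * U ^ 5 \<ge> 1" by simp
 have "\<eta> \<le> 1 / 1" unfolding \<eta>_def using U5 by (intro frac_le) auto
 moreover have "\<eta> > 0" unfolding \<eta>_def using U5 by (intro divide_pos_pos) linarith+
 ultimately have eta: "\<eta> > 0" "\<eta> \<le> 1" by simp_all
 have low: "norm (DS \<xi> (Complex r t)) \<ge> 2 * U * \<eta>" if s': "\<sigma> \<le> r" "r \<le> 2" "1 + \<eta> \<le> r" for r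
 proof -
  have gt: "r > 1" using s' s by simp
  define L where "L = norm (DS \<xi> (Complex r t))"
  have "1 \<le> norm (DS (prin 1) (of_real r)) ^ 3 * L ^ 4 * norm (DS (\<lambda>n. \<xi> n * \<xi> n) (Complex r (2 * t)))"
   unfolding L_def by (rule three_four_one[OF c gt])
  also have "... \<le> (19 / (r - 1)) ^ 3 * L ^ 4 * U" using zeta_real_bound[OF gt s'(2)] W[OF s'(1,2)] gt
   by (intro mult_mono power_mono mult_nonneg_nonneg) (auto simp: L_def)
  also have "... \<le> (19 / \<eta>) ^ 3 * L ^ 4 * U"
   using s' gt eta U by (intro mult_right_mono power_mono frac_le mult_nonneg_nonneg) (auto simp: L_def)
  finally have "1 \<le> (19 / \<eta>) ^ 3 * L ^ 4 * U" .
  hence "\<eta> ^ 3 / (19 ^ 3 * U) \<le> L ^ 4" by (rule quartic_lower_341) (use eta U in auto)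
  moreover have "(2 * U * \<eta>) ^ 4 = \<eta> ^ 3 / (m * U)" by (rule balance_341(1)[OF \<eta>_def]) (use U m1 in auto)
  ultimately have "(2 * U * \<eta>) ^ 4 \<le> L ^ 4" by (simp only: m_def)
  thus ?thesis using power_mono_iff[of "2 * U * \<eta>" L 4] U eta by (simp add: L_def)
 qed
 have goal: "norm (DS \<xi> (Complex \<sigma> t)) \<ge> U * \<eta>"
 proof (cases "\<sigma> \<ge> 1 + \<eta>")
  case True
  have "2 * U * \<eta> \<le> norm (DS \<xi> (Complex \<sigma> t))" by (rule low) (use s True in auto)
  moreover have "U * \<eta> \<ge> 0" using U eta by simp
  ultimately show ?thesis by linarith
 next
  case False
  let ?z = "Complex \<sigma> t" and ?w = "Complex (1 + \<eta>) t"
  have seg: "\<sigma> \<le> Re x \<and> Re x \<le> 2 \<and> Im x = t" if x: "x \<in> closed_segment ?z ?w" for x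
  proof -
   obtain u where u: "0 \<le> u" "u \<le> 1" "x = (1 - u) *\<^sub>R ?z + u *\<^sub>R ?w" using x by (auto simp: closed_segment_def)
   have "Re x = (1 - u) * \<sigma> + u * (1 + \<eta>)" "Im x = (1 - u) * t + u * t" by (simp_all add: u)
   moreover have "(1 - u) * \<sigma> + u * (1 + \<eta>) \<ge> (1 - u) * \<sigma> + u * \<sigma>" using u False by (intro add_left_mono mult_left_mono) auto
   moreover have "(1 - u) * \<sigma> + u * (1 + \<eta>) \<le> (1 - u) * 2 + u * 2" using u s eta by (intro add_mono mult_left_mono) auto
   ultimately show ?thesis by (simp add: algebra_simps)
  qed
  have "norm (DS \<xi> ?w - DS \<xi> ?z) \<le> U * norm (?w - ?z)"
  proof (rule field_differentiable_bound[of "closed_segment ?z ?w"])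
   fix x assume x: "x \<in> closed_segment ?z ?w"
   show "(DS \<xi> has_field_derivative deriv (DS \<xi>) x) (at x within closed_segment ?z ?w)"
    by (rule has_field_derivative_at_within, rule holomorphic_derivI[OF DS_holomorphic[OF tame_dchar[OF c]] open_halfspace_Re_gt])
     (use seg[OF x] s in auto)
   have "x = Complex (Re x) t" using seg[OF x] by (simp add: complex_eq_iff)
   thus "norm (deriv (DS \<xi>) x) \<le> U" using D[of "Re x"] seg[OF x] by simp
  qed auto
  also have "?w - ?z = of_real (1 + \<eta> - \<sigma>)" by (simp add: complex_eq_iff)
  also have "norm (complex_of_real (1 + \<eta> - \<sigma>)) = 1 + \<eta> - \<sigma>"
  proof -
   have "\<bar>1 + \<eta> - \<sigma>\<bar> = 1 + \<eta> - \<sigma>" using False by (intro abs_of_nonneg) linarith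
   thus ?thesis by (simp only: norm_of_real)
  qed
  also have "U * (1 + \<eta> - \<sigma>) \<le> U * \<eta>" using s U by (intro mult_left_mono) auto
  finally have "norm (DS \<xi> ?w - DS \<xi> ?z) \<le> U * \<eta>" .
  moreover have "2 * U * \<eta> \<le> norm (DS \<xi> ?w)" by (rule low) (use s eta False in auto)
  moreover have "norm (DS \<xi> ?w) \<le> norm (DS \<xi> ?z) + norm (DS \<xi> ?w - DS \<xi> ?z)" by (rule norm_triangle_sub)
  ultimately show ?thesis by linarith
 qed
 have "U * \<eta> = 1 / (16 * m * U ^ 4)" by (rule balance_341(2)[OF \<eta>_def]) (use U m1 in auto)
 moreover have "16 * m = 109744" by (simp add: m_def)
 ultimately show ?thesis using goal by (simp only:)
qed

lemma two_powr_le: fixes e V :: real shows "0 < e ==> e \<le> 1/2 ==> V \<ge> 0 ==> (2 * V) powr (2 * e) \<le> 2 * V powr (2 * e)"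
proof -
 assume e: "0 < e" "e \<le> 1/2" "V \<ge> 0"
 have "(2::real) powr (2 * e) \<le> 2 powr 1" using e by (intro powr_mono) auto
 thus ?thesis using e by (simp add: powr_mult mult_right_mono)
qed

lemma ball_Re_Im:
 assumes "w \<in> ball s e"
 shows "Re w \<ge> Re s - e" "\<bar>Im w\<bar> \<le> \<bar>Im s\<bar> + e" "\<bar>Im w\<bar> \<ge> \<bar>Im s\<bar> - e"
proof -
 have d: "norm (s - w) < e" using assms by (simp add: dist_norm)
 show "Re w \<ge> Re s - e" using complex_Re_le_cmod[of "s - w"] d by simp
 have "\<bar>Im (s - w)\<bar> \<le> norm (s - w)" by (rule abs_Im_le_cmod)
 thus "\<bar>Im w\<bar> \<le> \<bar>Im s\<bar> + e" "\<bar>Im w\<bar> \<ge> \<bar>Im s\<bar> - e" using d by auto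
qed

lemma bps_ball_bound:
 assumes b: "bps B b" and b1: "\<And>n. norm (b n) \<le> 1" and B: "B \<ge> 1"
  and e: "0 < e" "e \<le> 1/2" and s: "Re s \<ge> 1" and w: "w \<in> ball s e"
 shows "norm (DS b w) \<le> 2 * (zbound e + 4) * (B * (\<bar>Im s\<bar> + 2)) powr (2 * e)"
proof -
 have "norm (DS b w) \<le> (zbound e + 4) * (B * (\<bar>Im w\<bar> + 2)) powr (2 * e)"
  by (rule bps_DS_bound[OF b b1 B e]) (use ball_Re_Im[OF w] s in simp)
 also have "(B * (\<bar>Im w\<bar> + 2)) powr (2 * e) \<le> (2 * (B * (\<bar>Im s\<bar> + 2))) powr (2 * e)"
 proof (rule powr_mono2)
  have "B * (\<bar>Im w\<bar> + 2) \<le> B * (2 * (\<bar>Im s\<bar> + 2))"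
   using ball_Re_Im[OF w] B e by (intro mult_left_mono) auto
  thus "B * (\<bar>Im w\<bar> + 2) \<le> 2 * (B * (\<bar>Im s\<bar> + 2))" by (simp add: algebra_simps)
 qed (use B e in auto)
 also have "... \<le> 2 * (B * (\<bar>Im s\<bar> + 2)) powr (2 * e)" by (rule two_powr_le) (use e B in auto)
 finally have "norm (DS b w) \<le> (zbound e + 4) * (2 * (B * (\<bar>Im s\<bar> + 2)) powr (2 * e))"
  using zbound_nonneg[OF e(1)] by (simp add: mult_left_mono)
 thus ?thesis by (simp only: mult_ac)
qed

lemma bps_deriv_bound:
 assumes b: "bps B b" and b1: "\<And>n. norm (b n) \<le> 1" and B: "B \<ge> 1"
  and e: "0 < e" "e \<le> 1/2" and s: "Re s \<ge> 1"
 shows "norm (deriv (DS b) s) \<le> 4 * (zbound e + 4) / e * (B * (\<bar>Im s\<bar> + 2)) powr (2 * e)"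
proof -
 have sub: "ball s e \<subseteq> {s. Re s > 0}" using ball_Re_Im(1) s e by force
 have "norm (deriv (DS b) s) \<le> 2 * (2 * (zbound e + 4) * (B * (\<bar>Im s\<bar> + 2)) powr (2 * e)) / e"
  by (rule cauchy_deriv_bound_1[OF holomorphic_on_subset[OF bps_DS_holomorphic[OF b] sub]])
   (use bps_ball_bound[OF b b1 B e s] e in auto)
 thus ?thesis by (simp add: algebra_simps)
qed

text \<open>The critical factor in the 3-4-1 inequality is the L-function of the square of \<xi>,
  which has a pole just when \<xi> is real. For real \<xi>, a disc about 1 is treated by Siegel's
  bound for L(1, \<xi>) and the mean value inequality; outside it the distance to the pole is at
  least a small negative power of \<open>V\<close>.\<close>

lemma nonprin_lower:
 assumes eta: "\<eta> > 0"
 shows "\<exists>c>0. \<forall>q \<xi> s. dchar q \<xi> \<and> \<xi> \<noteq> prin q \<and> 1 < Re s \<and> Re s \<le> 2 -->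
  norm (DS \<xi> s) \<ge> c * (real q * (\<bar>Im s\<bar> + 2)) powr (- \<eta>)"
proof -
 \<comment> \<open>\<open>U\<close> will have the size \<open>V powr (5 * e)\<close> and enters
   \<open>lower_from_341\<close> to the fourth power, whence the 20.\<close>
 define e where "e = min (1/2) (\<eta> / 20)"
 have e: "0 < e" "e \<le> 1/2" "20 * e \<le> \<eta>" using eta by (auto simp: e_def)
 obtain cS where cS: "cS > 0" "\<And>q \<xi>. rchar q \<xi> ==> Re (DS \<xi> 1) \<ge> cS * real q powr (- e)"
  using siegel[OF e(1)] by blast
 define A where "A = zbound e + 4"
 have A: "A \<ge> 4" using zbound_nonneg[OF e(1)] by (simp add: A_def)
 define D where "D = 4 * A / e"
 have D: "D > 0" using A e by (simp add: D_def)
 define cR where "cR = min 1 cS"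
 have cR: "cR > 0" "cR \<le> 1" "cR \<le> cS" using cS by (auto simp: cR_def)
 define K where "K = 2 * A * (2 + 2 * D / cR) + D + 1"
 have K: "K \<ge> 1" "K \<ge> D" "K \<ge> 2 * A * (2 + 2 * D / cR)" "K \<ge> 2 * A"
 proof -
  have "2 * D / cR \<ge> 0" using D cR by simp
  hence "2 * A * (2 + 2 * D / cR) \<ge> 2 * A * 1" using A by (intro mult_left_mono) auto
  thus "K \<ge> 1" "K \<ge> D" "K \<ge> 2 * A * (2 + 2 * D / cR)" "K \<ge> 2 * A" unfolding K_def using A D by linarith+
 qed
 define c where "c = min (cS / 2) (1 / (109744 * K ^ 4))"
 have c: "c > 0" using cS K by (simp add: c_def)
 have "norm (DS \<xi> s) \<ge> c * (real q * (\<bar>Im s\<bar> + 2)) powr (- \<eta>)"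
  if d: "dchar q \<xi>" and np: "\<xi> \<noteq> prin q" and s: "1 < Re s" "Re s \<le> 2" for q \<xi> s
 proof -
  define t where "t = Im s"
  define V where "V = real q * (\<bar>t\<bar> + 2)"
  let ?W = "V powr (2 * e)"
  note b = bps_dchar[OF d np]
  have q: "real q \<ge> 1" using dchar_pos[OF d] by simp
  have V2: "V \<ge> 1 * 2" unfolding V_def using q by (intro mult_mono) auto
  have qV: "real q \<le> V" using mult_left_mono[of 1 "\<bar>t\<bar> + 2" "real q"] q by (simp add: V_def)
  have Ve: "V powr x \<le> V powr y" if "x \<le> y" for x y using V2 that by (intro powr_mono) auto
  have dchar1: "norm (\<xi> n) \<le> 1" for n by (rule dchar_norm_le[OF d])
  have db: "norm (deriv (DS \<xi>) w) \<le> D * ?W" if w: "Re w \<ge> 1" "\<bar>Im w\<bar> \<le> \<bar>t\<bar>" for w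
  proof -
   have "norm (deriv (DS \<xi>) w) \<le> D * (real q * (\<bar>Im w\<bar> + 2)) powr (2 * e)"
    using bps_deriv_bound[OF b dchar1 q e(1,2) w(1)] by (simp add: D_def A_def)
   also have "... \<le> D * ?W" unfolding V_def using D w q e by (intro mult_left_mono powr_mono2) auto
   finally show ?thesis .
  qed
  have s_eq: "s = Complex (Re s) t" by (simp add: t_def)
  \<comment> \<open>The two cases that rest on the 3-4-1 inequality share this conclusion; what
    remains for each is a bound at height \<open>2 * t\<close> for the square of \<xi>.\<close>
  have gen: "norm (DS \<xi> s) \<ge> c * V powr (- \<eta>)"
   if W: "\<And>r. Re s \<le> r ==> r \<le> 2 ==> norm (DS (\<lambda>n. \<xi> n * \<xi> n) (Complex r (2 * t))) \<le> K * V powr (5 * e)"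
  proof -
   define U where "U = K * V powr (5 * e)"
   have "V powr (5 * e) \<ge> 1" using V2 e by (intro ge_one_powr_ge_zero) auto
   hence U1: "U \<ge> 1 * 1" unfolding U_def using K by (intro mult_mono) auto
   have "norm (DS \<xi> (Complex (Re s) t)) \<ge> 1 / (109744 * U ^ 4)"
   proof (rule lower_from_341[OF d s])
    show "U \<ge> 1" using U1 by simp
    show "norm (DS (\<lambda>n. \<xi> n * \<xi> n) (Complex r (2 * t))) \<le> U" if "Re s \<le> r" "r \<le> 2" for r
     unfolding U_def by (rule W[OF that])
    show "norm (deriv (DS \<xi>) (Complex r t)) \<le> U" if "Re s \<le> r" "r \<le> 2" for r
    proof -
     have "norm (deriv (DS \<xi>) (Complex r t)) \<le> D * ?W" by (rule db) (use that s in auto)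
     also have "... \<le> U" unfolding U_def using K D e by (intro mult_mono Ve) auto
     finally show ?thesis .
    qed
   qed
   moreover have "1 / (109744 * U ^ 4) = 1 / (109744 * K ^ 4) * V powr (- (20 * e))"
   proof -
    have "U ^ 4 = K ^ 4 * V powr (20 * e)" using V2 by (simp add: U_def power_mult_distrib powr_realpow[symmetric] powr_powr)
    thus ?thesis using V2 by (simp add: powr_minus field_simps)
   qed
   moreover have "c * V powr (- \<eta>) \<le> 1 / (109744 * K ^ 4) * V powr (- (20 * e))"
    using K e by (intro mult_mono Ve) (auto simp: c_def)
   ultimately show ?thesis using s_eq by simp
  qed
  have "norm (DS \<xi> s) \<ge> c * V powr (- \<eta>)"
  proof (cases "(\<lambda>n. \<xi> n * \<xi> n) = prin q")
   case False
   have d2: "dchar q (\<lambda>n. \<xi> n * \<xi> n)" by (rule dchar_times[OF d d])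
   show ?thesis
   proof (rule gen)
    fix r assume s': "Re s \<le> r" "r \<le> 2"
    have "norm (DS (\<lambda>n. \<xi> n * \<xi> n) (Complex r (2 * t))) \<le> A * (real q * (\<bar>Im (Complex r (2 * t))\<bar> + 2)) powr (2 * e)"
     unfolding A_def by (rule bps_DS_bound[OF bps_dchar[OF d2 False] dchar_norm_le[OF d2] q e(1,2)]) (use s' s e in simp)
    also have "... \<le> A * (2 * V) powr (2 * e)"
    proof (intro mult_left_mono powr_mono2)
     have "real q * (\<bar>Im (Complex r (2 * t))\<bar> + 2) \<le> real q * (2 * (\<bar>t\<bar> + 2))"
      using q by (intro mult_left_mono) (auto simp: abs_mult)
     thus "real q * (\<bar>Im (Complex r (2 * t))\<bar> + 2) \<le> 2 * V" by (simp add: V_def algebra_simps)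
    qed (use e A in auto)
    also have "... \<le> A * (2 * ?W)" using A e V2 by (intro mult_left_mono two_powr_le) auto
    also have "... = 2 * A * ?W" by simp
    also have "... \<le> K * V powr (5 * e)" using K A e by (intro mult_mono Ve) auto
    finally show "norm (DS (\<lambda>n. \<xi> n * \<xi> n) (Complex r (2 * t))) \<le> K * V powr (5 * e)" .
   qed
  next
   case True
   have "\<xi> n \<in> \<real>" for n
   proof -
    have "\<xi> n * \<xi> n = prin q n" using fun_cong[OF True, of n] .
    hence "\<xi> n * \<xi> n = 0 \<or> \<xi> n * \<xi> n = 1" by (auto simp: prin_def)
    hence "\<xi> n = 0 \<or> \<xi> n = 1 \<or> \<xi> n = -1" by (auto simp: square_eq_1_iff)
    thus ?thesis by auto
   qed
   hence rc: "rchar q \<xi>" using d np by (simp add: rchar_def)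
   \<comment> \<open>Within this distance from 1 the function moves by at most half of Siegel's
     lower bound.\<close>
   define \<rho> where "\<rho> = cR * real q powr (- e) / (2 * D * ?W)"
   have qe: "real q powr (- e) > 0" using q by simp
   have rho: "\<rho> > 0" using cR qe D V2 by (simp add: \<rho>_def)
   show ?thesis
   proof (cases "norm (s - 1) \<le> \<rho>")
    case near: True
    have "norm (DS \<xi> s - DS \<xi> 1) \<le> (D * ?W) * norm (s - 1)"
    proof (rule field_differentiable_bound[of "closed_segment 1 s"])
     fix x assume x: "x \<in> closed_segment 1 s"
     obtain u where u: "0 \<le> u" "u \<le> 1" "x = (1 - u) *\<^sub>R 1 + u *\<^sub>R s" using x by (auto simp: closed_segment_def)
     have "Re x = 1 + u * (Re s - 1)" "Im x = u * t" by (simp_all add: u t_def algebra_simps)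
     hence R: "Re x \<ge> 1" and I: "\<bar>Im x\<bar> \<le> \<bar>t\<bar>" using u s by (auto simp: abs_mult mult_left_le_one_le)
     show "(DS \<xi> has_field_derivative deriv (DS \<xi>) x) (at x within closed_segment 1 s)"
      by (rule has_field_derivative_at_within, rule holomorphic_derivI[OF bps_DS_holomorphic[OF b] open_halfspace_Re_gt])
       (use R in auto)
     show "norm (deriv (DS \<xi>) x) \<le> D * ?W" by (rule db[OF R I])
    qed auto
    also have "... \<le> (D * ?W) * \<rho>" using near D by (intro mult_left_mono) auto
    also have "... = cR / 2 * real q powr (- e)" using D V2 by (simp add: \<rho>_def)
    also have "... \<le> cS / 2 * real q powr (- e)" using cR qe by (intro mult_right_mono) auto
    finally have "norm (DS \<xi> s - DS \<xi> 1) \<le> cS / 2 * real q powr (- e)" .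
    moreover have "norm (DS \<xi> 1) \<ge> cS * real q powr (- e)"
     using cS(2)[OF rc] complex_Re_le_cmod[of "DS \<xi> 1"] by linarith
    moreover have "norm (DS \<xi> 1) \<le> norm (DS \<xi> s) + norm (DS \<xi> s - DS \<xi> 1)"
     by (metis norm_minus_commute norm_triangle_sub)
    ultimately have "norm (DS \<xi> s) \<ge> cS / 2 * real q powr (- e)" by linarith
    moreover have "V powr (- \<eta>) \<le> real q powr (- e)"
    proof -
     have "V powr (- \<eta>) \<le> V powr (- e)" using e by (intro Ve) auto
     also have "... \<le> real q powr (- e)" using qV q e by (intro powr_mono2') auto
     finally show ?thesis .
    qed
    hence "c * V powr (- \<eta>) \<le> cS / 2 * real q powr (- e)" using cS by (intro mult_mono) (auto simp: c_def)
    ultimately show ?thesis by linarith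
   next
    case far: False
    show ?thesis
    proof (rule gen)
     fix r assume s': "Re s \<le> r" "r \<le> 2"
     define z where "z = Complex r (2 * t)"
     have z1: "Re z > 1" using s' s by (simp add: z_def)
     \<comment> \<open>Going from \<open>s\<close> to abscissa \<open>r \<ge> Re s\<close> and to
       twice the height can only increase the distance from 1.\<close>
     have "(norm (s - 1))\<^sup>2 \<le> (norm (z - 1))\<^sup>2"
     proof -
      have "(Re s - 1)\<^sup>2 \<le> (r - 1)\<^sup>2" using s s' by (intro power_mono) auto
      moreover have "t\<^sup>2 \<le> (2 * t)\<^sup>2" by (simp add: power2_eq_square)
      moreover have "(norm (z - 1))\<^sup>2 = (r - 1)\<^sup>2 + (2 * t)\<^sup>2" by (simp only: cmod_power2) (simp add: z_def)
      moreover have "(norm (s - 1))\<^sup>2 = (Re s - 1)\<^sup>2 + t\<^sup>2" by (simp only: cmod_power2) (simp add: t_def)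
      ultimately show ?thesis by linarith
     qed
     hence "norm (s - 1) \<le> norm (z - 1)" by (rule power2_le_imp_le) simp
     hence zr: "norm (z - 1) \<ge> \<rho>" using far by simp
     have z0: "norm (z - 1) > 0" using zr rho by linarith
     have V2': "(real q * (\<bar>Im z\<bar> + 2)) powr (2 * e) \<le> 2 * ?W"
      and V3': "(\<bar>Im z\<bar> + 2) powr (2 * e) \<le> 2 * ?W"
     proof -
      have "real q * (\<bar>Im z\<bar> + 2) \<le> real q * (2 * (\<bar>t\<bar> + 2))"
       using q by (intro mult_left_mono) (auto simp: abs_mult z_def)
      hence h: "real q * (\<bar>Im z\<bar> + 2) \<le> 2 * V" by (simp add: V_def algebra_simps)
      have "1 * (\<bar>Im z\<bar> + 2) \<le> real q * (\<bar>Im z\<bar> + 2)" using q by (intro mult_right_mono) auto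
      hence h': "\<bar>Im z\<bar> + 2 \<le> 2 * V" using h by simp
      have "(2 * V) powr (2 * e) \<le> 2 * ?W" using e V2 by (intro two_powr_le) auto
      moreover have "(real q * (\<bar>Im z\<bar> + 2)) powr (2 * e) \<le> (2 * V) powr (2 * e)" "(\<bar>Im z\<bar> + 2) powr (2 * e) \<le> (2 * V) powr (2 * e)"
       using h h' e q by (auto intro!: powr_mono2)
      ultimately show "(real q * (\<bar>Im z\<bar> + 2)) powr (2 * e) \<le> 2 * ?W"
       "(\<bar>Im z\<bar> + 2) powr (2 * e) \<le> 2 * ?W" by auto
     qed
     have n0: "norm (DS (prin0 q) z) \<le> A * (2 * ?W)"
     proof -
      have "norm (DS (prin0 q) z) \<le> A * (real q * (\<bar>Im z\<bar> + 2)) powr (2 * e)"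
       unfolding A_def by (rule bps_DS_bound[OF bps_prin0 norm_prin0_le q e(1,2)]) (use q z1 e in auto)
      also have "... \<le> A * (2 * ?W)" using V2' A by (intro mult_left_mono) auto
      finally show ?thesis .
     qed
     have "norm (zt z) \<le> A * (\<bar>Im z\<bar> + 2) powr (2 * e) * (1 + norm (z - 1))"
      unfolding A_def by (rule zt_bound[OF e(1,2)]) (use z1 e in simp)
     also have "... \<le> A * (2 * ?W) * (1 + norm (z - 1))" using V3' A by (intro mult_right_mono mult_left_mono) auto
     finally have "norm (zt z) / norm (z - 1) \<le> A * (2 * ?W) * (1 + norm (z - 1)) / norm (z - 1)"
      using z0 by (intro divide_right_mono) auto
     also have "... = A * (2 * ?W) * (1 + 1 / norm (z - 1))" using z0 by (simp add: field_simps)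
     also have "... \<le> A * (2 * ?W) * (1 + 1 / \<rho>)" using zr rho A by (intro mult_left_mono add_left_mono frac_le) auto
     finally have n1: "norm (zt z) / norm (z - 1) \<le> A * (2 * ?W) * (1 + 1 / \<rho>)" .
     have tq: "norm (of_nat (totient q) / of_nat q :: complex) \<le> 1"
      using totient_le[of q] q by (simp add: norm_divide divide_simps)
     have "DS (prin q) z = of_nat (totient q) / of_nat q * (zt z / (z - 1)) + DS (prin0 q) z"
      by (rule DS_prin[OF _ z1]) (use q in simp)
     hence "norm (DS (prin q) z) \<le> norm (of_nat (totient q) / of_nat q :: complex) * (norm (zt z) / norm (z - 1)) + norm (DS (prin0 q) z)"
      by (metis norm_divide norm_mult norm_triangle_ineq)
     also have "... \<le> 1 * (A * (2 * ?W) * (1 + 1 / \<rho>)) + A * (2 * ?W)"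
      using tq n1 n0 by (intro add_mono mult_mono) auto
     also have "... = 2 * A * ?W * (2 + 1 / \<rho>)" by (simp add: algebra_simps)
     finally have n2: "norm (DS (prin q) z) \<le> 2 * A * ?W * (2 + 1 / \<rho>)" .
     \<comment> \<open>The reciprocal of \<open>\<rho>\<close> is at most a constant times
       \<open>V powr (3 * e)\<close>; the bound for zeta supplies the remaining
       \<open>V powr (2 * e)\<close>.\<close>
     have "1 / \<rho> = 2 * D / cR * (?W * real q powr e)" using cR D q V2 by (simp add: \<rho>_def powr_minus field_simps)
     also have "... \<le> 2 * D / cR * (?W * V powr e)" using qV e q D cR by (intro mult_left_mono powr_mono2) auto
     also have "?W * V powr e = V powr (3 * e)" by (simp add: powr_add[symmetric])
     finally have "2 * A * ?W * (2 + 1 / \<rho>) \<le> 2 * A * ?W * (2 + 2 * D / cR * V powr (3 * e))"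
      using A by (intro mult_left_mono add_left_mono) auto
     with n2 have "norm (DS (prin q) z) \<le> 2 * A * ?W * (2 + 2 * D / cR * V powr (3 * e))"
      by (rule order_trans)
     also have "... \<le> 2 * A * ?W * (2 * V powr (3 * e) + 2 * D / cR * V powr (3 * e))"
     proof -
      have "V powr (3 * e) \<ge> 1" using V2 e by (intro ge_one_powr_ge_zero) auto
      thus ?thesis using A by (intro mult_left_mono) auto
     qed
     also have "... = 2 * A * (2 + 2 * D / cR) * (?W * V powr (3 * e))" by (simp add: algebra_simps)
     also have "?W * V powr (3 * e) = V powr (5 * e)" by (simp add: powr_add[symmetric])
     also have "2 * A * (2 + 2 * D / cR) * V powr (5 * e) \<le> K * V powr (5 * e)" using K by (intro mult_right_mono) auto
     finally show "norm (DS (\<lambda>n. \<xi> n * \<xi> n) (Complex r (2 * t))) \<le> K * V powr (5 * e)" unfolding True z_def .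
    qed
   qed
  qed
  thus ?thesis by (simp add: V_def t_def)
 qed
 thus ?thesis using c by blast
qed

section \<open>Derivatives of L'/L\<close>

abbreviation DSL :: "nat => (nat => complex) => complex => complex" where
 "DSL k a s \<equiv> DS (\<lambda>n. a n * of_real (ln (real n) ^ k)) s"

lemma higher_deriv_logderiv:
 assumes c: "dchar q \<xi>" and f: "f holomorphic_on S" and S: "open S" and s: "Re s > 1" "s \<in> S"
  and eq: "\<And>w. Re w > 1 ==> w \<in> S ==> f w = DS \<xi> w"
 shows "norm ((deriv ^^ k) (\<lambda>w. deriv f w / f w) s) =
  norm (DSL k (\<lambda>n. \<xi> n * of_real (mangoldt n)) s)"
proof -
 define g where "g = (\<lambda>n. - (\<xi> n * of_real (mangoldt n)))"
 have tg: "tame g" unfolding g_def by (rule tame_minus[OF tame_mangoldt[OF c]])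
 define T where "T = S \<inter> {s. Re s > 1}"
 have T: "open T" unfolding T_def by (intro open_Int S open_halfspace_Re_gt)
 have fT: "f holomorphic_on T" by (rule holomorphic_on_subset[OF f]) (simp add: T_def)
 have fnz: "f w \<noteq> 0" if "w \<in> T" for w using that DS_nonzero[OF c, of w] eq[of w] by (simp add: T_def)
 have "(deriv ^^ k) (\<lambda>w. deriv f w / f w) s = (deriv ^^ k) (DS g) s"
 proof (rule higher_deriv_transform_within_open[OF _ _ T])
  show "(\<lambda>w. deriv f w / f w) holomorphic_on T" by (intro holomorphic_on_divide holomorphic_deriv[OF fT T] fT fnz)
  show "DS g holomorphic_on T" by (rule holomorphic_on_subset[OF DS_holomorphic[OF tg]]) (simp add: T_def)
  show "s \<in> T" using s by (simp add: T_def)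
  fix w assume w: "w \<in> T"
  have "deriv f w = deriv (DS \<xi>) w"
   by (rule deriv_cong_ev) (use eventually_nhds_in_open[OF T w] eq in \<open>auto elim!: eventually_mono simp: T_def\<close>)
  hence "deriv f w / f w = deriv (DS \<xi>) w / DS \<xi> w" using w eq[of w] by (simp add: T_def)
  also have "... = - DS (\<lambda>n. \<xi> n * of_real (mangoldt n)) w"
   by (rule DS_log_deriv[OF c]) (use w in \<open>simp add: T_def\<close>)
  also have "... = DS g w" unfolding g_def
   by (rule DS_minus[OF tame_mangoldt[OF c], symmetric]) (use w in \<open>simp add: T_def\<close>)
  finally show "deriv f w / f w = DS g w" .
 qed
 also have "... = (-1) ^ k * DSL k g s" by (rule DS_higher_deriv[OF tg s(1)])
 also have "(\<lambda>n. g n * of_real (ln (real n) ^ k)) = (\<lambda>n. - (\<xi> n * of_real (mangoldt n) * of_real (ln (real n) ^ k)))"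
  by (simp add: g_def)
 also have "DS ... s = - DSL k (\<lambda>n. \<xi> n * of_real (mangoldt n)) s"
  by (rule DS_minus[OF tame_ln_power[OF tame_mangoldt[OF c]] s(1)])
 finally show ?thesis by (simp add: norm_mult norm_power)
qed

text \<open>Each of the \<open>k + 1\<close> factors in \<open>logderiv_bound\<close> costs
  \<open>V powr (2 * e + \<delta>)\<close>, at most \<open>V powr (3 * \<delta>)\<close>.\<close>

lemma logderiv_powr_bound:
 assumes f: "f holomorphic_on ball z R" and U: "\<And>w. w \<in> ball z R ==> norm (f w) \<le> A * V powr (2 * e)"
  and R: "R > 0" and c: "c > 0" "c * V powr (- \<delta>) \<le> norm (f z)" and A: "A \<ge> 0" and V: "V \<ge> 2"
  and e: "e \<le> \<delta>" "3 * \<delta> * real (Suc k) \<le> \<eta>"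
 shows "norm ((deriv ^^ k) (\<lambda>w. deriv f w / f w) z) \<le> fact k * (16 * A / (R * c)) ^ Suc k * V powr \<eta>"
proof -
 have "norm ((deriv ^^ k) (\<lambda>w. deriv f w / f w) z) \<le> fact k * (16 * (A * V powr (2 * e)) / (R * (c * V powr (- \<delta>)))) ^ Suc k"
  by (rule logderiv_bound[OF f U R _ c(2)]) (use c V in auto)
 also have "16 * (A * V powr (2 * e)) / (R * (c * V powr (- \<delta>))) = 16 * A / (R * c) * V powr (2 * e + \<delta>)"
  using V by (simp add: powr_minus powr_add field_simps)
 also have "fact k * (16 * A / (R * c) * V powr (2 * e + \<delta>)) ^ Suc k = fact k * (16 * A / (R * c)) ^ Suc k * V powr ((2 * e + \<delta>) * real (Suc k))"
  unfolding power_mult_distrib using V by (simp add: powr_realpow[symmetric] powr_powr mult.assoc del: power_Suc)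
 also have "... \<le> fact k * (16 * A / (R * c)) ^ Suc k * V powr \<eta>"
 proof (intro mult_left_mono powr_mono)
  have "(2 * e + \<delta>) * real (Suc k) \<le> 3 * \<delta> * real (Suc k)" using e by (intro mult_right_mono) auto
  thus "(2 * e + \<delta>) * real (Suc k) \<le> \<eta>" using e by linarith
 qed (use V A R c in auto)
 finally show ?thesis .
qed

text \<open>The upper bound holds on a disc of fixed radius \<open>e\<close>, part of which may lie
  to the left of 1; the lower bound is used at its centre, where \<open>nonprin_lower\<close>
  applies.\<close>

lemma nonprin_logderiv:
 assumes eta: "\<eta> > 0"
 shows "\<exists>C\<ge>0. \<forall>q \<xi> s. dchar q \<xi> \<and> \<xi> \<noteq> prin q \<and> 1 < Re s \<and> Re s \<le> 2 -->
  norm (DSL k (\<lambda>n. \<xi> n * of_real (mangoldt n)) s) \<le> C * (real q * (\<bar>Im s\<bar> + 2)) powr \<eta>"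
proof -
 define \<delta> where "\<delta> = \<eta> / (4 * real (Suc k))"
 define e where "e = min (1/2) \<delta>"
 have d: "\<delta> > 0" "3 * \<delta> * real (Suc k) \<le> \<eta>" using eta by (auto simp: \<delta>_def field_simps)
 have e: "0 < e" "e \<le> 1/2" "e \<le> \<delta>" using d by (auto simp: e_def)
 obtain c where c: "c > 0" "\<And>q \<xi> s. dchar q \<xi> ==> \<xi> \<noteq> prin q ==> 1 < Re s ==> Re s \<le> 2 ==>
  norm (DS \<xi> s) \<ge> c * (real q * (\<bar>Im s\<bar> + 2)) powr (- \<delta>)"
  using nonprin_lower[OF d(1)] by blast
 define A where "A = zbound e + 4"
 have A: "A \<ge> 4" using zbound_nonneg[OF e(1)] by (simp add: A_def)
 define C where "C = fact k * (16 * (2 * A) / (e * c)) ^ Suc k"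
 have C: "C \<ge> 0" using A e c by (simp add: C_def)
 show ?thesis
 proof (intro exI conjI allI impI)
  show "C \<ge> 0" by (rule C)
  fix q \<xi> s assume as: "dchar q \<xi> \<and> \<xi> \<noteq> prin q \<and> 1 < Re s \<and> Re s \<le> 2"
  hence dc: "dchar q \<xi>" and np: "\<xi> \<noteq> prin q" and s: "1 < Re s" "Re s \<le> 2" by auto
  define V where "V = real q * (\<bar>Im s\<bar> + 2)"
  have q: "real q \<ge> 1" using dchar_pos[OF dc] by simp
  have V2: "V \<ge> 1 * 2" unfolding V_def using q by (intro mult_mono) auto
  note b = bps_dchar[OF dc np]
  have sub: "ball s e \<subseteq> {s. Re s > 0}" using ball_Re_Im(1) s e by force
  have hol: "DS \<xi> holomorphic_on ball s e" by (rule holomorphic_on_subset[OF bps_DS_holomorphic[OF b] sub])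
  have "norm (DSL k (\<lambda>n. \<xi> n * of_real (mangoldt n)) s) =
    norm ((deriv ^^ k) (\<lambda>w. deriv (DS \<xi>) w / DS \<xi> w) s)"
   by (rule higher_deriv_logderiv[OF dc hol open_ball, symmetric]) (use s e in auto)
  also have "... \<le> C * V powr \<eta>" unfolding C_def
  proof (rule logderiv_powr_bound[OF hol _ e(1) c(1) _ _ _ e(3) d(2)])
   show "norm (DS \<xi> w) \<le> 2 * A * V powr (2 * e)" if "w \<in> ball s e" for w
    unfolding A_def V_def by (rule bps_ball_bound[OF b dchar_norm_le[OF dc] q e(1,2) _ that]) (use s in simp)
   show "c * V powr (- \<delta>) \<le> norm (DS \<xi> s)" unfolding V_def by (rule c(2)[OF dc np s])
  qed (use A V2 in auto)
  finally show "norm (DSL k (\<lambda>n. \<xi> n * of_real (mangoldt n)) s) \<le> C * (real q * (\<bar>Im s\<bar> + 2)) powr \<eta>"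
   by (simp add: V_def)
 qed
qed

text \<open>Zeta on \<open>Re s > 0\<close> away from 1; the value at 1 is the default 0 of
  division.\<close>

definition zf :: "complex => complex" where "zf s = zt s / (s - 1)"

lemma zf_eq: "Re s > 1 ==> zf s = DS (prin 1) s" using zt_eq[of s] by (cases "s = 1") (auto simp: zf_def)

lemma zf_holomorphic: "zf holomorphic_on ({s. Re s > 0} - {1})" unfolding zf_def[abs_def]
 by (intro holomorphic_on_divide holomorphic_on_subset[OF zt_holomorphic] holomorphic_intros) auto

text \<open>The distance from the pole is measured by the imaginary part alone, which on the disc
  stays at least \<open>\<tau> / 2\<close> in absolute value.\<close>

lemma zf_ball_bound:
 assumes e: "0 < e" "e \<le> 1/2" and s: "Re s \<ge> 1" and t: "\<tau> > 0" "\<bar>Im s\<bar> \<ge> \<tau>" and R: "R \<le> e" "R \<le> \<tau> / 2" "R > 0"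
  and w: "w \<in> ball s R"
 shows "norm (zf w) \<le> 2 * (zbound e + 4) * (1 + 2 / \<tau>) * (\<bar>Im s\<bar> + 2) powr (2 * e)"
  and "w \<in> {s. Re s > 0} - {1}"
proof -
 note b = ball_Re_Im[OF w]
 have Iw: "\<bar>Im w\<bar> \<ge> \<tau> / 2" using b t R by linarith
 have "\<bar>Im (w - 1)\<bar> \<le> norm (w - 1)" by (rule abs_Im_le_cmod)
 hence n1: "norm (w - 1) \<ge> \<tau> / 2" using Iw by simp
 show "w \<in> {s. Re s > 0} - {1}" using Iw t b s R e by auto
 have A: "zbound e + 4 > 0" using zbound_nonneg[OF e(1)] by simp
 have "norm (zt w) \<le> (zbound e + 4) * (\<bar>Im w\<bar> + 2) powr (2 * e) * (1 + norm (w - 1))"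
  by (rule zt_bound[OF e]) (use b s R in linarith)
 also have "(\<bar>Im w\<bar> + 2) powr (2 * e) \<le> (2 * (\<bar>Im s\<bar> + 2)) powr (2 * e)"
  using b R e by (intro powr_mono2) auto
 also have "(2 * (\<bar>Im s\<bar> + 2)) powr (2 * e) \<le> 2 * (\<bar>Im s\<bar> + 2) powr (2 * e)" by (rule two_powr_le) (use e in auto)
 finally have "norm (zt w) \<le> (zbound e + 4) * (2 * (\<bar>Im s\<bar> + 2) powr (2 * e)) * (1 + norm (w - 1))"
  using A by (simp add: mult_left_mono mult_right_mono)
 hence "norm (zf w) \<le> (zbound e + 4) * (2 * (\<bar>Im s\<bar> + 2) powr (2 * e)) * (1 + norm (w - 1)) / norm (w - 1)"
  unfolding zf_def norm_divide by (rule divide_right_mono) simp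
 also have "... = (zbound e + 4) * (2 * (\<bar>Im s\<bar> + 2) powr (2 * e)) * (1 + 1 / norm (w - 1))"
 proof -
  have *: "X * (1 + y) / y = X * (1 + 1 / y)" if "y > 0" for X y :: real using that by (simp add: field_simps)
  have "norm (w - 1) > 0" using n1 t by linarith
  thus ?thesis by (rule *)
 qed
 also have "... \<le> (zbound e + 4) * (2 * (\<bar>Im s\<bar> + 2) powr (2 * e)) * (1 + 1 / (\<tau> / 2))"
  using n1 t A by (intro mult_left_mono add_left_mono frac_le) auto
 also have "1 / (\<tau> / 2) = 2 / \<tau>" by simp
 finally show "norm (zf w) \<le> 2 * (zbound e + 4) * (1 + 2 / \<tau>) * (\<bar>Im s\<bar> + 2) powr (2 * e)" by (simp only: mult_ac)
qed

lemma prin1_square: "(\<lambda>n. prin 1 n * prin 1 n) = prin 1" by (simp add: prin_1)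

text \<open>\<open>lower_from_341\<close> with zeta also in the role of the squared character; its
  pole is kept away by the condition on \<open>Im s\<close>. The exponent \<open>8 * e\<close> is
  the fourth power of \<open>V powr (2 * e)\<close>.\<close>

lemma zeta_lower:
 assumes t: "0 < \<tau>" "\<tau> \<le> 1" and dl: "\<delta> > 0"
 shows "\<exists>c>0. \<forall>s. 1 < Re s \<and> Re s \<le> 2 \<and> \<bar>Im s\<bar> \<ge> \<tau> --> norm (DS (prin 1) s) \<ge> c * (\<bar>Im s\<bar> + 2) powr (- \<delta>)"
proof -
 define e where "e = min (1/2) (\<delta> / 8)"
 have e: "0 < e" "e \<le> 1/2" "8 * e \<le> \<delta>" using dl by (auto simp: e_def)
 define R where "R = min e (\<tau> / 2)"
 have R: "R \<le> e" "R \<le> \<tau> / 2" "R > 0" using e t by (auto simp: R_def)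
 define A where "A = 2 * (zbound e + 4) * (1 + 2 / \<tau>)"
 have A: "A \<ge> 2 * 4 * 1" unfolding A_def using zbound_nonneg[OF e(1)] t by (intro mult_mono) auto
 define K where "K = 2 * A / R + 2 * A"
 have "2 * A / R \<ge> 0" using A R by simp
 hence K: "K \<ge> 1" "K \<ge> 2 * A / R" "K \<ge> 2 * A" unfolding K_def using A by linarith+
 define c where "c = 1 / (109744 * K ^ 4)"
 have c: "c > 0" using K by (simp add: c_def)
 have "norm (DS (prin 1) s) \<ge> c * (\<bar>Im s\<bar> + 2) powr (- \<delta>)" if s: "1 < Re s" "Re s \<le> 2" "\<bar>Im s\<bar> \<ge> \<tau>" for s
 proof -
  define V where "V = \<bar>Im s\<bar> + 2"
  have V2: "V \<ge> 2" by (simp add: V_def)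
  define U where "U = K * V powr (2 * e)"
  have "V powr (2 * e) \<ge> 1" using V2 e by (intro ge_one_powr_ge_zero) auto
  hence U1: "U \<ge> 1 * 1" unfolding U_def using K by (intro mult_mono) auto
  have "norm (DS (prin 1) (Complex (Re s) (Im s))) \<ge> 1 / (109744 * U ^ 4)"
  proof (rule lower_from_341[OF dchar_prin1 s(1,2)])
   show "U \<ge> 1" using U1 by simp
   show "norm (DS (\<lambda>n. prin 1 n * prin 1 n) (Complex r (2 * Im s))) \<le> U" if s': "Re s \<le> r" "r \<le> 2" for r
   proof -
    let ?z = "Complex r (2 * Im s)"
    have "norm (zf ?z) \<le> A * (\<bar>Im ?z\<bar> + 2) powr (2 * e)"
     unfolding A_def by (rule zf_ball_bound(1)[OF e(1,2) _ t(1) _ R]) (use s s' R t in auto)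
    also have "... \<le> A * (2 * V) powr (2 * e)" using A e by (intro mult_left_mono powr_mono2) (auto simp: V_def)
    also have "... \<le> A * (2 * V powr (2 * e))" using A e V2 by (intro mult_left_mono two_powr_le) auto
    also have "... = 2 * A * V powr (2 * e)" by simp
    also have "... \<le> U" unfolding U_def using K by (intro mult_right_mono) auto
    finally show ?thesis using zf_eq[of ?z] s s' by (simp only: prin1_square) auto
   qed
   show "norm (deriv (DS (prin 1)) (Complex r (Im s))) \<le> U" if s': "Re s \<le> r" "r \<le> 2" for r
   proof -
    let ?z = "Complex r (Im s)"
    have hol: "zf holomorphic_on ball ?z R"
     by (rule holomorphic_on_subset[OF zf_holomorphic], rule subsetI, rule zf_ball_bound(2)[OF e(1,2) _ t(1) _ R])
      (use s s' in auto)
    have "norm (deriv zf ?z) \<le> 2 * (A * (\<bar>Im ?z\<bar> + 2) powr (2 * e)) / R"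
     by (rule cauchy_deriv_bound_1[OF hol], unfold A_def, rule zf_ball_bound(1)[OF e(1,2) _ t(1) _ R]) (use s s' R in auto)
    also have "... = 2 * A / R * V powr (2 * e)" by (simp add: V_def)
    also have "... \<le> U" unfolding U_def using K by (intro mult_right_mono) auto
    also have "deriv zf ?z = deriv (DS (prin 1)) ?z"
    proof (rule deriv_cong_ev)
     have "\<forall>\<^sub>F w in nhds ?z. w \<in> {w. Re w > 1}"
      by (rule eventually_nhds_in_open[OF open_halfspace_Re_gt]) (use s s' in simp)
     thus "\<forall>\<^sub>F w in nhds ?z. zf w = DS (prin 1) w" by eventually_elim (simp add: zf_eq)
    qed simp
    finally show ?thesis .
   qed
  qed
  moreover have "1 / (109744 * U ^ 4) = c * V powr (- (8 * e))"
  proof -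
   have "U ^ 4 = K ^ 4 * V powr (8 * e)" using V2 by (simp add: U_def power_mult_distrib powr_realpow[symmetric] powr_powr)
   moreover have "1 / (a * (b * p)) = 1 / (a * b) * (1 / p)" for a b p :: real by simp
   ultimately show ?thesis by (simp only: c_def powr_minus_divide)
  qed
  moreover have "c * V powr (- \<delta>) \<le> c * V powr (- (8 * e))" using c e V2 by (intro mult_left_mono powr_mono) auto
  ultimately show ?thesis by (simp add: V_def)
 qed
 thus ?thesis using c by blast
qed

lemma zt_nonzero:
 assumes s: "Re s \<ge> 1" "Re s \<le> 2" "\<bar>Im s\<bar> \<le> 1" shows "zt s \<noteq> 0"
proof (cases "s = 1")
 case True
 thus ?thesis by (simp add: zt_1)
next
 case ne: False
 show ?thesis
 proof (cases "Re s > 1")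
  case True
  thus ?thesis using zt_eq[OF True] DS_nonzero[OF dchar_prin1 True] ne by simp
 next
  case False
  hence R1: "Re s = 1" using s by simp
  hence t0: "\<bar>Im s\<bar> > 0" using ne by (auto simp: complex_eq_iff)
  obtain c where c: "c > 0" "\<And>w. 1 < Re w \<and> Re w \<le> 2 \<and> \<bar>Im w\<bar> \<ge> \<bar>Im s\<bar> ==> norm (DS (prin 1) w) \<ge> c * (\<bar>Im w\<bar> + 2) powr (- 1)"
   using zeta_lower[OF t0 s(3), of 1] by auto
  define m where "m = \<bar>Im s\<bar> * (c * (\<bar>Im s\<bar> + 2) powr (- 1))"
  have m: "m > 0" using t0 c by (simp add: m_def)
  have "m \<le> norm (zt s)"
  proof (rule tendsto_lowerbound)
   have "isCont zt s" using holomorphic_on_imp_continuous_on[OF zt_holomorphic] open_halfspace_Re_gt R1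
    by (simp add: continuous_on_eq_continuous_at)
   moreover have "((\<lambda>\<sigma>. Complex \<sigma> (Im s)) \<longlongrightarrow> Complex 1 (Im s)) (at_right (1::real))"
    by (intro tendsto_Complex tendsto_const tendsto_ident_at)
   hence "((\<lambda>\<sigma>. Complex \<sigma> (Im s)) \<longlongrightarrow> s) (at_right (1::real))" using R1 by (metis complex_surj)
   ultimately show "((\<lambda>\<sigma>. norm (zt (Complex \<sigma> (Im s)))) \<longlongrightarrow> norm (zt s)) (at_right (1::real))"
    by (intro tendsto_norm isCont_tendsto_compose[of s zt])
   have "\<forall>\<^sub>F \<sigma> in at_right (1::real). \<sigma> \<in> {1<..<2}" by (rule eventually_at_right_real) simp
   thus "\<forall>\<^sub>F \<sigma> in at_right (1::real). m \<le> norm (zt (Complex \<sigma> (Im s)))"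
   proof eventually_elim
    case (elim \<sigma>)
    let ?w = "Complex \<sigma> (Im s)"
    have "\<bar>Im (?w - 1)\<bar> \<le> norm (?w - 1)" by (rule abs_Im_le_cmod)
    hence "m \<le> norm (?w - 1) * norm (DS (prin 1) ?w)" unfolding m_def using c(2)[of ?w] c(1) elim by (intro mult_mono) auto
    thus ?case using zt_eq[of ?w] elim by (simp add: norm_mult)
   qed
  qed simp
  thus ?thesis using m by auto
 qed
qed

text \<open>The coefficients \<open>mangoldt n - 1\<close> are those of -zeta'/zeta - zeta, which
  has no pole at 1. Away from 1 the two parts can be estimated separately.\<close>

lemma zeta_logderiv_far:
 assumes eta: "\<eta> > 0"
 shows "\<exists>C\<ge>0. \<forall>s. 1 < Re s \<and> Re s \<le> 2 \<and> \<bar>Im s\<bar> \<ge> 1/2 -->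
  norm (DSL k (\<lambda>n. of_real (mangoldt n - 1)) s) \<le> C * (\<bar>Im s\<bar> + 2) powr \<eta>"
proof -
 define \<delta> where "\<delta> = \<eta> / (4 * real (Suc k))"
 define e where "e = min (1/2) \<delta>"
 have d: "\<delta> > 0" "3 * \<delta> * real (Suc k) \<le> \<eta>" using eta by (auto simp: \<delta>_def field_simps)
 have e: "0 < e" "e \<le> 1/2" "e \<le> \<delta>" using d by (auto simp: e_def)
 define \<tau> :: real where "\<tau> = 1/2"
 have t: "0 < \<tau>" "\<tau> \<le> 1" by (auto simp: \<tau>_def)
 obtain c where c: "c > 0" "\<And>s. 1 < Re s ==> Re s \<le> 2 ==> \<bar>Im s\<bar> \<ge> \<tau> ==>
  norm (DS (prin 1) s) \<ge> c * (\<bar>Im s\<bar> + 2) powr (- \<delta>)"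
  using zeta_lower[OF t d(1)] by blast
 define R where "R = min e (\<tau> / 2)"
 have R: "R \<le> e" "R \<le> \<tau> / 2" "R > 0" using e t by (auto simp: R_def)
 define A where "A = 2 * (zbound e + 4) * (1 + 2 / \<tau>)"
 have A: "A \<ge> 2 * 4 * 1" unfolding A_def using zbound_nonneg[OF e(1)] t by (intro mult_mono) auto
 define C1 where "C1 = fact k * (16 * A / (R * c)) ^ Suc k"
 define C2 where "C2 = fact k * A / (R / 2) ^ k"
 have C: "C1 \<ge> 0" "C2 \<ge> 0" using A R c by (auto simp: C1_def C2_def)
 show ?thesis
 proof (intro exI conjI allI impI)
  show "C1 + C2 \<ge> 0" using C by simp
  fix s assume as: "1 < Re s \<and> Re s \<le> 2 \<and> \<bar>Im s\<bar> \<ge> 1/2"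
  hence s: "1 < Re s" "Re s \<le> 2" "\<bar>Im s\<bar> \<ge> \<tau>" by (auto simp: \<tau>_def)
  define V where "V = \<bar>Im s\<bar> + 2"
  have V2: "V \<ge> 2" by (simp add: V_def)
  have bd: "norm (zf w) \<le> A * V powr (2 * e)" "w \<in> {s. Re s > 0} - {1}" if "w \<in> ball s R" for w
   using zf_ball_bound[OF e(1,2) _ t(1) s(3) R that] s(1) by (auto simp: A_def V_def)
  have hol: "zf holomorphic_on ball s R" by (rule holomorphic_on_subset[OF zf_holomorphic]) (use bd(2) in blast)
  have "norm (DSL k (\<lambda>n. prin 1 n * of_real (mangoldt n)) s) =
    norm ((deriv ^^ k) (\<lambda>w. deriv zf w / zf w) s)"
   by (rule higher_deriv_logderiv[OF dchar_prin1 hol open_ball, symmetric]) (use s R zf_eq in auto)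
  also have "... \<le> C1 * V powr \<eta>" unfolding C1_def
  proof (rule logderiv_powr_bound[OF hol bd(1) R(3) c(1) _ _ V2 e(3) d(2)])
   show "c * V powr (- \<delta>) \<le> norm (zf s)" unfolding V_def using c(2)[OF s] zf_eq[OF s(1)] by simp
  qed (use A in auto)
  finally have 1: "norm (DSL k (\<lambda>n. prin 1 n * of_real (mangoldt n)) s) \<le> C1 * V powr \<eta>" .
  have t1: "tame (prin 1)" by (rule tame_dchar[OF dchar_prin1])
  have "(deriv ^^ k) zf s = (deriv ^^ k) (DS (prin 1)) s"
  proof (rule higher_deriv_transform_within_open[of _ "ball s R \<inter> {s. Re s > 1}"])
   show "zf holomorphic_on ball s R \<inter> {s. 1 < Re s}" by (rule holomorphic_on_subset[OF hol]) auto
   show "DS (prin 1) holomorphic_on ball s R \<inter> {s. 1 < Re s}" by (rule holomorphic_on_subset[OF DS_holomorphic[OF t1]]) auto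
  qed (use s R zf_eq open_halfspace_Re_gt in auto)
  also have "... = (-1) ^ k * DSL k (prin 1) s" by (rule DS_higher_deriv[OF t1 s(1)])
  finally have "norm (DSL k (prin 1) s) = norm ((deriv ^^ k) zf s)" by (simp add: norm_mult norm_power)
  also have "... \<le> fact k * (A * V powr (2 * e)) / (R / 2) ^ k" by (rule cauchy_deriv_bound[OF hol bd(1) R(3)])
  also have "... = C2 * V powr (2 * e)" by (simp add: C2_def)
  also have "... \<le> C2 * V powr \<eta>"
  proof (intro mult_left_mono powr_mono)
   have "3 * \<delta> * 1 \<le> 3 * \<delta> * real (Suc k)" using d by (intro mult_left_mono) auto
   thus "2 * e \<le> \<eta>" using d e by linarith
  qed (use V2 C in auto)
  finally have 2: "norm (DSL k (prin 1) s) \<le> C2 * V powr \<eta>" .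
  have eq: "(\<lambda>n. of_real (mangoldt n - 1) * of_real (ln (real n) ^ k)) =
   (\<lambda>n. prin 1 n * of_real (mangoldt n) * of_real (ln (real n) ^ k) + - (prin 1 n * of_real (ln (real n) ^ k)) :: complex)"
   unfolding prin_1 of_real_diff of_real_1 by (simp add: algebra_simps)
  have "DSL k (\<lambda>n. of_real (mangoldt n - 1)) s =
   DSL k (\<lambda>n. prin 1 n * of_real (mangoldt n)) s + - DSL k (prin 1) s"
   unfolding eq by (subst DS_add[OF tame_ln_power[OF tame_mangoldt[OF dchar_prin1]] tame_minus[OF tame_ln_power[OF t1]] s(1)],
    subst DS_minus[OF tame_ln_power[OF t1] s(1)]) (rule refl)
  hence "norm (DSL k (\<lambda>n. of_real (mangoldt n - 1)) s) \<le> C1 * V powr \<eta> + C2 * V powr \<eta>"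
   using 1 2 norm_triangle_ineq4 by (metis (no_types, lifting) add_mono diff_conv_add_uminus order_trans)
  thus "norm (DSL k (\<lambda>n. of_real (mangoldt n - 1)) s) \<le> (C1 + C2) * (\<bar>Im s\<bar> + 2) powr \<eta>"
   by (simp add: V_def distrib_right)
 qed
qed

text \<open>Near 1 the poles of zeta'/zeta and of zeta cancel. \<open>W\<close> is the combination
  -zeta'/zeta - zeta written in terms of \<open>zt\<close>; it is holomorphic around the closed
  rectangle, and compactness bounds its derivatives.\<close>

lemma zeta_logderiv_near:
 "\<exists>C\<ge>0. \<forall>s. 1 < Re s \<and> Re s \<le> 2 \<and> \<bar>Im s\<bar> \<le> 1 -->
  norm (DSL k (\<lambda>n. of_real (mangoldt n - 1)) s) \<le> C"
proof -
 define S where "S = {s. Re s > 0} \<inter> zt -` (- {0})"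
 have S: "open S" unfolding S_def
  by (rule continuous_open_preimage[OF holomorphic_on_imp_continuous_on[OF zt_holomorphic] open_halfspace_Re_gt]) auto
 define E where "E = (\<lambda>s. if s = 1 then deriv zt 1 else (zt s - zt 1) / (s - 1))"
 have E: "E holomorphic_on {s. Re s > 0}" unfolding E_def by (rule pole_lemma_open[OF zt_holomorphic open_halfspace_Re_gt])
 define W where "W = (\<lambda>s. - (deriv zt s / zt s) - E s)"
 have subS: "S \<subseteq> {s. Re s > 0}" by (simp add: S_def)
 have ztS: "zt holomorphic_on S" by (rule holomorphic_on_subset[OF zt_holomorphic subS])
 have W: "W holomorphic_on S" unfolding W_def
  by (intro holomorphic_intros holomorphic_on_divide holomorphic_deriv[OF ztS S] ztS holomorphic_on_subset[OF E subS])
   (simp add: S_def)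
 define Kc where "Kc = cbox (Complex 1 (- 1)) (Complex 2 1)"
 have Kc: "s \<in> Kc \<longleftrightarrow> 1 \<le> Re s \<and> Re s \<le> 2 \<and> - 1 \<le> Im s \<and> Im s \<le> 1" for s
  by (auto simp: Kc_def in_cbox_complex_iff)
 have KS: "Kc \<subseteq> S" using zt_nonzero by (auto simp: S_def Kc)
 have "continuous_on Kc ((deriv ^^ k) W)"
  by (rule holomorphic_on_imp_continuous_on, rule holomorphic_on_subset[OF holomorphic_higher_deriv[OF W S] KS])
 hence "compact ((deriv ^^ k) W ` Kc)" by (rule compact_continuous_image) (simp add: Kc_def)
 hence "bounded ((deriv ^^ k) W ` Kc)" by (rule compact_imp_bounded)
 then obtain C where C0: "\<forall>x\<in>(deriv ^^ k) W ` Kc. norm x \<le> C" unfolding bounded_iff by blast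
 have t1: "tame (prin 1)" by (rule tame_dchar[OF dchar_prin1])
 define g where "g = (\<lambda>n. prin 1 n * of_real (mangoldt n) + - prin 1 n)"
 have g: "g n = of_real (mangoldt n - 1)" for n unfolding g_def prin_1 of_real_diff of_real_1 by simp
 have tg: "tame g" unfolding g_def by (intro tame_add tame_mangoldt[OF dchar_prin1] tame_minus t1)
 have bound: "norm (DSL k (\<lambda>n. of_real (mangoldt n - 1)) s) \<le> C"
  if s: "1 < Re s" "Re s \<le> 2" "\<bar>Im s\<bar> \<le> 1" for s
 proof -
  have sK: "s \<in> Kc" using s by (auto simp: Kc)
  define T where "T = S \<inter> {s. Re s > 1}"
  have T: "open T" unfolding T_def by (intro open_Int S open_halfspace_Re_gt)
  have "(deriv ^^ k) W s = (deriv ^^ k) (DS g) s"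
  proof (rule higher_deriv_transform_within_open[OF _ _ T])
   show "W holomorphic_on T" by (rule holomorphic_on_subset[OF W]) (simp add: T_def)
   show "DS g holomorphic_on T" by (rule holomorphic_on_subset[OF DS_holomorphic[OF tg]]) (simp add: T_def)
   show "s \<in> T" using sK KS s by (auto simp: T_def)
   fix w assume w: "w \<in> T"
   hence w1: "Re w > 1" and wS: "w \<in> S" by (auto simp: T_def)
   have wne: "w - 1 \<noteq> 0" using w1 by auto
   have znz: "zt w \<noteq> 0" using wS by (simp add: S_def)
   have dz: "(zt has_field_derivative deriv zt w) (at w)" by (rule holomorphic_derivI[OF ztS S wS])
   have ev: "\<forall>\<^sub>F u in nhds w. DS (prin 1) u = zt u / (u - 1)"
   proof -
    have "\<forall>\<^sub>F u in nhds w. u \<in> {u. Re u > 1}" by (rule eventually_nhds_in_open[OF open_halfspace_Re_gt]) (use w1 in simp)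
    thus ?thesis by eventually_elim (use zf_eq in \<open>simp add: zf_def\<close>)
   qed
   have "((\<lambda>u. zt u / (u - 1)) has_field_derivative (deriv zt w * (w - 1) - zt w * (1 - 0)) / ((w - 1) * (w - 1))) (at w)"
    by (intro DERIV_divide dz DERIV_diff DERIV_ident DERIV_const wne)
   hence dDS: "deriv (DS (prin 1)) w = (deriv zt w * (w - 1) - zt w * (1 - 0)) / ((w - 1) * (w - 1))"
    using deriv_cong_ev[OF ev refl] by (simp add: DERIV_imp_deriv)
   have Dw: "DS (prin 1) w = zt w / (w - 1)" using zf_eq[OF w1] by (simp add: zf_def)
   have "deriv (DS (prin 1)) w / DS (prin 1) w = deriv zt w / zt w - 1 / (w - 1)"
   proof -
    have "((d * v - z * (1 - 0)) / (v * v)) / (z / v) = d / z - 1 / v" if "v \<noteq> 0" "z \<noteq> 0" for d v z :: complex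
     using that by (simp add: field_simps)
    from this[OF wne znz, of "deriv zt w"] show ?thesis by (simp only: dDS Dw)
   qed
   note quot = this
   have L: "DS (\<lambda>n. prin 1 n * of_real (mangoldt n)) w = 1 / (w - 1) - deriv zt w / zt w"
   proof -
    note quot
    with DS_log_deriv[OF dchar_prin1 w1]
    have "- DS (\<lambda>n. prin 1 n * of_real (mangoldt n)) w = deriv zt w / zt w - 1 / (w - 1)" by (simp only:)
    hence "- (- DS (\<lambda>n. prin 1 n * of_real (mangoldt n)) w) = - (deriv zt w / zt w - 1 / (w - 1))" by (simp only:)
    thus ?thesis by (simp only: minus_minus minus_diff_eq)
   qed
   have "DS g w = DS (\<lambda>n. prin 1 n * of_real (mangoldt n)) w + - DS (prin 1) w"
    unfolding g_def by (subst DS_add[OF tame_mangoldt[OF dchar_prin1] tame_minus[OF t1] w1], subst DS_minus[OF t1 w1]) (rule refl)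
   also have "... = 1 / (w - 1) - deriv zt w / zt w - zt w / (w - 1)" by (simp only: L Dw diff_conv_add_uminus)
   also have "... = W w" using wne by (simp add: W_def E_def zt_1 diff_divide_distrib)
   finally show "W w = DS g w" by simp
  qed
  also have "... = (-1) ^ k * DSL k g s" by (rule DS_higher_deriv[OF tg s(1)])
  finally have "norm ((deriv ^^ k) W s) = norm (DSL k (\<lambda>n. of_real (mangoldt n - 1)) s)"
   unfolding g by (simp add: norm_mult norm_power)
  thus ?thesis using C0 sK by (metis imageI)
 qed
 have "max C 0 \<ge> 0" by simp
 moreover have "\<forall>s. 1 < Re s \<and> Re s \<le> 2 \<and> \<bar>Im s\<bar> \<le> 1 -->
  norm (DSL k (\<lambda>n. of_real (mangoldt n - 1)) s) \<le> max C 0"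
  using bound by (meson max.coboundedI1)
 ultimately show ?thesis by blast
qed

lemma zeta_logderiv:
 assumes eta: "\<eta> > 0"
 shows "\<exists>C\<ge>0. \<forall>s. 1 < Re s \<and> Re s \<le> 2 -->
  norm (DSL k (\<lambda>n. of_real (mangoldt n - 1)) s) \<le> C * (\<bar>Im s\<bar> + 2) powr \<eta>"
proof -
 obtain C1 where C1: "C1 \<ge> 0" "\<And>s. 1 < Re s \<and> Re s \<le> 2 \<and> \<bar>Im s\<bar> \<ge> 1/2 ==>
  norm (DSL k (\<lambda>n. of_real (mangoldt n - 1)) s) \<le> C1 * (\<bar>Im s\<bar> + 2) powr \<eta>"
  using zeta_logderiv_far[OF eta] by blast
 obtain C2 where C2: "C2 \<ge> 0" "\<And>s. 1 < Re s \<and> Re s \<le> 2 \<and> \<bar>Im s\<bar> \<le> 1 ==>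
  norm (DSL k (\<lambda>n. of_real (mangoldt n - 1)) s) \<le> C2"
  using zeta_logderiv_near by blast
 show ?thesis
 proof (intro exI conjI allI impI)
  show "max C1 C2 \<ge> 0" using C1 by simp
  fix s assume s: "1 < Re s \<and> Re s \<le> 2"
  have p1: "(\<bar>Im s\<bar> + 2) powr \<eta> \<ge> 1" using eta by (intro ge_one_powr_ge_zero) auto
  show "norm (DSL k (\<lambda>n. of_real (mangoldt n - 1)) s) \<le> max C1 C2 * (\<bar>Im s\<bar> + 2) powr \<eta>"
  proof (cases "\<bar>Im s\<bar> \<ge> 1/2")
   case True
   hence "norm (DSL k (\<lambda>n. of_real (mangoldt n - 1)) s) \<le> C1 * (\<bar>Im s\<bar> + 2) powr \<eta>"
    using C1(2) s by blast
   also have "... \<le> max C1 C2 * (\<bar>Im s\<bar> + 2) powr \<eta>" by (intro mult_right_mono) auto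
   finally show ?thesis .
  next
   case False
   hence "norm (DSL k (\<lambda>n. of_real (mangoldt n - 1)) s) \<le> C2" using C2(2) s by simp
   also have "... \<le> max C1 C2 * 1" by simp
   also have "... \<le> max C1 C2 * (\<bar>Im s\<bar> + 2) powr \<eta>" using p1 C1 by (intro mult_left_mono) auto
   finally show ?thesis .
  qed
 qed
qed

section \<open>Perron's formula\<close>

text \<open>The Perron kernel of the weight \<open>max 0 (1 - 1 / y)\<close>, which for
  \<open>y = x / n\<close> is \<open>1 - n / x\<close> up to \<open>x\<close>. The second factor in
  the denominator makes the integral over a vertical line absolutely convergent.\<close>

definition pk :: "real => complex => complex" where
 "pk y s = of_real y powr s / (s * (s + 1))"

lemma norm_real_powr: "y > 0 ==> norm (of_real y powr s :: complex) = y powr Re s"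
 using norm_powr_real_powr[of "of_real y" s] by simp

lemma pk_bound:
 assumes "y > 0" "norm s \<ge> A" "norm (s + 1) \<ge> B" "A > 0" "B > 0" "y powr Re s \<le> Y"
 shows "norm (pk y s) \<le> Y / (A * B)" unfolding pk_def norm_divide norm_mult norm_real_powr[OF assms(1)]
 using assms by (intro frac_le mult_mono order_trans[OF powr_ge_zero assms(6)] mult_pos_pos) auto

lemma seg_h:
 assumes "z \<in> closed_segment (Complex a t) (Complex b t)"
 shows "Im z = t" "min a b \<le> Re z" "Re z \<le> max a b"
 using assms by (auto simp: closed_segment_same_Im closed_segment_eq_real_ivl split: if_splits)

lemma seg_v:
 assumes "z \<in> closed_segment (Complex t a) (Complex t b)"
 shows "Re z = t" "min a b \<le> Im z" "Im z \<le> max a b"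
 using assms by (auto simp: closed_segment_same_Re closed_segment_eq_real_ivl split: if_splits)

lemma contour_integral_rectpath:
 assumes "Re a1 \<le> Re a3" "Im a1 \<le> Im a3" "continuous_on (path_image (rectpath a1 a3)) f"
 shows "contour_integral (rectpath a1 a3) f =
  contour_integral (linepath a1 (Complex (Re a3) (Im a1))) f + contour_integral (linepath (Complex (Re a3) (Im a1)) a3) f
 + contour_integral (linepath a3 (Complex (Re a1) (Im a3))) f + contour_integral (linepath (Complex (Re a1) (Im a3)) a1) f"
proof -
 define a2 where "a2 = Complex (Re a3) (Im a1)"
 define a4 where "a4 = Complex (Re a1) (Im a3)"
 have pi: "path_image (rectpath a1 a3) = closed_segment a1 a2 \<union> closed_segment a2 a3 \<union> closed_segment a3 a4 \<union> closed_segment a4 a1"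
  unfolding rectpath_def Let_def a2_def[symmetric] a4_def[symmetric] by (simp add: path_image_join Un_assoc)
 have sub: "closed_segment a1 a2 \<subseteq> path_image (rectpath a1 a3)" "closed_segment a2 a3 \<subseteq> path_image (rectpath a1 a3)"
  "closed_segment a3 a4 \<subseteq> path_image (rectpath a1 a3)" "closed_segment a4 a1 \<subseteq> path_image (rectpath a1 a3)"
  unfolding pi by blast+
 have c: "f contour_integrable_on linepath a1 a2" "f contour_integrable_on linepath a2 a3"
  "f contour_integrable_on linepath a3 a4" "f contour_integrable_on linepath a4 a1"
  by (intro contour_integrable_continuous_linepath continuous_on_subset[OF assms(3)] sub)+
 show ?thesis unfolding rectpath_def Let_def a2_def[symmetric] a4_def[symmetric]
  using c by (simp add: contour_integrable_joinI valid_path_join)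
qed

lemma complex_eq_neg1: "(z::complex) + 1 = 0 \<longleftrightarrow> z = -1" using eq_neg_iff_add_eq_0[of z 1] by blast

lemma real_powr_eq_exp: "y > 0 ==> complex_of_real y powr s = exp (s * of_real (ln y))"
 by (simp add: powr_def Ln_of_real)

lemma pk_continuous: assumes "y > 0" "0 \<notin> A" "-1 \<notin> A" shows "continuous_on A (pk y)"
proof -
 have "continuous_on A (\<lambda>s. exp (s * of_real (ln y)) / (s * (s + 1)))"
  using assms complex_eq_neg1 by (intro continuous_intros) auto
 thus ?thesis using assms(1) by (simp add: pk_def[abs_def] real_powr_eq_exp)
qed

lemma pk_continuous_h: "y > 0 ==> t \<noteq> 0 ==> continuous_on (closed_segment (Complex a t) (Complex b t)) (pk y)"
 by (rule pk_continuous) (auto dest: seg_h(1))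

lemma pk_continuous_v: "y > 0 ==> t \<noteq> 0 ==> t \<noteq> -1 ==> continuous_on (closed_segment (Complex t a) (Complex t b)) (pk y)"
 by (rule pk_continuous) (auto dest: seg_v(1))

lemma norm_Complex_h: "norm (Complex a t - Complex b t) = \<bar>a - b\<bar>"
proof -
 have "Complex a t - Complex b t = of_real (a - b)" by (simp add: complex_eq_iff)
 thus ?thesis by (simp only: norm_of_real)
qed

lemma norm_Complex_v: "norm (Complex t a - Complex t b) = \<bar>a - b\<bar>"
proof -
 have "Complex t a - Complex t b = \<i> * of_real (a - b)" by (simp add: complex_eq_iff)
 thus ?thesis by (simp only: norm_mult norm_of_real norm_ii mult_1)
qed

lemma norm_triangle3: "norm (a + b + c :: complex) \<le> norm a + norm b + norm c"
 using norm_triangle_ineq[of "a + b" c] norm_triangle_ineq[of a b] by linarith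

lemma pk_reverse_h: "y > 0 ==> t \<noteq> 0 ==>
 contour_integral (linepath (Complex a t) (Complex b t)) (pk y) = - contour_integral (linepath (Complex b t) (Complex a t)) (pk y)"
 by (rule contour_integral_reverse_linepath[OF pk_continuous_h])

lemma pk_reverse_v: "y > 0 ==> t \<noteq> 0 ==> t \<noteq> -1 ==>
 contour_integral (linepath (Complex t a) (Complex t b)) (pk y) = - contour_integral (linepath (Complex t b) (Complex t a)) (pk y)"
 by (rule contour_integral_reverse_linepath[OF pk_continuous_v])

text \<open>The other three sides of a rectangle closed to the left (\<open>u = - R\<close>) or to
  the right (\<open>u = R\<close>). The hypothesis \<open>mono\<close> says that
  \<open>y powr r\<close> does not exceed its value on the line;
  \<open>8 = 2 + 4 + 2\<close>.\<close>

lemma pk_three_sides: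
 assumes y: "y > 0" and s: "1 < \<sigma>" "\<sigma> \<le> 2" and R: "R \<ge> 4" and u: "\<bar>u\<bar> = R"
  and mono: "\<And>r. min u \<sigma> \<le> r ==> r \<le> max u \<sigma> ==> y powr r \<le> y powr \<sigma>"
 shows "norm (contour_integral (linepath (Complex \<sigma> (- R)) (Complex u (- R))) (pk y)
   + contour_integral (linepath (Complex u (- R)) (Complex u R)) (pk y)
   + contour_integral (linepath (Complex u R) (Complex \<sigma> R)) (pk y)) \<le> 8 * y powr \<sigma> / R"
proof -
 have R0: "R > 0" using R by simp
 have hb: "norm (pk y z) \<le> y powr \<sigma> / (R * R)" if "z \<in> closed_segment (Complex a t) (Complex b t)" "\<bar>t\<bar> = R" "{a, b} = {u, \<sigma>}" for z a b t
 proof (rule pk_bound[OF y])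
  have z: "Im z = t" "min u \<sigma> \<le> Re z" "Re z \<le> max u \<sigma>" using seg_h[OF that(1)] that(3) by (auto simp: doubleton_eq_iff)
  thus "y powr Re z \<le> y powr \<sigma>" by (intro mono)
  show "norm z \<ge> R" "norm (z + 1) \<ge> R" using z that(2) abs_Im_le_cmod[of z] abs_Im_le_cmod[of "z + 1"] by auto
 qed (use R0 in auto)
 have hl: "norm (contour_integral (linepath (Complex a t) (Complex b t)) (pk y)) \<le> y powr \<sigma> / (R * R) * (2 * R)" if "\<bar>t\<bar> = R" "{a, b} = {u, \<sigma>}" for a b t
 proof -
  have "norm (contour_integral (linepath (Complex a t) (Complex b t)) (pk y)) \<le> y powr \<sigma> / (R * R) * norm (Complex b t - Complex a t)"
   by (rule contour_integral_bound_linepath[OF contour_integrable_continuous_linepath[OF pk_continuous_h[OF y]]])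
    (use that R hb in auto)
  also have "... \<le> y powr \<sigma> / (R * R) * (2 * R)"
   unfolding norm_Complex_h using that u s R by (intro mult_left_mono) (auto simp: doubleton_eq_iff)
  finally show ?thesis .
 qed
 have v: "norm (contour_integral (linepath (Complex u (- R)) (Complex u R)) (pk y)) \<le> y powr \<sigma> / (R * (R / 2)) * norm (Complex u R - Complex u (- R))"
 proof (rule contour_integral_bound_linepath[OF contour_integrable_continuous_linepath[OF pk_continuous_v[OF y]]])
  show "norm (pk y z) \<le> y powr \<sigma> / (R * (R / 2))" if "z \<in> closed_segment (Complex u (- R)) (Complex u R)" for z
  proof (rule pk_bound[OF y])
   have z: "Re z = u" by (rule seg_v(1)[OF that])
   show "y powr Re z \<le> y powr \<sigma>" unfolding z by (rule mono) auto
   show "norm z \<ge> R" "norm (z + 1) \<ge> R / 2" using z u R abs_Re_le_cmod[of z] abs_Re_le_cmod[of "z + 1"] by auto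
  qed (use R0 in auto)
 qed (use R u in auto)
 have "norm (contour_integral (linepath (Complex \<sigma> (- R)) (Complex u (- R))) (pk y)
   + contour_integral (linepath (Complex u (- R)) (Complex u R)) (pk y)
   + contour_integral (linepath (Complex u R) (Complex \<sigma> R)) (pk y))
  \<le> y powr \<sigma> / (R * R) * (2 * R) + y powr \<sigma> / (R * (R / 2)) * norm (Complex u R - Complex u (- R)) + y powr \<sigma> / (R * R) * (2 * R)"
  by (rule order_trans[OF norm_triangle3]) (intro add_mono hl v; use R in auto)
 also have "... = 8 * y powr \<sigma> / R" unfolding norm_Complex_v using R0 by (simp add: field_simps)
 finally show ?thesis .
qed

text \<open>Closing to the left encloses the poles 0 and -1 with residues 1 and
  \<open>- 1 / y\<close>. In partial fractions these are two instances of Cauchy's integral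
  formula.\<close>

lemma perron_kernel_ge:
 assumes y: "y \<ge> 1" and s: "1 < \<sigma>" "\<sigma> \<le> 2" and R: "R \<ge> 4"
 shows "norm (contour_integral (linepath (Complex \<sigma> (- R)) (Complex \<sigma> R)) (pk y) - 2 * of_real pi * \<i> * of_real (1 - 1 / y))
  \<le> 8 * y powr \<sigma> / R"
proof -
 define a1 where "a1 = Complex (- R) (- R)"
 define a3 where "a3 = Complex \<sigma> R"
 have re: "Re a1 \<le> Re a3" "Im a1 \<le> Im a3" using s R by (auto simp: a1_def a3_def)
 have pimg: "path_image (rectpath a1 a3) = cbox a1 a3 - box a1 a3" by (rule path_image_rectpath_cbox_minus_box[OF re])
 have b0: "0 \<in> box a1 a3" and b1: "-1 \<in> box a1 a3" using s R by (auto simp: in_box_complex_iff a1_def a3_def)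
 have n01: "0 \<notin> path_image (rectpath a1 a3)" "-1 \<notin> path_image (rectpath a1 a3)" using b0 b1 pimg by auto
 have hol: "(\<lambda>w. of_real y powr w :: complex) holomorphic_on UNIV" unfolding powr_def using y by (auto intro!: holomorphic_intros)
 have w0: "winding_number (rectpath a1 a3) 0 = 1" by (rule winding_number_rectpath[OF b0])
 have w1: "winding_number (rectpath a1 a3) (-1) = 1" by (rule winding_number_rectpath[OF b1])
 have I0: "((\<lambda>w. of_real y powr w / (w - 0)) has_contour_integral (2 * pi * \<i> * winding_number (rectpath a1 a3) 0 * of_real y powr 0)) (rectpath a1 a3)"
  by (rule Cauchy_integral_formula_convex_simple[OF convex_UNIV hol]) (use n01 in auto)
 have I1: "((\<lambda>w. of_real y powr w / (w - (-1))) has_contour_integral (2 * pi * \<i> * winding_number (rectpath a1 a3) (-1) * of_real y powr (-1))) (rectpath a1 a3)"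
  by (rule Cauchy_integral_formula_convex_simple[OF convex_UNIV hol]) (use n01 in auto)
 have "((\<lambda>w. of_real y powr w / (w - 0) - of_real y powr w / (w - (-1))) has_contour_integral
  (2 * pi * \<i> * winding_number (rectpath a1 a3) 0 * of_real y powr 0 - 2 * pi * \<i> * winding_number (rectpath a1 a3) (-1) * of_real y powr (-1))) (rectpath a1 a3)"
  by (rule has_contour_integral_diff[OF I0 I1])
 moreover have "2 * pi * \<i> * winding_number (rectpath a1 a3) 0 * of_real y powr 0 - 2 * pi * \<i> * winding_number (rectpath a1 a3) (-1) * of_real y powr (-1)
  = 2 * of_real pi * \<i> * of_real (1 - 1 / y)"
 proof -
  have "complex_of_real y powr 0 = 1" using y by simp
  moreover have "complex_of_real y powr (-1) = of_real (1 / y)" using powr_of_real[of y "-1"] y by (simp add: powr_minus_divide)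
  ultimately show ?thesis unfolding w0 w1 by (simp add: algebra_simps)
 qed
 ultimately have "(pk y has_contour_integral (2 * of_real pi * \<i> * of_real (1 - 1 / y))) (rectpath a1 a3)"
 proof -
  assume F: "((\<lambda>w. of_real y powr w / (w - 0) - of_real y powr w / (w - (-1))) has_contour_integral
  (2 * pi * \<i> * winding_number (rectpath a1 a3) 0 * of_real y powr 0 - 2 * pi * \<i> * winding_number (rectpath a1 a3) (-1) * of_real y powr (-1))) (rectpath a1 a3)"
   and E: "2 * pi * \<i> * winding_number (rectpath a1 a3) 0 * of_real y powr 0 - 2 * pi * \<i> * winding_number (rectpath a1 a3) (-1) * of_real y powr (-1)
    = 2 * of_real pi * \<i> * of_real (1 - 1 / y)"
  show ?thesis
  proof (rule has_contour_integral_eq[OF F[unfolded E]])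
   fix x assume x: "x \<in> path_image (rectpath a1 a3)"
   have "x \<noteq> 0" "x + 1 \<noteq> 0" using x n01 complex_eq_neg1 by auto
   thus "of_real y powr x / (x - 0) - of_real y powr x / (x - (-1)) = pk y x" by (simp add: pk_def field_simps)
  qed
 qed
 hence tot: "contour_integral (rectpath a1 a3) (pk y) = 2 * of_real pi * \<i> * of_real (1 - 1 / y)"
  by (rule contour_integral_unique)
 have cont: "continuous_on (path_image (rectpath a1 a3)) (pk y)" by (rule pk_continuous) (use y n01 in auto)
 note four = contour_integral_rectpath[OF re cont]
 have "norm (- contour_integral (linepath (Complex (- R) (- R)) (Complex \<sigma> (- R))) (pk y)
   - contour_integral (linepath (Complex (- R) R) (Complex (- R) (- R))) (pk y)
   - contour_integral (linepath (Complex \<sigma> R) (Complex (- R) R)) (pk y)) \<le> 8 * y powr \<sigma> / R"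
  using pk_three_sides[of y \<sigma> R "- R"] y s R pk_reverse_h[of y "- R" \<sigma> "- R"] pk_reverse_v[of y "- R" "- R" R] pk_reverse_h[of y R "- R" \<sigma>]
  by (auto simp: powr_mono)
 moreover have "contour_integral (linepath (Complex \<sigma> (- R)) (Complex \<sigma> R)) (pk y) - 2 * of_real pi * \<i> * of_real (1 - 1 / y) =
  - contour_integral (linepath (Complex (- R) (- R)) (Complex \<sigma> (- R))) (pk y)
   - contour_integral (linepath (Complex (- R) R) (Complex (- R) (- R))) (pk y)
   - contour_integral (linepath (Complex \<sigma> R) (Complex (- R) R)) (pk y)"
  unfolding tot[symmetric] four by (simp add: a1_def a3_def)
 ultimately show ?thesis by (simp only:)
qed

text \<open>Closing to the right encloses no pole.\<close>

lemma perron_kernel_le: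
 assumes y: "0 < y" "y \<le> 1" and s: "1 < \<sigma>" "\<sigma> \<le> 2" and R: "R \<ge> 4"
 shows "norm (contour_integral (linepath (Complex \<sigma> (- R)) (Complex \<sigma> R)) (pk y)) \<le> 8 * y powr \<sigma> / R"
proof -
 define a1 where "a1 = Complex \<sigma> (- R)"
 define a3 where "a3 = Complex R R"
 have re: "Re a1 \<le> Re a3" "Im a1 \<le> Im a3" using s R by (auto simp: a1_def a3_def)
 have sub: "path_image (rectpath a1 a3) \<subseteq> {w. Re w > 0}"
  using path_image_rectpath_subset_cbox[OF re] s by (auto simp: in_cbox_complex_iff a1_def)
 have n01: "0 \<notin> path_image (rectpath a1 a3)" "-1 \<notin> path_image (rectpath a1 a3)" using sub by auto
 have cont: "continuous_on (path_image (rectpath a1 a3)) (pk y)" by (rule pk_continuous) (use y n01 in auto)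
 have hol: "pk y holomorphic_on {w. Re w > 0}"
  unfolding pk_def[abs_def] powr_def using y by (auto intro!: holomorphic_intros simp: complex_eq_neg1)
 have "(pk y has_contour_integral 0) (rectpath a1 a3)"
  by (rule Cauchy_theorem_convex_simple[OF hol convex_halfspace_Re_gt]) (use sub in auto)
 hence tot: "contour_integral (rectpath a1 a3) (pk y) = 0" by (rule contour_integral_unique)
 note four = contour_integral_rectpath[OF re cont]
 have "contour_integral (linepath (Complex \<sigma> (- R)) (Complex \<sigma> R)) (pk y) =
  contour_integral (linepath (Complex \<sigma> (- R)) (Complex R (- R))) (pk y) + contour_integral (linepath (Complex R (- R)) (Complex R R)) (pk y)
   + contour_integral (linepath (Complex R R) (Complex \<sigma> R)) (pk y)"
  using four pk_reverse_v[of y \<sigma> R "- R"] y s unfolding tot by (simp add: a1_def a3_def)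
 thus ?thesis using pk_three_sides[of y \<sigma> R R] y s R by (auto simp: powr_mono')
qed

lemma perron_kernel:
 assumes y: "0 < y" and s: "1 < \<sigma>" "\<sigma> \<le> 2" and R: "R \<ge> 4"
 shows "norm (contour_integral (linepath (Complex \<sigma> (- R)) (Complex \<sigma> R)) (pk y) - 2 * of_real pi * \<i> * of_real (max 0 (1 - 1 / y)))
  \<le> 8 * y powr \<sigma> / R"
proof (cases "y \<ge> 1")
 case True
 hence "max 0 (1 - 1 / y) = 1 - 1 / y" by simp
 thus ?thesis using perron_kernel_ge[OF True s R] by simp
next
 case False
 hence "max 0 (1 - 1 / y) = 0" using y by (simp add: max_def field_simps)
 thus ?thesis using perron_kernel_le[OF y _ s R] False by simp
qed

text \<open>The bound has to be free of \<open>R\<close>, which tends to infinity in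
  \<open>perron_sum\<close>.\<close>

lemma integral_majorant:
 assumes "R \<ge> 0"
 shows "(\<lambda>t::real. (1 + \<bar>t\<bar>) powr (-3/2)) integrable_on {- R..R}"
  and "integral {- R..R} (\<lambda>t::real. (1 + \<bar>t\<bar>) powr (-3/2)) \<le> 4"
proof -
 let ?g = "\<lambda>t::real. (1 + \<bar>t\<bar>) powr (-3/2)"
 have "continuous_on {- R..R} ?g" by (intro continuous_intros) auto
 thus int: "?g integrable_on {- R..R}" by (rule integrable_continuous_real)
 have p: "(?g has_integral (2 - 2 * (1 + R) powr (-1/2))) {0..R}"
 proof -
  have "((\<lambda>t. (1 + t) powr (-3/2)) has_integral (- 2 * (1 + R) powr (-1/2) - (- 2 * (1 + 0) powr (-1/2)))) {0..R}"
  proof (rule fundamental_theorem_of_calculus)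
   fix t assume t: "t \<in> {0..R}"
   have "((\<lambda>t. - 2 * (1 + t) powr (-1/2)) has_real_derivative - 2 * ((-1/2) * (1 + t) powr (-1/2 - 1) * (0 + 1))) (at t within {0..R})"
    by (intro DERIV_cmult DERIV_chain2[OF has_real_derivative_powr] DERIV_add DERIV_const DERIV_ident) (use t in auto)
   thus "((\<lambda>t. - 2 * (1 + t) powr (-1/2)) has_vector_derivative (1 + t) powr (-3/2)) (at t within {0..R})"
    by (simp add: has_real_derivative_iff_has_vector_derivative)
  qed (rule assms)
  hence "((\<lambda>t. (1 + t) powr (-3/2)) has_integral (2 - 2 * (1 + R) powr (-1/2))) {0..R}" by simp
  thus ?thesis by (rule has_integral_eq[rotated]) auto
 qed
 have n: "(?g has_integral (2 - 2 * (1 + R) powr (-1/2))) {- R..0}"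
  using has_integral_reflect_real[of "\<lambda>t. ?g t" "2 - 2 * (1 + R) powr (-1/2)" R 0] p by simp
 have "(?g has_integral (2 - 2 * (1 + R) powr (-1/2)) + (2 - 2 * (1 + R) powr (-1/2))) {- R..R}"
  by (rule has_integral_combine[OF _ _ n p]) (use assms in auto)
 hence "integral {- R..R} ?g = 4 - 4 * (1 + R) powr (-1/2)" by (simp add: integral_unique)
 thus "integral {- R..R} ?g \<le> 4" by simp
qed

text \<open>To the right of 1 both factors of the denominator are at least
  \<open>(1 + \<bar>Im s\<bar>) / sqrt 2\<close>, so the growth exponent 1/2 leaves the integrable
  exponent -3/2.\<close>

lemma majorant_bound:
 assumes s: "Re s \<ge> 1"
 shows "(\<bar>Im s\<bar> + 2) powr (1/2) / (norm s * norm (s + 1)) \<le> 3 * (1 + \<bar>Im s\<bar>) powr (-3/2)"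
proof -
 define v where "v = 1 + \<bar>Im s\<bar>"
 have v: "v \<ge> 1" by (simp add: v_def)
 have sq: "(norm s)\<^sup>2 \<ge> v\<^sup>2 / 2"
 proof -
  have "(Re s)\<^sup>2 \<ge> 1" using s by (simp add: power2_eq_square mult_mono[of 1 "Re s" 1 "Re s", simplified])
  moreover have "v\<^sup>2 = 1 + 2 * \<bar>Im s\<bar> + (Im s)\<^sup>2" by (simp add: v_def power2_eq_square algebra_simps)
  moreover have "2 * \<bar>Im s\<bar> \<le> 1 + (Im s)\<^sup>2"
   using zero_le_power2[of "\<bar>Im s\<bar> - 1"] by (simp add: power2_diff)
  ultimately show ?thesis unfolding cmod_power2 by linarith
 qed
 have "norm s \<le> norm (s + 1)" using s by (auto simp: cmod_def intro!: power_mono)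
 hence "(norm s)\<^sup>2 \<le> norm s * norm (s + 1)" by (simp add: power2_eq_square mult_left_mono)
 hence den: "v\<^sup>2 / 2 \<le> norm s * norm (s + 1)" using sq by linarith
 have "(\<bar>Im s\<bar> + 2) powr (1/2) \<le> (2 * v) powr (1/2)" by (intro powr_mono2) (auto simp: v_def)
 also have "... = sqrt 2 * v powr (1/2)" using v by (simp add: powr_mult powr_half_sqrt)
 also have "... \<le> 3/2 * v powr (1/2)" by (intro mult_right_mono real_le_lsqrt) (auto simp: power2_eq_square)
 finally have num: "(\<bar>Im s\<bar> + 2) powr (1/2) \<le> 3/2 * v powr (1/2)" .
 have "(\<bar>Im s\<bar> + 2) powr (1/2) / (norm s * norm (s + 1)) \<le> (3/2 * v powr (1/2)) / (v\<^sup>2 / 2)"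
  using num den v by (intro frac_le) auto
 also have "... = 3 * (v powr (1/2) / v powr 2)" using v by (simp add: powr_numeral)
 also have "v powr (1/2) / v powr 2 = v powr (1/2 - 2)" by (rule powr_diff[symmetric])
 also have "v powr (1/2 - 2) = v powr (-3/2)" by simp
 finally show ?thesis by (simp add: v_def)
qed

text \<open>Termwise integration up to height \<open>R\<close>: by absolute convergence the errors
  of the kernels add up to O(1 / R), and \<open>R\<close> tends to infinity. The constant is
  \<open>3 * 4\<close> from the majorant, divided by \<open>2 * pi > 6\<close>.\<close>

lemma perron_sum:
 assumes a: "tame a" and s: "1 < \<sigma>" "\<sigma> \<le> 2" and x: "x \<ge> 1" and B: "B \<ge> 0"
  and D: "\<And>t. norm (DS a (Complex \<sigma> t)) \<le> B * (\<bar>t\<bar> + 2) powr (1/2)"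
 shows "norm (\<Sum>n=1..nat \<lfloor>x\<rfloor>. a n * of_real (1 - real n / x)) \<le> 2 * B * x powr \<sigma>"
proof -
 define S where "S = (\<Sum>n=1..nat \<lfloor>x\<rfloor>. a n * of_real (1 - real n / x))"
 define A where "A = (\<Sum>n. norm (a n) * real n powr (- \<sigma>))"
 have sA: "summable (\<lambda>n. norm (a n) * real n powr (- \<sigma>))" using a s by (simp add: tame_def)
 define l where "l = (\<lambda>R. linepath (Complex \<sigma> (- R)) (Complex \<sigma> R))"
 have key: "norm (2 * of_real pi * \<i> * S) \<le> 12 * B * x powr \<sigma> + 8 * x powr \<sigma> * A / R" if R: "R \<ge> 4" for R :: real
 proof -
  let ?F = "\<lambda>z. \<Sum>n. a n * of_nat n powr (- z) * (of_real x powr z / (z * (z + 1)))"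
  have Rel: "Re z = \<sigma> \<and> -R \<le> Im z \<and> Im z \<le> R" if "z \<in> path_image (l R)" for z
   using that seg_v[of z \<sigma> "- R" R] R by (auto simp: l_def)
  have z0: "z \<noteq> 0 \<and> z + 1 \<noteq> 0 \<and> norm z \<ge> 1 \<and> norm (z + 1) \<ge> 1" if "Re z = \<sigma>" for z
   using that s complex_Re_le_cmod[of z] complex_Re_le_cmod[of "z + 1"] by (auto simp: complex_eq_neg1)
  have cz: "of_nat n powr (- z) * (of_real x powr z / (z * (z + 1))) = pk (x / real n) z" if n: "n > 0" for n z
  proof -
   have "of_real (x / real n) powr z = (of_real x powr z * of_nat n powr (- z) :: complex)"
   proof -
    have e: "of_nat n powr (- z) = exp (- z * of_real (ln (real n)))" using real_powr_eq_exp[of "real n" "- z"] n by simp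
    have "of_real (x / real n) powr z = exp (z * of_real (ln (x / real n)))" by (rule real_powr_eq_exp) (use x n in simp)
    also have "ln (x / real n) = ln x - ln (real n)" using x n by (simp add: ln_div)
    also have "exp (z * of_real (ln x - ln (real n))) = exp (z * of_real (ln x)) * exp (- z * of_real (ln (real n)))"
     by (simp add: exp_add[symmetric] algebra_simps)
    also have "exp (z * of_real (ln x)) = of_real x powr z" using real_powr_eq_exp[of x z] x by simp
    finally show ?thesis unfolding e .
   qed
   thus ?thesis by (simp add: pk_def)
  qed
  have ci: "pk y contour_integrable_on l R" if "y > 0" for y unfolding l_def
   using that s by (intro contour_integrable_continuous_linepath pk_continuous_v) auto
  define G where "G = (\<lambda>N z. \<Sum>n<N. a n * of_nat n powr (- z) * (of_real x powr z / (z * (z + 1))))"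
  have G_eq: "G N z = (\<Sum>n\<in>{1..<N}. a n * pk (x / real n) z)" for N z
  proof -
   have "G N z = (\<Sum>n\<in>{1..<N}. a n * of_nat n powr (- z) * (of_real x powr z / (z * (z + 1))))"
    unfolding G_def by (rule sum.mono_neutral_right) (auto simp: not_less_eq_eq One_nat_def)
   also have "... = (\<Sum>n\<in>{1..<N}. a n * pk (x / real n) z)"
   proof (rule sum.cong)
    fix n assume "n \<in> {1..<N}"
    hence "n > 0" by simp
    thus "a n * of_nat n powr (- z) * (of_real x powr z / (z * (z + 1))) = a n * pk (x / real n) z" by (simp only: mult.assoc cz)
   qed simp
   finally show ?thesis .
  qed
  have cia: "(\<lambda>z. a n * pk (x / real n) z) contour_integrable_on l R" if "n \<ge> 1" for n
   by (intro contour_integrable_lmul ci) (use x that in auto)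
  have Gint: "G N contour_integrable_on l R" for N unfolding G_eq[abs_def] by (intro contour_integrable_sum cia) auto
  have ul: "uniform_limit (path_image (l R)) G ?F sequentially" unfolding G_def
  proof (rule Weierstrass_m_test)
   show "summable (\<lambda>n. norm (a n) * real n powr (- \<sigma>) * x powr \<sigma>)" by (rule summable_mult2[OF sA])
   fix n z assume z: "z \<in> path_image (l R)"
   have "norm (of_real x powr z / (z * (z + 1))) \<le> x powr \<sigma> / 1"
   proof -
    have "1 * 1 \<le> norm z * norm (z + 1)" using z0[of z] Rel[OF z] by (intro mult_mono) auto
    thus ?thesis using Rel[OF z] x by (simp only: norm_divide norm_mult norm_real_powr) (intro frac_le, auto simp: norm_real_powr)
   qed
   thus "norm (a n * of_nat n powr (- z) * (of_real x powr z / (z * (z + 1)))) \<le> norm (a n) * real n powr (- \<sigma>) * x powr \<sigma>"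
    unfolding norm_mult[of "a n * of_nat n powr (- z)"] norm_DS_term using Rel[OF z] by (intro mult_mono) auto
  qed
  have F_eq: "?F z = DS a z * (of_real x powr z / (z * (z + 1)))" if "Re z = \<sigma>" for z
   unfolding DS_def by (rule suminf_mult2[OF tame_summable[OF a], symmetric]) (use that s in simp)
  have vd: "norm (vector_derivative (l R) (at t)) \<le> 2 * R" for t
   using R by (simp add: l_def vector_derivative_linepath_at norm_Complex_v)
  have vp: "valid_path (l R)" by (simp add: l_def)
  have Fint: "?F contour_integrable_on l R" and
   Flim: "(\<lambda>N. contour_integral (l R) (G N)) \<longlonglongrightarrow> contour_integral (l R) ?F"
   using contour_integral_uniform_limit[OF always_eventually[OF allI[OF Gint]] ul vd vp] by auto
  have CG: "contour_integral (l R) (G N) = (\<Sum>n\<in>{1..<N}. a n * contour_integral (l R) (pk (x / real n)))" for N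
  proof -
   have "contour_integral (l R) (G N) = (\<Sum>n\<in>{1..<N}. contour_integral (l R) (\<lambda>z. a n * pk (x / real n) z))"
    unfolding G_eq[abs_def] by (rule contour_integral_sum) (use cia in auto)
   also have "... = (\<Sum>n\<in>{1..<N}. a n * contour_integral (l R) (pk (x / real n)))"
    by (rule sum.cong) (use ci x in \<open>auto intro!: contour_integral_lmul\<close>)
   finally show ?thesis .
  qed
  have diff: "norm (contour_integral (l R) (G N) - 2 * of_real pi * \<i> * S) \<le> 8 * x powr \<sigma> * A / R" if N: "N > nat \<lfloor>x\<rfloor>" for N
  proof -
   have "2 * of_real pi * \<i> * S = (\<Sum>n\<in>{1..<N}. a n * (2 * of_real pi * \<i> * of_real (max 0 (1 - 1 / (x / real n)))))"
   proof -
    have "S = (\<Sum>n=1..nat \<lfloor>x\<rfloor>. a n * of_real (max 0 (1 - 1 / (x / real n))))" unfolding S_def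
    proof (rule sum.cong)
     fix n assume n: "n \<in> {1..nat \<lfloor>x\<rfloor>}"
     hence "real n \<le> x" using x by (auto simp: le_nat_floor nat_le_iff le_floor_iff) linarith
     hence "max 0 (1 - 1 / (x / real n)) = 1 - real n / x" using x by (simp add: max_def)
     thus "a n * of_real (1 - real n / x) = a n * of_real (max 0 (1 - 1 / (x / real n)))" by simp
    qed simp
    also have "... = (\<Sum>n\<in>{1..<N}. a n * of_real (max 0 (1 - 1 / (x / real n))))"
    proof (rule sum.mono_neutral_left)
     show "\<forall>n\<in>{1..<N} - {1..nat \<lfloor>x\<rfloor>}. a n * of_real (max 0 (1 - 1 / (x / real n))) = 0"
     proof
      fix n assume n: "n \<in> {1..<N} - {1..nat \<lfloor>x\<rfloor>}"
      hence "n > nat \<lfloor>x\<rfloor>" by auto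
      hence "real n > x" by linarith
      hence "max 0 (1 - 1 / (x / real n)) = 0" using x by (simp add: max_def field_simps)
      thus "a n * of_real (max 0 (1 - 1 / (x / real n))) = 0" by simp
     qed
    qed (use N in auto)
    finally show ?thesis by (simp add: sum_distrib_left mult_ac)
   qed
   hence "contour_integral (l R) (G N) - 2 * of_real pi * \<i> * S =
    (\<Sum>n\<in>{1..<N}. a n * (contour_integral (l R) (pk (x / real n)) - 2 * of_real pi * \<i> * of_real (max 0 (1 - 1 / (x / real n)))))"
    unfolding CG by (simp add: sum_subtractf right_diff_distrib)
   also have "norm ... \<le> (\<Sum>n\<in>{1..<N}. 8 * x powr \<sigma> / R * (norm (a n) * real n powr (- \<sigma>)))"
   proof (rule sum_norm_le)
    fix n assume n: "n \<in> {1..<N}"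
    have "norm (contour_integral (l R) (pk (x / real n)) - 2 * of_real pi * \<i> * of_real (max 0 (1 - 1 / (x / real n)))) \<le> 8 * (x / real n) powr \<sigma> / R"
     unfolding l_def by (rule perron_kernel[OF _ s R]) (use x n in auto)
    moreover have "(x / real n) powr \<sigma> = x powr \<sigma> * real n powr (- \<sigma>)" using x n by (simp add: powr_divide powr_minus_divide)
    ultimately have "norm (a n) * norm (contour_integral (l R) (pk (x / real n)) - 2 * of_real pi * \<i> * of_real (max 0 (1 - 1 / (x / real n))))
      \<le> norm (a n) * (8 * (x powr \<sigma> * real n powr (- \<sigma>)) / R)" by (intro mult_left_mono) auto
    thus "norm (a n * (contour_integral (l R) (pk (x / real n)) - 2 * of_real pi * \<i> * of_real (max 0 (1 - 1 / (x / real n)))))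
      \<le> 8 * x powr \<sigma> / R * (norm (a n) * real n powr (- \<sigma>))" by (simp add: norm_mult mult_ac)
   qed
   also have "... = 8 * x powr \<sigma> / R * (\<Sum>n\<in>{1..<N}. norm (a n) * real n powr (- \<sigma>))" by (simp add: sum_distrib_left)
   also have "... \<le> 8 * x powr \<sigma> / R * A" unfolding A_def using R by (intro mult_left_mono sum_le_suminf sA) auto
   finally show ?thesis by (simp add: mult_ac)
  qed
  have d1: "norm (contour_integral (l R) ?F - 2 * of_real pi * \<i> * S) \<le> 8 * x powr \<sigma> * A / R"
  proof (rule tendsto_upperbound)
   show "(\<lambda>N. norm (contour_integral (l R) (G N) - 2 * of_real pi * \<i> * S)) \<longlonglongrightarrow> norm (contour_integral (l R) ?F - 2 * of_real pi * \<i> * S)"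
    by (intro tendsto_norm tendsto_diff tendsto_const Flim)
   show "\<forall>\<^sub>F N in sequentially. norm (contour_integral (l R) (G N) - 2 * of_real pi * \<i> * S) \<le> 8 * x powr \<sigma> * A / R"
    using eventually_gt_at_top[of "nat \<lfloor>x\<rfloor>"] by eventually_elim (rule diff)
  qed simp
  have d2: "norm (contour_integral (l R) ?F) \<le> 12 * B * x powr \<sigma>"
  proof -
   have I: "((\<lambda>t. ?F (Complex \<sigma> t)) has_integral (- \<i> * contour_integral (l R) ?F)) {- R..R}"
   proof -
    have "(?F has_contour_integral contour_integral (l R) ?F) (l R)" using Fint by (rule has_contour_integral_integral)
    thus ?thesis unfolding l_def by (rule has_contour_integral_linepath_same_Re_iff[THEN iffD1, rotated 5]) (use R in auto)
   qed
   have "norm (integral {- R..R} (\<lambda>t. ?F (Complex \<sigma> t))) \<le> integral {- R..R} (\<lambda>t. (3 * B * x powr \<sigma>) * (1 + \<bar>t\<bar>) powr (-3/2))"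
   proof (rule integral_norm_bound_integral)
    show "(\<lambda>t. ?F (Complex \<sigma> t)) integrable_on {- R..R}" using I by (rule has_integral_integrable)
    show "(\<lambda>t. (3 * B * x powr \<sigma>) * (1 + \<bar>t\<bar>) powr (-3/2)) integrable_on {- R..R}"
     by (intro integrable_on_mult_right integral_majorant(1)) (use R in simp)
    fix t assume "t \<in> {- R..R}"
    let ?z = "Complex \<sigma> t"
    have "norm (?F ?z) = norm (DS a ?z) * (x powr \<sigma> / (norm ?z * norm (?z + 1)))"
     using x norm_real_powr[of x ?z] F_eq[of ?z] by (simp add: norm_mult norm_divide)
    also have "... \<le> (B * (\<bar>t\<bar> + 2) powr (1/2)) * (x powr \<sigma> / (norm ?z * norm (?z + 1)))"
     by (intro mult_right_mono D) auto
    also have "... = B * x powr \<sigma> * ((\<bar>Im ?z\<bar> + 2) powr (1/2) / (norm ?z * norm (?z + 1)))" by simp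
    also have "... \<le> B * x powr \<sigma> * (3 * (1 + \<bar>Im ?z\<bar>) powr (-3/2))"
     using B s by (intro mult_left_mono majorant_bound) auto
    finally show "norm (?F ?z) \<le> (3 * B * x powr \<sigma>) * (1 + \<bar>t\<bar>) powr (-3/2)" by (simp add: mult_ac)
   qed
   also have "... = (3 * B * x powr \<sigma>) * integral {- R..R} (\<lambda>t. (1 + \<bar>t\<bar>) powr (-3/2))" by (rule integral_mult_right)
   also have "... \<le> (3 * B * x powr \<sigma>) * 4" using integral_majorant(2)[of R] R B by (intro mult_left_mono) auto
   also have "integral {- R..R} (\<lambda>t. ?F (Complex \<sigma> t)) = - \<i> * contour_integral (l R) ?F" using I by (rule integral_unique)
   finally show ?thesis by (simp add: norm_mult)
  qed
  have "norm (2 * of_real pi * \<i> * S) \<le> norm (contour_integral (l R) ?F) + norm (contour_integral (l R) ?F - 2 * of_real pi * \<i> * S)"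
   using norm_triangle_ineq4[of "contour_integral (l R) ?F" "contour_integral (l R) ?F - 2 * of_real pi * \<i> * S"] by simp
  thus ?thesis using d1 d2 by linarith
 qed
 have "norm (2 * of_real pi * \<i> * S) \<le> 12 * B * x powr \<sigma>"
 proof (rule tendsto_lowerbound)
  show "((\<lambda>R. 12 * B * x powr \<sigma> + 8 * x powr \<sigma> * A / R) \<longlongrightarrow> 12 * B * x powr \<sigma>) at_top" by real_asymp
  show "\<forall>\<^sub>F R in at_top. norm (2 * of_real pi * \<i> * S) \<le> 12 * B * x powr \<sigma> + 8 * x powr \<sigma> * A / R"
   using eventually_ge_at_top[of 4] by eventually_elim (rule key)
 qed simp
 hence "2 * pi * norm S \<le> 12 * B * x powr \<sigma>" by (simp add: norm_mult)
 moreover have "2 * 3 * norm S \<le> 2 * pi * norm S" using pi_gt3 by (intro mult_right_mono) auto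
 ultimately show ?thesis by (simp add: S_def)
qed

text \<open>On the line \<open>\<sigma> = 1 + 1 / ln y\<close> the power
  \<open>y powr \<sigma>\<close> is just \<open>exp 1 * y\<close>.\<close>

lemma perron_smooth:
 assumes b: "tame b" and B: "B \<ge> 0" and y: "ln y \<ge> 1" "y > 0"
  and D: "\<And>s. 1 < Re s ==> Re s \<le> 2 ==> norm (DS b s) \<le> B * (\<bar>Im s\<bar> + 2) powr (1/2)"
 shows "norm (\<Sum>n=1..nat \<lfloor>y\<rfloor>. b n * of_real (1 - real n / y)) \<le> 6 * B * y"
proof -
 define \<sigma> where "\<sigma> = 1 + 1 / ln y"
 have s: "1 < \<sigma>" "\<sigma> \<le> 2" using y(1) by (simp_all add: \<sigma>_def divide_le_eq del: ln_gt_zero_iff)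
 have "ln y \<ge> 0" using y(1) by linarith
 hence y1: "y \<ge> 1" unfolding ln_ge_zero_iff[OF y(2)] .
 have "norm (\<Sum>n=1..nat \<lfloor>y\<rfloor>. b n * of_real (1 - real n / y)) \<le> 2 * B * y powr \<sigma>"
  by (rule perron_sum[OF b s y1 B]) (use D[of "Complex \<sigma> t" for t] s in simp)
 also have "y powr \<sigma> = y * exp 1"
 proof -
  have "\<sigma> * ln y = ln y + 1" unfolding \<sigma>_def distrib_right using \<open>ln y \<ge> 1\<close> by (simp del: ln_gt_zero_iff)
  thus ?thesis using y(2) by (simp add: powr_def exp_add)
 qed
 also have "2 * B * (y * exp 1) \<le> 2 * B * (y * 3)" using B y exp_le by (intro mult_left_mono) auto
 finally show ?thesis by simp
qed

text \<open>The sums weighted by \<open>y - n\<close> for \<open>y = x + h\<close> and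
  \<open>y = x\<close> differ by \<open>h\<close> times the plain sum, up to the terms of the short
  interval, each at most \<open>A * h\<close>.\<close>

lemma unsmooth:
 fixes b :: "nat => complex"
 assumes x: "x > 0" and h: "h > 0" and A: "A \<ge> 0" "\<And>n. n \<ge> 1 ==> real n \<le> x + h ==> norm (b n) \<le> A"
  and T: "\<And>y. y \<in> {x, x + h} ==> norm (\<Sum>n=1..nat \<lfloor>y\<rfloor>. b n * of_real (1 - real n / y)) \<le> E * y"
 shows "norm (\<Sum>n=1..nat \<lfloor>x\<rfloor>. b n) \<le> E * ((x + h)\<^sup>2 + x\<^sup>2) / h + A * (h + 1)"
proof -
 define M where "M = nat \<lfloor>x\<rfloor>"
 define N where "N = nat \<lfloor>x + h\<rfloor>"
 have MN: "M \<le> N" using h unfolding M_def N_def by (intro nat_mono floor_mono) simp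
 define S where "S = (\<Sum>n=1..M. b n)"
 have t: "norm (\<Sum>n=1..nat \<lfloor>y\<rfloor>. b n * of_real (y - real n)) \<le> E * y\<^sup>2" if y: "y \<in> {x, x + h}" for y
 proof -
  have y0: "y > 0" using y x h by auto
  have "(\<Sum>n=1..nat \<lfloor>y\<rfloor>. b n * of_real (y - real n)) = of_real y * (\<Sum>n=1..nat \<lfloor>y\<rfloor>. b n * of_real (1 - real n / y))"
   unfolding sum_distrib_left
  proof (rule sum.cong)
   fix n
   have "complex_of_real (y - real n) = of_real y * of_real (1 - real n / y)"
    unfolding of_real_mult[symmetric] using y0 by (simp add: right_diff_distrib)
   thus "b n * of_real (y - real n) = of_real y * (b n * of_real (1 - real n / y))" by simp
  qed simp
  also have "norm ... \<le> y * (E * y)" using T[OF y] y0 by (simp add: norm_mult mult_left_mono)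
  finally show ?thesis by (simp add: power2_eq_square mult_ac)
 qed
 have split: "{1..N} = {1..M} \<union> {M<..N}" using MN by auto
 have "(\<Sum>n=1..N. b n * of_real (x + h - real n)) =
   (\<Sum>n=1..M. b n * of_real (x + h - real n)) + (\<Sum>n\<in>{M<..N}. b n * of_real (x + h - real n))"
  unfolding split by (rule sum.union_disjoint) auto
 also have "(\<Sum>n=1..M. b n * of_real (x + h - real n)) = (\<Sum>n=1..M. b n * of_real (x - real n)) + of_real h * S"
  unfolding S_def sum_distrib_left sum.distrib[symmetric] by (rule sum.cong) (auto simp: algebra_simps)
 finally have "of_real h * S = (\<Sum>n=1..N. b n * of_real (x + h - real n)) - (\<Sum>n=1..M. b n * of_real (x - real n))
   - (\<Sum>n\<in>{M<..N}. b n * of_real (x + h - real n))" by simp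
 also have "norm ... \<le> norm (\<Sum>n=1..N. b n * of_real (x + h - real n)) + norm (\<Sum>n=1..M. b n * of_real (x - real n))
   + norm (\<Sum>n\<in>{M<..N}. b n * of_real (x + h - real n))"
  by (meson add_right_mono norm_triangle_ineq4 order_trans)
 also have "... \<le> E * (x + h)\<^sup>2 + E * x\<^sup>2 + A * h * (h + 1)"
 proof (intro add_mono)
  show "norm (\<Sum>n=1..N. b n * of_real (x + h - real n)) \<le> E * (x + h)\<^sup>2" unfolding N_def by (rule t) simp
  show "norm (\<Sum>n=1..M. b n * of_real (x - real n)) \<le> E * x\<^sup>2" unfolding M_def by (rule t) simp
  have "norm (\<Sum>n\<in>{M<..N}. b n * of_real (x + h - real n)) \<le> (\<Sum>n\<in>{M<..N}. A * h)"
  proof (rule sum_norm_le)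
   fix n assume n: "n \<in> {M<..N}"
   have "real n > x" using n unfolding M_def by (simp; linarith)
   moreover have "real n \<le> x + h" using n x h unfolding N_def by (simp; linarith)
   ultimately have "norm (complex_of_real (x + h - real n)) \<le> h" "norm (b n) \<le> A"
    using A(2)[of n] n by (auto simp del: of_real_diff of_real_add simp: norm_of_real)
   thus "norm (b n * of_real (x + h - real n)) \<le> A * h" unfolding norm_mult using A h by (intro mult_mono) auto
  qed
  also have "... = A * h * real (N - M)" by simp
  also have "... \<le> A * h * (h + 1)"
  proof (intro mult_left_mono)
   have "real N \<le> x + h" using x h unfolding N_def by simp
   moreover have "real M > x - 1" unfolding M_def using x by linarith
   ultimately show "real (N - M) \<le> h + 1" using MN by (simp add: of_nat_diff)
  qed (use A h in auto)
  finally show "norm (\<Sum>n\<in>{M<..N}. b n * of_real (x + h - real n)) \<le> A * h * (h + 1)" .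
 qed
 finally have "h * norm S \<le> E * ((x + h)\<^sup>2 + x\<^sup>2) + A * (h + 1) * h" using h by (simp add: norm_mult algebra_simps)
 hence "norm S \<le> (E * ((x + h)\<^sup>2 + x\<^sup>2) + A * (h + 1) * h) / h" using h by (simp add: pos_le_divide_eq mult.commute)
 also have "... = E * ((x + h)\<^sup>2 + x\<^sup>2) / h + A * (h + 1)" using h by (simp add: add_divide_distrib)
 finally show ?thesis by (simp add: S_def M_def)
qed

lemma abel_bound:
 fixes b :: "nat => complex" and g :: "nat => real"
 assumes MN: "M \<le> N" and S: "\<And>n. M \<le> n ==> n \<le> N ==> norm (\<Sum>m\<in>{M<..n}. b m) \<le> C"
  and g: "\<And>n. M < n ==> g (Suc n) \<le> g n" "\<And>n. M < n ==> g n \<ge> 0"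
 shows "norm (\<Sum>n\<in>{M<..N}. b n * of_real (g n)) \<le> C * g (Suc M)"
proof -
 define S where "S = (\<lambda>n. \<Sum>m\<in>{M<..n}. b m)"
 have eq: "(\<Sum>n\<in>{M<..N}. b n * of_real (g n)) = S N * of_real (g (Suc N)) + (\<Sum>n\<in>{M<..N}. S n * of_real (g n - g (Suc n)))"
  using MN
 proof (induction N rule: dec_induct)
  case base
  show ?case by (simp add: S_def)
 next
  case (step N)
  have i: "{M<..Suc N} = insert (Suc N) {M<..N}" using step by auto
  have "S (Suc N) = b (Suc N) + S N" by (simp add: S_def i)
  thus ?case using step by (simp add: i algebra_simps)
 qed
 have "norm (\<Sum>n\<in>{M<..N}. S n * of_real (g n - g (Suc n))) \<le> (\<Sum>n\<in>{M<..N}. C * (g n - g (Suc n)))"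
 proof (rule sum_norm_le)
  fix n assume n: "n \<in> {M<..N}"
  have "norm (complex_of_real (g n - g (Suc n))) = g n - g (Suc n)" using g(1)[of n] n by (simp only: norm_of_real) auto
  thus "norm (S n * of_real (g n - g (Suc n))) \<le> C * (g n - g (Suc n))"
   unfolding norm_mult using S_def S[of n] n g(1)[of n] by (auto intro!: mult_right_mono)
 qed
 also have "... = C * (g (Suc M) - g (Suc N))"
  unfolding sum_distrib_left[symmetric] by (simp only: sum_telescope_shift[OF MN, of g])
 finally have 1: "norm (\<Sum>n\<in>{M<..N}. S n * of_real (g n - g (Suc n))) \<le> C * (g (Suc M) - g (Suc N))" .
 have 2: "norm (S N * of_real (g (Suc N))) \<le> C * g (Suc N)"
  unfolding norm_mult using S[OF MN order_refl] g(2)[of "Suc N"] MN by (auto simp: S_def intro!: mult_right_mono)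
 have "norm (\<Sum>n\<in>{M<..N}. b n * of_real (g n)) \<le> C * g (Suc N) + C * (g (Suc M) - g (Suc N))"
  unfolding eq by (rule norm_triangle_mono[OF 2 1])
 thus ?thesis by (simp add: algebra_simps)
qed

lemma tame_ln_bound:
 assumes "\<And>n. n \<ge> 1 ==> norm (a n) \<le> ln (real n) + 1" shows "tame a"
proof (rule tame_comparison)
 have t: "tame (\<lambda>n. 1)" by (rule tame_bounded[of _ 1]) simp
 show "tame (\<lambda>n. 1 * of_real (ln (real n)) + 1 :: complex)" by (intro tame_add tame_ln t)
 fix n :: nat assume n: "n > 0"
 have "norm (1 * of_real (ln (real n)) + 1 :: complex) = norm (complex_of_real (ln (real n) + 1))" by simp
 also have "... = ln (real n) + 1" using n by (simp only: norm_of_real) simp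
 finally show "norm (a n) \<le> norm (1 * of_real (ln (real n)) + 1 :: complex)" using assms[of n] n by simp
qed

text \<open>With \<open>k = 3 * m\<close> logarithms in the weight, the smoothed sums are O(x).
  Unsmoothing with \<open>h = y / L ^ m\<close> gives plain weighted sums of size
  \<open>x * L ^ (2 * m + 1)\<close>, and removing \<open>ln n ^ (k + 1)\<close> by partial
  summation leaves \<open>x / L ^ m\<close>. \<open>K\<close> and \<open>x0\<close> come before
  \<open>a\<close> and \<open>B\<close>, because the statement serves all characters of all moduli
  at once.\<close>

lemma tauber:
 assumes m: "m \<ge> 1"
 shows "\<exists>K>0. \<exists>x0>1. \<forall>x\<ge>x0. \<forall>a B. B \<ge> 0 \<and> (\<forall>n\<ge>1. norm (a n) \<le> ln (real n) + 1) \<and>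
  (\<forall>s. 1 < Re s \<and> Re s \<le> 2 --> norm (DS (\<lambda>n. a n * of_real (ln (real n) ^ (3 * m))) s) \<le> B * (\<bar>Im s\<bar> + 2) powr (1/2))
  --> norm (\<Sum>n=2..nat \<lfloor>x\<rfloor>. a n / of_real (ln (real n))) \<le> K * (1 + B) * x / ln x ^ m"
proof -
 define k where "k = 3 * m"
 have "\<forall>\<^sub>F x::real in at_top. sqrt x \<ge> ln x ^ m" by real_asymp
 moreover have "\<forall>\<^sub>F x::real in at_top. ln x \<ge> 2" by real_asymp
 moreover have "\<forall>\<^sub>F x::real in at_top. x \<ge> 16" by (rule eventually_ge_at_top)
 ultimately have "\<forall>\<^sub>F x::real in at_top. sqrt x \<ge> ln x ^ m \<and> ln x \<ge> 2 \<and> x \<ge> 16" by eventually_elim simp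
 then obtain x0 where x0: "\<And>x. x \<ge> x0 ==> sqrt x \<ge> ln x ^ m \<and> ln x \<ge> 2 \<and> x \<ge> 16"
  unfolding eventually_at_top_linorder by blast
 define K :: real where "K = 3 + 2 * (30 + 6 * 2 ^ k) * 2 ^ (k + 1)"
 show ?thesis
 proof (rule exI[of _ K], intro conjI, goal_cases)
  case 1
  show "K > 0" by (simp add: K_def add_pos_nonneg)
 next
  case 2
  show ?case
  proof (rule exI[of _ "max x0 2"], intro conjI allI impI, goal_cases)
   case (2 x a B)
   have sq: "sqrt x \<ge> ln x ^ m" and L2: "ln x \<ge> 2" and x16: "x \<ge> 16" using x0[of x] 2 by auto
   have B: "B \<ge> 0" and an: "\<And>n. n \<ge> 1 ==> norm (a n) \<le> ln (real n) + 1"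
    and D: "\<And>s. 1 < Re s ==> Re s \<le> 2 ==> norm (DS (\<lambda>n. a n * of_real (ln (real n) ^ k)) s) \<le> B * (\<bar>Im s\<bar> + 2) powr (1/2)"
    using 2 by (auto simp: k_def)
   define L where "L = ln x"
   define b where "b = (\<lambda>n. a n * of_real (ln (real n) ^ k))"
   have L: "L \<ge> 2" "L ^ m \<ge> 1" "sqrt x \<ge> L ^ m" using L2 sq by (auto simp: L_def)
   have Lm0: "L ^ m > 0" using L by simp
   have tb: "tame b" unfolding b_def by (rule tame_ln_power[OF tame_ln_bound[OF an]])
   define A where "A = 3 * L * (2 * L) ^ k"
   define C where "C = (30 + 6 * 2 ^ k) * (1 + B) * x * L ^ (2 * m + 1)"
   \<comment> \<open>From \<open>sqrt x\<close> on, \<open>ln y\<close> is at least half of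
     \<open>L\<close>, hence at least 1 as \<open>perron_smooth\<close> demands.\<close>
   have S: "norm (\<Sum>n=1..nat \<lfloor>y\<rfloor>. b n) \<le> C" if y: "sqrt x \<le> y" "y \<le> x" for y
   proof -
    define h where "h = y / L ^ m"
    have "sqrt x > 0" using x16 by simp
    hence y0: "y > 0" using y by linarith
    hence y0': "y \<ge> 0" by simp
    have "ln (sqrt x) \<le> ln y" unfolding ln_le_cancel_iff[OF \<open>sqrt x > 0\<close> y0] by (rule y)
    hence lny: "ln y \<ge> 1" using L x16 by (simp add: ln_sqrt L_def)
    have h: "h \<ge> 1" "h \<le> y"
    proof -
     have "L ^ m \<le> y" using L y by linarith
     thus "h \<ge> 1" using Lm0 by (simp add: h_def)
     have "y / L ^ m \<le> y / 1" using L y0 by (intro divide_left_mono) auto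
     thus "h \<le> y" by (simp add: h_def)
    qed
    have ub: "norm (b n) \<le> A" if n: "n \<ge> 1" "real n \<le> y + h" for n
    proof -
     have "real n \<le> 2 * x" using n h y by simp
     hence "ln (real n) \<le> ln (2 * x)" using n x16 by simp
     also have "... = ln 2 + L" using x16 by (simp add: ln_mult L_def)
     also have "ln (2::real) \<le> 1" using ln_le_minus_one[of "2::real"] by simp
     finally have l1: "ln (real n) \<le> 1 + L" by simp
     have l0: "ln (real n) \<ge> 0" using n by simp
     have "norm (a n) * ln (real n) ^ k \<le> (3 * L) * (2 * L) ^ k"
      using an[OF n(1)] l1 l0 L by (intro mult_mono power_mono) auto
     moreover have "norm (complex_of_real (ln (real n) ^ k)) = ln (real n) ^ k" using l0 by (simp only: norm_of_real) simp
     ultimately show ?thesis by (simp only: b_def norm_mult A_def)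
    qed
    have A0: "A \<ge> 0" using L by (simp add: A_def)
    have "norm (\<Sum>n=1..nat \<lfloor>y\<rfloor>. b n) \<le> 6 * B * ((y + h)\<^sup>2 + y\<^sup>2) / h + A * (h + 1)"
    proof (rule unsmooth[OF y0 _ A0 ub])
     show "h > 0" using h by simp
     fix w assume w: "w \<in> {y, y + h}"
     have "w \<ge> y" "w > 0" using w h y0 by auto
     hence "ln w \<ge> ln y" using y0 by simp
     hence "ln w \<ge> 1" using lny by simp
     thus "norm (\<Sum>n=1..nat \<lfloor>w\<rfloor>. b n * of_real (1 - real n / w)) \<le> 6 * B * w"
      by (rule perron_smooth[OF tb B]) (use \<open>w > 0\<close> D in \<open>auto simp: b_def\<close>)
    qed auto
    also have "6 * B * ((y + h)\<^sup>2 + y\<^sup>2) / h \<le> 6 * B * (5 * y\<^sup>2) / h"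
    proof (intro divide_right_mono mult_left_mono)
     have "(y + h)\<^sup>2 \<le> (2 * y)\<^sup>2" using h y0 by (intro power_mono) auto
     thus "(y + h)\<^sup>2 + y\<^sup>2 \<le> 5 * y\<^sup>2" by (simp add: power2_eq_square)
    qed (use B h in auto)
    also have "6 * B * (5 * y\<^sup>2) / h = 30 * B * y * L ^ m" using y0 Lm0 by (simp add: h_def power2_eq_square)
    also have "A * (h + 1) \<le> A * (2 * h)" using A0 h by (intro mult_left_mono) auto
    also have "A * (2 * h) = 6 * 2 ^ k * y * (L * L ^ k / L ^ m)" by (simp add: A_def h_def power_mult_distrib)
    also have "L * L ^ k / L ^ m = L ^ (2 * m + 1)"
    proof -
     have "L ^ k = L ^ (2 * m) * L ^ m" by (simp add: k_def power_add[symmetric])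
     hence "L * L ^ k / L ^ m = L * L ^ (2 * m) * (L ^ m / L ^ m)" by simp
     also have "L ^ m / L ^ m = 1" using Lm0 by (intro divide_self) linarith
     finally show ?thesis by (simp add: power_add)
    qed
    finally have "norm (\<Sum>n=1..nat \<lfloor>y\<rfloor>. b n) \<le> 30 * B * y * L ^ m + 6 * 2 ^ k * y * L ^ (2 * m + 1)" by simp
    also have "... \<le> 30 * (1 + B) * x * L ^ (2 * m + 1) + 6 * 2 ^ k * ((1 + B) * x) * L ^ (2 * m + 1)"
    proof (intro add_mono mult_mono power_increasing)
     have "y * 1 \<le> x * (1 + B)" using y B y0 by (intro mult_mono) auto
     thus "y \<le> (1 + B) * x" by (simp add: mult.commute)
    qed (use B y(2) y0' L x16 in auto)
    also have "... = C" by (simp add: C_def algebra_simps)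
    finally show ?thesis .
   qed
   define M where "M = nat \<lfloor>sqrt x\<rfloor>"
   define N where "N = nat \<lfloor>x\<rfloor>"
   have sx: "sqrt x \<ge> 4" using x16 by (simp add: real_le_rsqrt)
   have sxx: "sqrt x \<le> x" using x16 by (intro real_le_lsqrt) (auto simp: power2_eq_square)
   have M: "M \<ge> 4" "real M \<le> sqrt x" "sqrt x < real (Suc M)" using sx unfolding M_def by linarith+
   have MN: "M \<le> N" using sxx unfolding M_def N_def by (intro nat_mono floor_mono)
   have bg: "a n / of_real (ln (real n)) = b n * of_real (1 / ln (real n) ^ (k + 1))" if n: "n \<ge> 2" for n
   proof -
    have "ln (real n) > 0" using n by simp
    hence "complex_of_real (ln (real n) ^ k) * of_real (1 / ln (real n) ^ (k + 1)) = of_real (1 / ln (real n))"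
     unfolding of_real_mult[symmetric] by (simp add: field_simps power_add)
    thus ?thesis by (simp only: b_def mult.assoc) (simp add: divide_inverse)
   qed
   have "norm (\<Sum>n\<in>{M<..N}. b n * of_real (1 / ln (real n) ^ (k + 1))) \<le> (2 * C) * (1 / ln (real (Suc M)) ^ (k + 1))"
   proof (rule abel_bound[OF MN])
    fix n assume n: "M \<le> n" "n \<le> N"
    have "{1..n} = {1..M} \<union> {M<..n}" using n by auto
    hence "(\<Sum>i=1..n. b i) = (\<Sum>i=1..M. b i) + (\<Sum>i\<in>{M<..n}. b i)" by (simp only:) (rule sum.union_disjoint, auto)
    hence e: "(\<Sum>i\<in>{M<..n}. b i) = (\<Sum>i=1..n. b i) - (\<Sum>i=1..M. b i)" by simp
    have SM: "norm (\<Sum>i=1..M. b i) \<le> C" unfolding M_def by (rule S) (use sxx in auto)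
    have Sn: "norm (\<Sum>i=1..n. b i) \<le> C"
    proof (cases "n = M")
     case True thus ?thesis using SM by simp
    next
     case False
     hence "n \<ge> Suc M" using n by simp
     hence "sqrt x \<le> real n" using M by (meson less_imp_le of_nat_mono order_trans)
     moreover have "real n \<le> x" using n x16 unfolding N_def by linarith
     ultimately show ?thesis using S[of "real n"] by simp
    qed
    show "norm (\<Sum>i\<in>{M<..n}. b i) \<le> 2 * C" unfolding e using SM Sn norm_triangle_ineq4[of "\<Sum>i=1..n. b i" "\<Sum>i=1..M. b i"] by linarith
   next
    fix n assume n: "M < n"
    have "ln (real n) > 0" using n M by simp
    moreover have "ln (real n) \<le> ln (real (Suc n))" using n by simp
    ultimately show "1 / ln (real (Suc n)) ^ (k + 1) \<le> 1 / ln (real n) ^ (k + 1)" by (intro frac_le power_mono) auto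
    show "1 / ln (real n) ^ (k + 1) \<ge> 0" using \<open>ln (real n) > 0\<close> by simp
   qed
   also have "1 / ln (real (Suc M)) ^ (k + 1) \<le> 1 / (L / 2) ^ (k + 1)"
   proof (intro frac_le power_mono)
    have "ln (sqrt x) \<le> ln (real (Suc M))" using M sx x16 by (subst ln_le_cancel_iff) auto
    thus "L / 2 \<le> ln (real (Suc M))" using x16 by (simp add: ln_sqrt L_def)
   qed (use L in auto)
   also have "2 * C * (1 / (L / 2) ^ (k + 1)) = 2 * (30 + 6 * 2 ^ k) * 2 ^ (k + 1) * ((1 + B) * x) * (L ^ (2 * m + 1) / L ^ (k + 1))"
    by (simp add: C_def power_divide)
   also have "L ^ (2 * m + 1) / L ^ (k + 1) = 1 / L ^ m"
   proof -
    have e: "L ^ (k + 1) = L ^ (2 * m + 1) * L ^ m" unfolding power_add[symmetric] k_def by simp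
    have "L ^ (2 * m + 1) > 0" using L(1) by simp
    thus ?thesis unfolding e by (metis divide_divide_eq_left divide_self less_irrefl)
   qed
   finally have big: "norm (\<Sum>n\<in>{M<..N}. b n * of_real (1 / ln (real n) ^ (k + 1))) \<le> 2 * (30 + 6 * 2 ^ k) * 2 ^ (k + 1) * ((1 + B) * x) * (1 / L ^ m)"
    using L x16 B by (simp add: C_def mult_left_mono)
   \<comment> \<open>Below \<open>sqrt x\<close> the logarithms may be much smaller than
     \<open>L\<close>, so these terms are bounded trivially.\<close>
   have small: "norm (\<Sum>n=2..M. a n / of_real (ln (real n))) \<le> 3 * ((1 + B) * x) * (1 / L ^ m)"
   proof -
    have "norm (\<Sum>n=2..M. a n / of_real (ln (real n))) \<le> (\<Sum>n=2..M. 3)"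
    proof (rule sum_norm_le)
     fix n assume n: "n \<in> {2..M}"
     have l2: "ln (2::real) \<ge> 1/2" using ln2_ge_two_thirds by simp
     have "ln (real n) \<ge> ln 2" using n by simp
     hence ln: "ln (real n) \<ge> 1/2" using l2 by linarith
     have "norm (a n) \<le> ln (real n) + 1" by (rule an) (use n in simp)
     also have "... \<le> 3 * ln (real n)" using ln by simp
     finally have "norm (a n) / ln (real n) \<le> 3" using ln by (simp add: pos_divide_le_eq)
     moreover have "norm (complex_of_real (ln (real n))) = ln (real n)" using ln by simp
     ultimately show "norm (a n / of_real (ln (real n))) \<le> 3" by (simp only: norm_divide)
    qed
    also have "... \<le> 3 * real M" by simp
    also have "... \<le> 3 * sqrt x" using M by simp
    also have "sqrt x \<le> x / L ^ m"
    proof -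
     have "sqrt x * L ^ m \<le> sqrt x * sqrt x" using L x16 by (intro mult_left_mono) auto
     hence "sqrt x * L ^ m \<le> x" using x16 by simp
     thus ?thesis using Lm0 by (simp add: pos_le_divide_eq)
    qed
    also have "3 * (x / L ^ m) \<le> 3 * ((1 + B) * x) * (1 / L ^ m)"
     using B x16 L by (simp add: divide_right_mono mult_right_mono)
    finally show ?thesis by simp
   qed
   have "{2..N} = {2..M} \<union> {M<..N}" using MN M by auto
   hence "(\<Sum>n=2..N. a n / of_real (ln (real n))) = (\<Sum>n=2..M. a n / of_real (ln (real n))) + (\<Sum>n\<in>{M<..N}. a n / of_real (ln (real n)))"
    by (simp only:) (rule sum.union_disjoint, auto)
   also have "(\<Sum>n\<in>{M<..N}. a n / of_real (ln (real n))) = (\<Sum>n\<in>{M<..N}. b n * of_real (1 / ln (real n) ^ (k + 1)))"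
    by (rule sum.cong) (use M bg in auto)
   finally have "norm (\<Sum>n=2..N. a n / of_real (ln (real n))) \<le> 3 * ((1 + B) * x) * (1 / L ^ m) + 2 * (30 + 6 * 2 ^ k) * 2 ^ (k + 1) * ((1 + B) * x) * (1 / L ^ m)"
    using norm_triangle_mono[OF small big] by simp
   also have "... = K * (1 + B) * x / L ^ m" by (simp add: K_def algebra_simps add_divide_distrib)
   finally show ?case by (simp add: N_def L_def)
  qed simp
 qed
qed

section \<open>The theorem of Siegel and Walfisz\<close>

lemma ln_recip_integrable: "2 \<le> (a::real) ==> (\<lambda>t. 1 / ln t) integrable_on {a..b}"
 by (intro integrable_continuous_interval continuous_intros) auto

lemma ln_recip_integral_bounds:
 fixes a b :: real
 assumes "2 \<le> a" "a \<le> b"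
 shows "integral {a..b} (\<lambda>t. 1 / ln t) \<le> (b - a) / ln a" "integral {a..b} (\<lambda>t. 1 / ln t) \<ge> (b - a) / ln b"
proof -
 have "integral {a..b} (\<lambda>t. 1 / ln t) \<le> integral {a..b} (\<lambda>t. 1 / ln a)"
 proof (rule integral_le[OF ln_recip_integrable[OF assms(1)]])
  fix t assume "t \<in> {a..b}"
  thus "1 / ln t \<le> 1 / ln a" using assms by (intro divide_left_mono mult_pos_pos) auto
 qed auto
 thus "integral {a..b} (\<lambda>t. 1 / ln t) \<le> (b - a) / ln a" using assms by simp
 have "integral {a..b} (\<lambda>t. 1 / ln b) \<le> integral {a..b} (\<lambda>t. 1 / ln t)"
 proof (rule integral_le[OF _ ln_recip_integrable[OF assms(1)]])
  fix t assume "t \<in> {a..b}"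
  thus "1 / ln b \<le> 1 / ln t" using assms by (intro divide_left_mono mult_pos_pos) auto
 qed auto
 thus "integral {a..b} (\<lambda>t. 1 / ln t) \<ge> (b - a) / ln b" using assms by simp
qed

lemma Li_nonneg: "Li x \<ge> 0"
proof (cases "x \<ge> 2")
 case True
 have "(x - 2) / ln x \<le> Li x" unfolding Li_def by (rule ln_recip_integral_bounds) (use True in auto)
 moreover have "(x - 2) / ln x \<ge> 0" using True by (intro divide_nonneg_nonneg) auto
 ultimately show ?thesis by simp
qed (simp add: Li_def)

lemma Li_le: assumes "x \<ge> 0" shows "Li x \<le> 2 * x"
proof (cases "x \<ge> 2")
 case True
 have l2: "ln (2::real) \<ge> 1/2" using ln2_ge_two_thirds by simp
 have "Li x \<le> (x - 2) / ln 2" unfolding Li_def by (rule ln_recip_integral_bounds) (use True in auto)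
 also have "... \<le> (x - 2) / (1/2)" using True l2 by (intro divide_left_mono) auto
 finally show ?thesis by simp
qed (use assms in \<open>simp add: Li_def\<close>)

text \<open>The integral over each unit interval lies between two neighbouring summands; the
  induction carries both one-sided bounds.\<close>

lemma sum_ln_recip_Li_nat:
 assumes "N \<ge> 2"
 shows "\<bar>(\<Sum>n=2..N. 1 / ln (real n)) - Li (real N)\<bar> \<le> 1 / ln 2"
proof -
 have "Li (real N) \<le> (\<Sum>n=2..N. 1 / ln (real n)) - 1 / ln (real N) \<and>
  (\<Sum>n=2..N. 1 / ln (real n)) - 1 / ln 2 \<le> Li (real N)" using assms
 proof (induction N rule: dec_induct)
  case base
  show ?case by (simp add: Li_def)
 next
  case (step N)
  have "Li (real (Suc N)) = Li (real N) + integral {real N..real (Suc N)} (\<lambda>t. 1 / ln t)"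
   unfolding Li_def by (rule Henstock_Kurzweil_Integration.integral_combine[symmetric]) (use step in \<open>auto intro: ln_recip_integrable\<close>)
  moreover have "(\<Sum>n=2..Suc N. 1 / ln (real n)) = (\<Sum>n=2..N. 1 / ln (real n)) + 1 / ln (real (Suc N))" using step by simp
  ultimately show ?case using ln_recip_integral_bounds[of "real N" "real (Suc N)"] step by auto
 qed
 moreover have "1 / ln (real N) \<ge> 0" using assms by simp
 ultimately show ?thesis by linarith
qed

lemma sum_ln_recip_Li:
 assumes "x \<ge> 2"
 shows "\<bar>(\<Sum>n=2..nat \<lfloor>x\<rfloor>. 1 / ln (real n)) - Li x\<bar> \<le> 4"
proof -
 define N where "N = nat \<lfloor>x\<rfloor>"
 have N: "N \<ge> 2" "real N \<le> x" "x \<le> real N + 1" using assms unfolding N_def by linarith+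
 have l2: "ln (2::real) \<ge> 1/2" using ln2_ge_two_thirds by simp
 have "Li x = Li (real N) + integral {real N..x} (\<lambda>t. 1 / ln t)"
  unfolding Li_def by (rule Henstock_Kurzweil_Integration.integral_combine[symmetric]) (use N in \<open>auto intro: ln_recip_integrable\<close>)
 moreover have "integral {real N..x} (\<lambda>t. 1 / ln t) \<le> 2"
 proof -
  have "integral {real N..x} (\<lambda>t. 1 / ln t) \<le> (x - real N) / ln (real N)"
   by (rule ln_recip_integral_bounds) (use N in auto)
  also have "... \<le> 1 / (1/2)"
  proof (intro frac_le)
   have "ln (real N) \<ge> ln 2" using N by simp
   thus "1/2 \<le> ln (real N)" using l2 by linarith
  qed (use N in auto)
  finally show ?thesis by simp
 qed
 moreover have "integral {real N..x} (\<lambda>t. 1 / ln t) \<ge> 0"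
 proof -
  have "(x - real N) / ln x \<ge> 0" using N assms by simp
  also have "(x - real N) / ln x \<le> integral {real N..x} (\<lambda>t. 1 / ln t)"
   by (rule ln_recip_integral_bounds) (use N in auto)
  finally show ?thesis .
 qed
 moreover have "1 / ln 2 \<le> (2::real)" using l2 by (simp add: divide_le_eq)
 ultimately show ?thesis using sum_ln_recip_Li_nat[OF N(1)] unfolding N_def[symmetric] by linarith
qed

section \<open>From prime powers to primes, and to the residue class 1\<close>

lemma mangoldt_nonprime:
 assumes "mangoldt n \<noteq> (0::real)" "\<not> prime n"
 obtains p k where "prime p" "k \<ge> 2" "n = p ^ k" "mangoldt n = ln (real n) / real k"
proof -
 have "primepow n" using assms by (auto simp: mangoldt_def split: if_splits)
 then obtain p k where pk: "prime p" "k > 0" "n = p ^ k" by (auto simp: primepow_def)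
 have "k \<noteq> 1" using pk assms by auto
 hence "k \<ge> 2" using pk by simp
 moreover have "mangoldt n = ln (real n) / real k" using pk by (simp add: ln_realpow)
 ultimately show ?thesis using that pk by blast
qed

lemma prime_power_count:
 assumes "x \<ge> 1"
 shows "finite {n. real n \<le> x \<and> (\<exists>p k. prime p \<and> k \<ge> 2 \<and> n = p ^ k)}"
  and "real (card {n. real n \<le> x \<and> (\<exists>p k. prime p \<and> k \<ge> 2 \<and> n = p ^ k)}) \<le> sqrt x * log 2 x"
proof -
 let ?A = "{n. real n \<le> x \<and> (\<exists>p k. prime (p::nat) \<and> k \<ge> 2 \<and> n = p ^ k)}"
 let ?B = "{1..nat \<lfloor>sqrt x\<rfloor>} \<times> {1..nat \<lfloor>log 2 x\<rfloor>}"
 have sub: "?A \<subseteq> (\<lambda>(p, k). p ^ k) ` ?B"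
 proof
  fix n assume "n \<in> ?A"
  then obtain p k where n: "real n \<le> x" "prime p" "k \<ge> 2" "n = p ^ k" by blast
  have p2: "p \<ge> 2" using n prime_ge_2_nat by blast
  have "real p ^ 2 \<le> real p ^ k" using n p2 by (intro power_increasing) auto
  hence "real p \<le> sqrt x" using n by (intro real_le_rsqrt) simp
  hence p: "p \<le> nat \<lfloor>sqrt x\<rfloor>" by (simp add: le_nat_floor)
  have "2 ^ k \<le> real p ^ k" using p2 by (intro power_mono) auto
  also have "real p ^ k = real n" using n by simp
  finally have "2 ^ k \<le> real n" .
  moreover have "(2::real) powr real k = 2 ^ k" by (simp add: powr_realpow)
  ultimately have "2 powr real k \<le> x" using n(1) by linarith
  hence "real k \<le> log 2 x" using assms by (simp add: le_log_iff)
  hence "k \<le> nat \<lfloor>log 2 x\<rfloor>" by (simp add: le_nat_floor)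
  thus "n \<in> (\<lambda>(p, k). p ^ k) ` ?B" using n p p2 by (intro image_eqI[of _ _ "(p, k)"]) auto
 qed
 show fin: "finite ?A" by (rule finite_subset[OF sub]) simp
 have "card ?A \<le> card ((\<lambda>(p, k). p ^ k) ` ?B)" by (rule card_mono[OF _ sub]) simp
 also have "... \<le> card ?B" by (rule card_image_le) simp
 finally have "real (card ?A) \<le> real (card ?B)" by (rule of_nat_mono)
 also have "... = real (nat \<lfloor>sqrt x\<rfloor>) * real (nat \<lfloor>log 2 x\<rfloor>)" by simp
 also have "... \<le> sqrt x * log 2 x" using assms by (intro mult_mono) auto
 finally show "real (card ?A) \<le> sqrt x * log 2 x" .
qed

text \<open>Primes carry the weight 1 exactly; a proper power \<open>p ^ k\<close> carries
  \<open>1 / k\<close>, and the proper powers up to \<open>x\<close> are few.\<close>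

lemma mangoldt_prime_diff:
 fixes \<xi> :: "nat => complex"
 assumes "\<And>n. norm (\<xi> n) \<le> 1" "x \<ge> 1"
 shows "norm ((\<Sum>n=2..nat \<lfloor>x\<rfloor>. \<xi> n * of_real (mangoldt n) / of_real (ln (real n))) - (\<Sum>p | prime p \<and> real p \<le> x. \<xi> p)) \<le> sqrt x * log 2 x"
proof -
 define A where "A = {n. real n \<le> x \<and> (\<exists>p k. prime (p::nat) \<and> k \<ge> 2 \<and> n = p ^ k)}"
 let ?I = "{2..nat \<lfloor>x\<rfloor>}"
 have memI: "n \<in> ?I \<longleftrightarrow> n \<ge> 2 \<and> real n \<le> x" for n using assms(2) by (simp; linarith)
 have "(\<Sum>p | prime p \<and> real p \<le> x. \<xi> p) = (\<Sum>n\<in>?I. if prime n then \<xi> n else 0)"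
 proof -
  have "{p. prime p \<and> real p \<le> x} = {n\<in>?I. prime n}" using memI prime_ge_2_nat by blast
  thus ?thesis by (simp only: sum.inter_filter[OF finite_atLeastAtMost])
 qed
 hence "(\<Sum>n\<in>?I. \<xi> n * of_real (mangoldt n) / of_real (ln (real n))) - (\<Sum>p | prime p \<and> real p \<le> x. \<xi> p)
  = (\<Sum>n\<in>?I. \<xi> n * of_real (mangoldt n) / of_real (ln (real n)) - (if prime n then \<xi> n else 0))"
  by (simp only: sum_subtractf)
 also have "norm ... \<le> (\<Sum>n\<in>?I. if n \<in> A then 1 else 0)"
 proof (rule sum_norm_le)
  fix n assume n: "n \<in> ?I"
  hence ln0: "ln (real n) > 0" by simp
  consider "prime n" | "\<not> prime n" "mangoldt n = (0::real)" | "\<not> prime n" "mangoldt n \<noteq> (0::real)" by blast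
  thus "norm (\<xi> n * of_real (mangoldt n) / of_real (ln (real n)) - (if prime n then \<xi> n else 0)) \<le> (if n \<in> A then 1 else 0)"
  proof cases
   case 1
   hence "\<xi> n * of_real (mangoldt n) / of_real (ln (real n)) = \<xi> n" using ln0 by (simp add: mangoldt_prime)
   thus ?thesis using 1 by simp
  next
   case 2
   thus ?thesis by (simp del: of_real_mangoldt)
  next
   case 3
   obtain p k where pk: "prime p" "k \<ge> 2" "n = p ^ k" "mangoldt n = ln (real n) / real k"
    by (rule mangoldt_nonprime[OF 3(2,1)])
   have "n \<in> A" using n memI pk unfolding A_def by blast
   have "norm (\<xi> n * of_real (mangoldt n) / of_real (ln (real n))) = norm (\<xi> n) * (mangoldt n / ln (real n))"
    using ln0 mangoldt_nonneg[of n] by (simp only: norm_mult norm_divide norm_of_real) (simp add: abs_of_nonneg)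
   also have "mangoldt n / ln (real n) = 1 / real k" using ln0 pk(4) by simp
   also have "norm (\<xi> n) * (1 / real k) \<le> 1 * 1" using assms(1)[of n] pk(2) by (intro mult_mono) auto
   finally show ?thesis using 3 \<open>n \<in> A\<close> by simp
  qed
 qed
 also have "... = real (card (A \<inter> ?I))" by (simp add: sum.If_cases Int_commute)
 also have "... \<le> real (card A)" unfolding A_def
  using prime_power_count(1)[OF assms(2)] by (intro of_nat_mono card_mono) auto
 also have "... \<le> sqrt x * log 2 x" unfolding A_def by (rule prime_power_count(2)[OF assms(2)])
 finally show ?thesis .
qed

definition primes_1_mod :: "real => nat => nat set" where
 "primes_1_mod x q = {p. prime p \<and> real p \<le> x \<and> [p = 1] (mod q)}"

lemma finite_primes_le: "finite {p :: nat. prime p \<and> real p \<le> x}"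
 by (rule finite_subset[of _ "{..nat \<lfloor>x\<rfloor>}"]) (auto simp: le_nat_floor)

lemma primes_1_mod_eq_sum:
 assumes "q > 0"
 shows "of_nat (totient q) * of_nat (card (primes_1_mod x q)) = (\<Sum>\<xi>|dchar q \<xi>. \<Sum>p|prime p \<and> real p \<le> x. \<xi> p)"
proof -
 have "(\<Sum>\<xi>|dchar q \<xi>. \<Sum>p|prime p \<and> real p \<le> x. \<xi> p) = (\<Sum>p|prime p \<and> real p \<le> x. \<Sum>\<xi>|dchar q \<xi>. \<xi> p)"
  by (rule sum.swap)
 also have "... = (\<Sum>p|prime p \<and> real p \<le> x. if [p = 1] (mod q) then of_nat (totient q) else 0)"
  by (simp only: sum_dchar[OF assms])
 also have "... = of_nat (totient q) * of_nat (card (primes_1_mod x q))" using finite_primes_le[of x]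
  by (simp add: sum.If_cases primes_1_mod_def Int_def conj_assoc)
 finally show ?thesis by simp
qed

lemma prime_coprime_iff: "prime (p :: nat) ==> coprime p q \<longleftrightarrow> \<not> p dvd q"
 by (metis coprime_absorb_left not_prime_unit prime_imp_coprime)

lemma norm_triangle_four: "norm (a - b + c - d :: complex) \<le> norm a + norm b + norm c + norm d"
 using norm_triangle_ineq4[of "a - b + c" d] norm_triangle_ineq[of "a - b" c] norm_triangle_ineq4[of a b] by linarith

text \<open>The factor \<open>q\<close> absorbs the \<open>q powr (1/2)\<close> of the analytic
  bound and the at most \<open>q\<close> primes dividing \<open>q\<close>; constants and threshold
  do not depend on \<open>q\<close>. For the principal character, \<open>tauber\<close> is applied
  to \<open>mangoldt n - 1\<close>, and \<open>Li\<close> arises from the sum of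
  \<open>1 / ln n\<close>.\<close>

theorem siegel_walfisz:
 fixes m :: nat
 assumes m: "m \<ge> 1"
 shows "\<exists>K>0. \<exists>x0. \<forall>x\<ge>x0. \<forall>q\<ge>1. \<bar>real (card (primes_1_mod x q)) - Li x / real (totient q)\<bar> \<le> K * real q * x / ln x ^ m"
proof -
 obtain K0 x0 where K0: "K0 > 0" "x0 > 1" and T0: "\<forall>x\<ge>x0. \<forall>a B. B \<ge> 0 \<and> (\<forall>n\<ge>1. norm (a n) \<le> ln (real n) + 1) \<and>
  (\<forall>s. 1 < Re s \<and> Re s \<le> 2 --> norm (DS (\<lambda>n. a n * of_real (ln (real n) ^ (3 * m))) s) \<le> B * (\<bar>Im s\<bar> + 2) powr (1/2))
  --> norm (\<Sum>n=2..nat \<lfloor>x\<rfloor>. a n / of_real (ln (real n))) \<le> K0 * (1 + B) * x / ln x ^ m"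
  using tauber[OF m] by (elim exE conjE) (rule that)
 note T = T0[rule_format, OF _ conjI[OF _ conjI[OF allI[OF impI] allI[OF impI]]]]
 obtain C1 where C1: "C1 \<ge> 0" "\<And>q \<xi> s. dchar q \<xi> ==> \<xi> \<noteq> prin q ==> 1 < Re s ==> Re s \<le> 2 ==>
  norm (DS (\<lambda>n. \<xi> n * of_real (mangoldt n) * of_real (ln (real n) ^ (3 * m))) s) \<le> C1 * (real q * (\<bar>Im s\<bar> + 2)) powr (1/2)"
  using nonprin_logderiv[of "1/2" "3 * m"] by auto
 obtain C2 where C2: "C2 \<ge> 0" "\<And>s. 1 < Re s ==> Re s \<le> 2 ==>
  norm (DS (\<lambda>n. of_real (mangoldt n - 1) * of_real (ln (real n) ^ (3 * m))) s) \<le> C2 * (\<bar>Im s\<bar> + 2) powr (1/2)"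
  using zeta_logderiv[of "1/2" "3 * m"] by auto
 have "\<forall>\<^sub>F x::real in at_top. sqrt x * log 2 x \<le> x / ln x ^ m" by real_asymp
 moreover have "\<forall>\<^sub>F x::real in at_top. 4 \<le> x / ln x ^ m" by real_asymp
 ultimately have "\<forall>\<^sub>F x::real in at_top. sqrt x * log 2 x \<le> x / ln x ^ m \<and> 4 \<le> x / ln x ^ m" by eventually_elim simp
 then obtain x1 where x1: "\<And>x. x \<ge> x1 ==> sqrt x * log 2 x \<le> x / ln x ^ m \<and> 4 \<le> x / ln x ^ m"
  unfolding eventually_at_top_linorder by blast
 define K where "K = K0 * (1 + C1 + C2) + 3"
 show ?thesis
 proof (rule exI[of _ K], intro conjI exI[of _ "max (max x0 x1) 2"] allI impI)
  show "K > 0" using K0 C1 C2 by (simp add: K_def add_nonneg_pos)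
 next
  fix x :: real and q :: nat assume x: "max (max x0 x1) 2 \<le> x" and q: "q \<ge> 1"
  have x2: "x \<ge> 2" "x \<ge> 1" and xx: "x \<ge> x0" "x \<ge> x1" using x by auto
  define Y where "Y = x / ln x ^ m"
  have Y: "sqrt x * log 2 x \<le> Y" "4 \<le> Y" using x1[OF xx(2)] by (auto simp: Y_def)
  define W where "W = K * real q * Y"
  let ?T = "\<lambda>\<xi>. (\<Sum>p|prime p \<and> real p \<le> x. \<xi> p :: complex)"
  let ?V = "\<lambda>\<xi>. (\<Sum>n=2..nat \<lfloor>x\<rfloor>. \<xi> n * of_real (mangoldt n) / of_real (ln (real n)) :: complex)"
  have Kq: "K0 * (1 + C1 * real q powr (1/2)) * Y + Y \<le> W" "K0 * (1 + C2) * Y + 3 * real q * Y \<le> W"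
  proof -
   have "real q powr (1/2) \<le> real q powr 1" using q by (intro powr_mono) auto
   hence "C1 * real q powr (1/2) \<le> C1 * real q" using q C1(1) by (intro mult_left_mono) auto
   moreover have "C2 * real q \<ge> 0" "real q \<ge> 1" using C2(1) q by auto
   ultimately have "1 + C1 * real q powr (1/2) \<le> real q + C1 * real q + C2 * real q" by linarith
   hence "1 + C1 * real q powr (1/2) \<le> (1 + C1 + C2) * real q" by (simp only: distrib_right mult_1)
   hence "K0 * (1 + C1 * real q powr (1/2)) * Y \<le> K0 * ((1 + C1 + C2) * real q) * Y"
    using K0 Y by (intro mult_right_mono mult_left_mono) auto
   moreover have "Y * 1 \<le> Y * (3 * real q)" using q Y by (intro mult_left_mono) auto
   ultimately show "K0 * (1 + C1 * real q powr (1/2)) * Y + Y \<le> W" by (simp add: W_def K_def algebra_simps)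
   have "1 + C2 \<le> (1 + C1 + C2) * 1" using C1 by simp
   also have "... \<le> (1 + C1 + C2) * real q" using q C1 C2 by (intro mult_left_mono) auto
   finally have "K0 * (1 + C2) * Y \<le> K0 * ((1 + C1 + C2) * real q) * Y" using K0 Y by (intro mult_right_mono mult_left_mono) auto
   thus "K0 * (1 + C2) * Y + 3 * real q * Y \<le> W" by (simp add: W_def K_def algebra_simps)
  qed
  have ml: "mangoldt n \<le> ln (real n) + 1" "\<bar>mangoldt n - 1\<bar> \<le> ln (real n) + 1" if "n \<ge> 1" for n
   using mangoldt_le_ln[of n] mangoldt_nonneg[of n] that by auto
  have np: "norm (?T \<xi>) \<le> W" if \<xi>: "dchar q \<xi>" "\<xi> \<noteq> prin q" for \<xi>
  proof -
   have "norm (?V \<xi>) \<le> K0 * (1 + C1 * real q powr (1/2)) * x / ln x ^ m"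
   proof (rule T[OF xx(1)])
    show "0 \<le> C1 * real q powr (1/2)" using C1 by simp
    show "norm (\<xi> n * of_real (mangoldt n)) \<le> ln (real n) + 1" if n: "n \<ge> 1" for n
    proof -
     have "norm (\<xi> n * of_real (mangoldt n)) = norm (\<xi> n) * mangoldt n"
      using mangoldt_nonneg[of n] by (simp only: norm_mult norm_of_real abs_of_nonneg)
     also have "... \<le> 1 * mangoldt n" using mangoldt_nonneg[of n] dchar_norm_le[OF \<xi>(1)] by (intro mult_right_mono) auto
     finally show ?thesis using ml(1)[OF n] by linarith
    qed
    fix s :: complex assume "1 < Re s \<and> Re s \<le> 2"
    hence s: "1 < Re s" "Re s \<le> 2" by auto
    show "norm (DS (\<lambda>n. \<xi> n * of_real (mangoldt n) * of_real (ln (real n) ^ (3 * m))) s) \<le> C1 * real q powr (1/2) * (\<bar>Im s\<bar> + 2) powr (1/2)"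
     using C1(2)[OF \<xi> s] by (simp only: powr_mult mult.assoc)
   qed
   also have "... = K0 * (1 + C1 * real q powr (1/2)) * Y" by (simp add: Y_def)
   finally have "norm (?V \<xi>) \<le> K0 * (1 + C1 * real q powr (1/2)) * Y" .
   moreover have "norm (?V \<xi> - ?T \<xi>) \<le> Y"
    using mangoldt_prime_diff[OF dchar_norm_le[OF \<xi>(1)] x2(2)] Y(1) by (rule order_trans)
   moreover have "norm (?T \<xi>) \<le> norm (?V \<xi>) + norm (?V \<xi> - ?T \<xi>)"
    using norm_triangle_ineq4[of "?V \<xi>" "?V \<xi> - ?T \<xi>"] by simp
   ultimately show ?thesis using Kq(1) by linarith
  qed
  have pr: "norm (?T (prin q) - of_real (Li x)) \<le> W"
  proof -
   define S where "S = (\<Sum>n=2..nat \<lfloor>x\<rfloor>. 1 / ln (real n))"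
   have 1: "norm (\<Sum>n=2..nat \<lfloor>x\<rfloor>. of_real (mangoldt n - 1) / complex_of_real (ln (real n))) \<le> K0 * (1 + C2) * x / ln x ^ m"
   proof (rule T[OF xx(1) C2(1)])
    show "norm (complex_of_real (mangoldt n - 1)) \<le> ln (real n) + 1" if "n \<ge> 1" for n
     using ml(2)[OF that] by (simp only: norm_of_real)
   qed (rule C2(2); simp)
   have e: "(\<Sum>n=2..nat \<lfloor>x\<rfloor>. of_real (mangoldt n - 1) / complex_of_real (ln (real n))) = ?V (\<lambda>_. 1) - of_real S"
    unfolding S_def of_real_sum sum_subtractf[symmetric]
    by (rule sum.cong) (simp_all add: diff_divide_distrib del: of_real_mangoldt)
   have a: "norm (?V (\<lambda>_. 1) - of_real S) \<le> K0 * (1 + C2) * Y" using 1 unfolding e by (simp add: Y_def)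
   have b: "norm (?V (\<lambda>_. 1) - ?T (\<lambda>_. 1)) \<le> Y"
    using mangoldt_prime_diff[of "\<lambda>_. 1", OF _ x2(2)] Y(1) by simp
   have c: "norm (complex_of_real S - of_real (Li x)) \<le> Y"
   proof -
    have "complex_of_real S - of_real (Li x) = of_real (S - Li x)" by simp
    thus ?thesis using sum_ln_recip_Li[OF x2(1)] Y(2) unfolding S_def by (simp only: norm_of_real)
   qed
   have d: "norm (?T (\<lambda>_. 1) - ?T (prin q)) \<le> real q * Y"
   proof -
    have "?T (\<lambda>_. 1) - ?T (prin q) = (\<Sum>p|prime p \<and> real p \<le> x. if p dvd q then 1 else 0)"
     unfolding sum_subtractf[symmetric] by (rule sum.cong) (auto simp: prin_def prime_coprime_iff)
    also have "... = of_nat (card {p. prime p \<and> real p \<le> x \<and> p dvd q})"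
     using finite_primes_le[of x] by (simp add: sum.If_cases Int_def conj_assoc)
    finally have "norm (?T (\<lambda>_. 1) - ?T (prin q)) = real (card {p. prime p \<and> real p \<le> x \<and> p dvd q})" by simp
    also have "... \<le> real (card {1..q})"
    proof (intro of_nat_mono card_mono)
     show "{p. prime p \<and> real p \<le> x \<and> p dvd q} \<subseteq> {1..q}" using q by (auto simp: prime_ge_1_nat intro!: dvd_imp_le)
    qed simp
    also have "... \<le> real q * Y" using Y q by simp
    finally show ?thesis .
   qed
   have "?T (prin q) - of_real (Li x) = (?V (\<lambda>_. 1) - of_real S) - (?V (\<lambda>_. 1) - ?T (\<lambda>_. 1)) + (of_real S - of_real (Li x)) - (?T (\<lambda>_. 1) - ?T (prin q))" by simp
   also have "norm ... \<le> K0 * (1 + C2) * Y + Y + Y + real q * Y"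
    by (intro order_trans[OF norm_triangle_four] add_mono a b c d)
   also have "K0 * (1 + C2) * Y + Y + Y + real q * Y = K0 * (1 + C2) * Y + (2 * Y + real q * Y)" by simp
   also have "2 * Y + real q * Y \<le> 3 * real q * Y" using q Y mult_right_mono[of 1 "real q" Y] by simp
   finally show ?thesis using Kq(2) by linarith
  qed
  have fin: "finite {\<xi>. dchar q \<xi>}" by (rule finite_dchar)
  have phi: "real (totient q) > 0" using q by simp
  have "complex_of_real (real (totient q) * real (card (primes_1_mod x q)) - Li x) = (\<Sum>\<xi>|dchar q \<xi>. ?T \<xi> - (if \<xi> = prin q then of_real (Li x) else 0))"
   using primes_1_mod_eq_sum[of q x] q dchar_prin[of q] fin by (simp add: sum_subtractf)
  also have "norm ... \<le> (\<Sum>\<xi>|dchar q \<xi>. W)"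
  proof (rule sum_norm_le)
   fix \<xi> assume "\<xi> \<in> {\<xi>. dchar q \<xi>}"
   thus "norm (?T \<xi> - (if \<xi> = prin q then of_real (Li x) else 0)) \<le> W" using np[of \<xi>] pr by auto
  qed
  also have "... = real (totient q) * W" using card_dchar[of q] q by simp
  finally have "\<bar>real (totient q) * real (card (primes_1_mod x q)) - Li x\<bar> \<le> real (totient q) * W" by (simp only: norm_of_real)
  moreover have "real (totient q) * real (card (primes_1_mod x q)) - Li x = real (totient q) * (real (card (primes_1_mod x q)) - Li x / real (totient q))"
   using phi by (simp add: right_diff_distrib)
  ultimately have "real (totient q) * \<bar>real (card (primes_1_mod x q)) - Li x / real (totient q)\<bar> \<le> real (totient q) * W"
   using phi by (simp add: abs_mult)
  hence "\<bar>real (card (primes_1_mod x q)) - Li x / real (totient q)\<bar> \<le> W" using phi by (simp only: mult_le_cancel_left_pos)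
  thus "\<bar>real (card (primes_1_mod x q)) - Li x / real (totient q)\<bar> \<le> K * real q * x / ln x ^ m" by (simp add: W_def Y_def)
 qed
qed

declare One_nat_def [simp]

section \<open>Stephens' constant\<close>

definition mu :: "nat => real" where
 "mu n = (if squarefree n then (-1) ^ card (prime_factors n) else 0)"

lemma mu_abs_le: "\<bar>mu n\<bar> \<le> 1" by (simp add: mu_def power_abs)

lemma squarefree_multiplicity_prime: "squarefree (e::nat) ==> p \<in> prime_factors e ==> multiplicity p e = 1"
 by (metis One_nat_def in_prime_factors_iff le_antisym multiplicity_gt_zero_iff prime_elem_multiplicity_eq_zero_iff not_prime_unit
  Suc_leI prime_factors_multiplicity mem_Collect_eq squarefree_factorial_semiring'' not_squarefree_0)

lemma squarefree_prod_prime_factors: "squarefree (e::nat) ==> \<Prod>(prime_factors e) = e"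
proof -
 assume e: "squarefree e"
 hence "e > 0" using not_squarefree_0[where 'a = nat] by (cases "e = 0") auto
 hence "e = (\<Prod>p\<in>prime_factors e. p ^ multiplicity p e)" by (simp add: prime_factorization_nat)
 also have "... = (\<Prod>p\<in>prime_factors e. p)" by (rule prod.cong) (use squarefree_multiplicity_prime[OF e] in auto)
 finally show ?thesis by simp
qed

lemma prime_factors_prod_primes:
 assumes "finite X" "\<And>p. p \<in> X ==> prime (p::nat)" shows "prime_factors (\<Prod>X) = X"
proof -
 have "prime_factors (\<Prod>X) = (\<Union>x\<in>X. prime_factors x)"
  using assms by (subst prime_factors_prod) (auto dest: assms(2))
 also have "... = X" using assms by (simp add: prime_factorization_prime)
 finally show ?thesis .
qed

lemma squarefree_prod_primes:
 assumes "finite X" "\<And>p. p \<in> X ==> prime (p::nat)" shows "squarefree (\<Prod>X)"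
 by (rule squarefree_prod_coprime) (use assms in \<open>auto simp: primes_coprime squarefree_prime\<close>)

lemma prod_primes_dvd:
 assumes "X \<subseteq> prime_factors n" "n > (0::nat)" shows "\<Prod>X dvd n"
proof -
 have X: "finite X" "\<And>p. p \<in> X ==> prime p" using assms finite_subset by auto
 have "\<Prod>X dvd \<Prod>(prime_factors n)" by (rule prod_dvd_prod_subset) (use assms in auto)
 also have "\<Prod>(prime_factors n) dvd (\<Prod>p\<in>prime_factors n. p ^ multiplicity p n)"
  by (rule prod_dvd_prod) (auto simp: prime_factors_multiplicity intro!: dvd_power)
 also have "... = n" by (rule prime_factorization_nat[OF assms(2), symmetric])
 finally show ?thesis .
qed

text \<open>Squarefree divisors correspond to sets of prime factors, and the sum over these sets is
  the expanded product.\<close>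

lemma mu_divisor_sum:
 fixes c :: "nat => real"
 assumes n: "n > 0" and c: "c 1 = 1" "\<And>a b. c (a * b) = c a * c b"
 shows "(\<Sum>e | e dvd n. mu e * c e) = (\<Prod>p\<in>prime_factors n. 1 - c p)"
proof -
 have cp: "c (\<Prod>X) = (\<Prod>p\<in>X. c p)" if "finite X" for X
  using that by (induction X rule: finite_induct) (simp_all add: c(2) c(1)[unfolded One_nat_def])
 have "(\<Sum>e | e dvd n. mu e * c e) = (\<Sum>e | e dvd n \<and> squarefree e. mu e * c e)"
  by (rule sum.mono_neutral_right) (use n in \<open>auto simp: mu_def\<close>)
 also have "... = (\<Sum>X\<in>Pow (prime_factors n). (\<Prod>p\<in>X. - c p) * (\<Prod>p\<in>prime_factors n - X. 1))"
 proof (rule sum.reindex_bij_witness[of _ "\<lambda>X. \<Prod>X" prime_factors])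
  fix e assume "e \<in> {e. e dvd n \<and> squarefree e}"
  hence e: "e dvd n" "squarefree e" by auto
  show "\<Prod>(prime_factors e) = e" by (rule squarefree_prod_prime_factors[OF e(2)])
  show "prime_factors e \<in> Pow (prime_factors n)" using dvd_prime_factors[OF _ e(1)] n by simp
  show "(\<Prod>p\<in>prime_factors e. - c p) * (\<Prod>p\<in>prime_factors n - prime_factors e. 1) = mu e * c e"
   using e cp[of "prime_factors e"] squarefree_prod_prime_factors[OF e(2)] by (simp add: mu_def prod_uminus)
 next
  fix X assume X: "X \<in> Pow (prime_factors n)"
  hence X': "finite X" "\<And>p. p \<in> X ==> prime p" using finite_subset by auto
  show "prime_factors (\<Prod>X) = X" by (rule prime_factors_prod_primes[OF X'])
  show "\<Prod>X \<in> {e. e dvd n \<and> squarefree e}" using prod_primes_dvd[of X n] squarefree_prod_primes[OF X'] X n by auto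
 qed
 also have "... = (\<Prod>p\<in>prime_factors n. - c p + 1)" by (rule prod_add[symmetric]) simp
 finally show ?thesis by simp
qed

lemma mu_sum_eq:
 assumes "n > 0" shows "(\<Sum>e | e dvd n. mu e) = (if n = 1 then 1 else 0)"
proof -
 have eq: "(\<Sum>e | e dvd n. mu e) = 0 ^ card (prime_factors n)" using mu_divisor_sum[OF assms, of "\<lambda>_. 1"] by simp
 show ?thesis
 proof (cases "n = 1")
  case False
  then obtain p where "prime p" "p dvd n" using prime_factor_nat by blast
  hence "p \<in> prime_factors n" using assms by (simp add: in_prime_factors_iff)
  hence "card (prime_factors n) > 0" by (auto simp: card_gt_0_iff)
  thus ?thesis using eq False by simp
 qed (use eq in simp)
qed

text \<open>By \<open>gdens_mu\<close> this is the sum of mu(q / d) / (q d) over the divisors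
  \<open>d\<close> of \<open>q\<close>: the share of a divisor \<open>q\<close> of
  \<open>p - 1\<close> in the expected proportion of pairs.\<close>

definition gdens :: "nat => real" where
 "gdens q = (\<Prod>p\<in>prime_factors q. 1 - real p) / real q ^ 2"

text \<open>This is \<open>gdens q / totient q\<close>, the contribution of the modulus
  \<open>q\<close> after averaging over primes. The value 0 at 0 makes \<open>suminf hdens\<close> a
  sum over positive \<open>q\<close>.\<close>

definition hdens :: "nat => real" where
 "hdens q = (if q = 0 then 0 else (\<Prod>p\<in>prime_factors q. - real p) / real q ^ 3)"

lemma gdens_mu: assumes q: "q > 0" shows "(\<Sum>d | d dvd q. mu (q div d) / (real q * real d)) = gdens q"
proof -
 have "(\<Sum>d | d dvd q. mu (q div d) / (real q * real d)) = (\<Sum>e | e dvd q. mu e * real e / real q ^ 2)"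
 proof (rule sum.reindex_bij_witness[of _ "\<lambda>e. q div e" "\<lambda>e. q div e"])
  fix d assume "d \<in> {d. d dvd q}"
  then obtain e where e: "q = d * e" by auto
  show "q div (q div d) = d" "q div d \<in> {e. e dvd q}" using q e by auto
  show "mu (q div d) * real (q div d) / real q ^ 2 = mu (q div d) / (real q * real d)"
   using q e by (simp add: power2_eq_square field_simps)
 next
  fix d assume "d \<in> {d. d dvd q}"
  then obtain e where e: "q = d * e" by auto
  show "q div (q div d) = d" "q div d \<in> {e. e dvd q}" using q e by auto
 qed
 also have "... = (\<Sum>e | e dvd q. mu e * real e) / real q ^ 2" by (simp add: sum_divide_distrib)
 also have "(\<Sum>e | e dvd q. mu e * real e) = (\<Prod>p\<in>prime_factors q. 1 - real p)" by (rule mu_divisor_sum[OF q]) auto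
 finally show ?thesis by (simp add: gdens_def)
qed

lemma prod_prime_factors_le: assumes "q > 0" shows "(\<Prod>p\<in>prime_factors q. real p) \<le> real q"
proof -
 have "\<Prod>(prime_factors q) dvd q" by (rule prod_primes_dvd) (use assms in auto)
 hence "\<Prod>(prime_factors q) \<le> q" using assms by (rule dvd_imp_le)
 hence "real (\<Prod>(prime_factors q)) \<le> real q" by (rule of_nat_mono)
 thus ?thesis by simp
qed

lemma gdens_abs_le: assumes q: "q > 0" shows "\<bar>gdens q\<bar> \<le> 1 / real q"
proof -
 have "\<bar>\<Prod>p\<in>prime_factors q. 1 - real p\<bar> = (\<Prod>p\<in>prime_factors q. \<bar>1 - real p\<bar>)" by (rule abs_prod)
 also have "... \<le> (\<Prod>p\<in>prime_factors q. real p)"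
  by (rule prod_mono) (auto dest!: in_prime_factors_imp_prime prime_gt_0_nat)
 also have "... \<le> real q" by (rule prod_prime_factors_le[OF q])
 finally have "\<bar>gdens q\<bar> \<le> real q / real q ^ 2" unfolding gdens_def abs_divide by (simp add: divide_right_mono)
 thus ?thesis using q by (simp add: power2_eq_square)
qed

lemma hdens_abs_le: assumes q: "q > 0" shows "\<bar>hdens q\<bar> \<le> 1 / real q ^ 2"
proof -
 have "\<bar>\<Prod>p\<in>prime_factors q. - real p\<bar> = (\<Prod>p\<in>prime_factors q. \<bar>- real p\<bar>)" by (rule abs_prod)
 also have "... = (\<Prod>p\<in>prime_factors q. real p)" by simp
 also have "... \<le> real q" by (rule prod_prime_factors_le[OF q])
 finally have "\<bar>hdens q\<bar> \<le> real q / real q ^ 3" using q unfolding hdens_def abs_divide by (simp add: divide_right_mono)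
 also have "real q / real q ^ 3 = 1 / real q ^ 2" using q by (simp add: power2_eq_square power3_eq_cube)
 finally show ?thesis .
qed

lemma gdens_totient: assumes q: "q > 0" shows "gdens q / real (totient q) = hdens q"
proof -
 have "real (totient q) * (\<Prod>p\<in>prime_factors q. - real p) = real q * ((\<Prod>p\<in>prime_factors q. 1 - 1 / real p) * (\<Prod>p\<in>prime_factors q. - real p))"
  by (simp only: totient_formula2 mult.assoc)
 also have "(\<Prod>p\<in>prime_factors q. 1 - 1 / real p) * (\<Prod>p\<in>prime_factors q. - real p) = (\<Prod>p\<in>prime_factors q. (1 - 1 / real p) * (- real p))"
  by (rule prod.distrib[symmetric])
 also have "... = (\<Prod>p\<in>prime_factors q. 1 - real p)"
  by (rule prod.cong) (auto dest!: in_prime_factors_imp_prime prime_gt_0_nat simp: field_simps)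
 finally have "(\<Prod>p\<in>prime_factors q. 1 - real p) = real (totient q) * (\<Prod>p\<in>prime_factors q. - real p) / real q" using q by simp
 thus ?thesis using q by (simp add: gdens_def hdens_def power2_eq_square power3_eq_cube)
qed

lemma hdens_mult_prime:
 assumes p: "prime p"
 shows "hdens (p * q) = hdens q / real p ^ 3 * (if p dvd q then 1 else - real p)"
proof (cases "q = 0")
 case True thus ?thesis by (simp add: hdens_def)
next
 case False
 have p0: "p > 0" using p prime_gt_0_nat by blast
 have "prime_factors (p * q) = insert p (prime_factors q)"
  using p p0 False by (simp add: prime_factorization_mult prime_factorization_prime)
 moreover have "p \<in> prime_factors q \<longleftrightarrow> p dvd q" using p False by (auto simp: in_prime_factors_iff)
 ultimately show ?thesis using p0 False by (auto simp: hdens_def insert_absorb power_mult_distrib mult_ac)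
qed

lemma inverse_square_tail:
 assumes "1 \<le> Q" "Q \<le> N" shows "(\<Sum>n\<in>{Q<..N}. 1 / real n ^ 2) \<le> 1 / real Q - 1 / real N"
 using assms(2)
proof (induction N rule: dec_induct)
 case (step N)
 have "{Q<..Suc N} = insert (Suc N) {Q<..N}" using step by auto
 moreover have "1 / real (Suc N) ^ 2 \<le> 1 / real N - 1 / real (Suc N)"
 proof -
  have N: "real N > 0" using step assms by simp
  hence "real N * real (Suc N) \<le> real (Suc N) ^ 2" unfolding power2_eq_square by (intro mult_right_mono) auto
  hence "1 / real (Suc N) ^ 2 \<le> 1 / (real N * real (Suc N))" using N by (intro divide_left_mono) auto
  also have "... = 1 / real N - 1 / real (Suc N)" using N by (simp add: field_simps)
  finally show ?thesis .
 qed
 ultimately show ?case using step by simp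
qed simp

lemma inverse_square_summable:
 assumes "\<And>n. n > 0 ==> \<bar>a n :: real\<bar> \<le> 1 / real n ^ 2" shows "summable a"
proof (rule summable_comparison_test_ev[of _ "\<lambda>n. 1 / real n ^ 2"])
 show "\<forall>\<^sub>F n in sequentially. norm (a n) \<le> 1 / real n ^ 2"
  using eventually_gt_at_top[of 0] by eventually_elim (simp add: assms)
 show "summable (\<lambda>n. 1 / real n ^ 2)" using inverse_power_summable[of 2, where 'a = real] by (simp add: inverse_eq_divide)
qed

lemma inverse_square_suminf:
 assumes a: "\<And>n. n > 0 ==> \<bar>a n :: real\<bar> \<le> 1 / real n ^ 2" and Q: "Q \<ge> 1"
 shows "\<bar>suminf a - (\<Sum>n\<le>Q. a n)\<bar> \<le> 1 / real Q"
proof -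
 have "\<bar>(\<Sum>n\<le>N. a n) - (\<Sum>n\<le>Q. a n)\<bar> \<le> 1 / real Q" if N: "N \<ge> Q" for N
 proof -
  have "{..N} = {..Q} \<union> {Q<..N}" using N by auto
  hence "(\<Sum>n\<le>N. a n) = (\<Sum>n\<le>Q. a n) + (\<Sum>n\<in>{Q<..N}. a n)" by (simp only:) (rule sum.union_disjoint, auto)
  moreover have "\<bar>\<Sum>n\<in>{Q<..N}. a n\<bar> \<le> (\<Sum>n\<in>{Q<..N}. 1 / real n ^ 2)"
   by (rule sum_abs[THEN order_trans], rule sum_mono) (use a in auto)
  ultimately show ?thesis using inverse_square_tail[OF Q N] by simp (smt (verit) divide_nonneg_nonneg of_nat_0_le_iff)
 qed
 hence ev: "\<forall>\<^sub>F N in sequentially. \<bar>(\<Sum>n\<le>N. a n) - (\<Sum>n\<le>Q. a n)\<bar> \<le> 1 / real Q"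
  unfolding eventually_sequentially by blast
 have "(\<lambda>N. \<Sum>n\<le>N. a n) \<longlonglongrightarrow> suminf a" by (rule summable_LIMSEQ'[OF inverse_square_summable[OF a]])
 hence "(\<lambda>N. \<bar>(\<Sum>n\<le>N. a n) - (\<Sum>n\<le>Q. a n)\<bar>) \<longlonglongrightarrow> \<bar>suminf a - (\<Sum>n\<le>Q. a n)\<bar>"
  by (intro tendsto_rabs tendsto_diff tendsto_const)
 thus ?thesis using ev by (rule tendsto_upperbound) simp
qed

text \<open>The restriction to numbers composed of primes from \<open>P\<close> lets the Euler
  product grow one prime at a time.\<close>

definition hsm :: "nat set => nat => real" where
 "hsm P q = (if prime_factors q \<subseteq> P then hdens q else 0)"

lemma hsm_abs_le: "q > 0 ==> \<bar>hsm P q\<bar> \<le> 1 / real q ^ 2"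
 using hdens_abs_le[of q] by (auto simp: hsm_def)

lemma hsm_summable: "summable (hsm P)" by (rule inverse_square_summable[OF hsm_abs_le])

text \<open>The terms divisible by \<open>p\<close> form a sum that reappears in itself after the
  substitution of \<open>p * q\<close>, by \<open>hdens_mult_prime\<close>. Solving this linear
  equation takes the place of the geometric series over powers of \<open>p\<close>.\<close>

lemma stephens_euler_step:
 assumes p: "prime p" "p \<notin> P"
 shows "suminf (hsm (insert p P)) = suminf (hsm P) * (1 - real p / (real p ^ 3 - 1))"
proof -
 have p0: "p > 0" and p2: "p \<ge> 2" using p prime_gt_0_nat prime_ge_2_nat by blast+
 define F where "F = (\<lambda>q. if p dvd q then hsm (insert p P) q else 0)"
 have Fb: "\<bar>F q\<bar> \<le> 1 / real q ^ 2" if "q > 0" for q using hsm_abs_le[OF that] by (auto simp: F_def)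
 have sF: "summable F" by (rule inverse_square_summable[OF Fb])
 have split: "hsm (insert p P) q = hsm P q + F q" for q
 proof (cases "q = 0")
  case True thus ?thesis by (simp add: hsm_def F_def hdens_def)
 next
  case False
  hence "p \<in> prime_factors q \<longleftrightarrow> p dvd q" using p by (auto simp: in_prime_factors_iff)
  thus ?thesis using p(2) by (auto simp: hsm_def F_def)
 qed
 have "(\<lambda>q. F (p * q)) sums suminf F \<longleftrightarrow> F sums suminf F"
 proof (rule sums_mono_reindex)
  show "strict_mono (\<lambda>q. p * q)" using p0 by (auto simp: strict_mono_def)
  fix n assume "n \<notin> range (\<lambda>q. p * q)"
  thus "F n = 0" by (auto simp: F_def dvd_def)
 qed
 hence 1: "(\<lambda>q. F (p * q)) sums suminf F" using sF by (simp add: summable_sums)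
 have e: "F (p * q) = (F q + hsm P q * (- real p)) / real p ^ 3" for q
 proof (cases "q = 0")
  case True thus ?thesis by (simp add: F_def hsm_def hdens_def)
 next
  case False
  have "prime_factors (p * q) = insert p (prime_factors q)"
   using p p0 False by (simp add: prime_factorization_mult prime_factorization_prime)
  moreover have "p \<in> prime_factors q \<longleftrightarrow> p dvd q" using p False by (auto simp: in_prime_factors_iff)
  ultimately show ?thesis using p(2) hdens_mult_prime[OF p(1), of q] by (auto simp: F_def hsm_def)
 qed
 have "(\<lambda>q. (F q + hsm P q * (- real p)) / real p ^ 3) sums ((suminf F + suminf (hsm P) * (- real p)) / real p ^ 3)"
  by (intro sums_divide sums_add sums_mult2 summable_sums sF hsm_summable)
 hence "suminf F = (suminf F + suminf (hsm P) * (- real p)) / real p ^ 3" using 1 unfolding e by (rule sums_unique2[rotated])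
 hence eq: "suminf F * (real p ^ 3 - 1) = - real p * suminf (hsm P)" using p0 by (simp add: field_simps)
 have "1 < real p ^ 3" using p2 by (intro one_less_power) auto
 hence "suminf F = - real p * suminf (hsm P) / (real p ^ 3 - 1)" using eq by (simp add: field_simps)
 moreover have "suminf (hsm (insert p P)) = suminf (hsm P) + suminf F"
  unfolding split by (rule suminf_add[symmetric, OF hsm_summable sF])
 ultimately show ?thesis by (simp add: algebra_simps)
qed

lemma stephens_euler_finite:
 assumes "finite P" "\<And>p. p \<in> P ==> prime p"
 shows "suminf (hsm P) = (\<Prod>p\<in>P. 1 - real p / (real p ^ 3 - 1))" using assms
proof (induction P rule: finite_induct)
 case empty
 have "hsm {} q = (if q = 1 then 1 else 0)" for q by (cases "q = 0") (auto simp: hsm_def hdens_def prime_factorization_empty_iff)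
 hence "hsm {} = (\<lambda>q. if q = 1 then 1 else 0)" by blast
 moreover have "(\<lambda>q::nat. if q = 1 then 1 else 0 :: real) sums 1" by (rule sums_single)
 ultimately show ?case by (simp add: sums_unique[symmetric])
next
 case (insert p P)
 thus ?case using stephens_euler_step[of p P] by simp
qed

text \<open>The product over primes up to \<open>n\<close> is the total of \<open>hsm\<close>, which
  agrees with \<open>hdens\<close> up to \<open>n\<close>; both tails are at most
  \<open>1 / n\<close>.\<close>

lemma stephens_C_hdens: "suminf hdens = stephens_C"
proof -
 let ?f = "\<lambda>n. if prime n then 1 - real n / (real n ^ 3 - 1) else 1"
 have "summable (\<lambda>n. norm (?f n - 1))"
 proof (rule summable_comparison_test_ev)
  show "\<forall>\<^sub>F n in sequentially. norm (norm (?f n - 1)) \<le> 2 * (1 / real n ^ 2)" using eventually_ge_at_top[of 2]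
  proof eventually_elim
   case (elim n)
   have "real n ^ 3 \<ge> 2 ^ 3" using elim by (intro power_mono) auto
   hence n3: "real n ^ 3 \<ge> 8" by simp
   hence "real n / (real n ^ 3 - 1) \<le> real n / (real n ^ 3 / 2)" using elim by (intro divide_left_mono) auto
   also have "... = 2 * (1 / real n ^ 2)" using elim by (simp add: power2_eq_square power3_eq_cube)
   finally have "real n / (real n ^ 3 - 1) \<le> 2 * (1 / real n ^ 2)" .
   moreover have "real n / (real n ^ 3 - 1) \<ge> 0" using n3 by simp
   ultimately show ?case by auto
  qed
  show "summable (\<lambda>n. 2 * (1 / real n ^ 2))"
   using inverse_power_summable[of 2, where 'a = real] by (intro summable_mult) (simp add: inverse_eq_divide)
 qed
 hence "convergent_prod ?f" by (intro abs_convergent_prod_imp_convergent_prod summable_imp_abs_convergent_prod)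
 hence lim: "(\<lambda>n. \<Prod>i\<le>n. ?f i) \<longlonglongrightarrow> stephens_C" unfolding stephens_C_def by (rule convergent_prod_LIMSEQ)
 have "\<bar>suminf hdens - (\<Prod>i\<le>n. ?f i)\<bar> \<le> 2 / real n" if n: "n \<ge> 1" for n
 proof -
  let ?P = "{p\<in>{..n}. prime p}"
  have "(\<Prod>i\<le>n. ?f i) = (\<Prod>p\<in>?P. 1 - real p / (real p ^ 3 - 1))" by (rule prod.inter_filter[symmetric]) simp
  also have "... = suminf (hsm ?P)" by (rule stephens_euler_finite[symmetric]) auto
  finally have e: "(\<Prod>i\<le>n. ?f i) = suminf (hsm ?P)" .
  have "(\<Sum>q\<le>n. hsm ?P q) = (\<Sum>q\<le>n. hdens q)"
  proof (rule sum.cong)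
   fix q assume q: "q \<in> {..n}"
   have "prime_factors q \<subseteq> ?P" if "q \<noteq> 0"
    using that q by (auto simp: in_prime_factors_iff intro: order_trans[OF dvd_imp_le])
   thus "hsm ?P q = hdens q" by (auto simp: hsm_def hdens_def)
  qed simp
  thus ?thesis using inverse_square_suminf[of hdens n, OF hdens_abs_le n] inverse_square_suminf[of "hsm ?P" n, OF hsm_abs_le n] unfolding e by simp
 qed
 hence "\<forall>\<^sub>F n in sequentially. norm (suminf hdens - (\<Prod>i\<le>n. ?f i)) \<le> 2 / real n"
  unfolding eventually_sequentially real_norm_def by blast
 moreover have "(\<lambda>n. 2 / real n) \<longlonglongrightarrow> 0" by real_asymp
 ultimately have "(\<lambda>n. suminf hdens - (\<Prod>i\<le>n. ?f i)) \<longlonglongrightarrow> 0" by (rule Lim_null_comparison)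
 moreover have "(\<lambda>n. suminf hdens - (\<Prod>i\<le>n. ?f i)) \<longlonglongrightarrow> suminf hdens - stephens_C" by (intro tendsto_diff tendsto_const lim)
 ultimately have "suminf hdens - stephens_C = 0" using LIMSEQ_unique by blast
 thus ?thesis by simp
qed

lemma stephens_C_partial: "Q \<ge> 1 ==> \<bar>stephens_C - (\<Sum>q=1..Q. hdens q)\<bar> \<le> 1 / real Q"
proof -
 assume Q: "Q \<ge> 1"
 have "(\<Sum>q\<le>Q. hdens q) = (\<Sum>q=1..Q. hdens q)" by (rule sum.mono_neutral_right) (auto simp: hdens_def not_less_eq_eq)
 thus ?thesis using inverse_square_suminf[of hdens Q, OF hdens_abs_le Q] stephens_C_hdens by simp
qed

section \<open>The densities summed over primes\<close>

lemma primes_1_mod_iff: "prime (p::nat) ==> [p = 1] (mod q) \<longleftrightarrow> q dvd p - 1"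
 unfolding cong_def by (rule mod_eq_dvd_iff_nat) (rule prime_ge_1_nat)

lemma primes_1_modD: "p \<in> primes_1_mod x q ==> q dvd p - 1 \<and> p \<ge> 2 \<and> real p \<le> x"
 using primes_1_mod_iff prime_ge_2_nat unfolding primes_1_mod_def by blast

text \<open>The quotient of \<open>p - 1\<close> by \<open>q\<close> determines \<open>p\<close> and
  is at least 1. This count serves the moduli for which the error in \<open>siegel_walfisz\<close>
  would be too large.\<close>

lemma card_primes_1_mod_le:
 assumes q: "q \<ge> 1" shows "real (card (primes_1_mod x q)) \<le> x / real q \<or> x < 0"
proof (cases "x < 0")
 case False
 have "card (primes_1_mod x q) \<le> card {1..nat \<lfloor>x / real q\<rfloor>}"
 proof (rule card_inj_on_le[of "\<lambda>p. (p - 1) div q"])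
  show "inj_on (\<lambda>p. (p - 1) div q) (primes_1_mod x q)"
  proof (rule inj_onI)
   fix p p' assume "p \<in> primes_1_mod x q" "p' \<in> primes_1_mod x q" and e: "(p - 1) div q = (p' - 1) div q"
   hence p: "q dvd p - 1" "q dvd p' - 1" "p \<ge> 1" "p' \<ge> 1" using primes_1_modD by fastforce+
   have "p - 1 = p' - 1" using p e by (metis dvd_div_mult_self)
   thus "p = p'" using p by simp
  qed
  show "(\<lambda>p. (p - 1) div q) ` primes_1_mod x q \<subseteq> {1..nat \<lfloor>x / real q\<rfloor>}"
  proof safe
   fix p assume p: "p \<in> primes_1_mod x q"
   hence d: "q dvd p - 1" "p \<ge> 2" "real p \<le> x" using primes_1_modD by blast+
   then obtain j where j: "p - 1 = q * j" by auto
   have "j \<noteq> 0" using j d by (intro notI) simp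
   have "q * j \<le> p" using j by simp
   hence "real q * real j \<le> real p" unfolding of_nat_mult[symmetric] by (rule of_nat_mono)
   hence "real j \<le> x / real q" using d q by (simp add: pos_le_divide_eq mult.commute)
   hence "j \<le> nat \<lfloor>x / real q\<rfloor>" by (simp add: le_nat_floor)
   thus "(p - 1) div q \<in> {1..nat \<lfloor>x / real q\<rfloor>}" using j q \<open>j \<noteq> 0\<close> by simp
  qed
 qed simp
 hence "real (card (primes_1_mod x q)) \<le> real (nat \<lfloor>x / real q\<rfloor>)" by simp
 also have "... \<le> x / real q" using False q by simp
 finally show ?thesis ..
qed simp

text \<open>For \<open>n = p - 1\<close>: the expected proportion, among pairs of residues prime to
  \<open>p\<close>, of those whose second member lies in the subgroup generated by the
  first.\<close>

definition Mdens :: "nat => real" where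
 "Mdens n = (\<Sum>q | q dvd n. gdens q)"

lemma sum_Mdens_primes:
 "(\<Sum>p | prime p \<and> real p \<le> x. Mdens (p - 1)) = (\<Sum>q=1..nat \<lfloor>x\<rfloor>. gdens q * real (card (primes_1_mod x q)))"
proof -
 have "(\<Sum>p | prime p \<and> real p \<le> x. Mdens (p - 1)) = (\<Sum>p | prime p \<and> real p \<le> x. \<Sum>q=1..nat \<lfloor>x\<rfloor>. if [p = 1] (mod q) then gdens q else 0)"
 proof (rule sum.cong)
  fix p assume "p \<in> {p. prime p \<and> real p \<le> x}"
  hence p: "prime p" "real p \<le> x" "p \<ge> 2" by (auto simp: prime_ge_2_nat)
  have "{q. q dvd p - 1} = {q\<in>{1..nat \<lfloor>x\<rfloor>}. [p = 1] (mod q)}"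
  proof (intro equalityI subsetI)
   fix q assume "q \<in> {q. q dvd p - 1}"
   hence q: "q dvd p - 1" by simp
   hence "q \<le> p - 1" "q \<noteq> 0" using p by (auto intro!: dvd_imp_le gr0I)
   moreover have "p \<le> nat \<lfloor>x\<rfloor>" using p by (simp add: le_nat_floor)
   ultimately show "q \<in> {q\<in>{1..nat \<lfloor>x\<rfloor>}. [p = 1] (mod q)}" using q primes_1_mod_iff[OF p(1)] by auto
  qed (use primes_1_mod_iff[OF p(1)] in auto)
  thus "Mdens (p - 1) = (\<Sum>q=1..nat \<lfloor>x\<rfloor>. if [p = 1] (mod q) then gdens q else 0)"
   unfolding Mdens_def by (simp only: sum.inter_filter[OF finite_atLeastAtMost])
 qed simp
 also have "... = (\<Sum>q=1..nat \<lfloor>x\<rfloor>. \<Sum>p | prime p \<and> real p \<le> x. if [p = 1] (mod q) then gdens q else 0)" by (rule sum.swap)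
 also have "... = (\<Sum>q=1..nat \<lfloor>x\<rfloor>. gdens q * real (card (primes_1_mod x q)))"
  using finite_primes_le[of x] by (intro sum.cong) (simp_all add: sum.If_cases primes_1_mod_def Int_def conj_assoc mult.commute)
 finally show ?thesis .
qed

text \<open>The moduli are cut at \<open>L = ln x ^ D\<close>. Up to there about \<open>L\<close>
  terms err by \<open>K0 * x / L ^ 2\<close> each, hence the exponent \<open>2 * D\<close> in
  \<open>siegel_walfisz\<close>; beyond, the terms are at most \<open>x / q ^ 2\<close>, and
  completing the series of \<open>hdens\<close> costs at most \<open>Li x / Q\<close>.\<close>

lemma sum_Mdens_primes_asymp:
 fixes D :: nat
 assumes D: "D \<ge> 1"
 shows "\<exists>K>0. \<exists>x0. \<forall>x\<ge>x0. \<bar>(\<Sum>p | prime p \<and> real p \<le> x. Mdens (p - 1)) - stephens_C * Li x\<bar> \<le> K * x / ln x ^ D"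
proof -
 have "2 * D \<ge> 1" using D by simp
 then obtain K0 x0 where K0: "K0 > 0" and sw: "\<And>x q. x \<ge> x0 ==> q \<ge> 1 ==> \<bar>real (card (primes_1_mod x q)) - Li x / real (totient q)\<bar> \<le> K0 * real q * x / ln x ^ (2 * D)"
  using siegel_walfisz[of "2 * D"] by blast
 have "\<forall>\<^sub>F x::real in at_top. ln x ^ D \<ge> 2" using D by real_asymp
 moreover have "\<forall>\<^sub>F x::real in at_top. ln x ^ D \<le> x" by real_asymp
 moreover have "\<forall>\<^sub>F x::real in at_top. x \<ge> max x0 2" by (rule eventually_ge_at_top)
 ultimately have "\<forall>\<^sub>F x::real in at_top. ln x ^ D \<ge> 2 \<and> ln x ^ D \<le> x \<and> x \<ge> max x0 2" by eventually_elim simp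
 then obtain x1 where x1: "\<And>x. x \<ge> x1 ==> ln x ^ D \<ge> 2 \<and> ln x ^ D \<le> x \<and> x \<ge> max x0 2"
  unfolding eventually_at_top_linorder by blast
 show ?thesis
 proof (rule exI[of _ "K0 + 6"], intro conjI exI[of _ x1] allI impI)
  fix x assume x: "x1 \<le> x"
  define L where "L = ln x ^ D"
  have L: "L \<ge> 2" "L \<le> x" and xx: "x \<ge> x0" "x \<ge> 2" using x1[OF x] by (auto simp: L_def)
  define X where "X = nat \<lfloor>x\<rfloor>"
  define Q where "Q = nat \<lfloor>L\<rfloor>"
  have Q: "Q \<ge> 1" "real Q \<le> L" "real Q \<ge> L / 2" using L unfolding Q_def by linarith+
  have QX: "Q \<le> X" using L unfolding Q_def X_def by (intro nat_mono floor_mono)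
  let ?c = "\<lambda>q. real (card (primes_1_mod x q))"
  have "{1..X} = {1..Q} \<union> {Q<..X}" using QX Q by auto
  hence "(\<Sum>q=1..X. gdens q * ?c q) = (\<Sum>q=1..Q. gdens q * ?c q) + (\<Sum>q\<in>{Q<..X}. gdens q * ?c q)"
   by (simp only:) (rule sum.union_disjoint, auto)
  also have "(\<Sum>q=1..Q. gdens q * ?c q) = (\<Sum>q=1..Q. gdens q * (?c q - Li x / real (totient q))) + (\<Sum>q=1..Q. hdens q) * Li x"
   unfolding sum_distrib_right sum.distrib[symmetric] by (rule sum.cong) (auto simp: gdens_totient[symmetric] right_diff_distrib)
  finally have eq: "(\<Sum>q=1..X. gdens q * ?c q) - stephens_C * Li x = (\<Sum>q=1..Q. gdens q * (?c q - Li x / real (totient q)))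
    + (\<Sum>q\<in>{Q<..X}. gdens q * ?c q) - (stephens_C - (\<Sum>q=1..Q. hdens q)) * Li x" by (simp add: algebra_simps)
  have 1: "\<bar>\<Sum>q=1..Q. gdens q * (?c q - Li x / real (totient q))\<bar> \<le> K0 * (x / L)"
  proof -
   have "\<bar>\<Sum>q=1..Q. gdens q * (?c q - Li x / real (totient q))\<bar> \<le> (\<Sum>q=1..Q. K0 * x / L\<^sup>2)"
   proof (rule sum_abs[THEN order_trans], rule sum_mono)
    fix q assume q: "q \<in> {1..Q}"
    have "\<bar>gdens q * (?c q - Li x / real (totient q))\<bar> \<le> (1 / real q) * (K0 * real q * x / ln x ^ (2 * D))"
     unfolding abs_mult using q gdens_abs_le[of q] sw[OF xx(1), of q] by (intro mult_mono) auto
    also have "... = K0 * x / L\<^sup>2" using q by (simp add: L_def power_mult[symmetric] mult.commute)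
    finally show "\<bar>gdens q * (?c q - Li x / real (totient q))\<bar> \<le> K0 * x / L\<^sup>2" .
   qed
   also have "... = real Q * (K0 * x / L\<^sup>2)" by simp
   also have "... \<le> L * (K0 * x / L\<^sup>2)" using Q K0 xx by (intro mult_right_mono) auto
   also have "... = K0 * (x / L)" using L by (simp add: power2_eq_square)
   finally show ?thesis .
  qed
  have Qinv: "1 / real Q \<le> 2 / L" using Q L by (simp add: field_simps)
  have 2: "\<bar>\<Sum>q\<in>{Q<..X}. gdens q * ?c q\<bar> \<le> 2 * (x / L)"
  proof -
   have "\<bar>\<Sum>q\<in>{Q<..X}. gdens q * ?c q\<bar> \<le> (\<Sum>q\<in>{Q<..X}. x * (1 / real q ^ 2))"
   proof (rule sum_abs[THEN order_trans], rule sum_mono)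
    fix q assume q: "q \<in> {Q<..X}"
    have "?c q \<le> x / real q" using card_primes_1_mod_le[of q x] q xx by auto
    hence "\<bar>gdens q * ?c q\<bar> \<le> (1 / real q) * (x / real q)"
     unfolding abs_mult using q gdens_abs_le[of q] by (intro mult_mono) auto
    thus "\<bar>gdens q * ?c q\<bar> \<le> x * (1 / real q ^ 2)" by (simp add: power2_eq_square)
   qed
   also have "... = x * (\<Sum>q\<in>{Q<..X}. 1 / real q ^ 2)" by (simp only: sum_distrib_left)
   also have "... \<le> x * (1 / real Q - 1 / real X)" using inverse_square_tail[OF Q(1) QX] xx by (intro mult_left_mono) auto
   also have "... \<le> x * (2 / L)"
   proof (intro mult_left_mono)
    have "1 / real X \<ge> 0" by simp
    thus "1 / real Q - 1 / real X \<le> 2 / L" using Qinv by linarith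
   qed (use xx in auto)
   finally show ?thesis by (simp add: mult_ac)
  qed
  have 3: "\<bar>(stephens_C - (\<Sum>q=1..Q. hdens q)) * Li x\<bar> \<le> 4 * (x / L)"
  proof -
   have "\<bar>(stephens_C - (\<Sum>q=1..Q. hdens q)) * Li x\<bar> \<le> (2 / L) * (2 * x)"
    unfolding abs_mult using stephens_C_partial[OF Q(1)] Qinv Li_nonneg[of x] Li_le[of x] xx L by (intro mult_mono) auto
   thus ?thesis by (simp add: mult_ac)
  qed
  have "\<bar>(\<Sum>q=1..X. gdens q * ?c q) - stephens_C * Li x\<bar> \<le> K0 * (x / L) + 2 * (x / L) + 4 * (x / L)"
   unfolding eq using 1 2 3 by linarith
  also have "... = (K0 + 6) * x / L" by (simp add: algebra_simps add_divide_distrib)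
  finally show "\<bar>(\<Sum>p | prime p \<and> real p \<le> x. Mdens (p - 1)) - stephens_C * Li x\<bar> \<le> (K0 + 6) * x / ln x ^ D"
   unfolding sum_Mdens_primes by (simp add: X_def L_def)
 qed (use K0 in auto)
qed

section \<open>Counting factorisations\<close>

text \<open>For \<open>n > 0\<close> this counts the ordered \<open>k\<close>-tuples from
  \<open>A\<close> with product \<open>n\<close>. When \<open>A\<close> consists of all positive
  integers it is the \<open>k\<close>-fold divisor function.\<close>

fun tupc :: "nat set => nat => nat => nat" where
 "tupc A 0 n = (if n = 1 then 1 else 0)"
| "tupc A (Suc k) n = (\<Sum>d\<in>{d\<in>A. d dvd n}. tupc A k (n div d))"

definition cmult :: "(nat => 'a::comm_semiring_1) => bool" where
 "cmult f \<longleftrightarrow> f 1 = 1 \<and> (\<forall>a>0. \<forall>b>0. f (a * b) = f a * f b)"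

lemma cmultD: "cmult f ==> f 1 = 1" "cmult f ==> a > 0 ==> b > 0 ==> f (a * b) = f a * f b"
 by (auto simp: cmult_def)

lemma sum_multiples:
 fixes g :: "nat => 'a::comm_monoid_add"
 assumes d: "d > 0"
 shows "(\<Sum>n\<in>{n\<in>{1..M}. d dvd n}. g (n div d)) = (\<Sum>m=1..M div d. g m)"
proof (rule sum.reindex_bij_witness[of _ "\<lambda>m. d * m" "\<lambda>n. n div d"])
 fix n assume n: "n \<in> {n\<in>{1..M}. d dvd n}"
 thus "d * (n div d) = n" by simp
 have "n div d \<le> M div d" using n by (intro div_le_mono) auto
 moreover have "n div d > 0" using n d by (auto simp: div_greater_zero_iff dvd_imp_le)
 ultimately show "n div d \<in> {1..M div d}" by simp
next
 fix m assume m: "m \<in> {1..M div d}"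
 show "d * m div d = m" using d by simp
 have "d * m \<le> M" using m d by (simp add: less_eq_div_iff_mult_less_eq mult.commute)
 thus "d * m \<in> {n\<in>{1..M}. d dvd n}" using m d by (simp add: Suc_le_eq)
qed simp

text \<open>The first component \<open>d\<close> of the tuples is split off; the cofactors then
  range up to \<open>M div d\<close>.\<close>

lemma tupc_sum_swap:
 fixes f :: "nat => 'a::comm_semiring_1"
 assumes f: "cmult f" and A: "0 \<notin> A"
 shows "(\<Sum>n=1..M. of_nat (tupc A (Suc k) n) * f n) =
  (\<Sum>d\<in>{d\<in>A. d \<le> M}. f d * (\<Sum>m=1..M div d. of_nat (tupc A k m) * f m))"
proof -
 have "(\<Sum>n=1..M. of_nat (tupc A (Suc k) n) * f n) =
  (\<Sum>n=1..M. \<Sum>d\<in>{d\<in>A. d \<le> M}. if d dvd n then f d * (of_nat (tupc A k (n div d)) * f (n div d)) else 0)"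
 proof (rule sum.cong)
  fix n assume n: "n \<in> {1..M}"
  have "{d\<in>A. d dvd n} = {d\<in>{d\<in>A. d \<le> M}. d dvd n}" using n by (auto dest: dvd_imp_le)
  hence "of_nat (tupc A (Suc k) n) * f n = (\<Sum>d\<in>{d\<in>{d\<in>A. d \<le> M}. d dvd n}. of_nat (tupc A k (n div d)) * f n)"
   by (simp add: sum_distrib_right)
  also have "... = (\<Sum>d\<in>{d\<in>{d\<in>A. d \<le> M}. d dvd n}. f d * (of_nat (tupc A k (n div d)) * f (n div d)))"
  proof (rule sum.cong)
   fix d assume d: "d \<in> {d\<in>{d\<in>A. d \<le> M}. d dvd n}"
   then obtain e where e: "n = d * e" by auto
   have "d > 0" "e > 0" using n e by auto
   thus "of_nat (tupc A k (n div d)) * f n = f d * (of_nat (tupc A k (n div d)) * f (n div d))"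
    using cmultD(2)[OF f, of d e] e by (simp add: mult_ac)
  qed simp
  also have "... = (\<Sum>d\<in>{d\<in>A. d \<le> M}. if d dvd n then f d * (of_nat (tupc A k (n div d)) * f (n div d)) else 0)"
   by (rule sum.inter_filter) simp
  finally show "of_nat (tupc A (Suc k) n) * f n = (\<Sum>d\<in>{d\<in>A. d \<le> M}. if d dvd n then f d * (of_nat (tupc A k (n div d)) * f (n div d)) else 0)" .
 qed simp
 also have "... = (\<Sum>d\<in>{d\<in>A. d \<le> M}. \<Sum>n=1..M. if d dvd n then f d * (of_nat (tupc A k (n div d)) * f (n div d)) else 0)" by (rule sum.swap)
 also have "... = (\<Sum>d\<in>{d\<in>A. d \<le> M}. f d * (\<Sum>m=1..M div d. of_nat (tupc A k m) * f m))"
 proof (rule sum.cong)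
  fix d assume "d \<in> {d\<in>A. d \<le> M}"
  hence d: "d > 0" using A by (auto intro!: gr0I)
  have "(\<Sum>n=1..M. if d dvd n then f d * (of_nat (tupc A k (n div d)) * f (n div d)) else 0)
    = (\<Sum>n\<in>{n\<in>{1..M}. d dvd n}. f d * (of_nat (tupc A k (n div d)) * f (n div d)))" by (rule sum.inter_filter[symmetric]) simp
  also have "... = (\<Sum>m=1..M div d. f d * (of_nat (tupc A k m) * f m))" by (rule sum_multiples[OF d])
  finally show "(\<Sum>n=1..M. if d dvd n then f d * (of_nat (tupc A k (n div d)) * f (n div d)) else 0) = f d * (\<Sum>m=1..M div d. of_nat (tupc A k m) * f m)"
   by (simp add: sum_distrib_left)
 qed simp
 finally show ?thesis .
qed

text \<open>A product of \<open>k\<close> numbers up to \<open>N\<close> is at most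
  \<open>N ^ k\<close>, so the range up to \<open>M\<close> misses no tuple.\<close>

lemma tupc_power:
 fixes f :: "nat => 'a::comm_semiring_1"
 assumes f: "cmult f" and N: "N \<ge> 1"
 shows "M \<ge> N ^ k ==> (\<Sum>n=1..M. of_nat (tupc {1..N} k n) * f n) = (\<Sum>a=1..N. f a) ^ k"
proof (induction k arbitrary: M)
 case 0
 have "(\<Sum>n=1..M. of_nat (tupc {1..N} 0 n) * f n) = (\<Sum>n\<in>{1}. of_nat (tupc {1..N} 0 n) * f n)"
  by (rule sum.mono_neutral_right) (use 0 in auto)
 thus ?case using cmultD(1)[OF f] by simp
next
 case (Suc k)
 have NM: "N \<le> M"
 proof -
  have "N * 1 \<le> N * N ^ k" using N by (intro mult_left_mono) auto
  also have "... \<le> M" using Suc.prems by simp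
  finally show ?thesis by simp
 qed
 have "(\<Sum>n=1..M. of_nat (tupc {1..N} (Suc k) n) * f n) = (\<Sum>d\<in>{d\<in>{1..N}. d \<le> M}. f d * (\<Sum>m=1..M div d. of_nat (tupc {1..N} k m) * f m))"
  by (rule tupc_sum_swap[OF f]) simp
 also have "{d\<in>{1..N}. d \<le> M} = {1..N}" using NM by auto
 also have "(\<Sum>d=1..N. f d * (\<Sum>m=1..M div d. of_nat (tupc {1..N} k m) * f m)) = (\<Sum>d=1..N. f d * (\<Sum>a=1..N. f a) ^ k)"
 proof (rule sum.cong)
  fix d assume d: "d \<in> {1..N}"
  have "N ^ k * d \<le> N ^ k * N" using d by (intro mult_left_mono) auto
  also have "N ^ k * N \<le> M" using Suc.prems by (simp add: mult.commute)
  finally have "N ^ k * d \<le> M" .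
  hence "N ^ k \<le> M div d" using d by (simp add: less_eq_div_iff_mult_less_eq)
  thus "f d * (\<Sum>m=1..M div d. of_nat (tupc {1..N} k m) * f m) = f d * (\<Sum>a=1..N. f a) ^ k" by (simp only: Suc.IH)
 qed simp
 also have "... = (\<Sum>a=1..N. f a) ^ Suc k" by (simp add: sum_distrib_right)
 finally show ?case .
qed

text \<open>Here the bound on the product excludes some tuples of the expanded power, which are
  nonnegative terms.\<close>

lemma tupc_power_le:
 fixes f :: "nat => real"
 assumes f: "cmult f" "\<And>n. f n \<ge> 0"
 shows "M \<le> X ==> (\<Sum>n=1..M. real (tupc {0<..} k n) * f n) \<le> (\<Sum>a=1..X. f a) ^ k"
proof (induction k arbitrary: M)
 case 0
 have "(\<Sum>n=1..M. real (tupc {0<..} 0 n) * f n) \<le> (\<Sum>n\<in>{1}. real (tupc {0<..} 0 n) * f n)"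
 proof (cases "M \<ge> 1")
  case True
  hence "(\<Sum>n=1..M. real (tupc {0<..} 0 n) * f n) = (\<Sum>n\<in>{1}. real (tupc {0<..} 0 n) * f n)"
   by (intro sum.mono_neutral_right) auto
  thus ?thesis by (rule eq_refl)
 next
  case False
  hence "{1..M} = {}" by simp
  thus ?thesis using f(2)[of 1] by (simp only: sum.empty) simp
 qed
 thus ?case using cmultD(1)[OF f(1)] by simp
next
 case (Suc k)
 have "(\<Sum>n=1..M. real (tupc {0<..} (Suc k) n) * f n) = (\<Sum>d\<in>{d\<in>{0<..}. d \<le> M}. f d * (\<Sum>m=1..M div d. real (tupc {0<..} k m) * f m))"
  by (rule tupc_sum_swap[OF f(1)]) simp
 also have "... \<le> (\<Sum>d\<in>{d\<in>{0<..}. d \<le> M}. f d * (\<Sum>a=1..X. f a) ^ k)"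
 proof (intro sum_mono mult_left_mono Suc.IH f)
  fix d assume "d \<in> {d\<in>{0<..}. d \<le> M}"
  have "M div d \<le> M" by simp
  thus "M div d \<le> X" using Suc.prems by linarith
 qed
 also have "... \<le> (\<Sum>d=1..X. f d * (\<Sum>a=1..X. f a) ^ k)"
  by (rule sum_mono2) (use Suc.prems f(2) in \<open>auto intro!: mult_nonneg_nonneg zero_le_power sum_nonneg\<close>)
 also have "... = (\<Sum>a=1..X. f a) ^ Suc k" by (simp add: sum_distrib_right)
 finally show ?case .
qed

abbreviation tk :: "nat => nat => nat" where "tk \<equiv> tupc {0<..}"

lemma tk_Suc: "n > 0 ==> tk (Suc k) n = (\<Sum>d | d dvd n. tk k (n div d))"
proof -
 assume n: "n > 0"
 have "{d\<in>{0<..}. d dvd n} = {d. d dvd n}" using n by (auto intro!: gr0I)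
 thus ?thesis by simp
qed

lemma tupc_le_tk: "n > 0 ==> 0 \<notin> A ==> tupc A k n \<le> tk k n"
proof (induction k arbitrary: n)
 case (Suc k)
 have "tupc A (Suc k) n \<le> (\<Sum>d\<in>{d\<in>A. d dvd n}. tk k (n div d))" unfolding tupc.simps
 proof (intro sum_mono Suc.IH Suc.prems)
  fix d assume "d \<in> {d\<in>A. d dvd n}"
  thus "0 < n div d" using Suc.prems by (auto elim!: dvdE)
 qed
 also have "... \<le> (\<Sum>d | d dvd n. tk k (n div d))" by (rule sum_mono2) (use Suc.prems in auto)
 finally show ?case using tk_Suc[OF Suc.prems(1)] by simp
qed simp

text \<open>Every divisor of \<open>m * n\<close> is a product of divisors of \<open>m\<close> and
  \<open>n\<close>, possibly in several ways.\<close>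

lemma tk_mult_le: "m > 0 ==> n > 0 ==> tk k (m * n) \<le> tk k m * tk k n"
proof (induction k arbitrary: m n)
 case (Suc k)
 have pos: "m * n > 0" using Suc.prems by simp
 let ?D = "{d. d dvd m} \<times> {e. e dvd n}"
 have "tk (Suc k) (m * n) = (\<Sum>d | d dvd m * n. tk k (m * n div d))" by (rule tk_Suc[OF pos])
 also have "{d. d dvd m * n} = (\<lambda>(d, e). d * e) ` ?D"
 proof
  show "{d. d dvd m * n} \<subseteq> (\<lambda>(d, e). d * e) ` ?D"
  proof
   fix d assume "d \<in> {d. d dvd m * n}"
   then obtain b c where "d = b * c" "b dvd m" "c dvd n" using division_decomp[of d m n] by blast
   thus "d \<in> (\<lambda>(d, e). d * e) ` ?D" by (intro image_eqI[of _ _ "(b, c)"]) auto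
  qed
 qed (auto intro: mult_dvd_mono)
 also have "(\<Sum>d\<in>(\<lambda>(d, e). d * e) ` ?D. tk k (m * n div d)) \<le> (\<Sum>x\<in>?D. tk k (m * n div (case x of (d, e) => d * e)))"
 proof -
  have "finite ?D" using Suc.prems by simp
  thus ?thesis using sum_image_le[of ?D "\<lambda>d. tk k (m * n div d)" "\<lambda>(d, e). d * e"] by (simp add: o_def)
 qed
 also have "... \<le> (\<Sum>(d, e)\<in>?D. tk k (m div d) * tk k (n div e))"
 proof (rule sum_mono)
  fix x assume x: "x \<in> ?D"
  obtain d e where [simp]: "x = (d, e)" by force
  have de: "d dvd m" "e dvd n" using x by auto
  have "m div d > 0" "n div e > 0" using de Suc.prems by (auto elim!: dvdE)
  moreover have "m * n div (d * e) = (m div d) * (n div e)" using de by (simp add: div_mult_div_if_dvd)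
  ultimately show "tk k (m * n div (case x of (d, e) => d * e)) \<le> (case x of (d, e) => tk k (m div d) * tk k (n div e))"
   using Suc.IH by simp
 qed
 also have "... = tk (Suc k) m * tk (Suc k) n" using Suc.prems by (simp only: tk_Suc sum_product sum.cartesian_product)
 finally show ?case .
qed simp

text \<open>An \<open>a\<close>-tuple and a \<open>b\<close>-tuple are concatenated. The two
  divisors are exchanged so that the induction hypothesis applies to \<open>n div e\<close>.\<close>

lemma tk_conv_le: "n > 0 ==> (\<Sum>d | d dvd n. tk a (n div d) * tk b d) \<le> tk (a + b) n"
proof (induction a arbitrary: n)
 case 0
 have "(\<Sum>d | d dvd n. tk 0 (n div d) * tk b d) = (\<Sum>d\<in>{n}. tk 0 (n div d) * tk b d)"
  by (rule sum.mono_neutral_right) (use 0 in \<open>auto elim!: dvdE\<close>)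
 thus ?case using 0 by simp
next
 case (Suc a)
 let ?P = "SIGMA d:{d. d dvd n}. {e. e dvd n div d}"
 have "(\<Sum>d | d dvd n. tk (Suc a) (n div d) * tk b d) = (\<Sum>d | d dvd n. \<Sum>e | e dvd n div d. tk a (n div d div e) * tk b d)"
 proof (rule sum.cong)
  fix d assume "d \<in> {d. d dvd n}"
  hence "n div d > 0" using Suc.prems by (auto elim!: dvdE)
  thus "tk (Suc a) (n div d) * tk b d = (\<Sum>e | e dvd n div d. tk a (n div d div e) * tk b d)"
   by (simp only: tk_Suc sum_distrib_right)
 qed simp
 also have "... = (\<Sum>(d, e)\<in>?P. tk a (n div d div e) * tk b d)"
  by (rule sum.Sigma) (use Suc.prems in \<open>auto elim!: dvdE\<close>)
 also have "... = (\<Sum>(e, d)\<in>?P. tk a (n div e div d) * tk b d)"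
 proof (rule sum.reindex_bij_witness[of _ "\<lambda>(e, d). (d, e)" "\<lambda>(d, e). (e, d)"])
  fix x assume x: "x \<in> ?P"
  obtain d e where [simp]: "x = (d, e)" by force
  have "d dvd n" "e dvd n div d" using x by auto
  then obtain r where r: "n = d * e * r" using Suc.prems by (auto elim!: dvdE)
  show "(case (case x of (d, e) => (e, d)) of (e, d) => (d, e)) = x" by simp
  show "(case x of (d, e) => (e, d)) \<in> ?P" using Suc.prems by (auto simp: r mult_ac)
  show "(case (case x of (d, e) => (e, d)) of (e, d) => tk a (n div e div d) * tk b d) = (case x of (d, e) => tk a (n div d div e) * tk b d)"
   by (simp add: div_mult2_eq[symmetric] mult.commute)
 next
  fix x assume x: "x \<in> ?P"
  obtain d e where [simp]: "x = (d, e)" by force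
  have "d dvd n" "e dvd n div d" using x by auto
  then obtain r where r: "n = d * e * r" using Suc.prems by (auto elim!: dvdE)
  show "(case (case x of (d, e) => (e, d)) of (e, d) => (d, e)) = x" by simp
  show "(case x of (d, e) => (e, d)) \<in> ?P" using Suc.prems by (auto simp: r mult_ac)
 qed
 also have "... = (\<Sum>e | e dvd n. \<Sum>d | d dvd n div e. tk a (n div e div d) * tk b d)"
  by (rule sum.Sigma[symmetric]) (use Suc.prems in \<open>auto elim!: dvdE\<close>)
 also have "... \<le> (\<Sum>e | e dvd n. tk (a + b) (n div e))"
 proof (intro sum_mono Suc.IH)
  fix e assume "e \<in> {e. e dvd n}"
  thus "n div e > 0" using Suc.prems by (auto elim!: dvdE)
 qed
 also have "... = tk (Suc a + b) n" using tk_Suc[OF Suc.prems] by simp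
 finally show ?case .
qed

lemma tk_at_1: "tk k 1 = 1"
proof (induction k)
 case (Suc k)
 have "{d\<in>{0<..}. d dvd (1::nat)} = {1}" by auto
 thus ?case using Suc by simp
qed simp

text \<open>Submultiplicativity splits \<open>tk l (e * d)\<close>, the induction hypothesis merges
  \<open>tk k e * tk l e\<close>, and \<open>tk_conv_le\<close> adds the remaining \<open>l\<close>.
  A square thus becomes a single divisor function, to which \<open>tupc_power_le\<close>
  applies.\<close>

lemma tk_times_le: "n > 0 ==> tk k n * tk l n \<le> tk (k * l) n"
proof (induction k arbitrary: n)
 case 0
 thus ?case using tk_at_1[of l] by (cases "n = 1") auto
next
 case (Suc k)
 have "tk (Suc k) n * tk l n = (\<Sum>d | d dvd n. tk k (n div d) * tk l n)"
  using Suc.prems by (simp only: tk_Suc sum_distrib_right)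
 also have "... \<le> (\<Sum>d | d dvd n. tk (k * l) (n div d) * tk l d)"
 proof (rule sum_mono)
  fix d assume "d \<in> {d. d dvd n}"
  then obtain e where e: "n = d * e" by auto
  hence de: "d > 0" "e > 0" using Suc.prems by auto
  have "tk k e * tk l (e * d) \<le> tk k e * (tk l e * tk l d)" using tk_mult_le[OF de(2,1)] by (rule mult_left_mono) simp
  also have "... \<le> tk (k * l) e * tk l d" using Suc.IH[OF de(2)] by (simp only: mult.assoc[symmetric]) (rule mult_right_mono, auto)
  finally show "tk k (n div d) * tk l n \<le> tk (k * l) (n div d) * tk l d" using e de by (simp add: mult.commute)
 qed
 also have "... \<le> tk (k * l + l) n" by (rule tk_conv_le[OF Suc.prems])
 finally show ?case by (simp add: add.commute)
qed

lemma tk_1: "n > 0 ==> tk 1 n = 1"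
proof -
 assume n: "n > 0"
 have "tk (Suc 0) n = (\<Sum>d | d dvd n. if n div d = 1 then 1 else 0)" using tk_Suc[OF n, of 0] by simp
 also have "... = (\<Sum>d\<in>{n}. 1)" by (rule sum.mono_neutral_cong_right) (use n in \<open>auto elim!: dvdE\<close>)
 finally show ?thesis by (simp add: One_nat_def)
qed

lemma tk_2: "n > 0 ==> tk 2 n = card {d. d dvd n}"
proof -
 assume n: "n > 0"
 have "tk (Suc 1) n = (\<Sum>d | d dvd n. 1)" unfolding tk_Suc[OF n]
 proof (rule sum.cong)
  fix d assume "d \<in> {d. d dvd n}"
  hence "n div d > 0" using n by (auto elim!: dvdE)
  thus "tk 1 (n div d) = 1" by (rule tk_1)
 qed simp
 thus ?thesis by (simp add: numeral_2_eq_2 One_nat_def)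
qed

text \<open>The square of the divisor function is at most the 4-fold divisor function by
  \<open>tk_times_le\<close>.\<close>

lemma sum_divisor_count_sq:
 "(\<Sum>n=1..X. real (card {d. d dvd n}) ^ 2 / real n) \<le> (\<Sum>n=1..X. 1 / real n) ^ 4"
proof -
 have f: "cmult (\<lambda>n. 1 / real n)" by (auto simp: cmult_def)
 have "(\<Sum>n=1..X. real (card {d. d dvd n}) ^ 2 / real n) \<le> (\<Sum>n=1..X. real (tk 4 n) * (1 / real n))"
 proof (rule sum_mono)
  fix n assume "n \<in> {1..X}"
  hence n: "n > 0" by simp
  have "card {d. d dvd n} * card {d. d dvd n} \<le> tk 4 n" using tk_times_le[OF n, of 2 2] tk_2[OF n] by simp
  hence "real (card {d. d dvd n}) ^ 2 \<le> real (tk 4 n)" unfolding power2_eq_square of_nat_mult[symmetric] by (rule of_nat_mono)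
  thus "real (card {d. d dvd n}) ^ 2 / real n \<le> real (tk 4 n) * (1 / real n)" by (simp add: divide_right_mono)
 qed
 also have "... \<le> (\<Sum>n=1..X. 1 / real n) ^ 4" by (rule tupc_power_le[OF f]) auto
 finally show ?thesis .
qed

section \<open>The second moment of the k-fold divisor function\<close>

lemma sum_squares_le_square_sum:
 fixes a :: "'i => real"
 assumes "finite I" "\<And>i. i \<in> I ==> a i \<ge> 0"
 shows "(\<Sum>i\<in>I. (a i)\<^sup>2) \<le> (\<Sum>i\<in>I. a i)\<^sup>2"
proof -
 have "(\<Sum>i\<in>I. (a i)\<^sup>2) \<le> (\<Sum>i\<in>I. a i * (\<Sum>i\<in>I. a i))"
  unfolding power2_eq_square using assms by (intro sum_mono mult_left_mono member_le_sum) auto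
 thus ?thesis by (simp add: power2_eq_square sum_distrib_right)
qed

lemma prime_factors_mult: "a > 0 ==> b > 0 ==> prime_factors (a * b :: nat) = prime_factors a \<union> prime_factors b"
 by (simp add: prime_factorization_mult)

text \<open>A finite Euler product: each prime multiplies the bound by
  \<open>1 / (1 - p powr (-1/2))\<close>. The exponent 1/2 is dictated by the squaring in
  \<open>tk_square_dirichlet_bound\<close>.\<close>

lemma smooth_sum_bounded:
 assumes "finite P" "\<And>p. p \<in> P ==> prime p"
 shows "\<exists>C\<ge>1. \<forall>X. (\<Sum>u=1..X. if prime_factors u \<subseteq> P then real u powr (-1/2) else 0) \<le> C"
 using assms
proof (induction P rule: finite_induct)
 case empty
 have "(\<Sum>u=1..X. if prime_factors u \<subseteq> {} then real u powr (-1/2) else 0) \<le> 1" for X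
 proof -
  have "(\<Sum>u=1..X. if prime_factors u \<subseteq> {} then real u powr (-1/2) else 0) \<le> (\<Sum>u=1..X. if u = 1 then 1 else 0)"
   by (rule sum_mono) (auto simp: prime_factorization_empty_iff)
  also have "... \<le> (1::real)" by simp
  finally show ?thesis .
 qed
 thus ?case by blast
next
 case (insert p P)
 then obtain C where C: "C \<ge> 1" "\<And>X. (\<Sum>u=1..X. if prime_factors u \<subseteq> P then real u powr (-1/2) else 0) \<le> C" by auto
 have p: "prime p" "p > 0" "p \<ge> 2" using insert prime_gt_0_nat prime_ge_2_nat by auto
 define t where "t = real p powr (-1/2)"
 have t: "t > 0" "t < 1"
 proof -
  have "real p powr (-1/2) < real p powr 0" using p by (intro powr_less_mono) auto
  thus "t < 1" using p by (simp add: t_def)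
  show "t > 0" using p by (simp add: t_def)
 qed
 define F where "F = (\<lambda>u. if prime_factors u \<subseteq> insert p P then real u powr (-1/2) else 0)"
 have F0: "F u \<ge> 0" for u by (simp add: F_def)
 have "(\<Sum>u=1..X. F u) \<le> C / (1 - t)" for X
 proof -
  have "(\<Sum>u=1..X. F u) = (\<Sum>u=1..X. if prime_factors u \<subseteq> P then real u powr (-1/2) else 0) + (\<Sum>u=1..X. if p dvd u then F u else 0)"
   unfolding sum.distrib[symmetric]
  proof (rule sum.cong)
   fix u assume "u \<in> {1..X}"
   hence "p \<in> prime_factors u \<longleftrightarrow> p dvd u" using p by (auto simp: in_prime_factors_iff)
   thus "F u = (if prime_factors u \<subseteq> P then real u powr (-1/2) else 0) + (if p dvd u then F u else 0)"
    using insert.hyps by (auto simp: F_def)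
  qed simp
  also have "(\<Sum>u=1..X. if p dvd u then F u else 0) = (\<Sum>u\<in>{u\<in>{1..X}. p dvd u}. F (p * (u div p)))"
   by (subst sum.inter_filter) (auto intro!: sum.cong)
  also have "... = (\<Sum>m=1..X div p. F (p * m))" by (rule sum_multiples[OF p(2)])
  also have "... = (\<Sum>m=1..X div p. t * F m)"
  proof (rule sum.cong)
   fix m assume "m \<in> {1..X div p}"
   hence "m > 0" by simp
   thus "F (p * m) = t * F m" using p prime_factors_mult[of p m] by (simp add: F_def t_def powr_mult prime_factorization_prime)
  qed simp
  also have "... \<le> (\<Sum>m=1..X. t * F m)"
   using F0 t by (intro sum_mono2) (auto intro: order_trans[OF _ div_le_dividend])
  also have "... = t * (\<Sum>m=1..X. F m)" by (simp only: sum_distrib_left)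
  finally have "(\<Sum>u=1..X. F u) \<le> C + t * (\<Sum>m=1..X. F m)" using C(2)[of X] by linarith
  hence "(\<Sum>u=1..X. F u) * (1 - t) \<le> C" by (simp add: algebra_simps)
  thus ?thesis using t by (simp add: pos_le_divide_eq)
 qed
 moreover have "C / (1 - t) \<ge> 1" using C t by (simp add: le_divide_eq)
 ultimately show ?case unfolding F_def by blast
qed

lemma smooth_rough_decomp:
 "n > 0 ==> \<exists>u v. n = u * v \<and> u > 0 \<and> v > 0 \<and> prime_factors u \<subseteq> P \<and> prime_factors v \<inter> P = {}" for n :: nat
proof (induction n rule: less_induct)
 case (less n)
 show ?case
 proof (cases "n = 1")
  case True
  thus ?thesis by (intro exI[of _ 1]) auto
 next
  case False
  then obtain p where p: "prime p" "p dvd n" using prime_factor_nat by blast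
  then obtain m where m: "n = p * m" by auto
  have "p \<ge> 2" using p prime_ge_2_nat by blast
  moreover have "m > 0" using m less.prems by (intro gr0I) auto
  ultimately have "m < n" using m by simp
  then obtain u v where uv: "m = u * v" "u > 0" "v > 0" "prime_factors u \<subseteq> P" "prime_factors v \<inter> P = {}"
   using less.IH[of m] \<open>m > 0\<close> by auto
  have p0: "p > 0" using \<open>p \<ge> 2\<close> by simp
  have pf: "prime_factors (p * w) = insert p (prime_factors w)" if "w > 0" for w
   using prime_factors_mult[OF p0 that] p by (simp add: prime_factorization_prime)
  show ?thesis
  proof (cases "p \<in> P")
   case True
   have "n = (p * u) * v" using m uv by simp
   thus ?thesis using uv True pf[of u] p0 by (intro exI[of _ "p * u"] exI[of _ v]) auto
  next
   case False
   have "n = u * (p * v)" using m uv by simp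
   thus ?thesis using uv False pf[of v] p0 by (intro exI[of _ u] exI[of _ "p * v"]) auto
  qed
 qed
qed

text \<open>\<open>k ^ 2\<close> may be as large as a multiple of \<open>ln x\<close>, so its
  coefficient \<eta> has to be free. With \<open>z\<close> chosen for \<eta>, the primes up to
  \<open>z\<close> are split off. On numbers made of them a sum of squares is at most the square of
  a sum with exponent 1/2, which gives \<open>C ^ (2 * k)\<close>. On numbers without them the
  square of \<open>tk k\<close> is at most \<open>tk (k * k)\<close>, and the base of the resulting
  power is 1 plus a tail of the series below \<eta>.\<close>

lemma tk_square_dirichlet_bound:
 assumes \<delta>: "\<delta> > 0" and \<eta>: "\<eta> > 0"
 shows "\<exists>C\<ge>1. \<forall>k X. (\<Sum>n=1..X. real (tk k n) ^ 2 * real n powr (- (1 + \<delta>))) \<le> C ^ (2 * k) * exp (\<eta> * real k ^ 2)"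
proof -
 define s where "s = 1 + \<delta>"
 have "summable (\<lambda>n. real n powr (- s))" using summable_real_powr_iff[of "- s"] \<delta> by (simp add: s_def)
 then obtain z where z: "\<And>m n. m \<ge> z ==> norm (\<Sum>i\<in>{m..<n}. real i powr (- s)) < \<eta>"
  using \<eta> unfolding summable_Cauchy by blast
 define P where "P = {p. prime p \<and> p \<le> z}"
 have P: "finite P" "\<And>p. p \<in> P ==> prime p" by (auto simp: P_def)
 obtain C where C: "C \<ge> 1" "\<And>X. (\<Sum>u=1..X. if prime_factors u \<subseteq> P then real u powr (-1/2) else 0) \<le> C"
  using smooth_sum_bounded[OF P] by auto
 define fs where "fs = (\<lambda>u. if prime_factors u \<subseteq> P then real u powr (-1/2) else 0)"
 define fr where "fr = (\<lambda>v. if prime_factors v \<inter> P = {} then real v powr (- s) else 0)"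
 have cfs: "cmult fs" unfolding cmult_def fs_def by (auto simp: prime_factors_mult powr_mult)
 have cfr: "cmult fr" unfolding cmult_def fr_def by (auto simp: prime_factors_mult powr_mult)
 have nn: "fs n \<ge> 0" "fr n \<ge> 0" for n by (simp_all add: fs_def fr_def)
 have rough: "(\<Sum>v=1..X. fr v) \<le> exp \<eta>" for X
 proof -
  have "(\<Sum>v=1..X. fr v) \<le> (\<Sum>v=1..X. (if v = 1 then 1 else 0) + (if v \<in> {z..<Suc X} then real v powr (- s) else 0))"
  proof (rule sum_mono)
   fix v assume v: "v \<in> {1..X}"
   show "fr v \<le> (if v = 1 then 1 else 0) + (if v \<in> {z..<Suc X} then real v powr (- s) else 0)"
   proof (cases "v = 1 \<or> fr v = 0")
    case True
    thus ?thesis by (auto simp: fr_def)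
   next
    case False
    \<comment> \<open>A number above 1 without prime factors in \<open>P\<close> exceeds
      \<open>z\<close>, so it lies in the tail.\<close>
    then obtain p where p: "prime p" "p dvd v" using prime_factor_nat by blast
    hence "p \<in> prime_factors v" using v by (auto simp: in_prime_factors_iff)
    hence "p \<notin> P" using False by (auto simp: fr_def split: if_splits)
    hence "p > z" using p by (simp add: P_def)
    moreover have "p \<le> v" using p v by (intro dvd_imp_le) auto
    ultimately show ?thesis using v False by (auto simp: fr_def)
   qed
  qed
  also have "... = (\<Sum>v=1..X. if v = 1 then 1 else 0) + (\<Sum>v=1..X. if v \<in> {z..<Suc X} then real v powr (- s) else 0)"
   by (rule sum.distrib)
  also have "... \<le> 1 + \<eta>"
  proof (intro add_mono)
   have "(\<Sum>v=1..X. if v \<in> {z..<Suc X} then real v powr (- s) else 0) = (\<Sum>v\<in>{v\<in>{1..X}. v \<in> {z..<Suc X}}. real v powr (- s))"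
    by (rule sum.inter_filter[symmetric]) simp
   also have "... \<le> (\<Sum>i\<in>{z..<Suc X}. real i powr (- s))" by (rule sum_mono2) auto
   also have "... \<le> \<eta>" using z[of z "Suc X"] by simp
   finally show "(\<Sum>v=1..X. if v \<in> {z..<Suc X} then real v powr (- s) else 0) \<le> \<eta>" .
  qed simp
  also have "... \<le> exp \<eta>" by (rule exp_ge_add_one_self)
  finally show ?thesis .
 qed
 have "(\<Sum>n=1..X. real (tk k n) ^ 2 * real n powr (- s)) \<le> C ^ (2 * k) * exp (\<eta> * real k ^ 2)" for k X
 proof -
  define I where "I = {u\<in>{1..X}. prime_factors u \<subseteq> P} \<times> {v\<in>{1..X}. prime_factors v \<inter> P = {}}"
  let ?G = "\<lambda>n. real (tk k n) ^ 2 * real n powr (- s)"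
  have sub: "{1..X} \<subseteq> (\<lambda>(u, v). u * v) ` I"
  proof
   fix n assume n: "n \<in> {1..X}"
   then obtain u v where uv: "n = u * v" "u > 0" "v > 0" "prime_factors u \<subseteq> P" "prime_factors v \<inter> P = {}"
    using smooth_rough_decomp[of n P] by auto
   have "u \<le> n" "v \<le> n" "n \<le> X" using uv n by auto
   hence "u \<le> X" "v \<le> X" by linarith+
   hence "u \<in> {1..X}" "v \<in> {1..X}" using uv by auto
   thus "n \<in> (\<lambda>(u, v). u * v) ` I" using uv by (intro image_eqI[of _ _ "(u, v)"]) (auto simp: I_def)
  qed
  have finI: "finite I" by (simp add: I_def)
  have "(\<Sum>n=1..X. ?G n) \<le> (\<Sum>n\<in>(\<lambda>(u, v). u * v) ` I. ?G n)"
   by (rule sum_mono2[OF _ sub]) (use finI in auto)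
  also have "... \<le> (\<Sum>x\<in>I. ?G (case x of (u, v) => u * v))"
   using sum_image_le[of I ?G "\<lambda>(u, v). u * v", OF finI] by (simp add: o_def)
  also have "... \<le> (\<Sum>(u, v)\<in>I. ?G u * ?G v)"
  proof (rule sum_mono)
   fix x assume x: "x \<in> I"
   obtain u v where [simp]: "x = (u, v)" by force
   have uv: "u > 0" "v > 0" using x by (auto simp: I_def)
   have "real (tk k (u * v)) \<le> real (tk k u) * real (tk k v)"
    unfolding of_nat_mult[symmetric] by (rule of_nat_mono[OF tk_mult_le[OF uv]])
   hence "real (tk k (u * v)) ^ 2 \<le> (real (tk k u) * real (tk k v)) ^ 2" by (rule power_mono) simp
   hence "real (tk k (u * v)) ^ 2 * real (u * v) powr (- s) \<le> (real (tk k u) * real (tk k v)) ^ 2 * real (u * v) powr (- s)"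
    by (rule mult_right_mono) simp
   also have "... = ?G u * ?G v" by (simp add: powr_mult power_mult_distrib)
   finally show "?G (case x of (u, v) => u * v) \<le> (case x of (u, v) => ?G u * ?G v)" by simp
  qed
  also have "... = (\<Sum>u\<in>{u\<in>{1..X}. prime_factors u \<subseteq> P}. ?G u) * (\<Sum>v\<in>{v\<in>{1..X}. prime_factors v \<inter> P = {}}. ?G v)"
   unfolding I_def sum_product by (simp add: sum.cartesian_product)
  also have "... \<le> C ^ (2 * k) * exp (\<eta> * real k ^ 2)"
  proof (intro mult_mono)
   have "(\<Sum>u\<in>{u\<in>{1..X}. prime_factors u \<subseteq> P}. ?G u) \<le> (\<Sum>u\<in>{u\<in>{1..X}. prime_factors u \<subseteq> P}. (real (tk k u) * fs u)\<^sup>2)"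
   proof (rule sum_mono)
    fix u assume u: "u \<in> {u\<in>{1..X}. prime_factors u \<subseteq> P}"
    hence "fs u ^ 2 = real u powr (-1)" by (simp add: fs_def powr_power)
    moreover have "real u powr (- s) \<le> real u powr (-1)" using u \<delta> by (intro powr_mono) (auto simp: s_def)
    ultimately have "real u powr (- s) \<le> fs u ^ 2" by simp
    thus "?G u \<le> (real (tk k u) * fs u)\<^sup>2" by (simp add: power_mult_distrib mult_left_mono)
   qed
   also have "... \<le> (\<Sum>u=1..X. (real (tk k u) * fs u)\<^sup>2)" by (rule sum_mono2) auto
   also have "... \<le> (\<Sum>u=1..X. real (tk k u) * fs u)\<^sup>2" by (rule sum_squares_le_square_sum) (use nn in auto)
   also have "... \<le> ((\<Sum>u=1..X. fs u) ^ k)\<^sup>2"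
    using tupc_power_le[OF cfs nn(1), of X X k] by (intro power_mono sum_nonneg) (use nn in auto)
   also have "... \<le> (C ^ k)\<^sup>2"
    using C(2)[of X] by (intro power_mono zero_le_power sum_nonneg) (use nn in \<open>auto simp: fs_def\<close>)
   also have "... = C ^ (2 * k)" by (simp add: power_mult[symmetric] mult.commute)
   finally show "(\<Sum>u\<in>{u\<in>{1..X}. prime_factors u \<subseteq> P}. ?G u) \<le> C ^ (2 * k)" .
   have "(\<Sum>v\<in>{v\<in>{1..X}. prime_factors v \<inter> P = {}}. ?G v) \<le> (\<Sum>v\<in>{v\<in>{1..X}. prime_factors v \<inter> P = {}}. real (tk (k * k) v) * fr v)"
   proof (rule sum_mono)
    fix v assume v: "v \<in> {v\<in>{1..X}. prime_factors v \<inter> P = {}}"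
    have "real (tk k v) ^ 2 \<le> real (tk (k * k) v)"
     unfolding power2_eq_square of_nat_mult[symmetric] by (rule of_nat_mono, rule tk_times_le) (use v in auto)
    thus "?G v \<le> real (tk (k * k) v) * fr v" using v by (simp add: fr_def mult_right_mono)
   qed
   also have "... \<le> (\<Sum>v=1..X. real (tk (k * k) v) * fr v)" by (rule sum_mono2) (use nn in auto)
   also have "... \<le> (\<Sum>v=1..X. fr v) ^ (k * k)" by (rule tupc_power_le[OF cfr nn(2)]) simp
   also have "... \<le> exp \<eta> ^ (k * k)" using rough[of X] by (intro power_mono sum_nonneg) (use nn in auto)
   also have "... = exp (\<eta> * real k ^ 2)" by (simp add: exp_of_nat_mult[symmetric] power2_eq_square mult_ac)
   finally show "(\<Sum>v\<in>{v\<in>{1..X}. prime_factors v \<inter> P = {}}. ?G v) \<le> exp (\<eta> * real k ^ 2)" .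
  qed (use C in \<open>auto intro!: sum_nonneg\<close>)
  finally show ?thesis .
 qed
 thus ?thesis using C(1) unfolding s_def by blast
qed

section \<open>Exceptional moduli\<close>

lemma dchar_cmult: "dchar q \<xi> ==> cmult \<xi>" using dchar_1 dchar_mult unfolding cmult_def by blast

text \<open>By the Chinese remainder theorem some \<open>n\<close> is \<open>a\<close> modulo
  \<open>p\<close> and 1 modulo \<open>r\<close>, which isolates the value of \<xi> at
  \<open>a\<close>.\<close>

lemma dchar_prod_nonprin:
 assumes \<xi>: "dchar p \<xi>" "\<xi> \<noteq> prin p" and \<psi>: "dchar r \<psi>" and c: "coprime p r"
 shows "(\<lambda>n. \<xi> n * cnj (\<psi> n)) \<noteq> prin (p * r)"
proof
 assume eq: "(\<lambda>n. \<xi> n * cnj (\<psi> n)) = prin (p * r)"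
 obtain a where a: "\<xi> a \<noteq> prin p a" using \<xi>(2) by blast
 have ca: "coprime a p" using a dchar_eq_0_iff[OF \<xi>(1), of a] by (auto simp: prin_def)
 obtain n where n: "[n = a] (mod p)" "[n = 1] (mod r)" using binary_chinese_remainder_nat[OF c] by blast
 have "\<xi> n = \<xi> a" by (rule dchar_cong[OF \<xi>(1) n(1)])
 moreover have "\<psi> n = 1" using dchar_cong[OF \<psi> n(2)] dchar_1[OF \<psi>] by simp
 moreover have "coprime n p" using n(1) ca cong_imp_coprime[OF cong_sym[OF n(1)]] by simp
 moreover have "coprime n r" using cong_imp_coprime[OF cong_sym[OF n(2)]] by simp
 ultimately have "\<xi> a = 1" using fun_cong[OF eq, of n] by (simp add: prin_def)
 thus False using a ca by (simp add: prin_def)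
qed

text \<open>With one character per prime, the product of two of them for different primes is
  nonprincipal, so its sums are at most \<open>x ^ 2\<close>. The \<open>k\<close>-th powers of the
  large sums, with phases \<open>c\<close>, form one linear form in the coefficients
  \<open>r\<close>. Cauchy-Schwarz separates these coefficients, bounded by \<open>tk\<close>, from
  the correlations of the characters.\<close>

lemma exceptional_moduli_bound:
 fixes \<xi> :: "nat => nat => complex"
 assumes E: "finite E" "real (card E) \<le> x" and p: "\<And>p. p \<in> E ==> prime p \<and> real p \<le> x"
  and \<xi>: "\<And>p. p \<in> E ==> dchar p (\<xi> p) \<and> \<xi> p \<noteq> prin p"
  and big: "\<And>p. p \<in> E ==> norm (\<Sum>a=1..N. \<xi> p a) \<ge> y * real N"
  and y: "y > 0" and N: "N \<ge> 1" and k: "real N ^ k \<ge> x ^ 3" and x: "x \<ge> 1"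
 shows "real (card E) * y ^ (2 * k) * real N ^ k \<le> 2 * (\<Sum>n=1..N ^ k. real (tk k n) ^ 2)"
proof (cases "E = {}")
 case True
 have "(\<Sum>n=1..N ^ k. real (tk k n) ^ 2) \<ge> 0" by (rule sum_nonneg) simp
 thus ?thesis using True by simp
next
 case False
 define M where "M = N ^ k"
 define S where "S = (\<lambda>p. (\<Sum>a=1..N. \<xi> p a))"
 \<comment> \<open>The conjugate phases make every \<open>c p * S p ^ k\<close> real and
   nonnegative.\<close>
 define c where "c = (\<lambda>p. cnj (sgn (S p ^ k)))"
 define F where "F = (\<lambda>n. \<Sum>p\<in>E. c p * \<xi> p n)"
 define r where "r = (\<lambda>n. real (tupc {1..N} k n))"
 define e where "e = real (card E)"
 have e: "e > 0" "e \<le> x" using False E by (auto simp: e_def card_gt_0_iff)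
 have M0: "real M > 0" using N by (simp add: M_def)
 have Mx: "x ^ 3 \<le> real M" using k by (simp add: M_def)
 have c1: "norm (c p) \<le> 1" for p by (simp add: c_def norm_sgn)
 have cS: "c p * S p ^ k = of_real (norm (S p) ^ k)" for p
 proof (cases "S p ^ k = 0")
  case True
  thus ?thesis using norm_power[of "S p" k] by (simp only: norm_zero of_real_0 mult_zero_right)
 next
  case False
  have "c p * S p ^ k = cnj (S p ^ k) * S p ^ k / of_real (norm (S p ^ k))"
   unfolding c_def sgn_eq by (simp only: complex_cnj_divide complex_cnj_complex_of_real times_divide_eq_left)
  also have "cnj (S p ^ k) * S p ^ k = of_real (norm (S p ^ k)) ^ 2"
   unfolding of_real_power[symmetric] complex_norm_square by (rule mult.commute)
  finally show ?thesis using False by (simp add: power2_eq_square norm_power)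
 qed
 define V where "V = (\<Sum>p\<in>E. norm (S p) ^ k)"
 have Vlow: "e * (y * real N) ^ k \<le> V"
 proof -
  have "(\<Sum>p\<in>E. (y * real N) ^ k) \<le> V" unfolding V_def using big y by (intro sum_mono power_mono) (auto simp: S_def)
  thus ?thesis by (simp add: e_def)
 qed
 have Spow: "S p ^ k = (\<Sum>n=1..M. of_real (r n) * \<xi> p n)" if "p \<in> E" for p
  using tupc_power[OF dchar_cmult[of p "\<xi> p"] N, of k M] \<xi>[OF that] by (simp add: S_def M_def r_def)
 have "complex_of_real V = (\<Sum>p\<in>E. c p * S p ^ k)" unfolding V_def cS by simp
 also have "... = (\<Sum>p\<in>E. \<Sum>n=1..M. of_real (r n) * (c p * \<xi> p n))"
  by (rule sum.cong) (simp_all add: Spow sum_distrib_left mult_ac)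
 also have "... = (\<Sum>n=1..M. of_real (r n) * F n)" unfolding F_def by (subst sum.swap) (simp add: sum_distrib_left)
 finally have "norm (complex_of_real V) = norm (\<Sum>n=1..M. of_real (r n) * F n)" by (rule arg_cong)
 moreover have "V \<ge> 0" unfolding V_def by (rule sum_nonneg) simp
 ultimately have "V = norm (\<Sum>n=1..M. of_real (r n) * F n)" by simp
 also have "... \<le> (\<Sum>n=1..M. r n * norm (F n))" by (rule sum_norm_le) (simp add: norm_mult r_def)
 finally have V1: "V \<le> (\<Sum>n=1..M. r n * norm (F n))" .
 have "V\<^sup>2 \<le> (\<Sum>n=1..M. r n * norm (F n))\<^sup>2" using V1 \<open>V \<ge> 0\<close> by (rule power_mono)
 also have "... \<le> (\<Sum>n=1..M. (r n)\<^sup>2) * (\<Sum>n=1..M. (norm (F n))\<^sup>2)" by (rule Cauchy_Schwarz_ineq_sum)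
 finally have V2: "V\<^sup>2 \<le> (\<Sum>n=1..M. (r n)\<^sup>2) * (\<Sum>n=1..M. (norm (F n))\<^sup>2)" .
 have Fsq: "(\<Sum>n=1..M. (norm (F n))\<^sup>2) \<le> 2 * e * real M"
 proof -
  have G: "norm (\<Sum>n=1..M. \<xi> p n * cnj (\<xi> q n)) \<le> (if p = q then real M else 0) + x\<^sup>2" if pq: "p \<in> E" "q \<in> E" for p q
  proof (cases "p = q")
   case True
   have "norm (\<Sum>n=1..M. \<xi> p n * cnj (\<xi> q n)) \<le> (\<Sum>n=1..M. 1 * 1)"
   proof (rule sum_norm_le)
    fix n
    show "norm (\<xi> p n * cnj (\<xi> q n)) \<le> 1 * 1"
     unfolding norm_mult using \<xi> pq dchar_norm_le by (intro mult_mono) auto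
   qed
   thus ?thesis using True by (simp add: add_increasing2)
  next
   case False
   have d: "dchar p (\<xi> p)" "\<xi> p \<noteq> prin p" "dchar q (\<xi> q)" using \<xi> pq by auto
   have cop: "coprime p q" using p pq False by (simp add: primes_coprime)
   have "norm (\<Sum>n=1..M. \<xi> p n * cnj (\<xi> q n)) \<le> real (p * q)"
    by (rule dchar_partial_sum[OF dchar_times'[OF d(1) dchar_cnj[OF d(3)]] dchar_prod_nonprin[OF d cop]])
   also have "... = real p * real q" by simp
   also have "... \<le> x * x" using p pq x by (intro mult_mono) auto
   finally show ?thesis using False by (simp add: power2_eq_square)
  qed
  have "complex_of_real (\<Sum>n=1..M. (norm (F n))\<^sup>2) = (\<Sum>n=1..M. F n * cnj (F n))"
   by (simp only: of_real_sum complex_norm_square)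
  also have "... = (\<Sum>n=1..M. \<Sum>p\<in>E. \<Sum>q\<in>E. c p * cnj (c q) * (\<xi> p n * cnj (\<xi> q n)))"
   unfolding F_def by (simp add: sum_product mult_ac)
  also have "... = (\<Sum>p\<in>E. \<Sum>n=1..M. \<Sum>q\<in>E. c p * cnj (c q) * (\<xi> p n * cnj (\<xi> q n)))" by (rule sum.swap)
  also have "... = (\<Sum>p\<in>E. \<Sum>q\<in>E. \<Sum>n=1..M. c p * cnj (c q) * (\<xi> p n * cnj (\<xi> q n)))" by (intro sum.cong refl sum.swap)
  also have "norm ... \<le> (\<Sum>p\<in>E. \<Sum>q\<in>E. (if p = q then real M else 0) + x\<^sup>2)"
  proof (intro sum_norm_le)
   fix p q assume pq: "p \<in> E" "q \<in> E"
   have "norm (\<Sum>n=1..M. c p * cnj (c q) * (\<xi> p n * cnj (\<xi> q n))) = norm (c p) * norm (c q) * norm (\<Sum>n=1..M. \<xi> p n * cnj (\<xi> q n))"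
    by (simp add: sum_distrib_left[symmetric] norm_mult)
   also have "... \<le> 1 * 1 * norm (\<Sum>n=1..M. \<xi> p n * cnj (\<xi> q n))"
    using c1 by (intro mult_right_mono mult_mono) auto
   finally show "norm (\<Sum>n=1..M. c p * cnj (c q) * (\<xi> p n * cnj (\<xi> q n))) \<le> (if p = q then real M else 0) + x\<^sup>2"
    using G[OF pq] by simp
  qed
  also have "... = e * real M + e * (e * x\<^sup>2)" using E by (simp add: sum.distrib e_def algebra_simps)
  also have "e * (e * x\<^sup>2) \<le> e * (x * x\<^sup>2)" using e by (intro mult_left_mono mult_right_mono) auto
  \<comment> \<open>Here \<open>N ^ k \<ge> x ^ 3\<close> enters: all off-diagonal terms together do
    not exceed the diagonal.\<close>
  also have "e * (x * x\<^sup>2) \<le> e * real M" using e Mx by (intro mult_left_mono) (auto simp: power2_eq_square power3_eq_cube mult_ac)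
  finally have "norm (complex_of_real (\<Sum>n=1..M. (norm (F n))\<^sup>2)) \<le> 2 * e * real M" by simp
  thus ?thesis by (simp only: norm_of_real)
 qed
 have rt: "(\<Sum>n=1..M. (r n)\<^sup>2) \<le> (\<Sum>n=1..M. real (tk k n) ^ 2)"
  unfolding r_def by (intro sum_mono power_mono of_nat_mono tupc_le_tk) auto
 have "(e * (y * real N) ^ k)\<^sup>2 \<le> V\<^sup>2" using Vlow e y by (intro power_mono) auto
 also note V2
 also have "(\<Sum>n=1..M. (r n)\<^sup>2) * (\<Sum>n=1..M. (norm (F n))\<^sup>2) \<le> (\<Sum>n=1..M. real (tk k n) ^ 2) * (2 * e * real M)"
  by (rule mult_mono[OF rt Fsq]) (auto intro: sum_nonneg)
 also have "(e * (y * real N) ^ k)\<^sup>2 = (e * real M) * (e * y ^ (2 * k) * real N ^ k)"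
  unfolding power_mult_distrib M_def power2_eq_square mult_2 power_add by (simp add: mult_ac)
 finally have "(e * real M) * (e * y ^ (2 * k) * real N ^ k) \<le> (e * real M) * (2 * (\<Sum>n=1..M. real (tk k n) ^ 2))"
  by (simp add: mult_ac)
 moreover have "e * real M > 0" using e M0 by simp
 ultimately show ?thesis unfolding mult_le_cancel_left_pos[OF \<open>e * real M > 0\<close>] by (simp add: e_def M_def)
qed

section \<open>Pairs of residues modulo a prime\<close>

text \<open>Regrouped by \<open>d\<close>, the inner sum of \<open>mu\<close> over the divisors of
  \<open>i div d\<close> vanishes unless \<open>d = i\<close>.\<close>

lemma moebius_inversion:
 fixes F :: "nat => real"
 assumes i: "i > 0"
 shows "(\<Sum>m | m dvd i. \<Sum>d | d dvd m. mu (m div d) * F d) = F i"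
proof -
 have fin: "finite {m. m dvd i}" using i by simp
 have pos: "m > 0" if "m dvd i" for m using that i by (auto intro!: gr0I)
 let ?P = "SIGMA m:{m. m dvd i}. {d. d dvd m}"
 let ?Q = "SIGMA d:{d. d dvd i}. {e. e dvd i div d}"
 have "(\<Sum>m | m dvd i. \<Sum>d | d dvd m. mu (m div d) * F d) = (\<Sum>(m, d)\<in>?P. mu (m div d) * F d)"
  by (rule sum.Sigma) (use fin pos in auto)
 also have "... = (\<Sum>(d, e)\<in>?Q. mu e * F d)"
 proof (rule sum.reindex_bij_witness[of _ "\<lambda>(d, e). (d * e, d)" "\<lambda>(m, d). (d, m div d)"])
  fix x assume x: "x \<in> ?P"
  obtain m d where [simp]: "x = (m, d)" by force
  have "m dvd i" "d dvd m" using x by auto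
  then obtain e r where e: "m = d * e" "i = d * e * r" by (auto elim!: dvdE)
  have "d > 0" using pos[OF \<open>m dvd i\<close>] e by auto
  thus "(case (case x of (m, d) => (d, m div d)) of (d, e) => (d * e, d)) = x"
   "(case x of (m, d) => (d, m div d)) \<in> ?Q"
   "(case (case x of (m, d) => (d, m div d)) of (d, e) => mu e * F d) = (case x of (m, d) => mu (m div d) * F d)"
   using e by (auto simp: mult.assoc)
 next
  fix x assume x: "x \<in> ?Q"
  obtain d e where [simp]: "x = (d, e)" by force
  have "d dvd i" "e dvd i div d" using x by auto
  obtain q where q: "i = d * q" using \<open>d dvd i\<close> by (rule dvdE)
  have "d > 0" using i q by (auto intro!: gr0I)
  hence "e dvd q" using \<open>e dvd i div d\<close> q by simp
  then obtain r where "q = e * r" by (rule dvdE)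
  hence r: "i = d * e * r" using q by simp
  thus "(case (case x of (d, e) => (d * e, d)) of (m, d) => (d, m div d)) = x"
   "(case x of (d, e) => (d * e, d)) \<in> ?P" using r \<open>d > 0\<close> by auto
 qed
 also have "... = (\<Sum>d | d dvd i. \<Sum>e | e dvd i div d. mu e * F d)"
  by (rule sum.Sigma[symmetric]) (use i in \<open>auto elim!: dvdE\<close>)
 also have "... = (\<Sum>d | d dvd i. if d = i then F d else 0)"
 proof (rule sum.cong)
  fix d assume "d \<in> {d. d dvd i}"
  then obtain r where r: "i = d * r" by auto
  have "i div d > 0" "i div d = 1 \<longleftrightarrow> d = i" using r i by auto
  thus "(\<Sum>e | e dvd i div d. mu e * F d) = (if d = i then F d else 0)" by (simp add: sum_distrib_right[symmetric] mu_sum_eq)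
 qed simp
 also have "... = F i" using fin by simp
 finally show ?thesis .
qed

text \<open>\<open>ind\<close> is a discrete logarithm to a primitive root. Only congruences modulo
  \<open>p - 1\<close> are kept, so that any representative of the exponent will do.\<close>

locale prime_index =
 fixes p :: nat and ind :: "nat => nat"
 assumes prime: "prime p"
  and ind_mult: "\<And>a b. \<not> p dvd a ==> \<not> p dvd b ==> [ind (a * b) = ind a + ind b] (mod (p - 1))"
  and ind_cong: "\<And>a b. \<not> p dvd a ==> \<not> p dvd b ==> [ind a = ind b] (mod (p - 1)) \<longleftrightarrow> [a = b] (mod p)"
  and ind_gen: "\<exists>g. \<not> p dvd g \<and> [ind g = 1] (mod (p - 1))"

lemma prime_index_exists:
 assumes p: "prime p" shows "\<exists>ind. prime_index p ind"
proof -
 obtain g where g: "residue_primroot p g" using prime_primitive_root_exists[of p] p prime_gt_1_nat by blast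
 have cg: "coprime p g" and ordg: "ord p g = p - 1" using g p by (auto simp: residue_primroot_def totient_prime)
 have p1: "p > 1" using p prime_gt_1_nat by blast
 have cop: "coprime a p \<longleftrightarrow> \<not> p dvd a" for a using prime_coprime_iff[OF p, of a] by (simp add: coprime_commute)
 have bij: "bij_betw (\<lambda>i. g ^ i mod p) {..<totient p} (totatives p)" by (rule residue_primroot_is_generator[OF p1 g])
 have "\<exists>i. [g ^ i = a] (mod p)" if "\<not> p dvd a" for a
 proof -
  have "a mod p \<in> totatives p" using that p1 cop[of a] by (auto simp: totatives_def dvd_eq_mod_eq_0 intro: less_imp_le)
  hence "a mod p \<in> (\<lambda>i. g ^ i mod p) ` {..<totient p}" using bij by (simp add: bij_betw_def)
  thus ?thesis by (auto simp: cong_def)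
 qed
 then obtain ind where ind: "\<And>a. \<not> p dvd a ==> [g ^ ind a = a] (mod p)" by metis
 have pw: "[g ^ i = g ^ j] (mod p) \<longleftrightarrow> [i = j] (mod (p - 1))" for i j
  using order_divides_expdiff[OF cg] ordg by simp
 have pg: "\<not> p dvd g" using cg cop[of g] by (simp add: coprime_commute)
 have "prime_index p ind"
 proof
  show "prime p" by (rule p)
 next
  fix a b assume a: "\<not> p dvd a" and b: "\<not> p dvd b"
  have ab: "\<not> p dvd a * b" using a b p by (simp add: prime_dvd_mult_iff)
  have "[g ^ ind (a * b) = g ^ ind a * g ^ ind b] (mod p)"
   by (rule cong_trans[OF ind[OF ab] cong_sym[OF cong_mult[OF ind[OF a] ind[OF b]]]])
  thus "[ind (a * b) = ind a + ind b] (mod (p - 1))" by (simp only: power_add[symmetric] pw)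
  have "[g ^ ind a = g ^ ind b] (mod p) \<longleftrightarrow> [a = b] (mod p)" using ind[OF a] ind[OF b] by (simp add: cong_def)
  thus "[ind a = ind b] (mod (p - 1)) \<longleftrightarrow> [a = b] (mod p)" by (simp only: pw)
 next
  have "[g ^ ind g = g ^ 1] (mod p)" using ind[OF pg] by simp
  thus "\<exists>g. \<not> p dvd g \<and> [ind g = 1] (mod (p - 1))" using pw pg by blast
 qed
 thus ?thesis by blast
qed

context prime_index
begin

lemma p_gt_1: "p > 1" using prime prime_gt_1_nat by blast

lemma p1_pos: "p - 1 > 0" using p_gt_1 by simp

lemma ind_one: "[ind 1 = 0] (mod (p - 1))"
proof -
 have "\<not> p dvd 1" using p_gt_1 by simp
 hence "[ind 1 + ind 1 = ind 1 + 0] (mod (p - 1))" using ind_mult[of 1 1] cong_sym by simp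
 thus ?thesis by (simp only: cong_add_lcancel_nat)
qed

lemma ind_power: "\<not> p dvd a ==> [ind (a ^ k) = k * ind a] (mod (p - 1))"
proof (induction k)
 case 0
 thus ?case using ind_one by simp
next
 case (Suc k)
 have "\<not> p dvd a ^ k" using Suc.prems prime prime_dvd_power by blast
 hence "[ind (a * a ^ k) = ind a + ind (a ^ k)] (mod (p - 1))" by (rule ind_mult[OF Suc.prems])
 also have "[ind a + ind (a ^ k) = ind a + k * ind a] (mod (p - 1))" by (rule cong_add[OF cong_refl Suc.IH[OF Suc.prems]])
 finally show ?case by simp
qed

text \<open>In exponents, the powers of \<open>a\<close> are the multiples of \<open>ind a\<close>
  modulo \<open>p - 1\<close>, that is, the multiples of the gcd.\<close>

lemma power_hits_iff:
 assumes a: "\<not> p dvd a"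
 shows "(\<exists>k::nat. k \<ge> 1 \<and> int p dvd (int a ^ k - int b)) \<longleftrightarrow> \<not> p dvd b \<and> gcd (ind a) (p - 1) dvd ind b"
proof -
 have c: "int p dvd (int a ^ k - int b) \<longleftrightarrow> [a ^ k = b] (mod p)" for k
  by (simp add: cong_iff_dvd_diff[symmetric] of_nat_power[symmetric] cong_int_iff del: of_nat_power)
 have ak: "\<not> p dvd a ^ k" for k using a prime prime_dvd_power by blast
 have nb: "\<not> p dvd b" if "[a ^ k = b] (mod p)" for k using that ak[of k] cong_dvd_iff by blast
 have iff: "[a ^ k = b] (mod p) \<longleftrightarrow> [k * ind a = ind b] (mod (p - 1))" if b: "\<not> p dvd b" for k
  using ind_cong[OF ak b, symmetric] ind_power[OF a, of k] by (simp add: cong_def)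
 show ?thesis
 proof
  assume "\<exists>k::nat. k \<ge> 1 \<and> int p dvd (int a ^ k - int b)"
  then obtain k where k: "[a ^ k = b] (mod p)" using c by blast
  hence b: "\<not> p dvd b" by (rule nb)
  have "[k * ind a = ind b] (mod (p - 1))" using iff[OF b] k by simp
  hence "[k * ind a = ind b] (mod gcd (ind a) (p - 1))" by (rule cong_dvd_modulus_nat) simp
  hence "gcd (ind a) (p - 1) dvd k * ind a \<longleftrightarrow> gcd (ind a) (p - 1) dvd ind b" using cong_dvd_iff by blast
  thus "\<not> p dvd b \<and> gcd (ind a) (p - 1) dvd ind b" using b by simp
 next
  assume h: "\<not> p dvd b \<and> gcd (ind a) (p - 1) dvd ind b"
  then obtain r where r: "ind b = gcd (ind a) (p - 1) * r" by auto
  obtain u where u: "[ind a * u = gcd (ind a) (p - 1)] (mod (p - 1))" using cong_solve_nat by blast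
  have "[ind a * u * r = ind b] (mod (p - 1))" unfolding r by (rule cong_mult[OF u cong_refl])
  hence 1: "[u * r * ind a = ind b] (mod (p - 1))" by (simp only: mult_ac)
  \<comment> \<open>Adding \<open>p - 1\<close> to the exponent changes nothing modulo
    \<open>p\<close> and makes it positive, as the count demands.\<close>
  have "[u * r * ind a + (p - 1) * ind a = ind b + 0] (mod (p - 1))" by (rule cong_add[OF 1]) (simp add: cong_0_iff)
  hence "[(u * r + (p - 1)) * ind a = ind b] (mod (p - 1))" by (simp only: distrib_right add_0_right)
  hence "[a ^ (u * r + (p - 1)) = b] (mod p)" using iff h by blast
  moreover have "u * r + (p - 1) \<ge> 1" using p1_pos by linarith
  ultimately show "\<exists>k::nat. k \<ge> 1 \<and> int p dvd (int a ^ k - int b)" using c by blast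
 qed
qed

text \<open>For \<open>m\<close> dividing \<open>p - 1\<close> these are the characters modulo
  \<open>p\<close> whose order divides \<open>m\<close>; \<open>j = 0\<close> gives the principal
  one.\<close>

definition ichar :: "nat => nat => nat => complex" where
 "ichar m j a = (if p dvd a then 0 else unity_root m ^ (j * ind a))"

lemma unity_root_cong:
 assumes "m > 0" "[i = j] (mod m)" shows "unity_root m ^ i = unity_root m ^ j"
proof -
 have "unity_root m ^ m = 1" using unity_root_power_eq_1_iff[OF assms(1)] by simp
 hence "unity_root m ^ i = unity_root m ^ (i mod m)" for i
  by (subst div_mult_mod_eq[of i m, symmetric]) (simp only: power_add power_mult mult.commute[of _ m] power_one mult_1_left)
 thus ?thesis using assms(2) unfolding cong_def by metis
qed

lemma ichar_dchar: assumes m: "m dvd p - 1" "m > 0" shows "dchar p (ichar m j)" unfolding dchar_def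
proof (intro conjI allI)
 show "p > 0" using p_gt_1 by simp
 fix a b
 show "ichar m j (a * b) = ichar m j a * ichar m j b"
 proof (cases "p dvd a \<or> p dvd b")
  case True
  thus ?thesis by (auto simp: ichar_def)
 next
  case False
  hence "[ind (a * b) = ind a + ind b] (mod m)" using ind_mult m cong_dvd_modulus_nat by blast
  hence "[j * ind (a * b) = j * (ind a + ind b)] (mod m)" by (rule cong_scalar_left)
  hence "unity_root m ^ (j * ind (a * b)) = unity_root m ^ (j * (ind a + ind b))" by (rule unity_root_cong[OF m(2)])
  moreover have "\<not> p dvd a * b" using False prime by (simp add: prime_dvd_mult_iff)
  ultimately show ?thesis using False by (simp add: ichar_def distrib_left power_add)
 qed
 show "ichar m j (a + p) = ichar m j a"
 proof (cases "p dvd a")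
  case True
  thus ?thesis by (simp add: ichar_def)
 next
  case False
  hence f: "\<not> p dvd a + p" by simp
  have "[ind (a + p) = ind a] (mod (p - 1))" using ind_cong[OF f False] by (simp add: cong_def)
  hence "[ind (a + p) = ind a] (mod m)" using m cong_dvd_modulus_nat by blast
  hence "[j * ind (a + p) = j * ind a] (mod m)" by (rule cong_scalar_left)
  hence "unity_root m ^ (j * ind (a + p)) = unity_root m ^ (j * ind a)" by (rule unity_root_cong[OF m(2)])
  thus ?thesis using False f by (simp add: ichar_def)
 qed
 show "(ichar m j a = 0) = (\<not> coprime a p)" using prime_coprime_iff[OF prime, of a] by (auto simp: ichar_def coprime_commute)
qed

lemma ichar_nonprin:
 assumes m: "m dvd p - 1" "m > 0" and j: "\<not> m dvd j" shows "ichar m j \<noteq> prin p"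
proof
 assume eq: "ichar m j = prin p"
 obtain g where g: "\<not> p dvd g" "[ind g = 1] (mod (p - 1))" using ind_gen by blast
 have "[ind g = 1] (mod m)" using g(2) m cong_dvd_modulus_nat by blast
 hence "[j * ind g = j * 1] (mod m)" by (rule cong_scalar_left)
 hence "unity_root m ^ (j * ind g) = unity_root m ^ (j * 1)" by (rule unity_root_cong[OF m(2)])
 hence "ichar m j g = unity_root m ^ j" using g by (simp add: ichar_def)
 moreover have "prin p g = 1" using g prime_coprime_iff[OF prime, of g] by (simp add: prin_def coprime_commute)
 ultimately have "unity_root m ^ j = 1" using fun_cong[OF eq, of g] by simp
 thus False using unity_root_power_eq_1_iff[OF m(2)] j by simp
qed

definition icount :: "nat => nat => real" where
 "icount N m = real (card {a\<in>{1..N}. \<not> p dvd a \<and> m dvd ind a})"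

lemma icount_eq_sum: "icount N m = (\<Sum>a\<in>{a\<in>{1..N}. \<not> p dvd a}. if m dvd ind a then 1 else 0)"
proof -
 have "{a\<in>{1..N}. \<not> p dvd a \<and> m dvd ind a} = {a\<in>{a\<in>{1..N}. \<not> p dvd a}. m dvd ind a}" by auto
 thus ?thesis by (simp add: icount_def sum.inter_filter[symmetric])
qed

lemma icount_one: "icount N 1 = real (card {a\<in>{1..N}. \<not> p dvd a})" by (simp add: icount_def)

lemma icount_le: "icount N m \<le> real N"
proof -
 have "card {a\<in>{1..N}. \<not> p dvd a \<and> m dvd ind a} \<le> card {1..N}" by (rule card_mono) auto
 thus ?thesis by (simp add: icount_def)
qed

text \<open>The \<open>m\<close> characters \<open>ichar m j\<close> detect
  \<open>m dvd ind a\<close>. The principal one gives the main term, each of the others at most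
  \<open>Y\<close>, and the whole is divided by \<open>m\<close>.\<close>

lemma icount_approx:
 assumes m: "m dvd p - 1" and ne: "\<And>\<xi>. dchar p \<xi> ==> \<xi> \<noteq> prin p ==> norm (\<Sum>a=1..N. \<xi> a) \<le> Y"
  and Y: "Y \<ge> 0"
 shows "\<bar>icount N m - icount N 1 / real m\<bar> \<le> Y"
proof -
 have m0: "m > 0" using m p1_pos by (auto intro!: gr0I)
 have "(\<Sum>j<m. \<Sum>a=1..N. ichar m j a) = (\<Sum>a=1..N. \<Sum>j<m. ichar m j a)" by (rule sum.swap)
 also have "... = (\<Sum>a=1..N. if \<not> p dvd a then (if m dvd ind a then of_nat m else 0) else 0)"
  by (rule sum.cong) (simp_all add: ichar_def unity_root_sum[OF m0])
 also have "... = (\<Sum>a\<in>{a\<in>{1..N}. \<not> p dvd a}. if m dvd ind a then of_nat m else 0)"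
  by (rule sum.inter_filter[symmetric]) simp
 also have "... = of_real (real m * icount N m)" unfolding icount_eq_sum sum_distrib_left of_real_sum by (rule sum.cong) auto
 finally have tot: "(\<Sum>j<m. \<Sum>a=1..N. ichar m j a) = of_real (real m * icount N m)" .
 have "(\<Sum>a=1..N. ichar m 0 a) = (\<Sum>a=1..N. if \<not> p dvd a then 1 else 0)" by (rule sum.cong) (auto simp: ichar_def)
 also have "... = of_real (icount N 1)" unfolding icount_eq_sum by (subst sum.inter_filter[symmetric]) auto
 finally have zero: "(\<Sum>a=1..N. ichar m 0 a) = of_real (icount N 1)" .
 have "{..<m} = insert 0 {1..<m}" using m0 by auto
 hence "(\<Sum>j<m. \<Sum>a=1..N. ichar m j a) = (\<Sum>a=1..N. ichar m 0 a) + (\<Sum>j\<in>{1..<m}. \<Sum>a=1..N. ichar m j a)"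
  by (simp only:) (rule sum.insert, auto)
 hence "complex_of_real (real m * icount N m - icount N 1) = (\<Sum>j\<in>{1..<m}. \<Sum>a=1..N. ichar m j a)"
  unfolding tot zero by simp
 also have "norm ... \<le> (\<Sum>j\<in>{1..<m}. Y)"
 proof (rule sum_norm_le)
  fix j assume j: "j \<in> {1..<m}"
  hence "\<not> m dvd j" using nat_dvd_not_less[of j m] by auto
  thus "norm (\<Sum>a=1..N. ichar m j a) \<le> Y" by (intro ne ichar_dchar ichar_nonprin m m0)
 qed
 also have "... \<le> real m * Y" using Y by (simp add: mult_right_mono)
 finally have "\<bar>real m * icount N m - icount N 1\<bar> \<le> real m * Y" by (simp only: norm_of_real)
 moreover have "real m * icount N m - icount N 1 = real m * (icount N m - icount N 1 / real m)"
  using m0 by (simp add: right_diff_distrib)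
 ultimately have "real m * \<bar>icount N m - icount N 1 / real m\<bar> \<le> real m * Y" by (simp add: abs_mult)
 thus ?thesis using m0 by simp
qed

text \<open>For fixed \<open>a\<close> and \<open>i = gcd (ind a) (p - 1)\<close> the number of
  suitable \<open>b\<close> is \<open>icount N i\<close>. Moebius inversion writes it as a sum over
  the divisors \<open>m\<close> of \<open>i\<close>, which turns the gcd into the condition
  \<open>m dvd ind a\<close>; summing over \<open>a\<close> produces a second factor
  \<open>icount\<close>.\<close>

lemma pair_count:
 "(\<Sum>a\<in>{a\<in>{1..N}. \<not> p dvd a}. \<Sum>b\<in>{b\<in>{1..N}. \<not> p dvd b}. if gcd (ind a) (p - 1) dvd ind b then 1 else 0 :: real)
  = (\<Sum>m | m dvd p - 1. \<Sum>d | d dvd m. mu (m div d) * (icount N m * icount N d))"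
proof -
 let ?A = "{a\<in>{1..N}. \<not> p dvd a}"
 have "(\<Sum>b\<in>?A. if gcd (ind a) (p - 1) dvd ind b then 1 else 0 :: real)
  = (\<Sum>m | m dvd p - 1. if m dvd ind a then (\<Sum>d | d dvd m. mu (m div d) * icount N d) else 0)" for a
 proof -
  define i where "i = gcd (ind a) (p - 1)"
  have i: "i > 0" using p1_pos by (simp add: i_def)
  have "(\<Sum>b\<in>?A. if i dvd ind b then 1 else 0 :: real) = (\<Sum>m | m dvd i. \<Sum>d | d dvd m. mu (m div d) * icount N d)"
   using moebius_inversion[OF i, of "icount N"] by (simp only: icount_eq_sum)
  also have "{m. m dvd i} = {m\<in>{m. m dvd p - 1}. m dvd ind a}" by (auto simp: i_def)
  also have "(\<Sum>m\<in>.... \<Sum>d | d dvd m. mu (m div d) * icount N d) = (\<Sum>m | m dvd p - 1. if m dvd ind a then (\<Sum>d | d dvd m. mu (m div d) * icount N d) else 0)"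
   by (rule sum.inter_filter) (use p1_pos in simp)
  finally show ?thesis by (simp only: i_def)
 qed
 hence "(\<Sum>a\<in>?A. \<Sum>b\<in>?A. if gcd (ind a) (p - 1) dvd ind b then 1 else 0 :: real)
  = (\<Sum>a\<in>?A. \<Sum>m | m dvd p - 1. if m dvd ind a then (\<Sum>d | d dvd m. mu (m div d) * icount N d) else 0)" by (simp only:)
 also have "... = (\<Sum>m | m dvd p - 1. \<Sum>a\<in>?A. if m dvd ind a then (\<Sum>d | d dvd m. mu (m div d) * icount N d) else 0)" by (rule sum.swap)
 also have "... = (\<Sum>m | m dvd p - 1. icount N m * (\<Sum>d | d dvd m. mu (m div d) * icount N d))"
  unfolding icount_eq_sum sum_distrib_right by (intro sum.cong refl) auto
 also have "... = (\<Sum>m | m dvd p - 1. \<Sum>d | d dvd m. mu (m div d) * (icount N m * icount N d))"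
  by (simp add: sum_distrib_left mult_ac)
 finally show ?thesis .
qed

text \<open>Each product of two counts is replaced by its expected value. The pairs
  \<open>(m, d)\<close> number at most the square of the number of divisors of
  \<open>p - 1\<close>.\<close>

lemma pair_count_approx:
 assumes ne: "\<And>\<xi>. dchar p \<xi> ==> \<xi> \<noteq> prin p ==> norm (\<Sum>a=1..N. \<xi> a) \<le> y * real N" and y: "y \<ge> 0"
 shows "\<bar>(\<Sum>m | m dvd p - 1. \<Sum>d | d dvd m. mu (m div d) * (icount N m * icount N d)) - icount N 1 ^ 2 * Mdens (p - 1)\<bar>
  \<le> 2 * y * real N ^ 2 * real (card {d. d dvd p - 1}) ^ 2"
proof -
 let ?n = "p - 1"
 define I where "I = icount N 1"
 have I: "I \<ge> 0" "I \<le> real N" unfolding I_def by (simp add: icount_def) (rule icount_le)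
 have fin: "finite {m. m dvd ?n}" using p1_pos by simp
 have pos: "m > 0" if "m dvd ?n" for m using that p1_pos by (auto intro!: gr0I)
 have "I ^ 2 * Mdens ?n = (\<Sum>m | m dvd ?n. \<Sum>d | d dvd m. mu (m div d) * (I / real m * (I / real d)))"
  unfolding Mdens_def sum_distrib_left
 proof (rule sum.cong)
  fix m assume "m \<in> {m. m dvd ?n}"
  hence "gdens m = (\<Sum>d | d dvd m. mu (m div d) / (real m * real d))" using pos by (intro gdens_mu[symmetric]) auto
  thus "I\<^sup>2 * gdens m = (\<Sum>d | d dvd m. mu (m div d) * (I / real m * (I / real d)))"
   by (simp add: sum_distrib_left power2_eq_square mult_ac)
 qed simp
 hence eq: "(\<Sum>m | m dvd ?n. \<Sum>d | d dvd m. mu (m div d) * (icount N m * icount N d)) - I ^ 2 * Mdens ?n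
  = (\<Sum>m | m dvd ?n. \<Sum>d | d dvd m. mu (m div d) * (icount N m * icount N d - I / real m * (I / real d)))"
  by (simp only: sum_subtractf[symmetric] right_diff_distrib[symmetric])
 have "\<bar>\<Sum>m | m dvd ?n. \<Sum>d | d dvd m. mu (m div d) * (icount N m * icount N d - I / real m * (I / real d))\<bar>
  \<le> (\<Sum>m | m dvd ?n. \<Sum>d | d dvd ?n. 2 * y * real N ^ 2)"
 proof (rule sum_abs[THEN order_trans], rule sum_mono)
  fix m assume "m \<in> {m. m dvd ?n}"
  hence m: "m dvd ?n" by simp
  have "\<bar>\<Sum>d | d dvd m. mu (m div d) * (icount N m * icount N d - I / real m * (I / real d))\<bar> \<le> (\<Sum>d | d dvd m. 2 * y * real N ^ 2)"
  proof (rule sum_abs[THEN order_trans], rule sum_mono)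
   fix d assume "d \<in> {d. d dvd m}"
   hence d: "d dvd ?n" using m by auto
   have Y: "y * real N \<ge> 0" using y by simp
   have A: "\<bar>icount N k - I / real k\<bar> \<le> y * real N" if "k dvd ?n" for k
    unfolding I_def by (rule icount_approx[OF that ne Y])
   have "\<bar>I / real d\<bar> \<le> real N"
   proof -
    have "I / real d \<le> I / 1" using pos[OF d] I by (intro divide_left_mono) auto
    thus ?thesis using I by simp
   qed
   have "icount N m * icount N d - I / real m * (I / real d) = icount N m * (icount N d - I / real d) + (icount N m - I / real m) * (I / real d)"
    by (simp add: algebra_simps)
   also have "\<bar>...\<bar> \<le> \<bar>icount N m * (icount N d - I / real d)\<bar> + \<bar>(icount N m - I / real m) * (I / real d)\<bar>" by (rule abs_triangle_ineq)
   also have "... \<le> real N * (y * real N) + y * real N * real N"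
    unfolding abs_mult using A[OF m] A[OF d] \<open>\<bar>I / real d\<bar> \<le> real N\<close> icount_le[of N m] Y
    by (intro add_mono mult_mono) (auto simp: icount_def)
   also have "... = 2 * y * real N ^ 2" by (simp add: power2_eq_square)
   finally have "\<bar>icount N m * icount N d - I / real m * (I / real d)\<bar> \<le> 2 * y * real N ^ 2" .
   hence "\<bar>mu (m div d)\<bar> * \<bar>icount N m * icount N d - I / real m * (I / real d)\<bar> \<le> 1 * (2 * y * real N ^ 2)"
    using mu_abs_le by (intro mult_mono) auto
   thus "\<bar>mu (m div d) * (icount N m * icount N d - I / real m * (I / real d))\<bar> \<le> 2 * y * real N ^ 2"
    by (simp only: abs_mult mult_1)
  qed
  also have "... \<le> (\<Sum>d | d dvd ?n. 2 * y * real N ^ 2)" by (rule sum_mono2) (use fin m y in auto)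
  finally show "\<bar>\<Sum>d | d dvd m. mu (m div d) * (icount N m * icount N d - I / real m * (I / real d))\<bar> \<le> (\<Sum>d | d dvd ?n. 2 * y * real N ^ 2)" .
 qed
 also have "... = 2 * y * real N ^ 2 * real (card {d. d dvd ?n}) ^ 2" by (simp add: power2_eq_square)
 finally show ?thesis unfolding I_def[symmetric] eq .
qed

end

lemma Mdens_abs_le: assumes "n > 0" shows "\<bar>Mdens n\<bar> \<le> real (card {d. d dvd n})"
proof -
 have "\<bar>Mdens n\<bar> \<le> (\<Sum>q | q dvd n. 1)" unfolding Mdens_def
 proof (rule sum_abs[THEN order_trans], rule sum_mono)
  fix q assume "q \<in> {q. q dvd n}"
  hence q: "q > 0" using assms by (auto intro!: gr0I)
  have "\<bar>gdens q\<bar> \<le> 1 / real q" by (rule gdens_abs_le[OF q])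
  also have "... \<le> 1" using q by simp
  finally show "\<bar>gdens q\<bar> \<le> 1" .
 qed
 thus ?thesis by simp
qed

lemma card_multiples: assumes "p > 0" shows "card {a\<in>{1..N}. p dvd a} = N div p"
proof -
 have "card {a\<in>{1..N}. p dvd a} = (\<Sum>a\<in>{a\<in>{1..N}. p dvd a}. 1)" by simp
 also have "... = (\<Sum>m=1..N div p. 1)" by (rule sum_multiples[OF assms])
 finally show ?thesis by simp
qed

definition hits :: "nat => nat => nat => bool" where
 "hits p a b \<longleftrightarrow> (\<exists>k::nat. k \<ge> 1 \<and> int p dvd (int a ^ k - int b))"

text \<open>Multiples of \<open>p\<close> are put back: when \<open>p\<close> divides
  \<open>a\<close>, a hit means that \<open>p\<close> divides \<open>b\<close>. Up to divisor
  factors, they and the passage from \<open>icount N 1\<close> to \<open>N\<close> cost a multiple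
  of \<open>N ^ 2 / p\<close>.\<close>

lemma hits_count_approx:
 assumes p: "prime p" and ne: "\<And>\<xi>. dchar p \<xi> ==> \<xi> \<noteq> prin p ==> norm (\<Sum>a=1..N. \<xi> a) \<le> y * real N" and y: "y \<ge> 0"
 shows "\<bar>(\<Sum>a=1..N. \<Sum>b=1..N. if hits p a b then 1 else 0) - real N ^ 2 * Mdens (p - 1)\<bar>
  \<le> real N ^ 2 * (2 * y * real (card {d. d dvd p - 1}) ^ 2 + 3 * real (card {d. d dvd p - 1}) ^ 2 / real (p - 1))"
proof -
 obtain ind where "prime_index p ind" using prime_index_exists[OF p] by blast
 then interpret prime_index p ind .
 define T where "T = real (card {d. d dvd p - 1})"
 define I where "I = icount N 1"
 let ?A = "{a\<in>{1..N}. \<not> p dvd a}" and ?Z = "{a\<in>{1..N}. p dvd a}"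
 have p0: "p > 0" using p_gt_1 by simp
 have T1: "T \<ge> 1"
 proof -
  have "card {1::nat} \<le> card {d. d dvd p - 1}" by (rule card_mono) (use p1_pos in auto)
  thus ?thesis by (simp add: T_def)
 qed
 define W where "W = (\<Sum>a\<in>?A. \<Sum>b\<in>?A. if gcd (ind a) (p - 1) dvd ind b then 1 else 0 :: real)"
 have split: "{1..N} = ?A \<union> ?Z" by auto
 have row: "(\<Sum>b=1..N. if hits p a b then 1 else 0 :: real) = (\<Sum>b\<in>?A. if gcd (ind a) (p - 1) dvd ind b then 1 else 0)"
  if "a \<in> ?A" for a
 proof -
  have "(\<Sum>b=1..N. if hits p a b then 1 else 0 :: real) = (\<Sum>b=1..N. if \<not> p dvd b then (if gcd (ind a) (p - 1) dvd ind b then 1 else 0) else 0)"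
   using that power_hits_iff[of a] by (intro sum.cong) (auto simp: hits_def)
  also have "... = (\<Sum>b\<in>?A. if gcd (ind a) (p - 1) dvd ind b then 1 else 0)" by (rule sum.inter_filter[symmetric]) simp
  finally show ?thesis .
 qed
 have rowz: "(\<Sum>b=1..N. if hits p a b then 1 else 0 :: real) = real (N div p)" if "a \<in> ?Z" for a
 proof -
  have h: "hits p a b \<longleftrightarrow> p dvd b" for b
  proof
   assume "hits p a b"
   then obtain k where k: "k \<ge> 1" "int p dvd int a ^ k - int b" by (auto simp: hits_def)
   have "int p dvd int a ^ k" using that k(1) by (auto intro!: dvd_power_le[of _ _ 1, simplified] dvd_trans[OF _ dvd_power])
   hence "int p dvd int b" using k(2) dvd_diff_right_iff by blast
   thus "p dvd b" by simp
  next
   assume "p dvd b"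
   hence "int p dvd int a ^ 1 - int b" using that by (intro dvd_diff) auto
   thus "hits p a b" unfolding hits_def by blast
  qed
  have "(\<Sum>b=1..N. if hits p a b then 1 else 0 :: real) = (\<Sum>b\<in>?Z. 1)" unfolding h by (rule sum.inter_filter[symmetric]) simp
  thus ?thesis using card_multiples[OF p0, of N] by simp
 qed
 have "(\<Sum>a=1..N. \<Sum>b=1..N. if hits p a b then 1 else 0 :: real)
  = (\<Sum>a\<in>?A. \<Sum>b=1..N. if hits p a b then 1 else 0) + (\<Sum>a\<in>?Z. \<Sum>b=1..N. if hits p a b then 1 else 0)"
  using sum.union_disjoint[of ?A ?Z "\<lambda>a. \<Sum>b=1..N. if hits p a b then 1 else 0 :: real"] unfolding split[symmetric] by fastforce
 also have "(\<Sum>a\<in>?A. \<Sum>b=1..N. if hits p a b then 1 else 0 :: real) = W" unfolding W_def by (rule sum.cong) (simp_all only: row)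
 also have "(\<Sum>a\<in>?Z. \<Sum>b=1..N. if hits p a b then 1 else 0 :: real) = (\<Sum>a\<in>?Z. real (N div p))" by (rule sum.cong) (simp_all only: rowz)
 also have "... = real (N div p) ^ 2" using card_multiples[OF p0, of N] by (simp add: power2_eq_square)
 finally have tot: "(\<Sum>a=1..N. \<Sum>b=1..N. if hits p a b then 1 else 0 :: real) = W + real (N div p) ^ 2" .
 have W: "\<bar>W - I ^ 2 * Mdens (p - 1)\<bar> \<le> 2 * y * real N ^ 2 * T ^ 2"
  using pair_count_approx[OF ne y] unfolding W_def pair_count I_def T_def .
 have Ndiv: "real (N div p) \<le> real N / real p"
 proof -
  have "real (N div p * p) \<le> real N" by (rule of_nat_mono) simp
  thus ?thesis using p0 by (simp add: pos_le_divide_eq)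
 qed
 have "N = card ?A + card ?Z"
 proof -
  have "card {1..N} = card ?A + card ?Z" by (subst (1) split) (rule card_Un_disjoint, auto)
  thus ?thesis by simp
 qed
 hence NI: "real N - I = real (N div p)" using card_multiples[OF p0, of N] icount_one[of N] by (simp add: I_def)
 have I: "0 \<le> I" "I \<le> real N" unfolding I_def by (simp add: icount_def) (rule icount_le)
 have q: "1 / real p \<le> 1 / real (p - 1)" using p1_pos by (intro divide_left_mono) auto
 define U where "U = real N ^ 2 * (T ^ 2 / real (p - 1))"
 have U: "real N * (real N / real p) * T \<le> U" "(real N / real p) ^ 2 \<le> U"
 proof -
  have TT: "T \<le> T ^ 2" using T1 by (simp add: power2_eq_square)
  have "real N * (real N / real p) * T = real N ^ 2 * (T * (1 / real p))" by (simp add: power2_eq_square)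
  also have "... \<le> real N ^ 2 * (T ^ 2 * (1 / real (p - 1)))" using TT q T1 by (intro mult_left_mono mult_mono) auto
  finally show "real N * (real N / real p) * T \<le> U" by (simp add: U_def)
  have "(real N / real p) ^ 2 = real N ^ 2 * (1 / real p * (1 / real p))" by (simp add: power2_eq_square)
  also have "... \<le> real N ^ 2 * (T ^ 2 * (1 / real (p - 1)))"
   using TT q T1 p0 by (intro mult_left_mono mult_mono) (auto simp: divide_le_eq intro: order_trans)
  finally show "(real N / real p) ^ 2 \<le> U" by (simp add: U_def)
 qed
 have M: "\<bar>(real N ^ 2 - I ^ 2) * Mdens (p - 1)\<bar> \<le> 2 * U"
 proof -
  have "real N ^ 2 - I ^ 2 = (real N + I) * (real N - I)" by (simp add: power2_eq_square algebra_simps)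
  also have "\<bar>...\<bar> \<le> (2 * real N) * (real N / real p)"
   unfolding abs_mult using I Ndiv NI by (intro mult_mono) auto
  finally have "\<bar>real N ^ 2 - I ^ 2\<bar> \<le> (2 * real N) * (real N / real p)" .
  hence "\<bar>(real N ^ 2 - I ^ 2) * Mdens (p - 1)\<bar> \<le> (2 * real N) * (real N / real p) * T"
   unfolding abs_mult using Mdens_abs_le[OF p1_pos] by (intro mult_mono) (auto simp: T_def)
  also have "... = 2 * (real N * (real N / real p) * T)" by simp
  finally show ?thesis using U(1) by linarith
 qed
 have Z: "\<bar>real (N div p) ^ 2\<bar> \<le> U"
 proof -
  have "real (N div p) ^ 2 \<le> (real N / real p) ^ 2" using Ndiv by (intro power_mono) auto
  thus ?thesis using U(2) abs_of_nonneg[OF zero_le_power2[of "real (N div p)"]] by linarith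
 qed
 have "W + real (N div p) ^ 2 - real N ^ 2 * Mdens (p - 1) = (W - I ^ 2 * Mdens (p - 1)) + real (N div p) ^ 2 - (real N ^ 2 - I ^ 2) * Mdens (p - 1)"
  by (simp add: algebra_simps)
 hence "\<bar>W + real (N div p) ^ 2 - real N ^ 2 * Mdens (p - 1)\<bar> \<le> 2 * y * real N ^ 2 * T ^ 2 + 3 * U" using W M Z by linarith
 also have "... = real N ^ 2 * (2 * y * T ^ 2 + 3 * T ^ 2 / real (p - 1))" by (simp add: U_def algebra_simps)
 finally show ?thesis unfolding tot T_def .
qed

section \<open>The average\<close>

definition exceptional_primes :: "real => nat => real => nat set" where
 "exceptional_primes x N y = {p. prime p \<and> real p \<le> x \<and>
  (\<exists>\<xi>. dchar p \<xi> \<and> \<xi> \<noteq> prin p \<and> norm (\<Sum>a=1..N. \<xi> a) > y * real N)}"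

text \<open>The double logarithm is first replaced by \<open>ln x powr (1/4)\<close>, which leaves
  an exponent of order \<open>ln x powr (3/4)\<close>.\<close>

lemma exceptional_primes_asymp:
 fixes c d :: real
 shows "\<forall>\<^sub>F x::real in at_top. 2 * exp (4 * sqrt (ln x) * (c + d * ln (ln x))) \<le> x powr (1/4)"
proof -
 have "\<forall>\<^sub>F x::real in at_top. c + d * ln (ln x) \<le> ln x powr (1/4)" by real_asymp
 moreover have "\<forall>\<^sub>F x::real in at_top. 2 * exp (4 * sqrt (ln x) * ln x powr (1/4)) \<le> x powr (1/4)" by real_asymp
 moreover have "\<forall>\<^sub>F x::real in at_top. sqrt (ln x) \<ge> 0" by real_asymp
 ultimately show ?thesis
 proof eventually_elim
  case (elim x)
  have "4 * sqrt (ln x) * (c + d * ln (ln x)) \<le> 4 * sqrt (ln x) * ln x powr (1/4)" using elim by (intro mult_left_mono) auto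
  hence "2 * exp (4 * sqrt (ln x) * (c + d * ln (ln x))) \<le> 2 * exp (4 * sqrt (ln x) * ln x powr (1/4))" by simp
  thus ?case using elim by linarith
 qed
qed

text \<open>The 3/4 is made of three quarters: Rankin's factor \<open>M powr (1/20)\<close>, the
  factor \<open>exp (k ^ 2 / 16)\<close>, and everything of size exp(O(k ln ln x)).\<close>

lemma card_exceptional_primes_le:
 fixes D :: nat
 shows "\<exists>x1. \<forall>x\<ge>x1. \<forall>N. real N > exp (3.42 * sqrt (ln x)) -->
  real (card (exceptional_primes x N (1 / ln x ^ D))) \<le> x powr (3/4)"
proof -
 \<comment> \<open>1/20 is made for \<open>k * l \<le> 5 * ln x\<close>, and 1/16 for
   \<open>k \<le> 2 * sqrt (ln x)\<close>; each yields \<open>ln x / 4\<close>.\<close>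
 obtain C where C: "C \<ge> 1" "\<And>k X. (\<Sum>n=1..X. real (tk k n) ^ 2 * real n powr (- (1 + 1/20))) \<le> C ^ (2 * k) * exp (1/16 * real k ^ 2)"
  using tk_square_dirichlet_bound[of "1/20" "1/16"] by auto
 have "\<forall>\<^sub>F x::real in at_top. 2 * exp (4 * sqrt (ln x) * (ln C + real D * ln (ln x))) \<le> x powr (1/4)" by (rule exceptional_primes_asymp)
 moreover have "\<forall>\<^sub>F x::real in at_top. ln x ^ D \<le> x" by real_asymp
 moreover have "\<forall>\<^sub>F x::real in at_top. ln x \<ge> 1" by real_asymp
 moreover have "\<forall>\<^sub>F x::real in at_top. x \<ge> 2" by (rule eventually_ge_at_top)
 ultimately have "\<forall>\<^sub>F x::real in at_top. 2 * exp (4 * sqrt (ln x) * (ln C + real D * ln (ln x))) \<le> x powr (1/4) \<and> ln x ^ D \<le> x \<and> ln x \<ge> 1 \<and> x \<ge> 2"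
  by eventually_elim blast
 then obtain x1 where x1: "\<And>x. x \<ge> x1 ==> 2 * exp (4 * sqrt (ln x) * (ln C + real D * ln (ln x))) \<le> x powr (1/4) \<and> ln x ^ D \<le> x \<and> ln x \<ge> 1 \<and> x \<ge> 2"
  unfolding eventually_at_top_linorder by blast
 show ?thesis
 proof (intro exI[of _ x1] allI impI)
  fix x N assume x: "x1 \<le> x" and N: "real N > exp (3.42 * sqrt (ln x))"
  let ?G = "ln C + real D * ln (ln x)"
  have as: "2 * exp (4 * sqrt (ln x) * (?G)) \<le> x powr (1/4)" and lD: "ln x ^ D \<le> x" and l1: "ln x \<ge> 1" and x2: "x \<ge> 2"
   using x1[OF x] by auto
  define y where "y = 1 / ln x ^ D"
  have lD0: "ln x ^ D \<ge> 1" using l1 by simp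
  have y: "y > 0" using lD0 by (simp add: y_def)
  define E where "E = exceptional_primes x N y"
  have finE: "finite E" by (rule finite_subset[OF _ finite_primes_le[of x]]) (auto simp: E_def exceptional_primes_def)
  have "real (card E) \<le> x powr (3/4)"
  \<comment> \<open>For very large \<open>N\<close> the bound of character sums by the modulus
    leaves no exceptional prime. Otherwise \<open>N \<le> x ^ 2\<close>, so that
    \<open>N ^ k\<close> overshoots \<open>x ^ 3\<close> by at most a factor
    \<open>x ^ 2\<close>.\<close>
  proof (cases "y * real N \<ge> x")
   case True
   have "E = {}"
   proof (rule ccontr)
    assume "E \<noteq> {}"
    then obtain p \<xi> where p: "real p \<le> x" "dchar p \<xi>" "\<xi> \<noteq> prin p" "norm (\<Sum>a=1..N. \<xi> a) > y * real N"
     by (auto simp: E_def exceptional_primes_def)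
    have "norm (\<Sum>a=1..N. \<xi> a) \<le> real p" by (rule dchar_partial_sum[OF p(2,3)])
    thus False using p True by linarith
   qed
   thus ?thesis by simp
  next
   case False
   hence "real N < x * ln x ^ D" using lD0 by (simp add: y_def field_simps)
   also have "... \<le> x * x" using lD x2 by (intro mult_left_mono) auto
   finally have Nx: "real N \<le> x ^ 2" by (simp add: power2_eq_square)
   define s where "s = sqrt (ln x)"
   have s: "s \<ge> 1" "s * s = ln x" using l1 by (auto simp: s_def)
   have "exp 0 < real N" using N s by (intro le_less_trans[OF _ N]) (auto simp: s_def)
   hence N1: "real N > 1" by simp
   define l where "l = ln (real N)"
   have l: "l > 3 * s"
   proof -
    have "ln (exp (3.42 * s)) < l" unfolding l_def using N N1 by (subst ln_less_cancel_iff) (auto simp: s_def)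
    hence "3.42 * s < l" by simp
    thus ?thesis using s by simp
   qed
   have l0: "l > 0" using l s by linarith
   have Nexp: "real N = exp l" using N1 by (simp add: l_def)
   have xexp: "x = exp (ln x)" using x2 by simp
   \<comment> \<open>The least \<open>k\<close> with \<open>N ^ k \<ge> x ^ 3\<close>.\<close>
   define k where "k = nat \<lceil>3 * ln x / l\<rceil>"
   have kl: "3 * ln x / l \<le> real k" "real k < 3 * ln x / l + 1"
   proof -
    have "3 * ln x / l \<ge> 0" using l0 l1 by simp
    thus "3 * ln x / l \<le> real k" "real k < 3 * ln x / l + 1" unfolding k_def by linarith+
   qed
   have k1: "3 * ln x \<le> real k * l" using kl(1) l0 by (simp add: pos_divide_le_eq)
   have k2: "real k * l \<le> 3 * ln x + l"
   proof -
    have "real k * l \<le> (3 * ln x / l + 1) * l" using kl(2) l0 by (intro mult_right_mono) auto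
    thus ?thesis using l0 by (simp add: distrib_right)
   qed
   have l2: "l \<le> 2 * ln x"
   proof -
    have "l \<le> ln (x ^ 2)" unfolding l_def using Nx N1 x2 by (subst ln_le_cancel_iff) auto
    thus ?thesis using x2 by (simp add: ln_realpow)
   qed
   have ks: "real k \<le> 2 * s"
   proof -
    have "3 * ln x / l \<le> 3 * ln x / (3 * s)" using l s l1 by (intro divide_left_mono) auto
    also have "... = s" using s by (simp add: s(2)[symmetric])
    finally show ?thesis using kl(2) s by linarith
   qed
   define M where "M = N ^ k"
   have Mexp: "real M = exp (real k * l)" by (simp add: M_def Nexp exp_of_nat_mult[symmetric])
   have M3: "real N ^ k \<ge> x ^ 3"
   proof -
    have "x ^ 3 = exp (3 * ln x)" using xexp by (metis exp_of_nat_mult of_nat_numeral)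
    also have "... \<le> exp (real k * l)" using k1 by simp
    finally show ?thesis using Mexp by (simp add: M_def)
   qed
   have "\<forall>p\<in>E. \<exists>\<xi>. dchar p \<xi> \<and> \<xi> \<noteq> prin p \<and> norm (\<Sum>a=1..N. \<xi> a) > y * real N"
    by (auto simp: E_def exceptional_primes_def)
   then obtain \<xi> where \<xi>: "\<And>p. p \<in> E ==> dchar p (\<xi> p) \<and> \<xi> p \<noteq> prin p \<and> norm (\<Sum>a=1..N. \<xi> p a) > y * real N"
    by metis
   have cE: "real (card E) \<le> x"
   proof -
    have "card E \<le> card {1..nat \<lfloor>x\<rfloor>}"
     by (rule card_mono) (auto simp: E_def exceptional_primes_def le_nat_floor prime_gt_0_nat Suc_le_eq)
    thus ?thesis using x2 by simp linarith
   qed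
   have tb: "(\<Sum>n=1..N ^ k. real (tk k n) ^ 2) \<le> real M powr (1 + 1/20) * (C ^ (2 * k) * exp (1/16 * real k ^ 2))"
   proof -
    \<comment> \<open>Rankin's trick: \<open>(M / n) powr (1 + 1/20)\<close> is at least 1 for every
      \<open>n\<close> up to \<open>M\<close>.\<close>
    have "(\<Sum>n=1..N ^ k. real (tk k n) ^ 2) \<le> (\<Sum>n=1..M. real M powr (1 + 1/20) * (real (tk k n) ^ 2 * real n powr (- (1 + 1/20))))"
     unfolding M_def[symmetric]
    proof (rule sum_mono)
     fix n assume n: "n \<in> {1..M}"
     have "real n powr (1 + 1/20) * real n powr (- (1 + 1/20)) = 1" using n by (simp add: powr_add[symmetric])
     moreover have "real n powr (1 + 1/20) \<le> real M powr (1 + 1/20)" using n by (intro powr_mono2) auto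
     ultimately have "1 \<le> real M powr (1 + 1/20) * real n powr (- (1 + 1/20))"
      using mult_right_mono[of "real n powr (1 + 1/20)" "real M powr (1 + 1/20)" "real n powr (- (1 + 1/20))"] by simp
     hence "real (tk k n) ^ 2 * 1 \<le> real (tk k n) ^ 2 * (real M powr (1 + 1/20) * real n powr (- (1 + 1/20)))"
      by (rule mult_left_mono) simp
     thus "real (tk k n) ^ 2 \<le> real M powr (1 + 1/20) * (real (tk k n) ^ 2 * real n powr (- (1 + 1/20)))" by (simp only: mult_1_right mult_ac)
    qed
    also have "... = real M powr (1 + 1/20) * (\<Sum>n=1..M. real (tk k n) ^ 2 * real n powr (- (1 + 1/20)))" by (simp only: sum_distrib_left)
    also have "... \<le> real M powr (1 + 1/20) * (C ^ (2 * k) * exp (1/16 * real k ^ 2))" by (intro mult_left_mono C(2)) auto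
    finally show ?thesis .
   qed
   have "real (card E) * y ^ (2 * k) * real N ^ k \<le> 2 * (\<Sum>n=1..N ^ k. real (tk k n) ^ 2)"
   proof (rule exceptional_moduli_bound[OF finE cE, where \<xi> = \<xi>])
    show "N \<ge> 1" using N1 by simp
   qed (use \<xi> y M3 x2 in \<open>auto simp: E_def exceptional_primes_def less_imp_le\<close>)
   also have "2 * (\<Sum>n=1..N ^ k. real (tk k n) ^ 2) \<le> 2 * (real M powr (1 + 1/20) * (C ^ (2 * k) * exp (1/16 * real k ^ 2)))"
    using tb by (intro mult_left_mono) auto
   also have "real M powr (1 + 1/20) = exp (real k * l * (1 + 1/20))" unfolding Mexp by (simp add: powr_def)
   also have "C ^ (2 * k) = exp (2 * real k * ln C)"
   proof -
    have "C ^ (2 * k) = exp (ln C) ^ (2 * k)" using C(1) by simp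
    thus ?thesis by (simp add: exp_of_nat_mult[symmetric])
   qed
   also have "2 * (exp (real k * l * (1 + 1/20)) * (exp (2 * real k * ln C) * exp (1/16 * real k ^ 2)))
     = 2 * exp (real k * l + real k * l / 20 + 2 * real k * ln C + real k ^ 2 / 16)"
    by (simp add: exp_add[symmetric] algebra_simps)
   also have "y ^ (2 * k) = exp (- (2 * real k * (real D * ln (ln x))))"
   proof -
    have "ln x ^ D = exp (real D * ln (ln x))" using l1 by (simp add: exp_of_nat_mult)
    hence "y = exp (- (real D * ln (ln x)))" by (simp add: y_def exp_minus inverse_eq_divide)
    hence "y ^ (2 * k) = exp (real (2 * k) * (- (real D * ln (ln x))))" by (simp only: exp_of_nat_mult)
    thus ?thesis by simp
   qed
   also have "real N ^ k = exp (real k * l)" using Mexp by (simp add: M_def)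
   finally have b: "real (card E) * exp (- (2 * real k * (real D * ln (ln x)))) * exp (real k * l)
     \<le> 2 * exp (real k * l + real k * l / 20 + 2 * real k * ln C + real k ^ 2 / 16)" .
   have "real (card E) = real (card E) * exp (- (2 * real k * (real D * ln (ln x)))) * exp (real k * l) * exp (2 * real k * (real D * ln (ln x)) - real k * l)"
    by (simp add: exp_add[symmetric] mult.assoc)
   also have "... \<le> 2 * exp (real k * l + real k * l / 20 + 2 * real k * ln C + real k ^ 2 / 16) * exp (2 * real k * (real D * ln (ln x)) - real k * l)"
    by (rule mult_right_mono[OF b]) simp
   also have "... = 2 * exp (real k * l / 20 + real k ^ 2 / 16 + 2 * real k * (?G))"
    by (simp add: exp_add[symmetric] algebra_simps)
   also have "... \<le> 2 * exp (ln x / 4 + ln x / 4 + 4 * sqrt (ln x) * (?G))"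
   proof -
    have "real k * l / 20 \<le> ln x / 4" using k2 l2 by linarith
    moreover have "real k ^ 2 / 16 \<le> ln x / 4"
    proof -
     have "real k ^ 2 \<le> (2 * s) ^ 2" using ks by (intro power_mono) auto
     also have "... = 4 * ln x" using s by (simp add: power2_eq_square)
     finally show ?thesis by simp
    qed
    moreover have "2 * real k * ?G \<le> 2 * (2 * s) * ?G" using ks C(1) l1 by (intro mult_right_mono) auto
    ultimately have "real k * l / 20 + real k ^ 2 / 16 + 2 * real k * ?G \<le> ln x / 4 + ln x / 4 + 4 * s * ?G" by linarith
    hence "exp (real k * l / 20 + real k ^ 2 / 16 + 2 * real k * ?G) \<le> exp (ln x / 4 + ln x / 4 + 4 * s * ?G)" by (rule exp_le_cancel_iff[THEN iffD2])
    thus ?thesis unfolding s_def by (rule mult_left_mono) simp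
   qed
   also have "... = x powr (1/2) * (2 * exp (4 * sqrt (ln x) * (?G)))" using x2 by (simp add: powr_def exp_add[symmetric])
   also have "... \<le> x powr (1/2) * x powr (1/4)" using as by (intro mult_left_mono) auto
   also have "... = x powr (3/4)" by (simp add: powr_add[symmetric])
   finally show ?thesis .
  qed
  thus "real (card (exceptional_primes x N (1 / ln x ^ D))) \<le> x powr (3/4)" by (simp add: E_def y_def)
 qed
qed

lemma harmonic_sum_le: "N \<ge> 1 ==> (\<Sum>n=1..N. 1 / real n) \<le> ln (real N) + 1"
proof (induction N rule: dec_induct)
 case (step N)
 have "ln (real N / real (Suc N)) \<le> real N / real (Suc N) - 1" using step by (intro ln_le_minus_one) auto
 also have "... = - (1 / real (Suc N))" by (simp add: field_simps)
 also have "ln (real N / real (Suc N)) = ln (real N) - ln (real (Suc N))" using step by (simp add: ln_div)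
 finally have "1 / real (Suc N) \<le> ln (real (Suc N)) - ln (real N)" by linarith
 thus ?case using step by (simp add: One_nat_def)
qed simp

lemma sum_recip_le: assumes "x \<ge> 1" shows "(\<Sum>n=1..nat \<lfloor>x\<rfloor>. 1 / real n) \<le> 1 + ln x"
proof -
 have pos: "nat \<lfloor>x\<rfloor> > 0" using assms by simp
 have "(\<Sum>n=1..nat \<lfloor>x\<rfloor>. 1 / real n) \<le> ln (real (nat \<lfloor>x\<rfloor>)) + 1" by (rule harmonic_sum_le) (use pos in linarith)
 also have "ln (real (nat \<lfloor>x\<rfloor>)) \<le> ln x" using assms pos by (subst ln_le_cancel_iff) auto
 finally show ?thesis by simp
qed

lemma Mdens_abs_le_ln: assumes "n > 0" "real n \<le> x" shows "\<bar>Mdens n\<bar> \<le> 1 + ln x"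
proof -
 have "\<bar>Mdens n\<bar> \<le> (\<Sum>q | q dvd n. 1 / real q)" unfolding Mdens_def
  by (rule sum_abs[THEN order_trans], rule sum_mono) (use assms in \<open>auto intro!: gdens_abs_le gr0I\<close>)
 also have "... \<le> (\<Sum>q=1..nat \<lfloor>x\<rfloor>. 1 / real q)"
 proof (rule sum_mono2)
  show "{q. q dvd n} \<subseteq> {1..nat \<lfloor>x\<rfloor>}"
  proof
   fix q assume "q \<in> {q. q dvd n}"
   hence q: "q dvd n" by simp
   have "q \<le> n" using q assms(1) by (rule dvd_imp_le)
   moreover have "n \<le> nat \<lfloor>x\<rfloor>" using assms(2) by (simp add: le_nat_floor)
   moreover have "q \<noteq> 0" using q assms(1) by (intro notI) simp
   ultimately show "q \<in> {1..nat \<lfloor>x\<rfloor>}" by simp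
  qed
 qed auto
 also have "... \<le> 1 + ln x" by (rule sum_recip_le) (use assms in simp)
 finally show ?thesis .
qed

lemma sum_primes_le:
 fixes f :: "nat => real"
 assumes "\<And>m. f m \<ge> 0"
 shows "(\<Sum>p | prime p \<and> real p \<le> x. f (p - 1)) \<le> (\<Sum>m=1..nat \<lfloor>x\<rfloor>. f m)"
proof -
 let ?P = "{p. prime p \<and> real p \<le> x}"
 have "inj_on (\<lambda>p. p - 1) ?P"
 proof (rule inj_onI)
  fix p q :: nat assume "p \<in> ?P" "q \<in> ?P" "p - 1 = q - 1"
  thus "p = q" using prime_ge_1_nat[of p] prime_ge_1_nat[of q] by auto
 qed
 hence "(\<Sum>p\<in>?P. f (p - 1)) = (\<Sum>m\<in>(\<lambda>p. p - 1) ` ?P. f m)" by (simp add: sum.reindex)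
 also have "... \<le> (\<Sum>m=1..nat \<lfloor>x\<rfloor>. f m)"
 proof (rule sum_mono2)
  show "(\<lambda>p. p - 1) ` ?P \<subseteq> {1..nat \<lfloor>x\<rfloor>}"
  proof (rule image_subsetI)
   fix p assume "p \<in> ?P"
   hence "p \<ge> 2" "p \<le> nat \<lfloor>x\<rfloor>" using prime_ge_2_nat by (auto simp: le_nat_floor)
   thus "p - 1 \<in> {1..nat \<lfloor>x\<rfloor>}" unfolding atLeastAtMost_iff by linarith
  qed
 qed (use assms in auto)
 finally show ?thesis .
qed

lemma cnt_eq: "real (cnt x a b) = (\<Sum>p | prime p \<and> real p \<le> x. if hits p a b then 1 else 0)"
proof -
 have "{p. prime p \<and> real p \<le> x \<and> (\<exists>n::nat. n \<ge> 1 \<and> int p dvd (int a ^ n - int b))} = {p\<in>{p. prime p \<and> real p \<le> x}. hits p a b}"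
  by (auto simp: hits_def)
 moreover have "(\<Sum>p | prime p \<and> real p \<le> x. if hits p a b then 1 else 0 :: real) = (\<Sum>p\<in>{p\<in>{p. prime p \<and> real p \<le> x}. hits p a b}. 1)"
  by (rule sum.inter_filter[symmetric]) (rule finite_primes_le)
 ultimately show ?thesis by (simp add: cnt_def)
qed

abbreviation average_cnt :: "real => nat => real" where
 "average_cnt x N \<equiv> (1 / real N ^ 2) * (\<Sum>a=1..N. \<Sum>b=1..N. real (cnt x a b))"

text \<open>Character sums up to \<open>N / ln x ^ (D + 4)\<close> are tolerated: the extra 4 pays
  for the fourth power of the logarithm from \<open>sum_divisor_count_sq\<close>. An exceptional
  prime costs at most \<open>2 + ln x\<close>.\<close>

lemma average_cnt_nat:
 fixes D :: nat
 assumes D: "D \<ge> 1"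
 shows "\<exists>K\<ge>0. \<exists>x0. \<forall>x N. x \<ge> x0 \<and> real N > exp (3.42 * sqrt (ln x)) -->
  \<bar>average_cnt x N - stephens_C * Li x\<bar> \<le> K * x / ln x ^ D"
proof -
 obtain K0 x0 where K0: "K0 > 0" "\<And>x. x \<ge> x0 ==> \<bar>(\<Sum>p | prime p \<and> real p \<le> x. Mdens (p - 1)) - stephens_C * Li x\<bar> \<le> K0 * x / ln x ^ D"
  using sum_Mdens_primes_asymp[OF D] by blast
 obtain x1 where x1: "\<And>x N. x \<ge> x1 ==> real N > exp (3.42 * sqrt (ln x)) ==> real (card (exceptional_primes x N (1 / ln x ^ (D + 4)))) \<le> x powr (3/4)"
  using card_exceptional_primes_le[of "D + 4"] by blast
 have "\<forall>\<^sub>F x::real in at_top. x powr (3/4) * (2 + ln x) \<le> x / ln x ^ D" by real_asymp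
 moreover have "\<forall>\<^sub>F x::real in at_top. 3 * (1 + ln x) ^ 4 \<le> x / ln x ^ D" by real_asymp
 moreover have "\<forall>\<^sub>F x::real in at_top. ln x \<ge> 1" by real_asymp
 moreover have "\<forall>\<^sub>F x::real in at_top. x \<ge> max (max x0 x1) 2" by (rule eventually_ge_at_top)
 ultimately have "\<forall>\<^sub>F x::real in at_top. x powr (3/4) * (2 + ln x) \<le> x / ln x ^ D \<and> 3 * (1 + ln x) ^ 4 \<le> x / ln x ^ D \<and> ln x \<ge> 1 \<and> x \<ge> max (max x0 x1) 2"
  by eventually_elim blast
 then obtain x2 where x2: "\<And>x. x \<ge> x2 ==> x powr (3/4) * (2 + ln x) \<le> x / ln x ^ D \<and> 3 * (1 + ln x) ^ 4 \<le> x / ln x ^ D \<and> ln x \<ge> 1 \<and> x \<ge> max (max x0 x1) 2"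
  unfolding eventually_at_top_linorder by blast
 show ?thesis
 \<comment> \<open>\<open>34 = 1 + 32 + 1\<close>: the exceptional primes, \<open>2 * 2 ^ 4\<close>
   from the character sums, and the terms with denominator \<open>p - 1\<close>.\<close>
 proof (rule exI[of _ "K0 + 34"], intro conjI exI[of _ x2] allI impI)
  fix x N assume xN: "x2 \<le> x \<and> real N > exp (3.42 * sqrt (ln x))"
  have A: "x powr (3/4) * (2 + ln x) \<le> x / ln x ^ D" "3 * (1 + ln x) ^ 4 \<le> x / ln x ^ D" and l1: "ln x \<ge> 1"
   and xx: "x \<ge> x0" "x \<ge> x1" "x \<ge> 2" using x2[of x] xN by auto
  have "real N > 0" using xN exp_gt_zero[of "3.42 * sqrt (ln x)"] by linarith
  hence N: "real N ^ 2 > 0" "N > 0" by auto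
  define y where "y = 1 / ln x ^ (D + 4)"
  have y: "y \<ge> 0" using l1 by (simp add: y_def)
  define E where "E = exceptional_primes x N y"
  let ?P = "{p. prime p \<and> real p \<le> x}"
  define T where "T = (\<lambda>m::nat. real (card {d. d dvd m}) ^ 2)"
  define w where "w = (\<lambda>p. (\<Sum>a=1..N. \<Sum>b=1..N. if hits p a b then 1 else 0) / real N ^ 2)"
  have "(\<Sum>a=1..N. \<Sum>b=1..N. real (cnt x a b)) = (\<Sum>a=1..N. \<Sum>b=1..N. \<Sum>p\<in>?P. if hits p a b then 1 else 0)"
   unfolding cnt_eq ..
  also have "... = (\<Sum>a=1..N. \<Sum>p\<in>?P. \<Sum>b=1..N. if hits p a b then 1 else 0)" by (intro sum.cong refl sum.swap)
  also have "... = (\<Sum>p\<in>?P. \<Sum>a=1..N. \<Sum>b=1..N. if hits p a b then 1 else 0)" by (rule sum.swap)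
  finally have avg: "average_cnt x N = (\<Sum>p\<in>?P. w p)" unfolding w_def sum_divide_distrib[symmetric] by simp
  have bound: "\<bar>w p - Mdens (p - 1)\<bar> \<le> (if p \<in> E then 2 + ln x else 0) + (2 * y * T (p - 1) + 3 * (T (p - 1) / real (p - 1)))" if p: "p \<in> ?P" for p
  proof -
   have pp: "prime p" "real p \<le> x" and p2: "p \<ge> 2" using p prime_ge_2_nat by auto
   have nonneg: "2 * y * T (p - 1) + 3 * (T (p - 1) / real (p - 1)) \<ge> 0" using y by (simp add: T_def)
   show ?thesis
   proof (cases "p \<in> E")
    case True
    have "(\<Sum>a=1..N. \<Sum>b=1..N. if hits p a b then 1 else 0) \<le> (\<Sum>a=1..N. \<Sum>b=1..N. 1 :: real)" by (intro sum_mono) auto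
    also have "... = real N ^ 2" by (simp add: power2_eq_square)
    finally have "w p \<le> 1" using N unfolding w_def by (simp add: pos_divide_le_eq)
    moreover have "w p \<ge> 0" unfolding w_def by (intro divide_nonneg_nonneg sum_nonneg) auto
    moreover have "\<bar>Mdens (p - 1)\<bar> \<le> 1 + ln x" by (rule Mdens_abs_le_ln) (use pp p2 in auto)
    ultimately have "\<bar>w p - Mdens (p - 1)\<bar> \<le> 2 + ln x" by linarith
    thus ?thesis using True nonneg by (simp only: if_True)
   next
    case False
    have ne: "norm (\<Sum>a=1..N. \<xi> a) \<le> y * real N" if "dchar p \<xi>" "\<xi> \<noteq> prin p" for \<xi>
    proof (rule ccontr)
     assume "\<not> norm (\<Sum>a=1..N. \<xi> a) \<le> y * real N"
     hence "norm (\<Sum>a=1..N. \<xi> a) > y * real N" by simp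
     hence "p \<in> E" using that pp unfolding E_def exceptional_primes_def by blast
     thus False using False by simp
    qed
    have "w p - Mdens (p - 1) = ((\<Sum>a=1..N. \<Sum>b=1..N. if hits p a b then 1 else 0) - real N ^ 2 * Mdens (p - 1)) / real N ^ 2"
     using N by (simp add: w_def diff_divide_distrib)
    also have "\<bar>...\<bar> \<le> 2 * y * T (p - 1) + 3 * T (p - 1) / real (p - 1)"
     using hits_count_approx[OF pp(1) ne y] N unfolding abs_divide T_def by (simp add: pos_divide_le_eq mult.commute)
    finally show ?thesis using False by simp
   qed
  qed
  have "\<bar>(\<Sum>p\<in>?P. w p) - (\<Sum>p\<in>?P. Mdens (p - 1))\<bar> \<le> (\<Sum>p\<in>?P. \<bar>w p - Mdens (p - 1)\<bar>)"
   unfolding sum_subtractf[symmetric] by (rule sum_abs)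
  also have "... \<le> (\<Sum>p\<in>?P. (if p \<in> E then 2 + ln x else 0) + (2 * y * T (p - 1) + 3 * (T (p - 1) / real (p - 1))))"
   by (intro sum_mono bound)
  also have "... = (\<Sum>p\<in>?P. if p \<in> E then 2 + ln x else 0) + (\<Sum>p\<in>?P. 2 * y * T (p - 1) + 3 * (T (p - 1) / real (p - 1)))"
   by (rule sum.distrib)
  also have "(\<Sum>p\<in>?P. if p \<in> E then 2 + ln x else 0) \<le> x / ln x ^ D"
  proof -
   have "?P \<inter> E = E" by (auto simp: E_def exceptional_primes_def)
   hence "(\<Sum>p\<in>?P. if p \<in> E then 2 + ln x else 0) = real (card E) * (2 + ln x)"
    using finite_primes_le[of x] by (simp add: sum.If_cases)
   also have "... \<le> x powr (3/4) * (2 + ln x)"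
    using x1[OF xx(2)] xN l1 by (intro mult_right_mono) (auto simp: E_def y_def)
   finally show ?thesis using A(1) by linarith
  qed
  \<comment> \<open>The errors are small enough to let all integers replace the shifted
    primes.\<close>
  also have "(\<Sum>p\<in>?P. 2 * y * T (p - 1) + 3 * (T (p - 1) / real (p - 1))) \<le> (\<Sum>m=1..nat \<lfloor>x\<rfloor>. 2 * y * T m + 3 * (T m / real m))"
   by (rule sum_primes_le) (use y in \<open>simp add: T_def\<close>)
  also have "... \<le> (\<Sum>m=1..nat \<lfloor>x\<rfloor>. (2 * y * x + 3) * (T m / real m))"
  proof (rule sum_mono)
   fix m assume m: "m \<in> {1..nat \<lfloor>x\<rfloor>}"
   hence m': "real m > 0" "real m \<le> x" using xx by (auto simp: le_nat_iff le_floor_iff)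
   have "T m = real m * (T m / real m)" using m' by simp
   also have "... \<le> x * (T m / real m)" using m' by (intro mult_right_mono) (auto simp: T_def)
   finally have "2 * y * T m \<le> 2 * y * (x * (T m / real m))" using y by (intro mult_left_mono) auto
   thus "2 * y * T m + 3 * (T m / real m) \<le> (2 * y * x + 3) * (T m / real m)" by (simp only: distrib_right mult.assoc add_le_cancel_right)
  qed
  also have "... = (2 * y * x + 3) * (\<Sum>m=1..nat \<lfloor>x\<rfloor>. T m / real m)" by (simp only: sum_distrib_left)
  also have "... \<le> (2 * y * x + 3) * (1 + ln x) ^ 4"
  proof (intro mult_left_mono)
   have "(\<Sum>m=1..nat \<lfloor>x\<rfloor>. T m / real m) \<le> (\<Sum>n=1..nat \<lfloor>x\<rfloor>. 1 / real n) ^ 4" unfolding T_def by (rule sum_divisor_count_sq)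
   also have "... \<le> (1 + ln x) ^ 4" using sum_recip_le[of x] xx by (intro power_mono sum_nonneg) auto
   finally show "(\<Sum>m=1..nat \<lfloor>x\<rfloor>. T m / real m) \<le> (1 + ln x) ^ 4" .
  qed (use y xx in simp)
  also have "... = 2 * y * x * (1 + ln x) ^ 4 + 3 * (1 + ln x) ^ 4" by (simp only: distrib_right)
  also have "2 * y * x * (1 + ln x) ^ 4 \<le> 2 * y * x * (2 * ln x) ^ 4" using y xx l1 by (intro mult_left_mono power_mono) auto
  also have "2 * y * x * (2 * ln x) ^ 4 = 32 * (x / ln x ^ D)" using l1 by (simp add: y_def power_add power_mult_distrib)
  also note A(2)
  finally have "\<bar>(\<Sum>p\<in>?P. w p) - (\<Sum>p\<in>?P. Mdens (p - 1))\<bar> \<le> x / ln x ^ D + (32 * (x / ln x ^ D) + x / ln x ^ D)" by simp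
  moreover have "\<bar>(\<Sum>p\<in>?P. Mdens (p - 1)) - stephens_C * Li x\<bar> \<le> K0 * (x / ln x ^ D)" using K0(2)[OF xx(1)] by simp
  ultimately have "\<bar>(\<Sum>p\<in>?P. w p) - stephens_C * Li x\<bar> \<le> K0 * (x / ln x ^ D) + 34 * (x / ln x ^ D)" by linarith
  also have "... = (K0 + 34) * x / ln x ^ D" by (simp add: distrib_right add_divide_distrib)
  finally show "\<bar>average_cnt x N - stephens_C * Li x\<bar> \<le> (K0 + 34) * x / ln x ^ D" unfolding avg .
 qed (use K0 in auto)
qed

theorem theorem1p3:
  shows "\<forall>D::real. D > 0 \<longrightarrow> (\<exists>K::real. \<exists>x0::real. \<forall>x::real. \<forall>N::nat.
     x \<ge> x0 \<and> real N > exp (3.42 * sqrt (ln x)) \<longrightarrow>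
     \<bar>(1 / real N ^ 2) * (\<Sum>a\<in>{1..N}. \<Sum>b\<in>{1..N}. real (cnt x a b))
        - stephens_C * Li x\<bar> \<le> K * x / (ln x) powr D)"
proof (intro allI impI)
 fix D :: real assume D: "D > 0"
 \<comment> \<open>A larger power of \<open>ln x\<close> is a stronger claim once
   \<open>ln x \<ge> 1\<close>, so \<open>D\<close> is rounded up; the threshold 3 lies above
   \<open>exp 1\<close>.\<close>
 define d where "d = nat \<lceil>D\<rceil>"
 have d: "d \<ge> 1" "D \<le> real d" using D unfolding d_def by linarith+
 obtain K x0 where K: "K \<ge> 0" and b: "\<And>x N. x \<ge> x0 ==> real N > exp (3.42 * sqrt (ln x)) ==>
  \<bar>average_cnt x N - stephens_C * Li x\<bar> \<le> K * x / ln x ^ d"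
  using average_cnt_nat[OF d(1)] by blast
 show "\<exists>K x0. \<forall>x N. x \<ge> x0 \<and> real N > exp (3.42 * sqrt (ln x)) -->
  \<bar>average_cnt x N - stephens_C * Li x\<bar> \<le> K * x / (ln x) powr D"
 proof (rule exI[of _ K], rule exI[of _ "max x0 3"], intro allI impI)
  fix x N assume h: "max x0 3 \<le> x \<and> real N > exp (3.42 * sqrt (ln x))"
  have "exp 1 \<le> x" using h exp_le by linarith
  hence l1: "ln x \<ge> 1" using ln_ge_iff[of x 1] h by simp
  have "ln x powr D \<le> ln x powr real d" using l1 d by (intro powr_mono) auto
  also have "... = ln x ^ d" using l1 by (simp add: powr_realpow)
  finally have "K * x / ln x ^ d \<le> K * x / ln x powr D" using K h l1 by (intro divide_left_mono) auto
  thus "\<bar>average_cnt x N - stephens_C * Li x\<bar> \<le> K * x / ln x powr D" using b[of x N] h by linarith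
 qed
qed

end
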